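(* Let $(M,x_0)$ be a path-connected pointed CW-complex with $\dim M=2$, and let $G$ be a path-connected topological group with unit $g_0$. Then there is a bijection $$\mathcal{B}_G(M)\cong H^2(M;\pi_1(G,g_0)),$$ where $\mathcal{B}_G(M)$ is the pointed set of equivalence classes of principal $G$-bundles over $M$.
   Context: A principal $G$-bundle over $M$ consists of a total space $E$ with a right action of $G$ and a continuous map $p:E\to M$ such that there is an open covering $\{U\}$ of $M$ with homeomorphisms $\phi_U: U\times G\to p^{-1}(U)$ satisfying $p(\phi_U(b,g))=b$ and $\phi_U(b,g)=\phi_U(b,g_0)\cdot g$. Two principal $G$-bundles $p_1:E_1\to M$ and $p_2:E_2\to M$ are equivalent if there is a homeomorphism $h:E_1\to E_2$ with $p_2\circ h=p_1$ and $h(e\cdot g)=h(e)\cdot g$ for all $e\in E_1$, $g\in G$. $\mathcal{B}_G(M)$ is the set of equivalence classes; its base point is the class of the trivial bundle $M\times G\to M$. $H^2(M;\pi)$ denotes singular cohomology with coefficients in the abelian group $\pi$. *)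

theory Defs
  imports "HOL-Homology.Homology"
begin

section \<open>CW-complexes\<close>

text \<open>Discs, open balls and spheres live in \<^term>\<open>Euclidean_space n\<close>, the space of real
  sequences vanishing from position \<open>n\<close> on; for \<open>n = 0\<close> they are a point, the same point and
  the empty set.\<close>

definition disc :: "nat \<Rightarrow> (nat \<Rightarrow> real) set"
  where "disc n = {x \<in> topspace (Euclidean_space n). (\<Sum>i<n. (x i)\<^sup>2) \<le> 1}"

definition open_disc :: "nat \<Rightarrow> (nat \<Rightarrow> real) set"
  where "open_disc n = {x \<in> topspace (Euclidean_space n). (\<Sum>i<n. (x i)\<^sup>2) < 1}"

definition disc_boundary :: "nat \<Rightarrow> (nat \<Rightarrow> real) set"
  where "disc_boundary n = {x \<in> topspace (Euclidean_space n). (\<Sum>i<n. (x i)\<^sup>2) = 1}"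

text \<open>A cell structure is the family \<open>C\<close> of its characteristic maps: \<open>C n\<close> contains one map
  for each \<open>n\<close>-cell, the open cell being the image of the open disc. In particular two maps that
  differ only outside the disc cannot both be in \<open>C n\<close>, because distinct cells are disjoint.\<close>

definition cw_complex :: "'m topology \<Rightarrow> (nat \<Rightarrow> ((nat \<Rightarrow> real) \<Rightarrow> 'm) set) \<Rightarrow> bool"
  where "cw_complex M C \<longleftrightarrow>
    Hausdorff_space M \<and>
    (\<forall>n. \<forall>\<phi>\<in>C n.
       continuous_map (subtopology (Euclidean_space n) (disc n)) M \<phi> \<and>
       homeomorphic_map (subtopology (Euclidean_space n) (open_disc n))
         (subtopology M (\<phi> ` open_disc n)) \<phi>) \<and>
    (\<Union>n. \<Union>\<phi>\<in>C n. \<phi> ` open_disc n) = topspace M \<and>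
    (\<forall>n m. \<forall>\<phi>\<in>C n. \<forall>\<psi>\<in>C m. (n, \<phi>) \<noteq> (m, \<psi>) \<longrightarrow> disjnt (\<phi> ` open_disc n) (\<psi> ` open_disc m)) \<and>
    (\<forall>n. \<forall>\<phi>\<in>C n. \<exists>F. finite F \<and> F \<subseteq> (SIGMA m:{..<n}. C m) \<and>
       \<phi> ` disc_boundary n \<subseteq> (\<Union>(m, \<psi>)\<in>F. \<psi> ` open_disc m)) \<and>
    (\<forall>A\<subseteq>topspace M.
       closedin M A \<longleftrightarrow>
       (\<forall>n. \<forall>\<phi>\<in>C n. closedin (subtopology (Euclidean_space n) (disc n)) {x \<in> disc n. \<phi> x \<in> A}))"

definition cw_has_dim :: "(nat \<Rightarrow> ((nat \<Rightarrow> real) \<Rightarrow> 'm) set) \<Rightarrow> nat \<Rightarrow> bool"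
  where "cw_has_dim C n \<longleftrightarrow> C n \<noteq> {} \<and> (\<forall>k>n. C k = {})"


section \<open>Topological groups and the fundamental group\<close>

definition topological_group :: "('g, 'b) monoid_scheme \<Rightarrow> 'g topology \<Rightarrow> bool"
  where "topological_group G T \<longleftrightarrow>
    group G \<and> topspace T = carrier G \<and>
    continuous_map (prod_topology T T) T (\<lambda>(g, h). g \<otimes>\<^bsub>G\<^esub> h) \<and>
    continuous_map T T (\<lambda>g. inv\<^bsub>G\<^esub> g)"

definition loop_at :: "'a topology \<Rightarrow> 'a \<Rightarrow> (real \<Rightarrow> 'a) \<Rightarrow> bool"
  where "loop_at X a p \<longleftrightarrow> pathin X p \<and> p 0 = a \<and> p 1 = a"

text \<open>Based homotopy of loops. The values of a loop outside the unit interval are irrelevant: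
  loops that agree on the interval are homotopic.\<close>

definition loop_homotopic :: "'a topology \<Rightarrow> 'a \<Rightarrow> (real \<Rightarrow> 'a) \<Rightarrow> (real \<Rightarrow> 'a) \<Rightarrow> bool"
  where "loop_homotopic X a =
    homotopic_with (\<lambda>r. r 0 = a \<and> r 1 = a) (top_of_set {0..1}) X"

text \<open>\<open>joinpaths\<close> is only available for types of class \<open>topological_space\<close>; this is the
  same concatenation on a bare type.\<close>

definition join_loops :: "(real \<Rightarrow> 'a) \<Rightarrow> (real \<Rightarrow> 'a) \<Rightarrow> real \<Rightarrow> 'a"
  where "join_loops p q = (\<lambda>t. if t \<le> 1/2 then p (2 * t) else q (2 * t - 1))"

definition loop_class :: "'a topology \<Rightarrow> 'a \<Rightarrow> (real \<Rightarrow> 'a) \<Rightarrow> (real \<Rightarrow> 'a) set"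
  where "loop_class X a p = {q. loop_homotopic X a p q}"

definition fundamental_group :: "'a topology \<Rightarrow> 'a \<Rightarrow> (real \<Rightarrow> 'a) set monoid"
  where "fundamental_group X a =
    \<lparr>carrier = loop_class X a ` {p. loop_at X a p},
     mult = \<lambda>A B. \<Union>p\<in>A. \<Union>q\<in>B. loop_class X a (join_loops p q),
     one = loop_class X a (\<lambda>t. a)\<rparr>"


section \<open>Singular cohomology with coefficients\<close>

text \<open>Cochains are homomorphisms on singular chains, made unique as functions by being
  \<open>undefined\<close> off the chain group.\<close>

definition cochain_group ::
    "nat \<Rightarrow> 'a topology \<Rightarrow> ('c, 'd) monoid_scheme \<Rightarrow> ('a chain \<Rightarrow> 'c) monoid"
  where "cochain_group n X A =
    \<lparr>carrier = hom (chain_group n X) A \<inter> extensional (carrier (chain_group n X)),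
     mult = \<lambda>f g. \<lambda>c\<in>carrier (chain_group n X). f c \<otimes>\<^bsub>A\<^esub> g c,
     one = \<lambda>c\<in>carrier (chain_group n X). \<one>\<^bsub>A\<^esub>\<rparr>"

definition coboundary :: "nat \<Rightarrow> 'a topology \<Rightarrow> ('a chain \<Rightarrow> 'c) \<Rightarrow> 'a chain \<Rightarrow> 'c"
  where "coboundary n X f =
    (\<lambda>c\<in>carrier (chain_group (Suc n) X). f (chain_boundary (Suc n) c))"

definition cocycle_group ::
    "nat \<Rightarrow> 'a topology \<Rightarrow> ('c, 'd) monoid_scheme \<Rightarrow> ('a chain \<Rightarrow> 'c) monoid"
  where "cocycle_group n X A =
    (cochain_group n X A)
      \<lparr>carrier := kernel (cochain_group n X A) (cochain_group (Suc n) X A) (coboundary n X)\<rparr>"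

definition coboundary_set ::
    "nat \<Rightarrow> 'a topology \<Rightarrow> ('c, 'd) monoid_scheme \<Rightarrow> ('a chain \<Rightarrow> 'c) set"
  where "coboundary_set n X A =
    (case n of
       0 \<Rightarrow> {\<one>\<^bsub>cochain_group 0 X A\<^esub>}
     | Suc k \<Rightarrow> coboundary k X ` carrier (cochain_group k X A))"

definition cohomology_group ::
    "nat \<Rightarrow> 'a topology \<Rightarrow> ('c, 'd) monoid_scheme \<Rightarrow> ('a chain \<Rightarrow> 'c) set monoid"
  where "cohomology_group n X A = cocycle_group n X A Mod coboundary_set n X A"


section \<open>Principal bundles\<close>

record ('e, 'g, 'm) gbundle =
  total_space :: "'e topology"
  act :: "'e \<Rightarrow> 'g \<Rightarrow> 'e"
  proj :: "'e \<Rightarrow> 'm"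

definition right_action ::
    "('g, 'b) monoid_scheme \<Rightarrow> 'g topology \<Rightarrow> 'e topology \<Rightarrow> ('e \<Rightarrow> 'g \<Rightarrow> 'e) \<Rightarrow> bool"
  where "right_action G T E a \<longleftrightarrow>
    continuous_map (prod_topology E T) E (\<lambda>(e, g). a e g) \<and>
    (\<forall>e\<in>topspace E. a e \<one>\<^bsub>G\<^esub> = e) \<and>
    (\<forall>e\<in>topspace E. \<forall>g\<in>carrier G. \<forall>h\<in>carrier G. a (a e g) h = a e (g \<otimes>\<^bsub>G\<^esub> h))"

definition local_trivialization ::
    "('g, 'b) monoid_scheme \<Rightarrow> 'g topology \<Rightarrow> 'm topology \<Rightarrow> ('e, 'g, 'm) gbundle \<Rightarrow>
     'm set \<Rightarrow> ('m \<times> 'g \<Rightarrow> 'e) \<Rightarrow> bool"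
  where "local_trivialization G T M P U \<phi> \<longleftrightarrow>
    homeomorphic_map (prod_topology (subtopology M U) T)
      (subtopology (total_space P) {e \<in> topspace (total_space P). proj P e \<in> U}) \<phi> \<and>
    (\<forall>b\<in>U. \<forall>g\<in>carrier G. proj P (\<phi> (b, g)) = b \<and> \<phi> (b, g) = act P (\<phi> (b, \<one>\<^bsub>G\<^esub>)) g)"

definition principal_bundle ::
    "('g, 'b) monoid_scheme \<Rightarrow> 'g topology \<Rightarrow> 'm topology \<Rightarrow> ('e, 'g, 'm) gbundle \<Rightarrow> bool"
  where "principal_bundle G T M P \<longleftrightarrow>
    right_action G T (total_space P) (act P) \<and>
    continuous_map (total_space P) M (proj P) \<and>
    (\<exists>\<U>. (\<forall>U\<in>\<U>. openin M U) \<and> \<Union>\<U> = topspace M \<and>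
         (\<forall>U\<in>\<U>. \<exists>\<phi>. local_trivialization G T M P U \<phi>))"

definition bundle_equivalent ::
    "('g, 'b) monoid_scheme \<Rightarrow> ('e1, 'g, 'm) gbundle \<Rightarrow> ('e2, 'g, 'm) gbundle \<Rightarrow> bool"
  where "bundle_equivalent G P Q \<longleftrightarrow>
    (\<exists>h. homeomorphic_map (total_space P) (total_space Q) h \<and>
         (\<forall>e\<in>topspace (total_space P). proj Q (h e) = proj P e) \<and>
         (\<forall>e\<in>topspace (total_space P). \<forall>g\<in>carrier G. h (act P e g) = act Q (h e) g))"

text \<open>The total spaces of the bundles in the quotient below are spaces on subsets of the type
  \<open>'m \<times> 'g\<close>, with an arbitrary topology. By \<open>principal_bundle_equivalent_pair_type\<close> this loses
  no equivalence class: a principal bundle with total space in any type is equivalent to such a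
  bundle.\<close>

definition bundle_equivalence ::
    "('g, 'b) monoid_scheme \<Rightarrow> 'g topology \<Rightarrow> 'm topology \<Rightarrow>
     (('m \<times> 'g, 'g, 'm) gbundle \<times> ('m \<times> 'g, 'g, 'm) gbundle) set"
  where "bundle_equivalence G T M =
    {(P, Q). principal_bundle G T M P \<and> principal_bundle G T M Q \<and> bundle_equivalent G P Q}"

definition bundle_classes ::
    "('g, 'b) monoid_scheme \<Rightarrow> 'g topology \<Rightarrow> 'm topology \<Rightarrow>
     ('m \<times> 'g, 'g, 'm) gbundle set set"
  where "bundle_classes G T M = Collect (principal_bundle G T M) // bundle_equivalence G T M"

definition trivial_bundle ::
    "('g, 'b) monoid_scheme \<Rightarrow> 'g topology \<Rightarrow> 'm topology \<Rightarrow> ('m \<times> 'g, 'g, 'm) gbundle"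
  where "trivial_bundle G T M =
    \<lparr>total_space = prod_topology M T, act = (\<lambda>(b, h) g. (b, h \<otimes>\<^bsub>G\<^esub> g)), proj = fst\<rparr>"

definition trivial_class ::
    "('g, 'b) monoid_scheme \<Rightarrow> 'g topology \<Rightarrow> 'm topology \<Rightarrow> ('m \<times> 'g, 'g, 'm) gbundle set"
  where "trivial_class G T M = bundle_equivalence G T M `` {trivial_bundle G T M}"


subsection \<open>Independence of the type of total spaces\<close>

lemma local_trivialization_exists:
  assumes P: "principal_bundle G T M P" and b: "b \<in> topspace M"
  obtains U \<phi> where "openin M U" "b \<in> U" "local_trivialization G T M P U \<phi>"
  using assms unfolding principal_bundle_def by blast

lemma local_trivialization_image:
  assumes tg: "topological_group G T" and op: "openin M U"
    and lt: "local_trivialization G T M P U \<phi>"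
  shows "\<phi> ` (U \<times> carrier G) = {e \<in> topspace (total_space P). proj P e \<in> U}"
    and "inj_on \<phi> (U \<times> carrier G)"
proof -
  have T: "topspace T = carrier G" using tg by (simp add: topological_group_def)
  have U: "topspace M \<inter> U = U" using openin_subset[OF op] by blast
  have h: "homeomorphic_map (prod_topology (subtopology M U) T)
      (subtopology (total_space P) {e \<in> topspace (total_space P). proj P e \<in> U}) \<phi>"
    using lt by (simp add: local_trivialization_def)
  show "\<phi> ` (U \<times> carrier G) = {e \<in> topspace (total_space P). proj P e \<in> U}"
    using homeomorphic_imp_surjective_map[OF h] U T by auto
  show "inj_on \<phi> (U \<times> carrier G)"
    using homeomorphic_imp_injective_map[OF h] U T by simp
qed

lemma local_trivialization_act:
  assumes tg: "topological_group G T" and op: "openin M U" and P: "principal_bundle G T M P"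
    and lt: "local_trivialization G T M P U \<phi>"
    and b: "b \<in> U" and g: "g \<in> carrier G" and h: "h \<in> carrier G"
  shows "act P (\<phi> (b, g)) h = \<phi> (b, g \<otimes>\<^bsub>G\<^esub> h)"
proof -
  interpret group G using tg by (simp add: topological_group_def)
  have eq: "\<phi> (b, k) = act P (\<phi> (b, \<one>\<^bsub>G\<^esub>)) k" if "k \<in> carrier G" for k
    using lt b that unfolding local_trivialization_def by blast
  have "\<phi> (b, \<one>\<^bsub>G\<^esub>) \<in> topspace (total_space P)"
    using local_trivialization_image(1)[OF tg op lt] b by blast
  then have "act P (act P (\<phi> (b, \<one>\<^bsub>G\<^esub>)) g) h = act P (\<phi> (b, \<one>\<^bsub>G\<^esub>)) (g \<otimes>\<^bsub>G\<^esub> h)"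
    using P g h by (simp add: principal_bundle_def right_action_def)
  then show ?thesis
    using eq[OF g] eq[of "g \<otimes>\<^bsub>G\<^esub> h"] g h by simp
qed

lemma principal_bundle_coordinates:
  assumes tg: "topological_group G T" and P: "principal_bundle G T M P"
  obtains k where "bij_betw k (topspace M \<times> carrier G) (topspace (total_space P))"
proof -
  interpret group G using tg by (simp add: topological_group_def)
  have "\<exists>\<psi>. inj_on \<psi> (carrier G) \<and> \<psi> ` carrier G = {e \<in> topspace (total_space P). proj P e = b}"
    if b: "b \<in> topspace M" for b
  proof -
    obtain U \<phi> where U: "openin M U" "b \<in> U" and lt: "local_trivialization G T M P U \<phi>"
      using local_trivialization_exists[OF P b] .
    note im = local_trivialization_image[OF tg U(1) lt]
    have pr: "proj P (\<phi> (b', g)) = b'" if "b' \<in> U" "g \<in> carrier G" for b' g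
      using lt that unfolding local_trivialization_def by blast
    have "inj_on (\<lambda>g. \<phi> (b, g)) (carrier G)"
      using im(2) U(2) by (auto simp: inj_on_def)
    moreover have "(\<lambda>g. \<phi> (b, g)) ` carrier G = {e \<in> topspace (total_space P). proj P e = b}"
    proof
      show "(\<lambda>g. \<phi> (b, g)) ` carrier G \<subseteq> {e \<in> topspace (total_space P). proj P e = b}"
        using im(1) U(2) pr by blast
      show "{e \<in> topspace (total_space P). proj P e = b} \<subseteq> (\<lambda>g. \<phi> (b, g)) ` carrier G"
      proof
        fix e assume e: "e \<in> {e \<in> topspace (total_space P). proj P e = b}"
        then have "e \<in> \<phi> ` (U \<times> carrier G)" using im(1) U(2) by blast
        then obtain b' g where bg: "b' \<in> U" "g \<in> carrier G" "e = \<phi> (b', g)" by blast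
        then have "b' = b" using pr e by auto
        then show "e \<in> (\<lambda>g. \<phi> (b, g)) ` carrier G" using bg by blast
      qed
    qed
    ultimately show ?thesis by blast
  qed
  then obtain \<psi> where \<psi>: "\<And>b. b \<in> topspace M \<Longrightarrow> inj_on (\<psi> b) (carrier G)"
      "\<And>b. b \<in> topspace M \<Longrightarrow> \<psi> b ` carrier G = {e \<in> topspace (total_space P). proj P e = b}"
    by metis
  have pM: "proj P e \<in> topspace M" if "e \<in> topspace (total_space P)" for e
    using P that unfolding principal_bundle_def continuous_map_def by blast
  have "inj_on (\<lambda>(b, g). \<psi> b g) (topspace M \<times> carrier G)"
  proof (rule inj_onI, clarsimp)
    fix b g b' g'
    assume *: "b \<in> topspace M" "g \<in> carrier G" "b' \<in> topspace M" "g' \<in> carrier G" "\<psi> b g = \<psi> b' g'"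
    have "proj P (\<psi> b g) = b" using \<psi>(2)[of b] * by blast
    moreover have "proj P (\<psi> b' g') = b'" using \<psi>(2)[of b'] * by blast
    ultimately have "b = b'" using * by simp
    with * show "b = b' \<and> g = g'" using \<psi>(1) by (auto simp: inj_on_def)
  qed
  moreover have "(\<lambda>(b, g). \<psi> b g) ` (topspace M \<times> carrier G) = topspace (total_space P)"
  proof
    show "(\<lambda>(b, g). \<psi> b g) ` (topspace M \<times> carrier G) \<subseteq> topspace (total_space P)"
    proof clarify
      fix b g assume "b \<in> topspace M" "g \<in> carrier G"
      then show "\<psi> b g \<in> topspace (total_space P)" using \<psi>(2)[of b] by blast
    qed
    show "topspace (total_space P) \<subseteq> (\<lambda>(b, g). \<psi> b g) ` (topspace M \<times> carrier G)"
    proof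
      fix e assume e: "e \<in> topspace (total_space P)"
      then have "e \<in> \<psi> (proj P e) ` carrier G" using \<psi>(2)[OF pM[OF e]] by blast
      then show "e \<in> (\<lambda>(b, g). \<psi> b g) ` (topspace M \<times> carrier G)" using pM[OF e] by (auto intro!: rev_image_eqI)
    qed
  qed
  ultimately show ?thesis using that by (auto simp: bij_betw_def)
qed

lemma principal_bundle_transport:
  assumes tg: "topological_group G T" and P: "principal_bundle G T M P"
    and hm: "homeomorphic_maps (total_space P) E h k"
  defines "Q \<equiv> \<lparr>total_space = E, act = (\<lambda>e g. h (act P (k e) g)), proj = proj P \<circ> k\<rparr>"
  shows "principal_bundle G T M Q" and "bundle_equivalent G P Q"
proof -
  have h: "homeomorphic_map (total_space P) E h" and k: "homeomorphic_map E (total_space P) k"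
    using hm homeomorphic_maps_map by blast+
  have kh: "\<And>e. e \<in> topspace (total_space P) \<Longrightarrow> k (h e) = e" and hk: "\<And>e. e \<in> topspace E \<Longrightarrow> h (k e) = e"
    using hm by (auto simp: homeomorphic_maps_def)
  have ch: "continuous_map (total_space P) E h" and ck: "continuous_map E (total_space P) k"
    using hm by (auto simp: homeomorphic_maps_def)
  have hE: "\<And>e. e \<in> topspace (total_space P) \<Longrightarrow> h e \<in> topspace E"
    and kP: "\<And>e. e \<in> topspace E \<Longrightarrow> k e \<in> topspace (total_space P)"
    using ch ck by (auto simp: continuous_map_def)
  have T: "topspace T = carrier G" using tg by (simp add: topological_group_def)
  have ca: "continuous_map (prod_topology (total_space P) T) (total_space P) (\<lambda>(e, g). act P e g)"
    using P by (simp add: principal_bundle_def right_action_def)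
  have aP: "act P e g \<in> topspace (total_space P)" if "e \<in> topspace (total_space P)" "g \<in> carrier G" for e g
    using ca that T by (force simp: continuous_map_def)
  have ra: "right_action G T E (\<lambda>e g. h (act P (k e) g))"
    unfolding right_action_def
  proof (intro conjI ballI)
    have "continuous_map (prod_topology E T) (prod_topology (total_space P) T) (\<lambda>(e, g). (k e, g))"
      using ck by (simp add: continuous_map_prod_top)
    then have "continuous_map (prod_topology E T) E (h \<circ> ((\<lambda>(e, g). act P e g) \<circ> (\<lambda>(e, g). (k e, g))))"
      by (intro continuous_map_compose[OF _ ch] continuous_map_compose[OF _ ca])
    then show "continuous_map (prod_topology E T) E (\<lambda>(e, g). h (act P (k e) g))"
      by (simp add: o_def case_prod_unfold)
    show "h (act P (k e) \<one>\<^bsub>G\<^esub>) = e" if "e \<in> topspace E" for e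
      using P that kP hk by (simp add: principal_bundle_def right_action_def)
    show "h (act P (k (h (act P (k e) g))) g') = h (act P (k e) (g \<otimes>\<^bsub>G\<^esub> g'))"
      if "e \<in> topspace E" "g \<in> carrier G" "g' \<in> carrier G" for e g g'
      using P that kP kh aP by (simp add: principal_bundle_def right_action_def)
  qed
  have cp: "continuous_map E M (proj P \<circ> k)"
    using P ck by (intro continuous_map_compose[OF ck]) (simp add: principal_bundle_def)
  have lt: "local_trivialization G T M Q U (h \<circ> \<phi>)"
    if op: "openin M U" and lt: "local_trivialization G T M P U \<phi>" for U \<phi>
  proof -
    let ?S = "{e \<in> topspace (total_space P). proj P e \<in> U}"
    let ?S' = "{e \<in> topspace E. proj P (k e) \<in> U}"
    have im: "h ` ?S = ?S'"
    proof
      show "h ` ?S \<subseteq> ?S'" using hE kh by auto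
      show "?S' \<subseteq> h ` ?S" using hk kP by (force simp: image_iff)
    qed
    have "homeomorphic_map (subtopology (total_space P) ?S) (subtopology E ?S') h"
      by (rule homeomorphic_map_subtopologies[OF h]) (use im hE in auto)
    then have 1: "homeomorphic_map (prod_topology (subtopology M U) T) (subtopology E ?S') (h \<circ> \<phi>)"
      using lt unfolding local_trivialization_def by (blast intro: homeomorphic_map_compose)
    have U: "\<phi> (b, g) \<in> topspace (total_space P)" if "b \<in> U" "g \<in> carrier G" for b g
      using local_trivialization_image(1)[OF tg op lt] that by blast
    have one: "\<one>\<^bsub>G\<^esub> \<in> carrier G"
      using tg by (simp add: topological_group_def group.is_monoid monoid.one_closed)
    have 2: "proj P (k (h (\<phi> (b, g)))) = b"
      and 3: "h (\<phi> (b, g)) = h (act P (k (h (\<phi> (b, \<one>\<^bsub>G\<^esub>)))) g)"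
      if "b \<in> U" "g \<in> carrier G" for b g
    proof -
      have *: "proj P (\<phi> (b, g)) = b" "\<phi> (b, g) = act P (\<phi> (b, \<one>\<^bsub>G\<^esub>)) g"
        using lt that unfolding local_trivialization_def by blast+
      show "proj P (k (h (\<phi> (b, g)))) = b"
        using *(1) kh[OF U[OF that]] by simp
      show "h (\<phi> (b, g)) = h (act P (k (h (\<phi> (b, \<one>\<^bsub>G\<^esub>)))) g)"
        unfolding kh[OF U[OF that(1) one]] by (rule arg_cong[OF *(2)])
    qed
    show ?thesis
      unfolding local_trivialization_def Q_def gbundle.simps o_def
      by (intro conjI ballI 1[unfolded o_def] 2 3)
  qed
  obtain \<U> where \<U>: "\<forall>U\<in>\<U>. openin M U" "\<Union>\<U> = topspace M"
      "\<forall>U\<in>\<U>. \<exists>\<phi>. local_trivialization G T M P U \<phi>"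
    using P unfolding principal_bundle_def by blast
  have "\<forall>U\<in>\<U>. \<exists>\<phi>. local_trivialization G T M Q U \<phi>"
    using \<U> lt by blast
  with ra cp \<U>(1,2) show "principal_bundle G T M Q"
    unfolding principal_bundle_def by (auto simp: Q_def)
  show "bundle_equivalent G P Q"
    unfolding bundle_equivalent_def Q_def
    by (rule exI[of _ h]) (simp add: h kh)
qed

lemma homeomorphic_maps_of_bij:
  assumes "bij_betw k A (topspace X)"
  shows "homeomorphic_maps X (pullback_topology A k X) (inv_into A k) k"
proof -
  have im: "k ` A = topspace X" and inj: "inj_on k A"
    using assms by (auto simp: bij_betw_def)
  have top: "topspace (pullback_topology A k X) = A"
    using im by (auto simp: topspace_pullback_topology)
  have "continuous_map X X (k \<circ> inv_into A k)"
    by (rule continuous_map_eq[of _ _ id]) (auto simp: im f_inv_into_f)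
  then have "continuous_map X (pullback_topology A k X) (inv_into A k)"
    by (rule continuous_map_pullback') (use im inv_into_into[of _ k A] in auto)
  moreover have "continuous_map (pullback_topology A k X) X k"
    using continuous_map_pullback[of X X id A k] by simp
  ultimately show ?thesis
    using im inj by (auto simp: homeomorphic_maps_def top f_inv_into_f)
qed

theorem principal_bundle_equivalent_pair_type:
  fixes P :: "('e, 'g, 'm) gbundle"
  assumes tg: "topological_group G T" and P: "principal_bundle G T M P"
  shows "\<exists>Q :: ('m \<times> 'g, 'g, 'm) gbundle. principal_bundle G T M Q \<and> bundle_equivalent G P Q"
proof -
  obtain k where "bij_betw k (topspace M \<times> carrier G) (topspace (total_space P))"
    using principal_bundle_coordinates[OF tg P] .
  from principal_bundle_transport[OF tg P homeomorphic_maps_of_bij[OF this]]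
  show ?thesis by blast
qed

end

(* Let A be the complement of the centres of the 2-cells and B the union of the open 2-cells. Both
   are open; A retracts to the 1-skeleton, and A Int B is a disjoint union of open annuli. A
   principal bundle has sections over A (extended cell by cell over the 1-skeleton, as G is path
   connected) and over B, so it is determined by a transition function u : A Int B -> G, up to
   u ~ alpha^-1 u beta with alpha : A -> G, beta : B -> G. A map u into G represents a
   one-dimensional class with values in pi_1(G): an edge is sent to the loop formed by its u-image
   and fixed paths from the unit to its endpoints, and a pointwise product of maps represents the
   product of the classes. On A, B and A Int B every such class is represented by a map, and a map
   on A Int B representing the trivial class extends over B after a modification near the centres.
   Hence gauge classes of transition functions correspond to H^1(A Int B) modulo
   H^1(A), which is H^2(M) by the Mayer-Vietoris sequence, as H^2(A) = H^1(B) = H^2(B) = 0. *)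


theory Submission
  imports Defs "HOL-Analysis.Abstract_Topological_Spaces"
begin

section \<open>Singular cochains as homomorphisms on chains\<close>

text \<open>Two obstacles shape the proof. A cochain assembled from open pieces is controlled only
  on simplices lying in one piece; \<open>small_vanishing_cocycle\<close> supplies, through iterated
  subdivision, a correction that is trivial on those simplices, so a glued cocycle restricts to the
  given ones exactly and not just up to coboundary. And infinitely many cells of M may meet, so
  homotopies on M are tested cell by cell by way of the compact interval. All vanishing and
  realisation statements come from one kind of space, the \<open>scattered\<close> ones, where
  coning kills cocycles of positive degree: the part of A over the 1-skeleton minus edge midpoints,
  the part over the open edges, and the annuli cut open along a ray are of this kind, as are the
  overlaps. The pointwise product of loops is homotopic to their concatenation; this makes pi_1
  abelian and is why multiplying maps into G multiplies their classes. The fixed paths from the unit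
  are not continuous in the point: a continuous choice would be a null homotopy and force the class
  to vanish (\<open>holonomy_null_homotopy\<close>).\<close>

context comm_group
begin

text \<open>In contrast to \<open>cochain_group\<close>, values off the chain group are left free,
  so that one function serves as a cochain on every subspace.\<close>

definition cochain :: "nat \<Rightarrow> 'x topology \<Rightarrow> ('x chain \<Rightarrow> 'a) \<Rightarrow> bool"
  where "cochain n X f \<longleftrightarrow> f \<in> hom (chain_group n X) G"

definition cocycle :: "nat \<Rightarrow> 'x topology \<Rightarrow> ('x chain \<Rightarrow> 'a) \<Rightarrow> bool"
  where "cocycle n X f \<longleftrightarrow>
    cochain n X f \<and> (\<forall>c. singular_chain (Suc n) X c \<longrightarrow> f (chain_boundary (Suc n) c) = \<one>)"

lemma cochain_iff:
  "cochain n X f \<longleftrightarrow>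
    (\<forall>c. singular_chain n X c \<longrightarrow> f c \<in> carrier G) \<and>
    (\<forall>c d. singular_chain n X c \<longrightarrow> singular_chain n X d \<longrightarrow> f (c + d) = f c \<otimes> f d)"
  by (auto simp: cochain_def hom_def)

lemma cochain_closed: "cochain n X f \<Longrightarrow> singular_chain n X c \<Longrightarrow> f c \<in> carrier G"
  by (simp add: cochain_iff)

lemma cochain_add:
  "cochain n X f \<Longrightarrow> singular_chain n X c \<Longrightarrow> singular_chain n X d \<Longrightarrow> f (c + d) = f c \<otimes> f d"
  by (simp add: cochain_iff)

lemma cochain_zero:
  assumes "cochain n X f"
  shows "f 0 = \<one>"
proof -
  have "f (0 + 0) = f 0 \<otimes> f 0"
    using assms by (intro cochain_add) auto
  moreover have "f 0 \<in> carrier G"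
    using assms by (rule cochain_closed) auto
  ultimately show ?thesis
    by simp
qed

lemma cochain_minus:
  assumes "cochain n X f" "singular_chain n X c"
  shows "f (- c) = inv (f c)"
proof -
  have "f (- c) \<otimes> f c = f (- c + c)"
    using assms by (intro cochain_add [symmetric]) (auto simp: singular_chain_minus)
  then show ?thesis
    using assms by (simp add: cochain_zero inv_equality cochain_closed singular_chain_minus)
qed

lemma cochain_diff:
  assumes "cochain n X f" "singular_chain n X c" "singular_chain n X d"
  shows "f (c - d) = f c \<otimes> inv (f d)"
  using cochain_add [of n X f c "- d"] cochain_minus [OF assms(1,3)] assms
  by (simp add: singular_chain_minus)

lemma cochain_mono:
  "cochain n X f \<Longrightarrow> (\<And>c. singular_chain n Y c \<Longrightarrow> singular_chain n X c) \<Longrightarrow> cochain n Y f"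
  by (auto simp: cochain_iff)

lemma cochain_subtopology: "cochain n X f \<Longrightarrow> cochain n (subtopology X S) f"
  by (erule cochain_mono) (simp add: singular_chain_subtopology)

lemma cochain_cong:
  assumes "cochain n X f" "\<And>c. singular_chain n X c \<Longrightarrow> g c = f c"
  shows "cochain n X g"
  using assms by (simp add: cochain_iff singular_chain_add)

lemma cocycle_cochain: "cocycle n X f \<Longrightarrow> cochain n X f"
  by (simp add: cocycle_def)

lemma cocycle_boundary:
  "cocycle n X f \<Longrightarrow> singular_chain (Suc n) X c \<Longrightarrow> f (chain_boundary (Suc n) c) = \<one>"
  by (simp add: cocycle_def)

lemma cocycle_subtopology: "cocycle n X f \<Longrightarrow> cocycle n (subtopology X S) f"
  by (auto simp: cocycle_def cochain_subtopology singular_chain_subtopology)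

lemma cocycle_cong:
  assumes "cocycle n X f" "\<And>c. singular_chain n X c \<Longrightarrow> g c = f c"
  shows "cocycle n X g"
  using assms cochain_cong [of n X f g]
  by (simp add: cocycle_def singular_chain_boundary_alt)

lemma cochain_one: "cochain n X (\<lambda>c. \<one>)"
  by (simp add: cochain_iff)

lemma cochain_mult: "cochain n X f \<Longrightarrow> cochain n X g \<Longrightarrow> cochain n X (\<lambda>c. f c \<otimes> g c)"
  by (auto simp: cochain_iff m_ac)

lemma cochain_inv: "cochain n X f \<Longrightarrow> cochain n X (\<lambda>c. inv (f c))"
  by (auto simp: cochain_iff inv_mult)

lemma cocycle_one: "cocycle n X (\<lambda>c. \<one>)"
  by (simp add: cocycle_def cochain_one)

lemma cocycle_mult: "cocycle n X f \<Longrightarrow> cocycle n X g \<Longrightarrow> cocycle n X (\<lambda>c. f c \<otimes> g c)"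
  by (simp add: cocycle_def cochain_mult)

lemma cocycle_inv: "cocycle n X f \<Longrightarrow> cocycle n X (\<lambda>c. inv (f c))"
  by (simp add: cocycle_def cochain_inv)

lemma cochain_coboundary:
  assumes "cochain n X f"
  shows "cochain (Suc n) X (\<lambda>c. f (chain_boundary (Suc n) c))"
  using assms by (auto simp: cochain_iff chain_boundary_add dest: singular_chain_boundary_alt)

lemma cocycle_coboundary:
  assumes "cochain n X f"
  shows "cocycle (Suc n) X (\<lambda>c. f (chain_boundary (Suc n) c))"
  using cochain_coboundary [OF assms]
  by (metis chain_boundary_boundary_alt cochain_zero [OF assms] cocycle_def singular_chain_boundary_alt)

lemma cochain_eqI:
  assumes f: "cochain n X f" and g: "cochain n X g"
    and eq: "\<And>\<sigma>. singular_simplex n X \<sigma> \<Longrightarrow> f (frag_of \<sigma>) = g (frag_of \<sigma>)"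
    and c: "singular_chain n X c"
  shows "f c = g c"
proof -
  \<comment> \<open>The chain property is carried through the induction because evaluating f and g
    on a difference requires both terms to be chains.\<close>
  have "singular_chain n X c \<and> f c = g c"
    using c unfolding singular_chain_def
  proof (induction c rule: frag_induction)
    case zero
    then show ?case using f g by (simp add: cochain_zero)
  next
    case (one \<sigma>)
    then show ?case using eq by simp
  next
    case (diff a b)
    have "singular_chain n X (a - b)"
      using diff by (intro singular_chain_diff) (auto simp: singular_chain_def)
    with diff show ?case
      by (metis (no_types, lifting) cochain_diff f g singular_chain_def)
  qed
  then show ?thesis ..
qed

lemma cochain_of_simplices:
  assumes "\<And>\<sigma>. singular_simplex n X \<sigma> \<Longrightarrow> \<phi> \<sigma> \<in> carrier G"
  obtains f where "cochain n X f" "\<And>\<sigma>. singular_simplex n X \<sigma> \<Longrightarrow> f (frag_of \<sigma>) = \<phi> \<sigma>"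
proof -
  have "\<phi> ` singular_simplex_set n X \<subseteq> carrier G" using assms by auto
  from free_Abelian_group_universal [OF this] show ?thesis
    using that unfolding cochain_def chain_group_def by (metis mem_Collect_eq)
qed

text \<open>Chains are free on simplices, so values on simplices may be prescribed at will. A
  simplex in neither piece gets the unit, which is why gluing cocycles yields in general only a
  cochain.\<close>

lemma cochain_glue:
  assumes a: "cochain n (subtopology X U) a" and b: "cochain n (subtopology X V) b"
    and eq: "\<And>\<sigma>. singular_simplex n (subtopology X (U \<inter> V)) \<sigma> \<Longrightarrow> a (frag_of \<sigma>) = b (frag_of \<sigma>)"
  obtains f where "cochain n X f"
    "\<And>c. singular_chain n (subtopology X U) c \<Longrightarrow> f c = a c"
    "\<And>c. singular_chain n (subtopology X V) c \<Longrightarrow> f c = b c"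
proof -
  define \<phi> where "\<phi> \<sigma> = (if singular_simplex n (subtopology X U) \<sigma> then a (frag_of \<sigma>)
     else if singular_simplex n (subtopology X V) \<sigma> then b (frag_of \<sigma>) else \<one>)" for \<sigma>
  have "\<phi> \<sigma> \<in> carrier G" for \<sigma>
    using a b by (auto simp: \<phi>_def singular_chain_of intro: cochain_closed)
  then obtain f where f: "cochain n X f" "\<And>\<sigma>. singular_simplex n X \<sigma> \<Longrightarrow> f (frag_of \<sigma>) = \<phi> \<sigma>"
    using cochain_of_simplices by metis
  show ?thesis
  proof
    show "cochain n X f" by fact
    show "f c = a c" if "singular_chain n (subtopology X U) c" for c
      by (rule cochain_eqI [OF cochain_subtopology [OF f(1)] a _ that])
        (auto simp: f(2) \<phi>_def singular_simplex_subtopology)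
    show "f c = b c" if "singular_chain n (subtopology X V) c" for c
      by (rule cochain_eqI [OF cochain_subtopology [OF f(1)] b _ that])
        (use eq in \<open>auto simp: f(2) \<phi>_def singular_simplex_subtopology\<close>)
  qed
qed

subsection \<open>Small simplices\<close>

text \<open>\<open>D p m\<close> sums one fixed one-step homotopy \<open>h\<close> over the first m
  subdivisions. Homotopies chosen separately for each m would be unrelated; here the terms added
  after stage m are images under \<open>h\<close> of chains that are already small, which gives the
  last property. The spaces vary inside each property because the same operator is used on X and on
  its pieces.\<close>

lemma subdivision_operator_exists:
  obtains D :: "nat \<Rightarrow> nat \<Rightarrow> 'x chain \<Rightarrow> 'x chain" where
    "\<And>p m c d. D p m (c - d) = D p m c - D p m d"
    "\<And>p m X c. singular_chain p X c \<Longrightarrow> singular_chain (Suc p) X (D p m c)"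
    "\<And>p m X c. singular_chain (Suc p) X c \<Longrightarrow>
       chain_boundary (Suc (Suc p)) (D (Suc p) m c) + D p m (chain_boundary (Suc p) c)
         = (singular_subdivision (Suc p) ^^ m) c - c"
    "\<And>p m m' X U V c. singular_chain p X c \<Longrightarrow>
       (\<And>k. k \<ge> m \<Longrightarrow> \<exists>a b. (singular_subdivision p ^^ k) c = a + b \<and>
          singular_chain p (subtopology X U) a \<and> singular_chain p (subtopology X V) b) \<Longrightarrow>
       m \<le> m' \<Longrightarrow>
       \<exists>a b. D p m' c = D p m c + a + b \<and>
          singular_chain (Suc p) (subtopology X U) a \<and> singular_chain (Suc p) (subtopology X V) b"
proof -
  obtain h :: "nat \<Rightarrow> 'x chain \<Rightarrow> 'x chain" where
    h0: "\<And>p. h p 0 = 0" and hd: "\<And>p c d. h p (c - d) = h p c - h p d"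
    and hc: "\<And>p X c. singular_chain p X c \<Longrightarrow> singular_chain (Suc p) X (h p c)"
    and hb: "\<And>p X c. singular_chain p X c \<Longrightarrow>
       chain_boundary (Suc p) (h p c) + h (p - Suc 0) (chain_boundary p c)
         = (singular_subdivision p ^^ 1) c - c"
    using chain_homotopic_iterated_singular_subdivision [of 1] by metis
  have ha: "h p (c + d) = h p c + h p d" for p c d
    using hd [of p c "0 - d"] hd [of p 0 d] h0 by simp
  define D where "D p m c = (\<Sum>i<m. h p ((singular_subdivision p ^^ i) c))" for p m c
  have sd: "singular_chain p X ((singular_subdivision p ^^ i) c)" if "singular_chain p X c" for p X c i
    using that by (induction i) (auto simp: singular_chain_singular_subdivision)
  have sb: "chain_boundary (Suc p) ((singular_subdivision (Suc p) ^^ i) c)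
      = (singular_subdivision p ^^ i) (chain_boundary (Suc p) c)"
    if "singular_chain (Suc p) X c" for p X c i
  proof (induction i)
    case (Suc i)
    then show ?case
      using chain_boundary_singular_subdivision [OF sd [OF that, of i]] by simp
  qed auto
  show ?thesis
  proof (rule that [of D])
    show "D p m (c - d) = D p m c - D p m d" for p m c d
      by (simp add: D_def singular_subdivision_power_diff hd sum_subtractf)
    show "singular_chain (Suc p) X (D p m c)" if "singular_chain p X c" for p m X c
      unfolding D_def by (intro singular_chain_sum hc sd that)
    show "chain_boundary (Suc (Suc p)) (D (Suc p) m c) + D p m (chain_boundary (Suc p) c)
         = (singular_subdivision (Suc p) ^^ m) c - c" if c: "singular_chain (Suc p) X c" for p m X c
    proof (induction m)
      case (Suc m)
      have "chain_boundary (Suc (Suc p)) (h (Suc p) ((singular_subdivision (Suc p) ^^ m) c))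
        + h p ((singular_subdivision p ^^ m) (chain_boundary (Suc p) c))
        = (singular_subdivision (Suc p) ^^ Suc m) c - (singular_subdivision (Suc p) ^^ m) c"
        using hb [OF sd [OF c, of m]] by (simp add: sb [OF c])
      then have "chain_boundary (Suc (Suc p)) (D (Suc p) (Suc m) c) + D p (Suc m) (chain_boundary (Suc p) c)
        = ((singular_subdivision (Suc p) ^^ m) c - c)
          + ((singular_subdivision (Suc p) ^^ Suc m) c - (singular_subdivision (Suc p) ^^ m) c)"
        unfolding Suc [symmetric] by (simp add: D_def chain_boundary_add add_ac)
      then show ?case
        by simp
    qed (simp add: D_def)
    show "\<exists>a b. D p m' c = D p m c + a + b \<and>
          singular_chain (Suc p) (subtopology X U) a \<and> singular_chain (Suc p) (subtopology X V) b"
      if c: "singular_chain p X c"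
        and ab: "\<And>k. k \<ge> m \<Longrightarrow> \<exists>a b. (singular_subdivision p ^^ k) c = a + b \<and>
          singular_chain p (subtopology X U) a \<and> singular_chain p (subtopology X V) b"
        and "m \<le> m'" for p m m' X U V c
      using \<open>m \<le> m'\<close>
    proof (induction m' rule: dec_induct)
      case base
      show ?case by (rule exI [of _ 0], rule exI [of _ 0]) simp
    next
      case (step k)
      then obtain a b where ab': "D p k c = D p m c + a + b"
          "singular_chain (Suc p) (subtopology X U) a" "singular_chain (Suc p) (subtopology X V) b"
        by blast
      obtain a' b' where *: "(singular_subdivision p ^^ k) c = a' + b'"
          "singular_chain p (subtopology X U) a'" "singular_chain p (subtopology X V) b'"
        using ab step by blast
      have "D p (Suc k) c = D p m c + (a + h p a') + (b + h p b')"
        using ab'(1) *(1) by (simp add: D_def ha algebra_simps)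
      then show ?case
        using ab' * hc singular_chain_add by blast
    qed
  qed
qed

lemma eventually_small_chain:
  assumes U: "openin X U" and V: "openin X V" and UV: "topspace X \<subseteq> U \<union> V" and c: "singular_chain p X c"
  obtains n where "\<And>m. n \<le> m \<Longrightarrow> \<exists>a b. (singular_subdivision p ^^ m) c = a + b \<and>
     singular_chain p (subtopology X U) a \<and> singular_chain p (subtopology X V) b"
proof -
  obtain n where n: "\<And>m f. \<lbrakk>n \<le> m; f \<in> Poly_Mapping.keys ((singular_subdivision p ^^ m) c)\<rbrakk>
      \<Longrightarrow> \<exists>W \<in> {U, V}. f \<in> standard_simplex p \<rightarrow> W"
    by (rule sufficient_iterated_singular_subdivision_exists [of "{U, V}" X, OF _ _ c]) (use U V UV in auto)
  show ?thesis
  proof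
    fix m assume "n \<le> m"
    have "singular_chain p X ((singular_subdivision p ^^ m) c)"
      by (induction m) (auto simp: singular_chain_singular_subdivision c)
    then have "Poly_Mapping.keys ((singular_subdivision p ^^ m) c) \<subseteq>
        singular_simplex_set p (subtopology X U) \<union> singular_simplex_set p (subtopology X V)"
      using n [OF \<open>n \<le> m\<close>] by (force simp: singular_chain_def singular_simplex_subtopology)
    from frag_split [OF this] show "\<exists>a b. (singular_subdivision p ^^ m) c = a + b \<and>
        singular_chain p (subtopology X U) a \<and> singular_chain p (subtopology X V) b"
      unfolding singular_chain_def by metis
  qed
qed

text \<open>On a fine subdivision of c and on boundaries f is trivial, so the homotopy formula for
  \<open>D\<close> gives \<open>f c\<close> as the inverse of f at \<open>D\<close> of the boundary
  of c. The number of subdivisions in \<open>D\<close> can be any sufficiently large one, as further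
  terms lie in the pieces.\<close>

lemma small_vanishing_cocycle:
  fixes X :: "'x topology"
  assumes U: "openin X U" and V: "openin X V" and UV: "topspace X \<subseteq> U \<union> V"
    and f: "cocycle (Suc n) X f"
    and fU: "\<And>c. singular_chain (Suc n) (subtopology X U) c \<Longrightarrow> f c = \<one>"
    and fV: "\<And>c. singular_chain (Suc n) (subtopology X V) c \<Longrightarrow> f c = \<one>"
  obtains e where "cochain n X e"
    "\<And>c. singular_chain (Suc n) X c \<Longrightarrow> f c = e (chain_boundary (Suc n) c)"
    "\<And>c. singular_chain n (subtopology X U) c \<Longrightarrow> e c = \<one>"
    "\<And>c. singular_chain n (subtopology X V) c \<Longrightarrow> e c = \<one>"
proof -
  obtain D :: "nat \<Rightarrow> nat \<Rightarrow> 'x chain \<Rightarrow> 'x chain" where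
    Dd: "\<And>p m c d. D p m (c - d) = D p m c - D p m d"
    and Dc: "\<And>p m X c. singular_chain p X c \<Longrightarrow> singular_chain (Suc p) X (D p m c)"
    and Db: "\<And>p m X c. singular_chain (Suc p) X c \<Longrightarrow>
       chain_boundary (Suc (Suc p)) (D (Suc p) m c) + D p m (chain_boundary (Suc p) c)
         = (singular_subdivision (Suc p) ^^ m) c - c"
    and Ds: "\<And>p m m' X U V c. singular_chain p X c \<Longrightarrow>
       (\<And>k. k \<ge> m \<Longrightarrow> \<exists>a b. (singular_subdivision p ^^ k) c = a + b \<and>
          singular_chain p (subtopology X U) a \<and> singular_chain p (subtopology X V) b) \<Longrightarrow>
       m \<le> m' \<Longrightarrow>
       \<exists>a b. D p m' c = D p m c + a + b \<and>
          singular_chain (Suc p) (subtopology X U) a \<and> singular_chain (Suc p) (subtopology X V) b"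
  proof (rule subdivision_operator_exists [where ?'x = 'x], goal_cases)
    case (1 D)
    show ?case by (rule 1(1) [of D]) (fact 1)+
  qed
  note cf = cocycle_cochain [OF f]
  have sub: "singular_chain p X c" if "singular_chain p (subtopology X S) c" for p S and c :: "'x chain"
    using that by (simp add: singular_chain_subtopology)
  define small where "small p m c \<longleftrightarrow> (\<forall>k\<ge>m. \<exists>a b. (singular_subdivision p ^^ k) c = a + b \<and>
     singular_chain p (subtopology X U) a \<and> singular_chain p (subtopology X V) b)" for p m and c :: "'x chain"
  have ex: "\<exists>m. small p m c" if "singular_chain p X c" for p and c :: "'x chain"
    using eventually_small_chain [OF U V UV that] unfolding small_def by metis
  have mono: "small p m' c" if "small p m c" "m \<le> m'" for p m m' and c :: "'x chain"
    using that by (simp add: small_def)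
  have fab: "f (a + b) = \<one>" if "singular_chain (Suc n) (subtopology X U) a" "singular_chain (Suc n) (subtopology X V) b" for a b
    using cochain_add [OF cf sub sub, OF that] fU fV that by simp
  have indep: "f (D n m' c) = f (D n m c)" if c: "singular_chain n X c" and s: "small n m c" and "m \<le> m'" for m m' c
  proof -
    obtain a b where ab: "D n m' c = D n m c + a + b"
          "singular_chain (Suc n) (subtopology X U) a" "singular_chain (Suc n) (subtopology X V) b"
      using Ds [OF c _ \<open>m \<le> m'\<close>] s unfolding small_def by metis
    then have "f (D n m' c) = f (D n m c) \<otimes> f (a + b)"
      using cochain_add [OF cf Dc [OF c, of m] singular_chain_add [OF sub sub, OF ab(2,3)]]
      by (simp add: add.assoc)
    then show ?thesis
      using fab ab cochain_closed [OF cf Dc [OF c]] by simp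
  qed
  \<comment> \<open>No number of subdivisions is fine enough for all chains, so it depends on the
    chain. Additivity of e is checked at a number that suffices for c, d and c + d.\<close>
  define N where "N c = (SOME m. small n m c)" for c
  have N: "small n (N c) c" if "singular_chain n X c" for c
    unfolding N_def using ex [OF that] by (rule someI_ex)
  define e where "e c = inv (f (D n (N c) c))" for c
  have e: "e c = inv (f (D n m c))" if "singular_chain n X c" "N c \<le> m" for c m
    using indep [OF that(1) N that(2)] that by (simp add: e_def)
  have ec: "e c \<in> carrier G" if "singular_chain n X c" for c
    using cochain_closed [OF cf Dc [OF that]] by (simp add: e_def)
  have Da: "D p m (c + d) = D p m c + D p m d" for p m c d
    using Dd [of p m c "0 - d"] Dd [of p m 0 d] Dd [of p m 0 0] by simp
  show ?thesis
  proof
    show "cochain n X e"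
      unfolding cochain_iff
    proof (intro conjI allI impI ec)
      fix c d assume cd: "singular_chain n X c" "singular_chain n X d"
      define m where "m = max (N c) (max (N d) (N (c + d)))"
      have "e (c + d) = inv (f (D n m c + D n m d))"
        using e [OF singular_chain_add [OF cd], of m] by (simp add: m_def Da)
      also have "\<dots> = inv (f (D n m c)) \<otimes> inv (f (D n m d))"
        using cochain_add [OF cf Dc Dc, OF cd] cochain_closed [OF cf Dc] cd by (simp add: inv_mult)
      also have "\<dots> = e c \<otimes> e d"
        using e [OF cd(1), of m] e [OF cd(2), of m] by (simp add: m_def)
      finally show "e (c + d) = e c \<otimes> e d" .
    qed
    show "f c = e (chain_boundary (Suc n) c)" if c: "singular_chain (Suc n) X c" for c
    proof -
      let ?b = "chain_boundary (Suc n) c"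
      have b: "singular_chain n X ?b" using c by (rule singular_chain_boundary_alt)
      obtain m0 where m0: "small (Suc n) m0 c" using ex [OF c] by blast
      define m where "m = max m0 (N ?b)"
      obtain a a' where aa: "(singular_subdivision (Suc n) ^^ m) c = a + a'"
         "singular_chain (Suc n) (subtopology X U) a" "singular_chain (Suc n) (subtopology X V) a'"
        using mono [OF m0, of m] unfolding small_def m_def by (meson max.cobounded1 order_refl)
      have eq: "a + a' = c + (chain_boundary (Suc (Suc n)) (D (Suc n) m c) + D n m ?b)"
        using Db [OF c, of m] aa(1) by simp
      have DB: "singular_chain (Suc n) X (chain_boundary (Suc (Suc n)) (D (Suc n) m c))"
        using Dc [OF c] by (rule singular_chain_boundary_alt)
      have DB1: "f (chain_boundary (Suc (Suc n)) (D (Suc n) m c)) = \<one>"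
        by (rule cocycle_boundary [OF f Dc [OF c]])
      have "\<one> = f (a + a')"
        using fab aa by simp
      also have "\<dots> = f c \<otimes> (\<one> \<otimes> f (D n m ?b))"
        unfolding eq cochain_add [OF cf c singular_chain_add [OF DB Dc [OF b]]]
          cochain_add [OF cf DB Dc [OF b]] DB1 ..
      finally have "f c \<otimes> f (D n m ?b) = \<one>"
        using cochain_closed [OF cf Dc [OF b]] by simp
      then have "f c = inv (f (D n m ?b))"
        using cochain_closed [OF cf c] cochain_closed [OF cf Dc [OF b]] by (metis inv_equality)
      then show ?thesis
        using e [OF b, of m] by (simp add: m_def)
    qed
    \<comment> \<open>\<open>D\<close> turns chains of a subspace into chains of the same subspace,
      where f is trivial by hypothesis.\<close>
    have e1: "e c = \<one>" if c: "singular_chain n X c" and cUV: "singular_chain n (subtopology X U) c \<or> singular_chain n (subtopology X V) c" for c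
    proof -
      have "f (D n (N c) c) = \<one>"
        using cUV Dc fU fV by metis
      then show ?thesis by (simp add: e_def)
    qed
    show "e c = \<one>" if "singular_chain n (subtopology X U) c" for c
      using e1 that sub by blast
    show "e c = \<one>" if "singular_chain n (subtopology X V) c" for c
      using e1 that sub by blast
  qed
qed

text \<open>The coboundary of the glued cochain is trivial on both pieces. Dividing by the
  correction from \<open>small_vanishing_cocycle\<close> removes it and, since the correction is
  trivial on the pieces, keeps the restrictions.\<close>

lemma cocycle_glue:
  fixes X :: "'x topology"
  assumes U: "openin X U" and V: "openin X V" and UV: "topspace X \<subseteq> U \<union> V"
    and a: "cocycle n (subtopology X U) a" and b: "cocycle n (subtopology X V) b"
    and eq: "\<And>\<sigma>. singular_simplex n (subtopology X (U \<inter> V)) \<sigma> \<Longrightarrow> a (frag_of \<sigma>) = b (frag_of \<sigma>)"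
  obtains c where "cocycle n X c"
    "\<And>x. singular_chain n (subtopology X U) x \<Longrightarrow> c x = a x"
    "\<And>x. singular_chain n (subtopology X V) x \<Longrightarrow> c x = b x"
proof -
  obtain f where f: "cochain n X f"
    and fa: "\<And>c. singular_chain n (subtopology X U) c \<Longrightarrow> f c = a c"
    and fb: "\<And>c. singular_chain n (subtopology X V) c \<Longrightarrow> f c = b c"
    using cochain_glue [OF cocycle_cochain [OF a] cocycle_cochain [OF b] eq] by blast
  have df: "cocycle (Suc n) X (\<lambda>c. f (chain_boundary (Suc n) c))"
    by (rule cocycle_coboundary [OF f])
  have "f (chain_boundary (Suc n) c) = \<one>" if "singular_chain (Suc n) (subtopology X U) c" for c
    using cocycle_boundary [OF a that] fa [OF singular_chain_boundary_alt [OF that]] by simp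
  moreover have "f (chain_boundary (Suc n) c) = \<one>" if "singular_chain (Suc n) (subtopology X V) c" for c
    using cocycle_boundary [OF b that] fb [OF singular_chain_boundary_alt [OF that]] by simp
  ultimately obtain e where e: "cochain n X e"
    "\<And>c. singular_chain (Suc n) X c \<Longrightarrow> f (chain_boundary (Suc n) c) = e (chain_boundary (Suc n) c)"
    "\<And>c. singular_chain n (subtopology X U) c \<Longrightarrow> e c = \<one>"
    "\<And>c. singular_chain n (subtopology X V) c \<Longrightarrow> e c = \<one>"
    using small_vanishing_cocycle [OF U V UV df] by blast
  have sub: "singular_chain n X c" if "singular_chain n (subtopology X S) c" for S and c :: "'x chain"
    using that by (simp add: singular_chain_subtopology)
  show ?thesis
  proof
    show "cocycle n X (\<lambda>c. f c \<otimes> inv (e c))"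
      unfolding cocycle_def using f e
      by (auto intro!: cochain_mult cochain_inv r_inv cochain_closed singular_chain_boundary_alt)
    show "f x \<otimes> inv (e x) = a x" if "singular_chain n (subtopology X U) x" for x
      using e(3) fa that cochain_closed [OF f sub [OF that]] by simp
    show "f x \<otimes> inv (e x) = b x" if "singular_chain n (subtopology X V) x" for x
      using e(4) fb that cochain_closed [OF f sub [OF that]] by simp
  qed
qed

end


section \<open>Loops in a topological group\<close>

lemma square_topology:
  "prod_topology (top_of_set {0..1}) (top_of_set {0..1}) = top_of_set ({0..1::real} \<times> {0..1::real})"
  by (simp add: subtopology_Times flip: euclidean_product_topology)

locale topological_group_space = group G for G (structure) +
  fixes T
  assumes topgroup: "topological_group G T"
begin

lemma topspace_T [simp]: "topspace T = carrier G"
  using topgroup by (simp add: topological_group_def)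

lemma continuous_mult:
  assumes "continuous_map X T f" "continuous_map X T g"
  shows "continuous_map X T (\<lambda>x. f x \<otimes> g x)"
proof -
  have "continuous_map X T ((\<lambda>(g, h). g \<otimes> h) \<circ> (\<lambda>x. (f x, g x)))"
    using topgroup assms
    by (intro continuous_map_compose [where X' = "prod_topology T T"])
      (auto simp: topological_group_def continuous_map_pairwise o_def)
  then show ?thesis by (simp add: o_def)
qed

lemma continuous_inv:
  assumes "continuous_map X T f"
  shows "continuous_map X T (\<lambda>x. inv (f x))"
  using continuous_map_compose [OF assms, of T "\<lambda>g. inv g"] topgroup
  by (simp add: topological_group_def o_def)

lemma continuous_closed: "continuous_map X T f \<Longrightarrow> x \<in> topspace X \<Longrightarrow> f x \<in> carrier G"
  using continuous_map_image_subset_topspace by fastforce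

lemma continuous_path:
  assumes "pathin T p" "continuous_map X euclideanreal e" "\<And>x. x \<in> topspace X \<Longrightarrow> e x \<in> {0..1}"
  shows "continuous_map X T (\<lambda>x. p (e x))"
proof -
  have "continuous_map X (top_of_set {0..1}) e"
    using assms by (auto simp: continuous_map_in_subtopology)
  from continuous_map_compose [OF this, of T p] show ?thesis
    using assms(1) by (simp add: pathin_def o_def)
qed

lemma pathin_closed: "pathin T p \<Longrightarrow> t \<in> {0..1} \<Longrightarrow> p t \<in> carrier G"
  unfolding pathin_def by (drule continuous_closed) auto

lemma pathin_mult: "pathin T p \<Longrightarrow> pathin T q \<Longrightarrow> pathin T (\<lambda>t. p t \<otimes> q t)"
  unfolding pathin_def by (rule continuous_mult)

lemma pathin_inv: "pathin T p \<Longrightarrow> pathin T (\<lambda>t. inv (p t))"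
  unfolding pathin_def by (rule continuous_inv)

lemma pathin_one: "pathin T (\<lambda>t. \<one>)"
  by (simp add: pathin_def)

lemma inv_mult_cancel [simp]: "x \<in> carrier G \<Longrightarrow> y \<in> carrier G \<Longrightarrow> inv x \<otimes> (x \<otimes> y) = y"
  by (simp flip: m_assoc)

lemma mult_inv_cancel [simp]: "x \<in> carrier G \<Longrightarrow> y \<in> carrier G \<Longrightarrow> x \<otimes> (inv x \<otimes> y) = y"
  by (simp flip: m_assoc)

abbreviation unit_loop :: "(real \<Rightarrow> 'a) \<Rightarrow> bool"
  where "unit_loop \<equiv> loop_at T \<one>"

abbreviation loop_eqv :: "(real \<Rightarrow> 'a) \<Rightarrow> (real \<Rightarrow> 'a) \<Rightarrow> bool" (infix \<open>\<simeq>\<close> 50)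
  where "p \<simeq> q \<equiv> loop_homotopic T \<one> p q"

abbreviation cls :: "(real \<Rightarrow> 'a) \<Rightarrow> (real \<Rightarrow> 'a) set"
  where "cls \<equiv> loop_class T \<one>"

abbreviation P :: "(real \<Rightarrow> 'a) set monoid"
  where "P \<equiv> fundamental_group T \<one>"

lemma loop_eqv_iff:
  "p \<simeq> q \<longleftrightarrow> (\<exists>F. continuous_map (top_of_set ({0..1::real} \<times> {0..1::real})) T F \<and>
     (\<forall>t\<in>{0..1}. F (0, t) = p t) \<and> (\<forall>t\<in>{0..1}. F (1, t) = q t) \<and>
     (\<forall>s\<in>{0..1}. F (s, 0) = \<one> \<and> F (s, 1) = \<one>))"
  unfolding loop_homotopic_def
  by (subst homotopic_with) (simp_all add: square_topology)

lemma loop_eqvI: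
  assumes "continuous_map (top_of_set ({0..1::real} \<times> {0..1::real})) T (\<lambda>z. F (fst z) (snd z))"
    and "\<And>t. 0 \<le> t \<Longrightarrow> t \<le> 1 \<Longrightarrow> F 0 t = p t" "\<And>t. 0 \<le> t \<Longrightarrow> t \<le> 1 \<Longrightarrow> F 1 t = q t"
    and "\<And>s. 0 \<le> s \<Longrightarrow> s \<le> 1 \<Longrightarrow> F s 0 = \<one>" "\<And>s. 0 \<le> s \<Longrightarrow> s \<le> 1 \<Longrightarrow> F s 1 = \<one>"
  shows "p \<simeq> q"
  unfolding loop_eqv_iff
  by (rule exI [of _ "\<lambda>z. F (fst z) (snd z)"]) (use assms in auto)

lemma loop_eqv_sym: "p \<simeq> q \<Longrightarrow> q \<simeq> p"
  unfolding loop_homotopic_def by (rule homotopic_with_symD)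

lemma loop_eqv_trans: "p \<simeq> q \<Longrightarrow> q \<simeq> r \<Longrightarrow> p \<simeq> r"
  unfolding loop_homotopic_def by (rule homotopic_with_trans)

lemma loop_eqv_refl: "p \<simeq> p \<longleftrightarrow> unit_loop p"
  by (simp add: loop_homotopic_def loop_at_def pathin_def)

lemma loop_eqv_loop: "p \<simeq> q \<Longrightarrow> unit_loop p \<and> unit_loop q"
  by (meson loop_eqv_refl loop_eqv_sym loop_eqv_trans)

lemma loop_eqv_cong:
  assumes "unit_loop p" "\<And>t. t \<in> {0..1} \<Longrightarrow> p t = q t"
  shows "p \<simeq> q"
  using assms unfolding loop_homotopic_def loop_at_def pathin_def
  by (intro homotopic_with_equal) auto

lemma unit_loop_mult: "unit_loop p \<Longrightarrow> unit_loop q \<Longrightarrow> unit_loop (\<lambda>t. p t \<otimes> q t)"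
  by (simp add: loop_at_def pathin_mult)

lemma unit_loop_inv: "unit_loop p \<Longrightarrow> unit_loop (\<lambda>t. inv (p t))"
  by (simp add: loop_at_def pathin_inv)

lemma unit_loop_one: "unit_loop (\<lambda>t. \<one>)"
  by (simp add: loop_at_def pathin_one)

lemma unit_loop_closed: "unit_loop p \<Longrightarrow> t \<in> {0..1} \<Longrightarrow> p t \<in> carrier G"
  by (simp add: loop_at_def pathin_closed)

lemma loop_eqv_mult:
  assumes "p \<simeq> p'" "q \<simeq> q'"
  shows "(\<lambda>t. p t \<otimes> q t) \<simeq> (\<lambda>t. p' t \<otimes> q' t)"
proof -
  obtain F where F: "continuous_map (top_of_set ({0..1::real} \<times> {0..1::real})) T F"
     "\<forall>t\<in>{0..1}. F (0, t) = p t" "\<forall>t\<in>{0..1}. F (1, t) = p' t"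
     "\<forall>s\<in>{0..1}. F (s, 0) = \<one> \<and> F (s, 1) = \<one>"
    using assms(1) loop_eqv_iff by metis
  obtain H where H: "continuous_map (top_of_set ({0..1::real} \<times> {0..1::real})) T H"
     "\<forall>t\<in>{0..1}. H (0, t) = q t" "\<forall>t\<in>{0..1}. H (1, t) = q' t"
     "\<forall>s\<in>{0..1}. H (s, 0) = \<one> \<and> H (s, 1) = \<one>"
    using assms(2) loop_eqv_iff by metis
  show ?thesis
    by (rule loop_eqvI [of "\<lambda>s t. F (s, t) \<otimes> H (s, t)"])
      (use F H continuous_mult [OF F(1) H(1)] in auto)
qed

text \<open>The interval is convex, so the two parameters are joined linearly. The purpose is to
  squeeze a loop into one half of the interval.\<close>

lemma loop_eqv_reparam:
  assumes p: "unit_loop p" and a: "continuous_on {0..1} a" "a \<in> {0..1} \<rightarrow> {0..1}"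
    and b: "continuous_on {0..1} b" "b \<in> {0..1} \<rightarrow> {0..1}"
    and e: "a 0 = b 0" "p (a 0) = \<one>" "a 1 = b 1" "p (a 1) = \<one>"
  shows "(\<lambda>t. p (a t)) \<simeq> (\<lambda>t. p (b t))"
proof (rule loop_eqvI [of "\<lambda>s t. p ((1 - s) * a t + s * b t)"])
  have con: "(1 - s) * x + s * y \<in> {0..1}" if "x \<in> {0..1}" "y \<in> {0..1}" "s \<in> {0..1}" for s x y :: real
    using that convexD_alt [of "{0..1::real}" x y s] by auto
  show "continuous_map (top_of_set ({0..1::real} \<times> {0..1::real})) T
      (\<lambda>z. p ((1 - fst z) * a (snd z) + fst z * b (snd z)))"
  proof (rule continuous_path)
    show "pathin T p" using p by (simp add: loop_at_def)
    have "continuous_on ({0..1} \<times> {0..1}) (\<lambda>z::real\<times>real. a (snd z))"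
      by (rule continuous_on_compose2 [OF a(1)]) (auto intro: continuous_intros)
    moreover have "continuous_on ({0..1} \<times> {0..1}) (\<lambda>z::real\<times>real. b (snd z))"
      by (rule continuous_on_compose2 [OF b(1)]) (auto intro: continuous_intros)
    ultimately show "continuous_map (top_of_set ({0..1::real} \<times> {0..1::real})) euclideanreal
        (\<lambda>z. (1 - fst z) * a (snd z) + fst z * b (snd z))"
      by (auto intro!: continuous_intros)
    show "(1 - fst z) * a (snd z) + fst z * b (snd z) \<in> {0..1}"
      if "z \<in> topspace (top_of_set ({0..1::real} \<times> {0..1::real}))" for z
      using that a(2) b(2) by (intro con) auto
  qed
  have "(1 - s) * x + s * x = x" for s x :: real by (simp add: algebra_simps)
  then show "p ((1 - s) * a 0 + s * b 0) = \<one>" "p ((1 - s) * a 1 + s * b 1) = \<one>" for s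
    using e by auto
qed auto

lemma loop_eqv_early:
  "unit_loop p \<Longrightarrow> (\<lambda>t. p (min (2 * t) 1)) \<simeq> p"
  by (rule loop_eqv_reparam [of p "\<lambda>t. min (2 * t) 1" "\<lambda>t. t"])
    (auto simp: loop_at_def intro!: continuous_on_min continuous_on_max continuous_intros)

lemma loop_eqv_late:
  "unit_loop p \<Longrightarrow> (\<lambda>t. p (max (2 * t - 1) 0)) \<simeq> p"
  by (rule loop_eqv_reparam [of p "\<lambda>t. max (2 * t - 1) 0" "\<lambda>t. t"])
    (auto simp: loop_at_def intro!: continuous_on_min continuous_on_max continuous_intros)

lemma loop_eqv_early_late:
  assumes "unit_loop p" "unit_loop q"
  shows "(\<lambda>t. p (min (2 * t) 1) \<otimes> q (max (2 * t - 1) 0)) \<simeq> (\<lambda>t. p t \<otimes> q t)"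
  by (intro loop_eqv_mult loop_eqv_early loop_eqv_late assms)

text \<open>The Eckmann-Hilton argument: with p squeezed into the first half and q into the second,
  one factor is the unit at each time, and the pointwise product is literally the
  concatenation.\<close>

lemma join_loops_eqv_mult:
  assumes p: "unit_loop p" and q: "unit_loop q"
  shows "join_loops p q \<simeq> (\<lambda>t. p t \<otimes> q t)"
proof -
  have "(\<lambda>t. p (min (2 * t) 1) \<otimes> q (max (2 * t - 1) 0)) \<simeq> join_loops p q"
  proof (rule loop_eqv_cong)
    show "unit_loop (\<lambda>t. p (min (2 * t) 1) \<otimes> q (max (2 * t - 1) 0))"
      using loop_eqv_early_late [OF p q] loop_eqv_loop by blast
    show "p (min (2 * t) 1) \<otimes> q (max (2 * t - 1) 0) = join_loops p q t" if t: "t \<in> {0..1}" for t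
    proof (cases "t \<le> 1/2")
      case True
      then have "min (2 * t) 1 = 2 * t" "max (2 * t - 1) 0 = 0" by auto
      then show ?thesis
        using True t p q by (simp add: join_loops_def loop_at_def pathin_closed)
    next
      case False
      then have "min (2 * t) 1 = 1" "max (2 * t - 1) 0 = 2 * t - 1" by auto
      then show ?thesis
        using False t p q by (simp add: join_loops_def loop_at_def pathin_closed)
    qed
  qed
  then show ?thesis
    using loop_eqv_early_late [OF p q] loop_eqv_sym loop_eqv_trans by blast
qed

text \<open>After the same squeezing the two factors are never both different from the unit, so they
  commute at each time although G may be nonabelian.\<close>

lemma loop_eqv_commute:
  assumes p: "unit_loop p" and q: "unit_loop q"
  shows "(\<lambda>t. p t \<otimes> q t) \<simeq> (\<lambda>t. q t \<otimes> p t)"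
proof -
  have "(\<lambda>t. p (min (2 * t) 1) \<otimes> q (max (2 * t - 1) 0)) \<simeq> (\<lambda>t. q (max (2 * t - 1) 0) \<otimes> p (min (2 * t) 1))"
  proof (rule loop_eqv_cong)
    show "unit_loop (\<lambda>t. p (min (2 * t) 1) \<otimes> q (max (2 * t - 1) 0))"
      using loop_eqv_early_late [OF p q] loop_eqv_loop by blast
    show "p (min (2 * t) 1) \<otimes> q (max (2 * t - 1) 0) = q (max (2 * t - 1) 0) \<otimes> p (min (2 * t) 1)"
      if t: "t \<in> {0..1}" for t
    proof (cases "t \<le> 1/2")
      case True
      then have "min (2 * t) 1 = 2 * t" "max (2 * t - 1) 0 = 0" by auto
      then show ?thesis
        using True t p q by (simp add: loop_at_def pathin_closed)
    next
      case False
      then have "min (2 * t) 1 = 1" "max (2 * t - 1) 0 = 2 * t - 1" by auto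
      then show ?thesis
        using False t p q by (simp add: loop_at_def pathin_closed)
    qed
  qed
  moreover have "(\<lambda>t. q (max (2 * t - 1) 0) \<otimes> p (min (2 * t) 1)) \<simeq> (\<lambda>t. q t \<otimes> p t)"
    by (intro loop_eqv_mult loop_eqv_early loop_eqv_late assms)
  ultimately show ?thesis
    using loop_eqv_early_late [OF p q] loop_eqv_sym loop_eqv_trans by blast
qed

text \<open>The conjugating path is shrunk to its start, the unit. Its end is arbitrary: p is the
  unit there, so the conjugate remains a loop during the deformation.\<close>

lemma loop_eqv_conjugate:
  assumes p: "unit_loop p" and c: "pathin T c" "c 0 = \<one>"
  shows "(\<lambda>t. c t \<otimes> p t \<otimes> inv (c t)) \<simeq> p"
proof (rule loop_eqv_sym, rule loop_eqvI [of "\<lambda>s t. c (s * t) \<otimes> p t \<otimes> inv (c (s * t))"])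
  have 1: "continuous_map (top_of_set ({0..1::real} \<times> {0..1::real})) T (\<lambda>z. c (fst z * snd z))"
    by (rule continuous_path [OF c(1)]) (auto intro!: continuous_intros mult_le_one)
  have 2: "continuous_map (top_of_set ({0..1::real} \<times> {0..1::real})) T (\<lambda>z. p (snd z :: real))"
    using p by (intro continuous_path) (auto simp: loop_at_def intro!: continuous_intros)
  show "continuous_map (top_of_set ({0..1::real} \<times> {0..1::real})) T
     (\<lambda>z. c (fst z * snd z) \<otimes> p (snd z) \<otimes> inv (c (fst z * snd z)))"
    by (intro continuous_mult continuous_inv 1 2)
  have "c s \<in> carrier G" if "0 \<le> s" "s \<le> 1" for s
    using c pathin_closed that by auto
  moreover have "p s \<in> carrier G" if "0 \<le> s" "s \<le> 1" for s
    using p unit_loop_closed that by auto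
  ultimately show "c (s * 1) \<otimes> p 1 \<otimes> inv (c (s * 1)) = \<one>"
    "c (s * 0) \<otimes> p 0 \<otimes> inv (c (s * 0)) = \<one>" 
    "c (0 * s) \<otimes> p s \<otimes> inv (c (0 * s)) = p s"
    "c (1 * s) \<otimes> p s \<otimes> inv (c (1 * s)) = c s \<otimes> p s \<otimes> inv (c s)" if "0 \<le> s" "s \<le> 1" for s
    using p c that by (auto simp: loop_at_def)
qed

subsection \<open>The fundamental group\<close>

lemma cls_mem [simp]: "q \<in> cls p \<longleftrightarrow> p \<simeq> q"
  by (simp add: loop_class_def)

text \<open>A function that is not a unit loop is homotopic to nothing and has an empty class; two
  such classes would coincide, hence the hypothesis.\<close>

lemma cls_eq_iff: "unit_loop p \<Longrightarrow> cls p = cls q \<longleftrightarrow> p \<simeq> q"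
  unfolding loop_class_def using loop_eqv_refl loop_eqv_sym loop_eqv_trans
  by (smt (verit, ccfv_SIG) Collect_cong mem_Collect_eq)

lemma cls_cong: "p \<simeq> q \<Longrightarrow> cls p = cls q"
  using cls_eq_iff loop_eqv_loop by blast

lemma cls_eqI:
  "unit_loop p \<Longrightarrow> (\<And>t. t \<in> {0..1} \<Longrightarrow> p t = q t) \<Longrightarrow> cls p = cls q"
  by (intro cls_cong loop_eqv_cong)

lemma carrier_P: "carrier P = cls ` Collect unit_loop"
  by (simp add: fundamental_group_def)

lemma cls_closed [simp]: "unit_loop p \<Longrightarrow> cls p \<in> carrier P"
  by (simp add: carrier_P)

lemma one_P: "\<one>\<^bsub>P\<^esub> = cls (\<lambda>t. \<one>)"
  by (simp add: fundamental_group_def)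

text \<open>The product in \<open>fundamental_group\<close> is a union over all pairs of
  representatives; by homotopy invariance all members of the union are the same class.\<close>

lemma cls_mult:
  assumes p: "unit_loop p" and q: "unit_loop q"
  shows "cls p \<otimes>\<^bsub>P\<^esub> cls q = cls (\<lambda>t. p t \<otimes> q t)"
proof -
  have "cls (join_loops p' q') = cls (\<lambda>t. p t \<otimes> q t)" if "p' \<in> cls p" "q' \<in> cls q" for p' q'
  proof -
    have "unit_loop p'" "unit_loop q'" "p' \<simeq> p" "q' \<simeq> q"
      using that loop_eqv_loop loop_eqv_sym by auto
    then have "join_loops p' q' \<simeq> (\<lambda>t. p t \<otimes> q t)"
      using loop_eqv_trans [OF join_loops_eqv_mult loop_eqv_mult] by blast
    then show ?thesis by (rule cls_cong)
  qed
  moreover have "p \<in> cls p" "q \<in> cls q"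
    using p q by (auto simp: loop_eqv_refl)
  ultimately have "(\<Union>p'\<in>cls p. \<Union>q'\<in>cls q. cls (join_loops p' q')) = cls (\<lambda>t. p t \<otimes> q t)"
    by (simp only: cong: SUP_cong) blast
  then show ?thesis
    by (simp add: fundamental_group_def)
qed

lemma comm_group_P: "comm_group P"
proof (rule comm_groupI)
  show "x \<otimes>\<^bsub>P\<^esub> y \<in> carrier P" if "x \<in> carrier P" "y \<in> carrier P" for x y
    using that by (auto simp: carrier_P cls_mult unit_loop_mult)
  show "\<one>\<^bsub>P\<^esub> \<in> carrier P"
    by (simp add: one_P unit_loop_one)
  show "x \<otimes>\<^bsub>P\<^esub> y \<otimes>\<^bsub>P\<^esub> z = x \<otimes>\<^bsub>P\<^esub> (y \<otimes>\<^bsub>P\<^esub> z)"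
    if "x \<in> carrier P" "y \<in> carrier P" "z \<in> carrier P" for x y z
    using that
    by (clarsimp simp: carrier_P cls_mult unit_loop_mult)
      (rule cls_eqI, auto simp: unit_loop_mult m_assoc unit_loop_closed)
  show "x \<otimes>\<^bsub>P\<^esub> y = y \<otimes>\<^bsub>P\<^esub> x" if "x \<in> carrier P" "y \<in> carrier P" for x y
    using that by (clarsimp simp: carrier_P cls_mult) (rule cls_cong, rule loop_eqv_commute)
  show "\<one>\<^bsub>P\<^esub> \<otimes>\<^bsub>P\<^esub> x = x" if "x \<in> carrier P" for x
    using that
    by (clarsimp simp: carrier_P one_P cls_mult unit_loop_one)
      (rule cls_eqI, auto simp: unit_loop_mult unit_loop_one unit_loop_closed)
  show "\<exists>y\<in>carrier P. y \<otimes>\<^bsub>P\<^esub> x = \<one>\<^bsub>P\<^esub>" if x: "x \<in> carrier P" for x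
  proof -
    obtain p where p: "unit_loop p" "x = cls p" using x by (auto simp: carrier_P)
    have "cls (\<lambda>t. inv (p t) \<otimes> p t) = cls (\<lambda>t. \<one>)"
      using p by (intro cls_eqI) (auto simp: unit_loop_mult unit_loop_inv unit_loop_closed)
    then show ?thesis
      using p by (intro bexI [of _ "cls (\<lambda>t. inv (p t))"]) (auto simp: cls_mult unit_loop_inv one_P)
  qed
qed

end

sublocale topological_group_space \<subseteq> pi: comm_group P
  by (rule comm_group_P)

context topological_group_space
begin

lemma cls_inv:
  assumes p: "unit_loop p"
  shows "inv\<^bsub>P\<^esub> (cls p) = cls (\<lambda>t. inv (p t))"
proof -
  have "cls (\<lambda>t. inv (p t)) \<otimes>\<^bsub>P\<^esub> cls p = \<one>\<^bsub>P\<^esub>"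
    unfolding cls_mult [OF unit_loop_inv [OF p] p] one_P
    using p by (intro cls_eqI) (auto simp: unit_loop_mult unit_loop_inv unit_loop_closed)
  then show ?thesis
    using p by (intro pi.inv_equality) (auto simp: unit_loop_inv)
qed

lemma cls_rep:
  assumes "a \<in> carrier P"
  obtains p where "unit_loop p" "a = cls p"
  using assms by (auto simp: carrier_P)

end


section \<open>Low-dimensional singular simplices\<close>

text \<open>Serves in two roles: barycentric coordinates in simplices of dimension at most two, and,
  with last entry 0, a point of the plane containing the 2-disc.\<close>

definition bary :: "real \<Rightarrow> real \<Rightarrow> real \<Rightarrow> nat \<Rightarrow> real"
  where "bary a b c = (\<lambda>i. if i = 0 then a else if i = 1 then b else if i = 2 then c else 0)"

lemma bary_simps [simp]: "bary a b c 0 = a" "bary a b c (Suc 0) = b" "bary a b c (Suc (Suc 0)) = c" "bary a b c 2 = c"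
  by (simp_all add: bary_def)

lemma bary_bounds:
  "(\<forall>i. 0 \<le> bary a b c i \<and> bary a b c i \<le> 1) \<longleftrightarrow>
    0 \<le> a \<and> a \<le> 1 \<and> 0 \<le> b \<and> b \<le> 1 \<and> 0 \<le> c \<and> c \<le> 1" (is "?L \<longleftrightarrow> ?R")
proof
  assume ?L
  from this [THEN spec, of 0] this [THEN spec, of 1] this [THEN spec, of 2] show ?R
    by (simp add: bary_def)
next
  assume ?R
  then show ?L
    by (simp add: bary_def)
qed

lemma bary_in_simplex_1: "bary a b 0 \<in> standard_simplex (Suc 0) \<longleftrightarrow> 0 \<le> a \<and> 0 \<le> b \<and> a + b = 1"
proof -
  have "(\<Sum>i\<le>Suc 0. bary a b 0 i) = a + b" by (simp add: atMost_Suc)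
  moreover have "\<forall>i>Suc 0. bary a b 0 i = 0" by (auto simp: bary_def)
  moreover have "(\<forall>i. 0 \<le> bary a b 0 i \<and> bary a b 0 i \<le> 1) \<longleftrightarrow> 0 \<le> a \<and> a \<le> 1 \<and> 0 \<le> b \<and> b \<le> 1"
    by (rule bary_bounds [of a b 0, simplified])
  ultimately show ?thesis by (auto simp: standard_simplex_def)
qed

lemma bary_in_simplex_2:
  "bary a b c \<in> standard_simplex (Suc (Suc 0)) \<longleftrightarrow> 0 \<le> a \<and> 0 \<le> b \<and> 0 \<le> c \<and> a + b + c = 1"
proof -
  have "(\<Sum>i\<le>Suc (Suc 0). bary a b c i) = a + b + c" by (simp add: atMost_Suc numeral_2_eq_2)
  moreover have "\<forall>i>Suc (Suc 0). bary a b c i = 0" by (auto simp: bary_def)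
  moreover have "(\<forall>i. 0 \<le> bary a b c i \<and> bary a b c i \<le> 1) \<longleftrightarrow>
      0 \<le> a \<and> a \<le> 1 \<and> 0 \<le> b \<and> b \<le> 1 \<and> 0 \<le> c \<and> c \<le> 1"
    by (rule bary_bounds)
  ultimately show ?thesis by (auto simp: standard_simplex_def)
qed

lemma standard_simplex_1_eq:
  assumes "x \<in> standard_simplex (Suc 0)"
  shows "x = bary (1 - x 1) (x 1) 0" "0 \<le> x 1" "x 1 \<le> 1"
proof -
  have *: "\<forall>i>Suc 0. x i = 0" "x 0 + x 1 = 1" "\<forall>i. 0 \<le> x i \<and> x i \<le> 1"
    using assms by (auto simp: standard_simplex_def atMost_Suc)
  show "x = bary (1 - x 1) (x 1) 0"
  proof
    fix i
    show "x i = bary (1 - x 1) (x 1) 0 i"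
      using * by (cases "i = 0"; cases "i = 1"; cases "i = 2") (auto simp: bary_def)
  qed
  show "0 \<le> x 1" "x 1 \<le> 1" using * by auto
qed

lemma continuous_map_simplex:
  assumes \<sigma>: "singular_simplex p X \<sigma>"
    and e: "\<And>i. continuous_map Z euclideanreal (\<lambda>z. e z i)"
    and s: "\<And>z. z \<in> topspace Z \<Longrightarrow> e z \<in> standard_simplex p"
  shows "continuous_map Z X (\<lambda>z. \<sigma> (e z))"
proof -
  have "continuous_map Z (subtopology (powertop_real UNIV) (standard_simplex p)) e"
    using e s by (auto simp: continuous_map_in_subtopology continuous_map_componentwise_UNIV)
  from continuous_map_compose [OF this, of X \<sigma>] show ?thesis
    using \<sigma> by (simp add: singular_simplex_def o_def)
qed

definition edge :: "((nat \<Rightarrow> real) \<Rightarrow> 'x) \<Rightarrow> real \<Rightarrow> 'x"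
  where "edge \<sigma> t = \<sigma> (bary (1 - t) t 0)"

lemma pathin_edge:
  assumes "singular_simplex (Suc 0) X \<sigma>"
  shows "pathin X (edge \<sigma>)"
  unfolding pathin_def edge_def [abs_def]
proof (rule continuous_map_simplex [OF assms])
  show "continuous_map (top_of_set {0..1}) euclideanreal (\<lambda>t. bary (1 - t) t 0 i)" for i
    by (cases "i = 0"; cases "i = 1") (auto simp: bary_def intro!: continuous_intros)
qed (auto simp: bary_in_simplex_1)

lemma edge_in_topspace: "singular_simplex (Suc 0) X \<sigma> \<Longrightarrow> t \<in> {0..1} \<Longrightarrow> edge \<sigma> t \<in> topspace X"
  using pathin_edge [of X \<sigma>] unfolding pathin_def
  by (metis continuous_map_image_subset_topspace image_subset_iff topspace_euclidean_subtopology)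

lemma pathin_simplex_exists:
  assumes "pathin X p"
  obtains \<sigma> where "singular_simplex (Suc 0) X \<sigma>" "\<And>t. t \<in> {0..1} \<Longrightarrow> edge \<sigma> t = p t"
proof
  let ?S = "subtopology (powertop_real UNIV) (standard_simplex (Suc 0))"
  have "continuous_map (powertop_real UNIV) euclideanreal (\<lambda>x. x (Suc 0))"
    by (rule continuous_map_product_projection) auto
  then have "continuous_map ?S (top_of_set {0..1}) (\<lambda>x. x (Suc 0))"
    using standard_simplex_1_eq(2,3) [unfolded One_nat_def]
    by (auto simp: continuous_map_in_subtopology intro: continuous_map_from_subtopology)
  then have "continuous_map ?S X (p \<circ> (\<lambda>x. x (Suc 0)))"
    using assms unfolding pathin_def by (rule continuous_map_compose)
  then show "singular_simplex (Suc 0) X (restrict (p \<circ> (\<lambda>x. x (Suc 0))) (standard_simplex (Suc 0)))"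
    unfolding singular_simplex_def by (auto intro: continuous_map_eq)
  show "edge (restrict (p \<circ> (\<lambda>x. x (Suc 0))) (standard_simplex (Suc 0))) t = p t" if "t \<in> {0..1}" for t
    using that by (simp add: edge_def bary_in_simplex_1)
qed

definition point_simplex :: "'x \<Rightarrow> (nat \<Rightarrow> real) \<Rightarrow> 'x"
  where "point_simplex x = (\<lambda>_\<in>standard_simplex 0. x)"

lemma singular_point_simplex: "x \<in> topspace X \<Longrightarrow> singular_simplex 0 X (point_simplex x)"
  unfolding singular_simplex_def point_simplex_def
  by (auto intro: continuous_map_eq [where f = "\<lambda>_. x"])

lemma singular_simplex_0_eq:
  assumes "singular_simplex 0 X \<sigma>"
  shows "\<sigma> = point_simplex (\<sigma> (bary 1 0 0))" "\<sigma> (bary 1 0 0) \<in> topspace X"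
proof -
  have 0: "standard_simplex 0 = {bary 1 0 0}"
    by (auto simp: standard_simplex_0 bary_def)
  have "\<sigma> \<in> extensional (standard_simplex 0)"
    using assms by (simp add: singular_simplex_def)
  then show "\<sigma> = point_simplex (\<sigma> (bary 1 0 0))"
    by (auto simp: point_simplex_def 0 extensional_def)
  show "\<sigma> (bary 1 0 0) \<in> topspace X"
    using assms 0 by (auto simp: singular_simplex_def continuous_map_def)
qed

lemma simplical_face_bary:
  "simplical_face 0 (bary a b 0) = bary 0 a b"
  "simplical_face (Suc 0) (bary a b 0) = bary a 0 b"
  "simplical_face (Suc (Suc 0)) (bary a b 0) = bary a b 0"
  by (auto simp: simplical_face_def bary_def fun_eq_iff numeral_2_eq_2)

lemma singular_face_1:
  "singular_face (Suc 0) 0 \<sigma> = point_simplex (edge \<sigma> 1)"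
  "singular_face (Suc 0) (Suc 0) \<sigma> = point_simplex (edge \<sigma> 0)"
proof -
  have 0: "standard_simplex 0 = {bary 1 0 0}"
    by (auto simp: standard_simplex_0 bary_def)
  show "singular_face (Suc 0) 0 \<sigma> = point_simplex (edge \<sigma> 1)"
    "singular_face (Suc 0) (Suc 0) \<sigma> = point_simplex (edge \<sigma> 0)"
    by (rule ext, auto simp: singular_face_def point_simplex_def 0 edge_def simplical_face_bary restrict_def)+
qed

lemma boundary_1:
  "chain_boundary (Suc 0) (frag_of \<sigma>) = frag_of (point_simplex (edge \<sigma> 1)) - frag_of (point_simplex (edge \<sigma> 0))"
  by (simp add: chain_boundary_of atMost_Suc singular_face_1)

lemma boundary_2:
  "chain_boundary (Suc (Suc 0)) (frag_of \<tau>) =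
     frag_of (singular_face (Suc (Suc 0)) 0 \<tau>) - frag_of (singular_face (Suc (Suc 0)) (Suc 0) \<tau>)
     + frag_of (singular_face (Suc (Suc 0)) (Suc (Suc 0)) \<tau>)"
  by (simp add: chain_boundary_of atMost_Suc)

lemma edge_face_2:
  assumes "t \<in> {0..1}"
  shows "edge (singular_face (Suc (Suc 0)) 0 \<tau>) t = \<tau> (bary 0 (1 - t) t)"
    "edge (singular_face (Suc (Suc 0)) (Suc 0) \<tau>) t = \<tau> (bary (1 - t) 0 t)"
    "edge (singular_face (Suc (Suc 0)) (Suc (Suc 0)) \<tau>) t = \<tau> (bary (1 - t) t 0)"
  using assms by (auto simp: edge_def singular_face_def bary_in_simplex_1 simplical_face_bary)

section \<open>The first cohomology class of a map into a topological group\<close>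

context topological_group_space
begin

text \<open>Stands for the loop that follows c, then p, then d backwards. The pointwise form, with p
  translated to start at the unit, avoids a subdivision of the interval.\<close>

definition transport :: "(real \<Rightarrow> 'a) \<Rightarrow> (real \<Rightarrow> 'a) \<Rightarrow> (real \<Rightarrow> 'a) \<Rightarrow> real \<Rightarrow> 'a"
  where "transport p c d t = c t \<otimes> inv (p 0) \<otimes> p t \<otimes> inv (d t)"

definition path_to :: "'a \<Rightarrow> (real \<Rightarrow> 'a) \<Rightarrow> bool"
  where "path_to g c \<longleftrightarrow> pathin T c \<and> c 0 = \<one> \<and> c 1 = g"

lemma path_to_closed: "path_to g c \<Longrightarrow> t \<in> {0..1} \<Longrightarrow> c t \<in> carrier G"
  by (simp add: path_to_def pathin_closed)

lemma path_to_mult: "path_to g c \<Longrightarrow> path_to h d \<Longrightarrow> path_to (g \<otimes> h) (\<lambda>t. c t \<otimes> d t)"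
  by (simp add: path_to_def pathin_mult)

lemma path_to_inv: "path_to g c \<Longrightarrow> path_to (inv g) (\<lambda>t. inv (c t))"
  by (simp add: path_to_def pathin_inv)

lemma unit_loop_iff_path_to: "unit_loop c \<longleftrightarrow> path_to \<one> c"
  by (simp add: path_to_def loop_at_def)

lemma path_to_closed_end: "path_to g c \<Longrightarrow> g \<in> carrier G"
  using path_to_closed [of g c 1] by (simp add: path_to_def)

lemma unit_loop_transport:
  assumes p: "pathin T p" and c: "path_to (p 0) c" and d: "path_to (p 1) d"
  shows "unit_loop (transport p c d)"
proof -
  have "pathin T (transport p c d)"
    unfolding transport_def [abs_def]
    using p c d pathin_closed [OF p, of 0]
    by (intro pathin_mult pathin_inv) (auto simp: path_to_def pathin_def)
  then show ?thesis
    using pathin_closed [OF p, of 0] pathin_closed [OF p, of 1] c d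
    by (simp add: loop_at_def transport_def path_to_def)
qed

text \<open>In the product on the left the path b to the middle vertex cancels; what remains is
  deformed inside the triangle, with all factors multiplied in G. This is the source of the cocycle
  condition.\<close>

lemma transport_triangle:
  assumes \<rho>: "singular_simplex (Suc (Suc 0)) T \<rho>"
    and a: "path_to (\<rho> (bary 1 0 0)) a" and b: "path_to (\<rho> (bary 0 1 0)) b" and c: "path_to (\<rho> (bary 0 0 1)) c"
  shows "cls (transport (\<lambda>t. \<rho> (bary (1 - t) t 0)) a b) \<otimes>\<^bsub>P\<^esub> cls (transport (\<lambda>t. \<rho> (bary 0 (1 - t) t)) b c)
     = cls (transport (\<lambda>t. \<rho> (bary (1 - t) 0 t)) a c)"
proof -
  have \<rho>G: "\<rho> (bary x y z) \<in> carrier G" if "0 \<le> x" "0 \<le> y" "0 \<le> z" "x + y + z = 1" for x y z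
  proof -
    have "bary x y z \<in> standard_simplex (Suc (Suc 0))"
      using that by (simp add: bary_in_simplex_2)
    then show ?thesis
      using \<rho> by (auto simp: singular_simplex_def continuous_map_def)
  qed
  have con: "continuous_map Z T (\<lambda>w. \<rho> (bary (x w) (y w) (z w)))"
    if "continuous_map Z euclideanreal x" "continuous_map Z euclideanreal y" "continuous_map Z euclideanreal z"
      "\<And>w. w \<in> topspace Z \<Longrightarrow> 0 \<le> x w \<and> 0 \<le> y w \<and> 0 \<le> z w \<and> x w + y w + z w = 1"
    for x y z and Z :: "'z topology"
  proof (rule continuous_map_simplex [OF \<rho>])
    show "continuous_map Z euclideanreal (\<lambda>w. bary (x w) (y w) (z w) i)" for i
      by (cases "i = 0"; cases "i = 1"; cases "i = 2") (auto simp: bary_def that)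
  qed (use that in \<open>auto simp: bary_in_simplex_2\<close>)
  let ?p = "\<lambda>t. \<rho> (bary (1 - t) t 0)" and ?q = "\<lambda>t. \<rho> (bary 0 (1 - t) t)" and ?r = "\<lambda>t. \<rho> (bary (1 - t) 0 t)"
  have pq: "pathin T ?p" "pathin T ?q" "pathin T ?r"
    unfolding pathin_def by (intro con; auto intro!: continuous_intros)+
  have lp: "unit_loop (transport ?p a b)" "unit_loop (transport ?q b c)" "unit_loop (transport ?r a c)"
    using a b c pq by (auto intro!: unit_loop_transport)
  have aG: "a t \<in> carrier G" "b t \<in> carrier G" "c t \<in> carrier G" if "0 \<le> t" "t \<le> 1" for t
    using a b c path_to_closed that by auto
  \<comment> \<open>At s = 0 the three points of the triangle lie on the first edge, at the middle
    vertex and on the second edge. At s = 1 they coincide on the third edge, where x, inv x, x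
    multiply to x.\<close>
  let ?H = "\<lambda>s t. a t \<otimes> inv (\<rho> (bary 1 0 0)) \<otimes> (\<rho> (bary (1 - t) ((1 - s) * t) (s * t))
      \<otimes> inv (\<rho> (bary (s * (1 - t)) (1 - s) (s * t))) \<otimes> \<rho> (bary (s * (1 - t)) ((1 - s) * (1 - t)) t)) \<otimes> inv (c t)"
  have "(\<lambda>t. transport ?p a b t \<otimes> transport ?q b c t) \<simeq> transport ?r a c"
  proof (rule loop_eqvI [of ?H])
    have path: "continuous_map (top_of_set ({0..1::real} \<times> {0..1::real})) T (\<lambda>z. d (snd z))" if "path_to g d" for g d
      using that by (intro continuous_path) (auto simp: path_to_def intro!: continuous_intros)
    have ab: "a + b \<le> 1 + a * b" if "0 \<le> a" "a \<le> 1" "0 \<le> b" "b \<le> 1" for a b :: real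
      using mult_nonneg_nonneg [of "1 - a" "1 - b"] that by (simp add: algebra_simps)
    show "continuous_map (top_of_set ({0..1::real} \<times> {0..1::real})) T (\<lambda>z. ?H (fst z) (snd z))"
      by (intro continuous_mult continuous_inv con path [OF a] path [OF c])
        (auto intro!: continuous_intros \<rho>G simp: algebra_simps mult_left_le mult_left_le_one_le ab)
    show "?H 0 t = transport ?p a b t \<otimes> transport ?q b c t" if "0 \<le> t" "t \<le> 1" for t
      using that \<rho>G aG by (simp add: transport_def m_assoc)
    show "?H 1 t = transport ?r a c t" if "0 \<le> t" "t \<le> 1" for t
      using that \<rho>G aG by (simp add: transport_def m_assoc)
    show "?H s 0 = \<one>" if "0 \<le> s" "s \<le> 1" for s
      using that \<rho>G a c by (simp add: path_to_def m_assoc)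
    show "?H s 1 = \<one>" if "0 \<le> s" "s \<le> 1" for s
      using that \<rho>G a c by (simp add: path_to_def m_assoc)
  qed
  then show ?thesis
    using lp by (simp add: cls_mult cls_cong)
qed

text \<open>The paths \<open>\<gamma> x\<close> from the unit to \<open>u x\<close> are chosen point by point, without continuity in \<open>x\<close>.\<close>

definition lifting :: "'x topology \<Rightarrow> ('x \<Rightarrow> 'a) \<Rightarrow> ('x \<Rightarrow> real \<Rightarrow> 'a) \<Rightarrow> bool"
  where "lifting X u \<gamma> \<longleftrightarrow> continuous_map X T u \<and> (\<forall>x\<in>topspace X. path_to (u x) (\<gamma> x))"

definition holonomy :: "('x \<Rightarrow> 'a) \<Rightarrow> ('x \<Rightarrow> real \<Rightarrow> 'a) \<Rightarrow> ((nat \<Rightarrow> real) \<Rightarrow> 'x) \<Rightarrow> (real \<Rightarrow> 'a) set"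
  where "holonomy u \<gamma> \<sigma> = cls (transport (\<lambda>t. u (edge \<sigma> t)) (\<gamma> (edge \<sigma> 0)) (\<gamma> (edge \<sigma> 1)))"

lemma pathin_lifting_edge:
  assumes "lifting X u \<gamma>" "singular_simplex (Suc 0) X \<sigma>"
  shows "pathin T (\<lambda>t. u (edge \<sigma> t))"
  using continuous_map_compose [OF pathin_edge [OF assms(2), unfolded pathin_def], of T u] assms(1)
  by (simp add: lifting_def pathin_def o_def)

lemma unit_loop_holonomy:
  assumes "lifting X u \<gamma>" "singular_simplex (Suc 0) X \<sigma>"
  shows "unit_loop (transport (\<lambda>t. u (edge \<sigma> t)) (\<gamma> (edge \<sigma> 0)) (\<gamma> (edge \<sigma> 1)))"
  using pathin_lifting_edge [OF assms] assms edge_in_topspace [OF assms(2)]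
  by (intro unit_loop_transport) (auto simp: lifting_def)

lemma cls_transport_cong:
  assumes "unit_loop (transport p c d)" "\<And>t. t \<in> {0..1} \<Longrightarrow> p t = q t"
  shows "cls (transport p c d) = cls (transport q c d)"
  by (rule cls_eqI [OF assms(1)]) (use assms(2) in \<open>simp add: transport_def\<close>)

lemma holonomy_cocycle:
  fixes X :: "'x topology"
  assumes l: "lifting X u \<gamma>"
  obtains z where "pi.cocycle (Suc 0) X z"
    "\<And>\<sigma>. singular_simplex (Suc 0) X \<sigma> \<Longrightarrow> z (frag_of \<sigma>) = holonomy u \<gamma> \<sigma>"
proof -
  have "holonomy u \<gamma> \<sigma> \<in> carrier P" if "singular_simplex (Suc 0) X \<sigma>" for \<sigma>
    using unit_loop_holonomy [OF l that] by (simp add: holonomy_def)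
  then obtain z where z: "pi.cochain (Suc 0) X z"
    "\<And>\<sigma>. singular_simplex (Suc 0) X \<sigma> \<Longrightarrow> z (frag_of \<sigma>) = holonomy u \<gamma> \<sigma>"
    using pi.cochain_of_simplices [of "Suc 0" X "holonomy u \<gamma>"] by metis
  have "z (chain_boundary (Suc (Suc 0)) c) = \<one>\<^bsub>P\<^esub>" if "singular_chain (Suc (Suc 0)) X c" for c
  proof (rule pi.cochain_eqI [OF pi.cochain_coboundary [OF z(1)] pi.cochain_one _ that])
    fix \<tau> assume \<tau>: "singular_simplex (Suc (Suc 0)) X \<tau>"
    let ?f = "\<lambda>k. singular_face (Suc (Suc 0)) k \<tau>"
    have f: "singular_simplex (Suc 0) X (?f k)" if "k \<le> 2" for k
      using singular_simplex_singular_face [OF \<tau>, of k] that by simp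
    then have f': "singular_chain (Suc 0) X (frag_of (?f k))" if "k \<le> 2" for k
      using that by (simp add: singular_chain_of)
    let ?\<rho> = "simplex_map (Suc (Suc 0)) u \<tau>"
    have \<rho>: "singular_simplex (Suc (Suc 0)) T ?\<rho>"
      using \<tau> l by (auto simp: lifting_def intro: singular_simplex_simplex_map)
    have \<rho>eq: "?\<rho> (bary x y z) = u (\<tau> (bary x y z))" if "0 \<le> x" "0 \<le> y" "0 \<le> z" "x + y + z = 1" for x y z
      using that by (simp add: simplex_map_def bary_in_simplex_2)
    let ?v = "\<lambda>x. \<gamma> (\<tau> x)"
    have v: "path_to (?\<rho> x) (?v x)" if "x \<in> standard_simplex (Suc (Suc 0))" for x
    proof -
      have "\<tau> x \<in> topspace X" using \<tau> that by (auto simp: singular_simplex_def continuous_map_def)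
      then show ?thesis using l that by (simp add: lifting_def simplex_map_def)
    qed
    \<comment> \<open>Face 2 runs from vertex 0 to vertex 1, face 0 from 1 to 2 and face 1 from 0 to
      2.\<close>
    have "holonomy u \<gamma> (?f 2) \<otimes>\<^bsub>P\<^esub> holonomy u \<gamma> (?f 0) = holonomy u \<gamma> (?f (Suc 0))"
    proof -
      have h: "holonomy u \<gamma> (?f 2) = cls (transport (\<lambda>t. ?\<rho> (bary (1 - t) t 0)) (?v (bary 1 0 0)) (?v (bary 0 1 0)))"
        "holonomy u \<gamma> (?f 0) = cls (transport (\<lambda>t. ?\<rho> (bary 0 (1 - t) t)) (?v (bary 0 1 0)) (?v (bary 0 0 1)))"
        "holonomy u \<gamma> (?f (Suc 0)) = cls (transport (\<lambda>t. ?\<rho> (bary (1 - t) 0 t)) (?v (bary 1 0 0)) (?v (bary 0 0 1)))"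
        using unit_loop_holonomy [OF l f, of 0] unit_loop_holonomy [OF l f, of "Suc 0"]
          unit_loop_holonomy [OF l f, of "Suc (Suc 0)"]
        by (auto simp: holonomy_def numeral_2_eq_2 edge_face_2 \<rho>eq intro!: cls_transport_cong)
      show ?thesis
        unfolding h by (rule transport_triangle [OF \<rho>]) (auto intro!: v simp: bary_in_simplex_2)
    qed
    then have "z (frag_of (?f 2)) \<otimes>\<^bsub>P\<^esub> z (frag_of (?f 0)) = z (frag_of (?f (Suc 0)))"
      using z(2) f by simp
    moreover have "z (chain_boundary (Suc (Suc 0)) (frag_of \<tau>))
        = z (frag_of (?f 0)) \<otimes>\<^bsub>P\<^esub> inv\<^bsub>P\<^esub> z (frag_of (?f (Suc 0))) \<otimes>\<^bsub>P\<^esub> z (frag_of (?f 2))"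
      unfolding boundary_2 numeral_2_eq_2
      using f' by (subst pi.cochain_add [OF z(1)]) (auto simp: pi.cochain_diff [OF z(1)] singular_chain_diff numeral_2_eq_2)
    moreover have "z (frag_of (?f k)) \<in> carrier P" if "k \<le> 2" for k
      using pi.cochain_closed [OF z(1) f'] that by blast
    ultimately show "z (chain_boundary (Suc (Suc 0)) (frag_of \<tau>)) = \<one>\<^bsub>P\<^esub>"
      by (metis (no_types, lifting) One_nat_def less_eq_Suc_le one_le_numeral pi.inv_closed pi.m_assoc pi.m_comm
          pi.m_closed pi.r_inv zero_le order_refl)
  qed
  with z show ?thesis
    using that [of z] by (simp add: pi.cocycle_def)
qed

text \<open>The choice of paths is hidden by the existential quantifier, so a map represents all
  cocycles of one cohomology class: \<open>represents_coboundary\<close> and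
  \<open>represents_unique\<close>.\<close>

definition represents :: "'x topology \<Rightarrow> ('x \<Rightarrow> 'a) \<Rightarrow> ('x chain \<Rightarrow> (real \<Rightarrow> 'a) set) \<Rightarrow> bool"
  where "represents X u z \<longleftrightarrow> pi.cocycle (Suc 0) X z \<and>
    (\<exists>\<gamma>. lifting X u \<gamma> \<and> (\<forall>\<sigma>. singular_simplex (Suc 0) X \<sigma> \<longrightarrow> z (frag_of \<sigma>) = holonomy u \<gamma> \<sigma>))"

lemma represents_subtopology:
  "represents X u z \<Longrightarrow> represents (subtopology X S) u z"
  unfolding represents_def lifting_def
  by (auto simp: pi.cocycle_subtopology singular_simplex_subtopology intro: continuous_map_from_subtopology)

lemma represents_cocycle: "represents X u z \<Longrightarrow> pi.cocycle (Suc 0) X z"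
  by (simp add: represents_def)

lemma represents_continuous: "represents X u z \<Longrightarrow> continuous_map X T u"
  by (auto simp: represents_def lifting_def)

lemma represents_cong:
  assumes "represents X u z"
    and u: "\<And>x. x \<in> topspace X \<Longrightarrow> v x = u x"
    and z: "\<And>c. singular_chain (Suc 0) X c \<Longrightarrow> w c = z c"
  shows "represents X v w"
proof -
  obtain \<gamma> where \<gamma>: "lifting X u \<gamma>"
      "\<And>\<sigma>. singular_simplex (Suc 0) X \<sigma> \<Longrightarrow> z (frag_of \<sigma>) = holonomy u \<gamma> \<sigma>"
    using assms(1) by (auto simp: represents_def)
  have "lifting X v \<gamma>"
    using \<gamma>(1) u by (auto simp: lifting_def intro: continuous_map_eq)
  moreover have "w (frag_of \<sigma>) = holonomy v \<gamma> \<sigma>" if \<sigma>: "singular_simplex (Suc 0) X \<sigma>" for \<sigma>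
  proof -
    have "holonomy u \<gamma> \<sigma> = holonomy v \<gamma> \<sigma>"
      unfolding holonomy_def
      by (rule cls_transport_cong [OF unit_loop_holonomy [OF \<gamma>(1) \<sigma>]])
        (use u edge_in_topspace [OF \<sigma>] in auto)
    then show ?thesis
      using \<gamma>(2) [OF \<sigma>] z \<sigma> by (simp add: singular_chain_of)
  qed
  ultimately show ?thesis
    using pi.cocycle_cong [OF represents_cocycle [OF assms(1)] z] by (auto simp: represents_def)
qed

lemma transport_closed:
  assumes p: "pathin T p" and c: "path_to (p 0) c" and d: "path_to (p 1) d" and t: "0 \<le> t" "t \<le> 1"
  shows "c t \<in> carrier G" "d t \<in> carrier G" "p t \<in> carrier G" "p 0 \<in> carrier G" "p 1 \<in> carrier G"
  using assms pathin_closed [OF p] path_to_closed [OF c] path_to_closed [OF d] by auto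

text \<open>The factor \<open>d t \<otimes> inv (q 0)\<close>, a path ending at the unit, is moved past
  \<open>inv (p 0) \<otimes> p t\<close>, a path starting at the unit.\<close>

lemma transport_mult:
  assumes p: "pathin T p" and c: "path_to (p 0) c" and c': "path_to (p 1) c'"
    and q: "pathin T q" and d: "path_to (q 0) d" and d': "path_to (q 1) d'"
  shows "cls (transport (\<lambda>t. p t \<otimes> q t) (\<lambda>t. c t \<otimes> d t) (\<lambda>t. c' t \<otimes> d' t))
    = cls (transport p c c') \<otimes>\<^bsub>P\<^esub> cls (transport q d d')"
proof -
  note pc = transport_closed [OF p c c'] and qd = transport_closed [OF q d d']
  let ?L = "transport p c c'" and ?K = "transport q d d'"
  have L: "unit_loop ?L" and K: "unit_loop ?K"
    using assms by (auto intro: unit_loop_transport)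
  have pq: "unit_loop (transport (\<lambda>t. p t \<otimes> q t) (\<lambda>t. c t \<otimes> d t) (\<lambda>t. c' t \<otimes> d' t))"
    using assms by (intro unit_loop_transport pathin_mult path_to_mult)
  have sq: "continuous_map (top_of_set ({0..1::real} \<times> {0..1::real})) T (\<lambda>z. f (snd z))" if "pathin T f" for f
    using that by (rule continuous_path) (auto intro!: continuous_intros)
  define e where "e x = d x \<otimes> inv (q 0)" for x
  have eG: "e t \<in> carrier G" if "0 \<le> t" "t \<le> 1" for t
    using qd [OF that] by (simp add: e_def)
  have e: "pathin T e"
    using d qd(4) [of 0] unfolding e_def [abs_def]
    by (intro pathin_mult) (auto simp: path_to_def pathin_def)
  have e1: "e 1 = \<one>"  "e 0 = inv (q 0)" if "q 0 \<in> carrier G"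
    using d that by (auto simp: e_def path_to_def)
  \<comment> \<open>At s = 0 the maximum is t, and H is \<open>?L\<close> times a conjugate of
    \<open>?K\<close>. At s = 1 it is 1, where e is the unit, and H is the transport of the
    product.\<close>
  define H where "H s t = c t \<otimes> e t \<otimes> inv (e (max s t)) \<otimes> (inv (p 0) \<otimes> p t) \<otimes> e (max s t) \<otimes> q t \<otimes> inv (d' t) \<otimes> inv (c' t)" for s t
  have "(\<lambda>t. ?L t \<otimes> (c' t \<otimes> ?K t \<otimes> inv (c' t))) \<simeq> transport (\<lambda>t. p t \<otimes> q t) (\<lambda>t. c t \<otimes> d t) (\<lambda>t. c' t \<otimes> d' t)"
  proof (rule loop_eqvI [of H])
    have m: "continuous_map (top_of_set ({0..1::real} \<times> {0..1::real})) T (\<lambda>z. e (max (fst z) (snd z)))"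
      by (rule continuous_path [OF e]) (auto intro!: continuous_intros continuous_on_max)
    show "continuous_map (top_of_set ({0..1::real} \<times> {0..1::real})) T (\<lambda>z. H (fst z) (snd z))"
      unfolding H_def using assms e pc(4) [of 0]
      by (intro continuous_mult continuous_inv m sq) (auto simp: path_to_def)
    show "H 0 t = ?L t \<otimes> (c' t \<otimes> ?K t \<otimes> inv (c' t))" if "0 \<le> t" "t \<le> 1" for t
      using pc [OF that] qd [OF that] that eG [OF that]
      by (simp add: H_def max_absorb2) (simp add: transport_def e_def m_assoc)
    show "H 1 t = transport (\<lambda>t. p t \<otimes> q t) (\<lambda>t. c t \<otimes> d t) (\<lambda>t. c' t \<otimes> d' t) t" if "0 \<le> t" "t \<le> 1" for t
      using pc [OF that] qd [OF that] that eG [OF that]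
      by (simp add: H_def max_absorb1 e1) (simp add: transport_def e_def m_assoc inv_mult_group)
    show "H s 0 = \<one>" if "0 \<le> s" "s \<le> 1" for s
      using pc [of 0] qd [of 0] that eG [of s] eG [of 0] c c' d d' e1
      by (simp add: H_def path_to_def max_absorb1 m_assoc)
    show "H s 1 = \<one>" if "0 \<le> s" "s \<le> 1" for s
      using pc [of 1] qd [of 1] that c c' d d'
      by (simp add: H_def path_to_def max_absorb2 m_assoc e1)
  qed
  moreover have "(\<lambda>t. ?L t \<otimes> (c' t \<otimes> ?K t \<otimes> inv (c' t))) \<simeq> (\<lambda>t. ?L t \<otimes> ?K t)"
    using L K c' by (intro loop_eqv_mult loop_eqv_conjugate) (auto simp: loop_eqv_refl path_to_def)
  ultimately have "(\<lambda>t. ?L t \<otimes> ?K t) \<simeq> transport (\<lambda>t. p t \<otimes> q t) (\<lambda>t. c t \<otimes> d t) (\<lambda>t. c' t \<otimes> d' t)"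
    by (meson loop_eqv_sym loop_eqv_trans)
  then show ?thesis
    using L K by (simp add: cls_mult cls_cong)
qed

lemma represents_mult:
  assumes u: "represents X u z" and v: "represents X v w"
  shows "represents X (\<lambda>x. u x \<otimes> v x) (\<lambda>c. z c \<otimes>\<^bsub>P\<^esub> w c)"
proof -
  obtain \<gamma> where \<gamma>: "lifting X u \<gamma>"
      "\<And>\<sigma>. singular_simplex (Suc 0) X \<sigma> \<Longrightarrow> z (frag_of \<sigma>) = holonomy u \<gamma> \<sigma>"
    using u by (auto simp: represents_def)
  obtain \<delta> where \<delta>: "lifting X v \<delta>"
      "\<And>\<sigma>. singular_simplex (Suc 0) X \<sigma> \<Longrightarrow> w (frag_of \<sigma>) = holonomy v \<delta> \<sigma>"
    using v by (auto simp: represents_def)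
  have "lifting X (\<lambda>x. u x \<otimes> v x) (\<lambda>x t. \<gamma> x t \<otimes> \<delta> x t)"
    using \<gamma>(1) \<delta>(1) by (auto simp: lifting_def path_to_mult intro: continuous_mult)
  moreover have "z (frag_of \<sigma>) \<otimes>\<^bsub>P\<^esub> w (frag_of \<sigma>) = holonomy (\<lambda>x. u x \<otimes> v x) (\<lambda>x t. \<gamma> x t \<otimes> \<delta> x t) \<sigma>"
    if \<sigma>: "singular_simplex (Suc 0) X \<sigma>" for \<sigma>
  proof -
    have l: "path_to (u (edge \<sigma> t)) (\<gamma> (edge \<sigma> t))" "path_to (v (edge \<sigma> t)) (\<delta> (edge \<sigma> t))" if "t \<in> {0..1}" for t
      using \<gamma>(1) \<delta>(1) edge_in_topspace [OF \<sigma> that] by (auto simp: lifting_def)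
    show ?thesis
      using transport_mult [of "\<lambda>t. u (edge \<sigma> t)" "\<gamma> (edge \<sigma> 0)" "\<gamma> (edge \<sigma> 1)" "\<lambda>t. v (edge \<sigma> t)" "\<delta> (edge \<sigma> 0)" "\<delta> (edge \<sigma> 1)"]
        pathin_lifting_edge [OF \<gamma>(1) \<sigma>] pathin_lifting_edge [OF \<delta>(1) \<sigma>] l
      by (simp add: holonomy_def \<gamma>(2) [OF \<sigma>] \<delta>(2) [OF \<sigma>])
  qed
  ultimately show ?thesis
    using pi.cocycle_mult [OF represents_cocycle [OF u] represents_cocycle [OF v]]
    unfolding represents_def by blast
qed

text \<open>The added loops appear as outer factors and are moved together since the group P is
  abelian. The loop at the start counts positively and the one at the end negatively, the opposite
  of the sign in a boundary.\<close>

lemma transport_shift: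
  assumes p: "pathin T p" and c: "path_to (p 0) c" and d: "path_to (p 1) d"
    and l: "unit_loop l" and k: "unit_loop k"
  shows "cls (transport p (\<lambda>t. l t \<otimes> c t) (\<lambda>t. k t \<otimes> d t)) = cls (transport p c d) \<otimes>\<^bsub>P\<^esub> (cls l \<otimes>\<^bsub>P\<^esub> inv\<^bsub>P\<^esub> cls k)"
proof -
  have tr: "unit_loop (transport p c d)"
    using p c d by (rule unit_loop_transport)
  have lc: "path_to (p 0) (\<lambda>t. l t \<otimes> c t)" "path_to (p 1) (\<lambda>t. k t \<otimes> d t)"
    using l k c d path_to_mult [of \<one> l "p 0" c] path_to_mult [of \<one> k "p 1" d] path_to_closed_end
    by (auto simp: unit_loop_iff_path_to)
  have "cls (transport p (\<lambda>t. l t \<otimes> c t) (\<lambda>t. k t \<otimes> d t)) = cls (\<lambda>t. l t \<otimes> transport p c d t \<otimes> inv (k t))"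
    using unit_loop_transport [OF p lc]
  proof (rule cls_eqI)
    fix t :: real assume "t \<in> {0..1}"
    then show "transport p (\<lambda>t. l t \<otimes> c t) (\<lambda>t. k t \<otimes> d t) t = l t \<otimes> transport p c d t \<otimes> inv (k t)"
      using transport_closed [OF p c d, of t] unit_loop_closed [OF l] unit_loop_closed [OF k]
      by (simp add: transport_def m_assoc inv_mult_group)
  qed
  also have "\<dots> = cls l \<otimes>\<^bsub>P\<^esub> cls (transport p c d) \<otimes>\<^bsub>P\<^esub> inv\<^bsub>P\<^esub> cls k"
    using l k tr by (simp add: cls_mult cls_inv unit_loop_mult unit_loop_inv)
  also have "\<dots> = cls (transport p c d) \<otimes>\<^bsub>P\<^esub> (cls l \<otimes>\<^bsub>P\<^esub> inv\<^bsub>P\<^esub> cls k)"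
    using l k tr by (simp add: pi.m_ac)
  finally show ?thesis .
qed

end

section \<open>Degree 0 cochains as functions on points\<close>

context comm_group
begin

lemma cochain_0_exists:
  assumes "\<And>x. x \<in> topspace X \<Longrightarrow> f x \<in> carrier G"
  obtains e where "cochain 0 X e" "\<And>x. x \<in> topspace X \<Longrightarrow> e (frag_of (point_simplex x)) = f x"
proof -
  have 0: "bary 1 0 0 \<in> standard_simplex 0"
    by (auto simp: standard_simplex_0 bary_def)
  obtain e where "cochain 0 X e" and e: "\<And>\<sigma>. singular_simplex 0 X \<sigma> \<Longrightarrow> e (frag_of \<sigma>) = f (\<sigma> (bary 1 0 0))"
    using cochain_of_simplices [of 0 X "\<lambda>\<sigma>. f (\<sigma> (bary 1 0 0))"] assms singular_simplex_0_eq(2) by metis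
  moreover have "e (frag_of (point_simplex x)) = f x" if "x \<in> topspace X" for x
    using e [OF singular_point_simplex [OF that]] 0 by (simp add: point_simplex_def)
  ultimately show ?thesis
    using that by blast
qed

lemma cochain_point_closed:
  assumes "cochain 0 X e" "x \<in> topspace X"
  shows "e (frag_of (point_simplex x)) \<in> carrier G"
  by (rule cochain_closed [OF assms(1)]) (simp add: singular_chain_of singular_point_simplex assms(2))

lemma cochain_boundary_1:
  assumes e: "cochain 0 X e" and \<sigma>: "singular_simplex (Suc 0) X \<sigma>"
  shows "e (chain_boundary (Suc 0) (frag_of \<sigma>))
    = e (frag_of (point_simplex (edge \<sigma> 1))) \<otimes> inv (e (frag_of (point_simplex (edge \<sigma> 0))))"
  unfolding boundary_1
  by (rule cochain_diff [OF e]) (use edge_in_topspace [OF \<sigma>] in \<open>auto simp: singular_chain_of singular_point_simplex\<close>)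

end

context topological_group_space
begin

lemma represents_coboundary:
  assumes u: "represents X u z" and e: "pi.cochain 0 X e"
  shows "represents X u (\<lambda>c. z c \<otimes>\<^bsub>P\<^esub> e (chain_boundary (Suc 0) c))"
proof -
  obtain \<gamma> where \<gamma>: "lifting X u \<gamma>"
      "\<And>\<sigma>. singular_simplex (Suc 0) X \<sigma> \<Longrightarrow> z (frag_of \<sigma>) = holonomy u \<gamma> \<sigma>"
    using u by (auto simp: represents_def)
  \<comment> \<open>The inverse reconciles the signs: \<open>transport_shift\<close> counts start
    minus end, the boundary of an edge end minus start.\<close>
  have "\<exists>l. unit_loop l \<and> cls l = inv\<^bsub>P\<^esub> e (frag_of (point_simplex x))" if "x \<in> topspace X" for x
    using pi.cochain_point_closed [OF e that] cls_rep by (metis pi.inv_closed)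
  then obtain l where l: "\<And>x. x \<in> topspace X \<Longrightarrow> unit_loop (l x)"
      "\<And>x. x \<in> topspace X \<Longrightarrow> cls (l x) = inv\<^bsub>P\<^esub> e (frag_of (point_simplex x))"
    by metis
  have path: "path_to (u x) (\<lambda>t. l x t \<otimes> \<gamma> x t)" if "x \<in> topspace X" for x
    using path_to_mult [of \<one> "l x" "u x" "\<gamma> x"] l(1) [OF that] \<gamma>(1) that path_to_closed_end [of "u x" "\<gamma> x"]
    by (simp add: lifting_def unit_loop_iff_path_to)
  then have "lifting X u (\<lambda>x t. l x t \<otimes> \<gamma> x t)"
    using \<gamma>(1) by (simp add: lifting_def)
  moreover have "z (frag_of \<sigma>) \<otimes>\<^bsub>P\<^esub> e (chain_boundary (Suc 0) (frag_of \<sigma>)) = holonomy u (\<lambda>x t. l x t \<otimes> \<gamma> x t) \<sigma>"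
    if \<sigma>: "singular_simplex (Suc 0) X \<sigma>" for \<sigma>
  proof -
    have E: "edge \<sigma> 0 \<in> topspace X" "edge \<sigma> 1 \<in> topspace X"
      using edge_in_topspace [OF \<sigma>] by auto
    then have EE: "e (frag_of (point_simplex (edge \<sigma> 0))) \<in> carrier P" "e (frag_of (point_simplex (edge \<sigma> 1))) \<in> carrier P"
      using pi.cochain_point_closed [OF e] by auto
    have "path_to (u (edge \<sigma> t)) (\<gamma> (edge \<sigma> t))" if "t \<in> {0..1}" for t
      using \<gamma>(1) edge_in_topspace [OF \<sigma> that] by (auto simp: lifting_def)
    then show ?thesis
      using transport_shift [OF pathin_lifting_edge [OF \<gamma>(1) \<sigma>], of "\<gamma> (edge \<sigma> 0)" "\<gamma> (edge \<sigma> 1)" "l (edge \<sigma> 0)" "l (edge \<sigma> 1)"]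
        l [OF E(1)] l [OF E(2)] EE
      by (simp add: holonomy_def \<gamma>(2) [OF \<sigma>] pi.cochain_boundary_1 [OF e \<sigma>] pi.m_comm)
  qed
  ultimately show ?thesis
    using pi.cocycle_mult [OF represents_cocycle [OF u] pi.cocycle_coboundary [OF e]]
    unfolding represents_def by blast
qed

lemma unit_loop_difference:
  assumes "path_to g c" "path_to g d"
  shows "unit_loop (\<lambda>t. d t \<otimes> inv (c t))"
  using path_to_mult [OF assms(2) path_to_inv [OF assms(1)]] path_to_closed_end [OF assms(1)]
  by (simp add: unit_loop_iff_path_to)

lemma holonomy_change:
  assumes \<gamma>: "lifting X u \<gamma>" and \<delta>: "lifting X u \<delta>" and \<sigma>: "singular_simplex (Suc 0) X \<sigma>"
  shows "holonomy u \<delta> \<sigma> = holonomy u \<gamma> \<sigma> \<otimes>\<^bsub>P\<^esub>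
    (cls (\<lambda>t. \<delta> (edge \<sigma> 0) t \<otimes> inv (\<gamma> (edge \<sigma> 0) t)) \<otimes>\<^bsub>P\<^esub>
     inv\<^bsub>P\<^esub> cls (\<lambda>t. \<delta> (edge \<sigma> 1) t \<otimes> inv (\<gamma> (edge \<sigma> 1) t)))"
proof -
  define l where "l x t = \<delta> x t \<otimes> inv (\<gamma> x t)" for x t
  have p: "path_to (u (edge \<sigma> t)) (\<gamma> (edge \<sigma> t))" "path_to (u (edge \<sigma> t)) (\<delta> (edge \<sigma> t))" if "t \<in> {0..1}" for t
    using \<gamma> \<delta> edge_in_topspace [OF \<sigma> that] by (auto simp: lifting_def)
  have l: "unit_loop (l (edge \<sigma> t))" if "t \<in> {0..1}" for t
    unfolding l_def [abs_def] by (rule unit_loop_difference [OF p [OF that]])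
  have "l (edge \<sigma> s) t \<otimes> \<gamma> (edge \<sigma> s) t = \<delta> (edge \<sigma> s) t" if "s \<in> {0..1}" "t \<in> {0..1}" for s t
    using path_to_closed [OF p(1) [OF that(1)] that(2)] path_to_closed [OF p(2) [OF that(1)] that(2)]
    by (simp add: l_def m_assoc)
  then have "holonomy u \<delta> \<sigma>
    = cls (transport (\<lambda>t. u (edge \<sigma> t)) (\<lambda>t. l (edge \<sigma> 0) t \<otimes> \<gamma> (edge \<sigma> 0) t) (\<lambda>t. l (edge \<sigma> 1) t \<otimes> \<gamma> (edge \<sigma> 1) t))"
    unfolding holonomy_def
    by (intro cls_eqI [OF unit_loop_holonomy [OF \<delta> \<sigma>]]) (simp add: transport_def)
  also have "\<dots> = holonomy u \<gamma> \<sigma> \<otimes>\<^bsub>P\<^esub> (cls (l (edge \<sigma> 0)) \<otimes>\<^bsub>P\<^esub> inv\<^bsub>P\<^esub> cls (l (edge \<sigma> 1)))"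
    unfolding holonomy_def using p l by (intro transport_shift pathin_lifting_edge [OF \<gamma> \<sigma>]) auto
  finally show ?thesis
    by (simp add: l_def [abs_def])
qed

lemma represents_unique:
  fixes X :: "'x topology"
  assumes z: "represents X u z" and w: "represents X u w"
  obtains e where "pi.cochain 0 X e"
    "\<And>c. singular_chain (Suc 0) X c \<Longrightarrow> w c = z c \<otimes>\<^bsub>P\<^esub> e (chain_boundary (Suc 0) c)"
proof -
  obtain \<gamma> where \<gamma>: "lifting X u \<gamma>"
      "\<And>\<sigma>. singular_simplex (Suc 0) X \<sigma> \<Longrightarrow> z (frag_of \<sigma>) = holonomy u \<gamma> \<sigma>"
    using z by (auto simp: represents_def)
  obtain \<delta> where \<delta>: "lifting X u \<delta>"
      "\<And>\<sigma>. singular_simplex (Suc 0) X \<sigma> \<Longrightarrow> w (frag_of \<sigma>) = holonomy u \<delta> \<sigma>"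
    using w by (auto simp: represents_def)
  let ?l = "\<lambda>x. cls (\<lambda>t. \<delta> x t \<otimes> inv (\<gamma> x t))"
  have l: "?l x \<in> carrier P" if "x \<in> topspace X" for x
    using \<gamma>(1) \<delta>(1) that by (auto simp: lifting_def intro!: cls_closed unit_loop_difference)
  then obtain e where e: "pi.cochain 0 X e"
      "\<And>x. x \<in> topspace X \<Longrightarrow> e (frag_of (point_simplex x)) = inv\<^bsub>P\<^esub> ?l x"
    using pi.cochain_0_exists [of X "\<lambda>x. inv\<^bsub>P\<^esub> ?l x"] by blast
  show ?thesis
  proof
    show "pi.cochain 0 X e" by fact
    show "w c = z c \<otimes>\<^bsub>P\<^esub> e (chain_boundary (Suc 0) c)" if "singular_chain (Suc 0) X c" for c
    proof (rule pi.cochain_eqI [OF _ _ _ that])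
      show "pi.cochain (Suc 0) X w"
        by (rule pi.cocycle_cochain [OF represents_cocycle [OF w]])
      show "pi.cochain (Suc 0) X (\<lambda>c. z c \<otimes>\<^bsub>P\<^esub> e (chain_boundary (Suc 0) c))"
        by (rule pi.cochain_mult [OF pi.cocycle_cochain [OF represents_cocycle [OF z]] pi.cochain_coboundary [OF e(1)]])
    next
      fix \<sigma> assume \<sigma>: "singular_simplex (Suc 0) X \<sigma>"
      have E: "edge \<sigma> 0 \<in> topspace X" "edge \<sigma> 1 \<in> topspace X"
        using edge_in_topspace [OF \<sigma>] by auto
      show "w (frag_of \<sigma>) = z (frag_of \<sigma>) \<otimes>\<^bsub>P\<^esub> e (chain_boundary (Suc 0) (frag_of \<sigma>))"
        unfolding \<gamma>(2) [OF \<sigma>] \<delta>(2) [OF \<sigma>] holonomy_change [OF \<gamma>(1) \<delta>(1) \<sigma>]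
        using l [OF E(1)] l [OF E(2)] by (simp add: pi.cochain_boundary_1 [OF e(1) \<sigma>] e(2) E pi.m_comm)
    qed
  qed
qed

text \<open>Paths that come from a null homotopy vary continuously with the point, so the homotopy
  along an edge is a map \<Phi> on a square. The transport lives on the sides of the square and is
  contracted through its interior.\<close>

lemma holonomy_null_homotopy:
  assumes F: "continuous_map (prod_topology X (top_of_set {0..1})) T F"
    and F0: "\<And>x. x \<in> topspace X \<Longrightarrow> F (x, 0) = \<one>" and F1: "\<And>x. x \<in> topspace X \<Longrightarrow> F (x, 1) = u x"
  shows "lifting X u (\<lambda>x t. F (x, t))"
    and "singular_simplex (Suc 0) X \<sigma> \<Longrightarrow> holonomy u (\<lambda>x t. F (x, t)) \<sigma> = \<one>\<^bsub>P\<^esub>"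
proof -
  have comp: "continuous_map Z T (\<lambda>z. F (f z, g z))"
    if "continuous_map Z X f" "continuous_map Z (top_of_set {0..1}) g" for f g and Z :: "'z topology"
    using continuous_map_compose [OF _ F, of Z "\<lambda>z. (f z, g z)"] that
    by (simp add: continuous_map_pairwise o_def)
  have path: "path_to (u x) (\<lambda>t. F (x, t))" if "x \<in> topspace X" for x
    using that F0 F1 by (auto simp: path_to_def pathin_def intro!: comp)
  have "continuous_map X T (\<lambda>x. F (x, 1))"
    by (rule comp) auto
  then have "continuous_map X T u"
    using F1 by (auto intro: continuous_map_eq)
  with path show l: "lifting X u (\<lambda>x t. F (x, t))"
    by (simp add: lifting_def)
  assume \<sigma>: "singular_simplex (Suc 0) X \<sigma>"
  define \<Phi> where "\<Phi> a b = F (edge \<sigma> a, b)" for a b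
  let ?Q = "top_of_set ({0..1::real} \<times> {0..1::real})"
  have \<Phi>: "continuous_map ?Q T (\<lambda>z. \<Phi> (f z) (g z))"
    if fg: "continuous_on ({0..1} \<times> {0..1}) f" "continuous_on ({0..1} \<times> {0..1}) g"
      "\<And>z. z \<in> {0..1} \<times> {0..1} \<Longrightarrow> f z \<in> {0..1} \<and> g z \<in> {0..1}" for f g
    unfolding \<Phi>_def
  proof (rule comp)
    have "continuous_map ?Q (top_of_set {0..1}) f" "continuous_map ?Q (top_of_set {0..1}) g"
      using fg by (auto simp: continuous_map_in_subtopology)
    then show "continuous_map ?Q X (\<lambda>z. edge \<sigma> (f z))" "continuous_map ?Q (top_of_set {0..1}) g"
      using continuous_map_compose [OF \<open>continuous_map ?Q (top_of_set {0..1}) f\<close> pathin_edge [OF \<sigma>, unfolded pathin_def]]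
      by (simp_all add: o_def)
  qed
  have \<Phi>G: "\<Phi> a b \<in> carrier G" if "a \<in> {0..1}" "b \<in> {0..1}" for a b
    unfolding \<Phi>_def by (rule continuous_closed [OF F]) (use that edge_in_topspace [OF \<sigma>] in auto)
  have \<Phi>01: "\<Phi> a 0 = \<one>" "\<Phi> a 1 = u (edge \<sigma> a)" if "a \<in> {0..1}" for a
    using edge_in_topspace [OF \<sigma> that] F0 F1 by (auto simp: \<Phi>_def)
  have uG: "u (edge \<sigma> a) \<in> carrier G" if "a \<in> {0..1}" for a
    using \<Phi>G [OF that, of 1] \<Phi>01(2) [OF that] by simp
  have tr: "transport (\<lambda>t. u (edge \<sigma> t)) (\<lambda>t. F (edge \<sigma> 0, t)) (\<lambda>t. F (edge \<sigma> 1, t)) t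
      = \<Phi> 0 t \<otimes> inv (\<Phi> 0 1) \<otimes> \<Phi> t 1 \<otimes> inv (\<Phi> 1 t)" if "t \<in> {0..1}" for t
    using that \<Phi>01 by (simp add: transport_def) (simp add: \<Phi>_def)
  \<comment> \<open>The second coordinate is lowered from 1 to t; then the first two factors cancel
    and the third is \<Phi> on the diagonal.\<close>
  have "transport (\<lambda>t. u (edge \<sigma> t)) (\<lambda>t. F (edge \<sigma> 0, t)) (\<lambda>t. F (edge \<sigma> 1, t)) \<simeq> (\<lambda>t. \<Phi> t t \<otimes> inv (\<Phi> 1 t))"
  proof (rule loop_eqvI [of "\<lambda>s t. \<Phi> 0 t \<otimes> inv (\<Phi> 0 (max t (1 - s))) \<otimes> \<Phi> t (max t (1 - s)) \<otimes> inv (\<Phi> 1 t)"])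
    show "continuous_map ?Q T (\<lambda>z. \<Phi> 0 (snd z) \<otimes> inv (\<Phi> 0 (max (snd z) (1 - fst z))) \<otimes> \<Phi> (snd z) (max (snd z) (1 - fst z)) \<otimes> inv (\<Phi> 1 (snd z)))"
      by (intro continuous_mult continuous_inv \<Phi>) (auto intro!: continuous_intros continuous_on_max)
  qed (use tr \<Phi>01 \<Phi>G uG in \<open>auto simp: max_absorb1 max_absorb2 m_assoc\<close>)
  \<comment> \<open>Raising the first coordinate from t to 1 cancels the two remaining
    factors.\<close>
  also have "(\<lambda>t. \<Phi> t t \<otimes> inv (\<Phi> 1 t)) \<simeq> (\<lambda>t. \<one>)"
  proof (rule loop_eqvI [of "\<lambda>s t. \<Phi> (max s t) t \<otimes> inv (\<Phi> 1 t)"])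
    show "continuous_map ?Q T (\<lambda>z. \<Phi> (max (fst z) (snd z)) (snd z) \<otimes> inv (\<Phi> 1 (snd z)))"
      by (intro continuous_mult continuous_inv \<Phi>) (auto intro!: continuous_intros continuous_on_max)
  qed (use \<Phi>01 \<Phi>G uG in \<open>auto simp: max_absorb1 max_absorb2\<close>)
  finally (loop_eqv_trans) show "holonomy u (\<lambda>x t. F (x, t)) \<sigma> = \<one>\<^bsub>P\<^esub>"
    unfolding holonomy_def one_P by (rule cls_cong)
qed

lemma represents_one: "represents X (\<lambda>x. \<one>) (\<lambda>c. \<one>\<^bsub>P\<^esub>)"
proof -
  have "continuous_map (prod_topology X (top_of_set {0..1::real})) T (\<lambda>x. \<one>)"
    by simp
  from holonomy_null_homotopy [OF this, of "\<lambda>x. \<one>"] show ?thesis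
    unfolding represents_def using pi.cocycle_one by fastforce
qed

text \<open>For a closed edge both end paths coincide and the transport is a conjugate of the
  translated loop. This reads off from a class whether a map is null homotopic around a
  circle.\<close>

lemma represents_closed_edge:
  assumes u: "represents X u z" and \<sigma>: "singular_simplex (Suc 0) X \<sigma>" "edge \<sigma> 0 = edge \<sigma> 1"
  shows "unit_loop (\<lambda>t. inv (u (edge \<sigma> 0)) \<otimes> u (edge \<sigma> t))"
    and "z (frag_of \<sigma>) = cls (\<lambda>t. inv (u (edge \<sigma> 0)) \<otimes> u (edge \<sigma> t))"
proof -
  obtain \<gamma> where \<gamma>: "lifting X u \<gamma>"
      "\<And>\<sigma>. singular_simplex (Suc 0) X \<sigma> \<Longrightarrow> z (frag_of \<sigma>) = holonomy u \<gamma> \<sigma>"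
    using u by (auto simp: represents_def)
  note p = pathin_lifting_edge [OF \<gamma>(1) \<sigma>(1)]
  have uG: "u (edge \<sigma> t) \<in> carrier G" if "t \<in> {0..1}" for t
    using pathin_closed [OF p that] .
  let ?\<gamma> = "\<gamma> (edge \<sigma> 0)"
  have \<gamma>0: "path_to (u (edge \<sigma> 0)) ?\<gamma>"
    using \<gamma>(1) edge_in_topspace [OF \<sigma>(1), of 0] by (auto simp: lifting_def)
  show l: "unit_loop (\<lambda>t. inv (u (edge \<sigma> 0)) \<otimes> u (edge \<sigma> t))"
  proof -
    have "pathin T (\<lambda>t. inv (u (edge \<sigma> 0)))"
      using uG [of 0] by (simp add: pathin_def)
    then show ?thesis
      using \<sigma>(2) uG [of 1] pathin_mult [OF _ p] by (simp add: loop_at_def)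
  qed
  have "z (frag_of \<sigma>) = cls (\<lambda>t. ?\<gamma> t \<otimes> (inv (u (edge \<sigma> 0)) \<otimes> u (edge \<sigma> t)) \<otimes> inv (?\<gamma> t))"
    unfolding \<gamma>(2) [OF \<sigma>(1)] holonomy_def
    using unit_loop_holonomy [OF \<gamma>(1) \<sigma>(1)]
    by (rule cls_eqI) (use uG path_to_closed [OF \<gamma>0] \<sigma>(2) in \<open>auto simp: transport_def m_assoc\<close>)
  also have "\<dots> = cls (\<lambda>t. inv (u (edge \<sigma> 0)) \<otimes> u (edge \<sigma> t))"
    using \<gamma>0 by (intro cls_cong loop_eqv_conjugate l) (auto simp: path_to_def)
  finally show "z (frag_of \<sigma>) = cls (\<lambda>t. inv (u (edge \<sigma> 0)) \<otimes> u (edge \<sigma> t))" .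
qed

end

section \<open>Classes of arbitrary maps into a path-connected group\<close>

locale path_connected_group = topological_group_space +
  assumes path_connected: "path_connected_space T"
begin

lemma path_to_exists: "g \<in> carrier G \<Longrightarrow> \<exists>c. path_to g c"
  using path_connected unfolding path_connected_space_def path_to_def by fastforce

lemma represents_exists:
  fixes X :: "'x topology"
  assumes u: "continuous_map X T u"
  obtains z where "represents X u z"
proof -
  have l: "lifting X u (\<lambda>x. SOME c. path_to (u x) c)"
    unfolding lifting_def using u path_to_exists continuous_closed by (metis (mono_tags) someI_ex)
  obtain z where "pi.cocycle (Suc 0) X z"
    "\<And>\<sigma>. singular_simplex (Suc 0) X \<sigma> \<Longrightarrow> z (frag_of \<sigma>) = holonomy u (\<lambda>x. SOME c. path_to (u x) c) \<sigma>"
    using holonomy_cocycle [OF l] by blast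
  with l show ?thesis
    using that [of z] unfolding represents_def by blast
qed

text \<open>Some w is represented by the inverse map, and the product of z and w by the constant
  map. Uniqueness for the constant map shows that w and the inverse of z differ by a coboundary,
  which can be absorbed.\<close>

lemma represents_inv:
  fixes X :: "'x topology"
  assumes u: "represents X u z"
  shows "represents X (\<lambda>x. inv (u x)) (\<lambda>c. inv\<^bsub>P\<^esub> z c)"
proof -
  note cu = represents_continuous [OF u]
  obtain w where w: "represents X (\<lambda>x. inv (u x)) w"
    using represents_exists [OF continuous_inv [OF cu]] .
  have 1: "represents X (\<lambda>x. \<one>) (\<lambda>c. z c \<otimes>\<^bsub>P\<^esub> w c)"
    by (rule represents_cong [OF represents_mult [OF u w]]) (use continuous_closed [OF cu] in auto)
  obtain e where e: "pi.cochain 0 X e"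
      "\<And>c. singular_chain (Suc 0) X c \<Longrightarrow> \<one>\<^bsub>P\<^esub> = z c \<otimes>\<^bsub>P\<^esub> w c \<otimes>\<^bsub>P\<^esub> e (chain_boundary (Suc 0) c)"
    using represents_unique [OF 1 represents_one] by blast
  show ?thesis
  proof (rule represents_cong [OF represents_coboundary [OF w e(1)]])
    fix c assume c: "singular_chain (Suc 0) X c"
    have "z c \<in> carrier P" "w c \<in> carrier P" "e (chain_boundary (Suc 0) c) \<in> carrier P"
      using c by (auto intro!: pi.cochain_closed [OF pi.cocycle_cochain [OF represents_cocycle]] u w
          pi.cochain_closed [OF e(1)] singular_chain_boundary_alt)
    then show "inv\<^bsub>P\<^esub> z c = w c \<otimes>\<^bsub>P\<^esub> e (chain_boundary (Suc 0) c)"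
      using e(2) [OF c] by (metis pi.inv_equality pi.m_assoc pi.m_closed pi.m_comm)
  qed auto
qed

end


section \<open>Spaces with contractible components\<close>

text \<open>A homotopy from the identity to a locally constant map that has come to rest at time \<open>1/2\<close>;
  because of the rest, coning a singular simplex along it is continuous at the apex.\<close>

definition scattering :: "'x topology \<Rightarrow> (real \<times> 'x \<Rightarrow> 'x) \<Rightarrow> ('x \<Rightarrow> 'x) \<Rightarrow> bool"
  where "scattering X H k \<longleftrightarrow>
    continuous_map (prod_topology (top_of_set {0..1}) X) X H \<and>
    (\<forall>x\<in>topspace X. H (0, x) = x \<and> (\<forall>t\<in>{1/2..1}. H (t, x) = k x)) \<and>
    (\<forall>y. openin X {x \<in> topspace X. k x = y})"

lemma half_le_one: "1/2 \<le> (1::real)"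
  by simp

definition scattered :: "'x topology \<Rightarrow> bool"
  where "scattered X \<longleftrightarrow> (\<exists>H k. scattering X H k)"

text \<open>Vertex 0 is the apex and \<open>x 0\<close> the cone parameter; the remaining
  coordinates, rescaled, give the point of the base. The value near the apex is taken from the base
  vertex \<open>bary 1 0 0\<close>, an arbitrary choice because k is constant on a simplex.\<close>

definition cone :: "(real \<times> 'x \<Rightarrow> 'x) \<Rightarrow> ('x \<Rightarrow> 'x) \<Rightarrow> nat \<Rightarrow> ((nat \<Rightarrow> real) \<Rightarrow> 'x) \<Rightarrow> (nat \<Rightarrow> real) \<Rightarrow> 'x"
  where "cone H k n \<sigma> = (\<lambda>x\<in>standard_simplex (Suc n).
    if x 0 \<le> 1/2 then H (x 0, \<sigma> (\<lambda>i. x (Suc i) / (1 - x 0))) else k (\<sigma> (bary 1 0 0)))"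

lemma bary_100_in_simplex: "bary 1 0 0 \<in> standard_simplex n"
proof -
  have "bary 1 0 0 = (\<lambda>j. if j = 0 then 1 else 0)"
    by (auto simp: bary_def)
  then show ?thesis
    using basis_in_standard_simplex [of 0 n] by simp
qed

lemma continuous_locally_constant:
  assumes "\<And>y. openin X {x \<in> topspace X. f x = y}"
  shows "continuous_map X (discrete_topology UNIV) f"
  unfolding continuous_map_def
proof (intro conjI allI impI)
  fix U
  have "{x \<in> topspace X. f x \<in> U} = (\<Union>y\<in>U. {x \<in> topspace X. f x = y})" by auto
  then show "openin X {x \<in> topspace X. f x \<in> U}"
    using assms by auto
qed auto

lemma scattering_constant_on_simplex:
  assumes k: "scattering X H k" and \<sigma>: "singular_simplex n X \<sigma>"
    and x: "x \<in> standard_simplex n" and y: "y \<in> standard_simplex n"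
  shows "k (\<sigma> x) = k (\<sigma> y)"
proof -
  have "continuous_map X (discrete_topology UNIV) k"
    using k by (intro continuous_locally_constant) (auto simp: scattering_def)
  with \<sigma> have "continuous_map (subtopology (powertop_real UNIV) (standard_simplex n)) (discrete_topology UNIV) (k \<circ> \<sigma>)"
    by (auto simp: singular_simplex_def intro: continuous_map_compose)
  then have "connectedin (discrete_topology UNIV) ((k \<circ> \<sigma>) ` standard_simplex n)"
    using connectedin_standard_simplex
    by (intro connectedin_continuous_map_image) (auto simp: connectedin_subtopology)
  then show ?thesis
    using x y by (auto simp: connectedin_discrete_topology)
qed

lemma singular_simplex_cone:
  assumes H: "scattering X H k" and \<sigma>: "singular_simplex n X \<sigma>"
  shows "singular_simplex (Suc n) X (cone H k n \<sigma>)"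
proof -
  let ?S = "subtopology (powertop_real UNIV) (standard_simplex (Suc n))"
  let ?f = "\<lambda>x. H (x 0, \<sigma> (\<lambda>i. x (Suc i) / (1 - x 0)))"
  have proj: "continuous_map ?S euclideanreal (\<lambda>x. x i)" for i
    by (intro continuous_map_from_subtopology continuous_map_product_projection) auto
  have simplex: "(\<lambda>i. x (Suc i) / (1 - x 0)) \<in> standard_simplex n"
    if x: "x \<in> standard_simplex (Suc n)" "x 0 \<le> 1/2" for x
  proof -
    have s: "x 0 + (\<Sum>i\<le>n. x (Suc i)) = 1" and p: "\<forall>i. 0 \<le> x i"
      using x by (auto simp: standard_simplex_def sum.atMost_Suc_shift simp del: sum.atMost_Suc)
    have le: "x (Suc i) \<le> 1 - x 0" for i
    proof (cases "i \<le> n")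
      case True
      then have "x (Suc i) \<le> (\<Sum>i\<le>n. x (Suc i))"
        using p by (intro member_le_sum) auto
      then show ?thesis using s by simp
    next
      case False
      then show ?thesis using x by (auto simp: standard_simplex_def)
    qed
    have "(\<Sum>i\<le>n. x (Suc i) / (1 - x 0)) = 1"
      using s x(2) by (simp flip: sum_divide_distrib)
    then show ?thesis
      using x le p by (auto simp: standard_simplex_def)
  qed
  have "continuous_map ?S X (\<lambda>x. if x 0 \<le> 1/2 then ?f x else k (\<sigma> (bary 1 0 0)))"
  proof (rule continuous_map_cases_le)
    show "continuous_map ?S euclideanreal (\<lambda>x. x 0)" by (rule proj)
    let ?T = "subtopology ?S {x \<in> topspace ?S. x 0 \<le> 1/2}"
    have "continuous_map ?T X (\<lambda>x. \<sigma> (\<lambda>i. x (Suc i) / (1 - x 0)))"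
      using simplex
      by (intro continuous_map_simplex [OF \<sigma>] continuous_intros continuous_map_from_subtopology proj) auto
    moreover have "continuous_map ?T (top_of_set {0..1}) (\<lambda>x. x 0)"
      by (auto simp: continuous_map_in_subtopology standard_simplex_def intro!: continuous_map_from_subtopology continuous_map_product_projection)
    ultimately have "continuous_map ?T (prod_topology (top_of_set {0..1}) X) (\<lambda>x. (x 0, \<sigma> (\<lambda>i. x (Suc i) / (1 - x 0))))"
      by (simp add: continuous_map_pairwise o_def)
    then show "continuous_map ?T X ?f"
      using continuous_map_compose [of ?T _ _ X H] H by (fastforce simp: scattering_def o_def)
    have "\<sigma> (bary 1 0 0) \<in> topspace X"
      using \<sigma> bary_100_in_simplex by (auto simp: singular_simplex_def continuous_map_def)
    then have "H (1, \<sigma> (bary 1 0 0)) = k (\<sigma> (bary 1 0 0))" "H (1, \<sigma> (bary 1 0 0)) \<in> topspace X"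
      using H Pi_mem [of H _ "\<lambda>_. topspace X" "(1, \<sigma> (bary 1 0 0))"]
      unfolding scattering_def continuous_map_def by force+
    then show "continuous_map (subtopology ?S {x \<in> topspace ?S. 1/2 \<le> x 0}) X (\<lambda>x. k (\<sigma> (bary 1 0 0)))"
      by simp
    show "?f x = k (\<sigma> (bary 1 0 0))" if "x \<in> topspace ?S" "x 0 = 1/2" for x
    proof -
      have x: "(\<lambda>i. x (Suc i) / (1 - x 0)) \<in> standard_simplex n"
        using that by (intro simplex) auto
      then have "\<sigma> (\<lambda>i. x (Suc i) / (1 - x 0)) \<in> topspace X"
        using \<sigma> by (auto simp: singular_simplex_def continuous_map_def)
      then have "?f x = k (\<sigma> (\<lambda>i. x (Suc i) / (1 - x 0)))"
        using H that(2) unfolding scattering_def by (metis atLeastAtMost_iff half_le_one order_refl)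
      then show ?thesis
        using scattering_constant_on_simplex [OF H \<sigma> x bary_100_in_simplex] by simp
    qed
  qed auto
  then show ?thesis
    unfolding singular_simplex_def cone_def
    by (auto intro: continuous_map_eq)
qed

lemma singular_face_cone_0:
  assumes H: "scattering X H k" and \<sigma>: "singular_simplex n X \<sigma>"
  shows "singular_face (Suc n) 0 (cone H k n \<sigma>) = \<sigma>"
proof
  fix y
  show "singular_face (Suc n) 0 (cone H k n \<sigma>) y = \<sigma> y"
  proof (cases "y \<in> standard_simplex n")
    case True
    then have "simplical_face 0 y \<in> standard_simplex (Suc n)"
      using simplical_face_in_standard_simplex [of "Suc n" 0 y] by simp
    moreover have "\<sigma> y \<in> topspace X"
      using \<sigma> True by (auto simp: singular_simplex_def continuous_map_def)
    ultimately show ?thesis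
      using True H by (simp add: singular_face_def cone_def simplical_face_def scattering_def)
  next
    case False
    then show ?thesis
      using \<sigma> by (auto simp: singular_face_def singular_simplex_def extensional_def)
  qed
qed

lemma singular_face_cone_Suc:
  assumes H: "scattering X H k" and \<sigma>: "singular_simplex (Suc n) X \<sigma>" and j: "j \<le> Suc n"
  shows "singular_face (Suc (Suc n)) (Suc j) (cone H k (Suc n) \<sigma>) = cone H k n (singular_face (Suc n) j \<sigma>)"
proof
  fix y
  show "singular_face (Suc (Suc n)) (Suc j) (cone H k (Suc n) \<sigma>) y = cone H k n (singular_face (Suc n) j \<sigma>) y"
  proof (cases "y \<in> standard_simplex (Suc n)")
    case True
    then have 1: "simplical_face (Suc j) y \<in> standard_simplex (Suc (Suc n))"
      using simplical_face_in_standard_simplex [of "Suc (Suc n)" "Suc j" y] j by simp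
    have 2: "simplical_face (Suc j) y 0 = y 0"
      by (simp add: simplical_face_def)
    have 3: "(\<lambda>i. simplical_face (Suc j) y (Suc i) / (1 - y 0)) = simplical_face j (\<lambda>i. y (Suc i) / (1 - y 0))"
      by (auto simp: simplical_face_def fun_eq_iff)
    have 4: "(\<lambda>i. y (Suc i) / (1 - y 0)) \<in> standard_simplex n" if "y 0 \<le> 1/2"
    proof -
      have s: "y 0 + (\<Sum>i\<le>n. y (Suc i)) = 1" and p: "\<forall>i. 0 \<le> y i"
        using True by (auto simp: standard_simplex_def sum.atMost_Suc_shift simp del: sum.atMost_Suc)
      have le: "y (Suc i) \<le> 1 - y 0" for i
      proof (cases "i \<le> n")
        case True
        then have "y (Suc i) \<le> (\<Sum>i\<le>n. y (Suc i))"
          using p by (intro member_le_sum) auto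
        then show ?thesis using s by simp
      next
        case False
        then show ?thesis using True by (auto simp: standard_simplex_def)
      qed
      have "(\<Sum>i\<le>n. y (Suc i) / (1 - y 0)) = 1"
        using s that by (simp flip: sum_divide_distrib)
      then show ?thesis
        using True le p that by (auto simp: standard_simplex_def)
    qed
    have 5: "k (\<sigma> (bary 1 0 0)) = k (singular_face (Suc n) j \<sigma> (bary 1 0 0))"
    proof -
      have "simplical_face j (bary 1 0 0) \<in> standard_simplex (Suc n)"
        using simplical_face_in_standard_simplex [of "Suc n" j "bary 1 0 0"] j bary_100_in_simplex by simp
      from scattering_constant_on_simplex [OF H \<sigma> bary_100_in_simplex this] show ?thesis
        by (simp add: singular_face_def bary_100_in_simplex)
    qed
    show ?thesis
      using True 1 2 3 4 5 by (simp add: singular_face_def cone_def)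
  next
    case False
    then show ?thesis
      by (simp add: singular_face_def cone_def)
  qed
qed

section \<open>Coning as a contracting homotopy of chains\<close>

definition chain_cone :: "(real \<times> 'x \<Rightarrow> 'x) \<Rightarrow> ('x \<Rightarrow> 'x) \<Rightarrow> nat \<Rightarrow> 'x chain \<Rightarrow> 'x chain"
  where "chain_cone H k n = frag_extend (frag_of \<circ> cone H k n)"

lemma singular_chain_chain_cone:
  assumes "scattering X H k" "singular_chain n X c"
  shows "singular_chain (Suc n) X (chain_cone H k n c)"
  using assms unfolding chain_cone_def
  by (intro singular_chain_extend) (auto simp: singular_chain_of singular_chain_def intro: singular_simplex_cone)

text \<open>The face opposite the apex is the base and every other face of a cone is the cone of a
  face. In degree 0 an apex would be left over, so the degree is a successor.\<close>

lemma chain_boundary_chain_cone: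
  assumes H: "scattering X H k" and c: "singular_chain (Suc n) X c"
  shows "chain_boundary (Suc (Suc n)) (chain_cone H k (Suc n) c) = c - chain_cone H k n (chain_boundary (Suc n) c)"
  using c unfolding singular_chain_def
proof (induction c rule: frag_induction)
  case (one \<sigma>)
  then have \<sigma>: "singular_simplex (Suc n) X \<sigma>" by simp
  have "chain_boundary (Suc (Suc n)) (chain_cone H k (Suc n) (frag_of \<sigma>))
    = (\<Sum>j\<le>Suc (Suc n). frag_cmul ((-1) ^ j) (frag_of (singular_face (Suc (Suc n)) j (cone H k (Suc n) \<sigma>))))"
    by (simp add: chain_cone_def chain_boundary_of)
  also have "\<dots> = frag_of \<sigma> + (\<Sum>j\<le>Suc n. frag_cmul ((-1) ^ Suc j) (frag_of (cone H k n (singular_face (Suc n) j \<sigma>))))"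
    by (subst sum.atMost_Suc_shift) (simp add: singular_face_cone_0 [OF H \<sigma>] singular_face_cone_Suc [OF H \<sigma>] del: sum.atMost_Suc)
  also have "\<dots> = frag_of \<sigma> - chain_cone H k n (chain_boundary (Suc n) (frag_of \<sigma>))"
    by (simp add: chain_cone_def chain_boundary_of frag_extend_sum frag_extend_cmul o_def flip: sum_negf del: sum.atMost_Suc)
  finally show ?case .
qed (simp_all add: chain_cone_def chain_boundary_diff frag_extend_diff)

text \<open>The primitive is f evaluated on cones; f is trivial on the boundary of the cone over c,
  which is c minus the cone over its boundary.\<close>

lemma (in comm_group) scattered_cocycle_coboundary:
  fixes X :: "'x topology"
  assumes X: "scattered X" and f: "cocycle (Suc n) X f"
  obtains e where "cochain n X e" "\<And>c. singular_chain (Suc n) X c \<Longrightarrow> f c = e (chain_boundary (Suc n) c)"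
proof -
  obtain H k where H: "scattering X H k"
    using X unfolding scattered_def by blast
  note cf = cocycle_cochain [OF f]
  show ?thesis
  proof
    show "cochain n X (\<lambda>c. f (chain_cone H k n c))"
      using cf singular_chain_chain_cone [OF H]
      by (auto simp: cochain_iff chain_cone_def frag_extend_add)
    show "f c = f (chain_cone H k n (chain_boundary (Suc n) c))" if c: "singular_chain (Suc n) X c" for c
    proof -
      let ?d = "chain_cone H k n (chain_boundary (Suc n) c)"
      have d: "singular_chain (Suc n) X ?d"
        using c by (intro singular_chain_chain_cone [OF H] singular_chain_boundary_alt)
      have "\<one> = f (c - ?d)"
        using cocycle_boundary [OF f singular_chain_chain_cone [OF H c]] chain_boundary_chain_cone [OF H c] by simp
      also have "\<dots> = f c \<otimes> inv (f ?d)"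
        by (rule cochain_diff [OF cf c d])
      finally show ?thesis
        using cochain_closed [OF cf] c d by (metis inv_closed inv_equality inv_inv)
    qed
  qed
qed

text \<open>The homotopy H joins x to \<open>k x\<close> by a path, so f takes the same value at
  both points, and k is locally constant.\<close>

lemma scattered_path_constant:
  assumes X: "scattered X"
    and f: "\<And>p. pathin X p \<Longrightarrow> f (p 0) = f (p 1)"
  shows "openin X {x \<in> topspace X. f x = y}"
proof -
  obtain H k where H: "scattering X H k"
    using X unfolding scattered_def by blast
  have "f x = f (k x)" if x: "x \<in> topspace X" for x
  proof -
    have "continuous_map (top_of_set {0..1}) (prod_topology (top_of_set {0..1}) X) (\<lambda>t. (t, x))"
      using x by (simp add: continuous_map_pairwise o_def)
    then have "pathin X (\<lambda>t. H (t, x))"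
      using continuous_map_compose [of _ _ "\<lambda>t. (t, x)" X H] H by (fastforce simp: pathin_def scattering_def o_def)
    from f [OF this] show ?thesis
      using H x by (simp add: scattering_def)
  qed
  then have "{x \<in> topspace X. f x = y} = (\<Union>z\<in>{z. f z = y}. {x \<in> topspace X. k x = z})"
    by auto
  then show ?thesis
    using H by (auto simp: scattering_def)
qed

section \<open>Cohomology of a union of two open sets\<close>

context comm_group
begin

lemma eq_mult_of_div:
  assumes "x \<otimes> inv y = e" "x \<in> carrier G" "y \<in> carrier G"
  shows "x = y \<otimes> e"
proof -
  have "y \<otimes> (x \<otimes> inv y) = x \<otimes> (y \<otimes> inv y)"
    using assms(2,3) by (simp add: m_lcomm)
  then show ?thesis
    using assms(2,3) unfolding assms(1) [symmetric] by simp
qed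

lemma cochain_extend:
  assumes f: "cochain n (subtopology X S) f"
  obtains g where "cochain n X g" "\<And>c. singular_chain n (subtopology X S) c \<Longrightarrow> g c = f c"
proof (rule cochain_glue [OF f cochain_one [of n "subtopology X {}"]])
  show "f (frag_of \<sigma>) = \<one>" if "singular_simplex n (subtopology X (S \<inter> {})) \<sigma>" for \<sigma>
    using that singular_simplex_empty [of "subtopology X {}" n \<sigma>] by simp
qed (use that in blast)

text \<open>Equality on small edges gives more than cohomologous cocycles: the 0-cochain bounding
  their quotient is trivial on each piece, and every point lies in a piece.\<close>

lemma cocycle_1_eqI:
  fixes X :: "'x topology"
  assumes U: "openin X U" and V: "openin X V" and UV: "topspace X \<subseteq> U \<union> V"
    and f: "cocycle (Suc 0) X f" and g: "cocycle (Suc 0) X g"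
    and fgU: "\<And>\<sigma>. singular_simplex (Suc 0) (subtopology X U) \<sigma> \<Longrightarrow> f (frag_of \<sigma>) = g (frag_of \<sigma>)"
    and fgV: "\<And>\<sigma>. singular_simplex (Suc 0) (subtopology X V) \<sigma> \<Longrightarrow> f (frag_of \<sigma>) = g (frag_of \<sigma>)"
    and c: "singular_chain (Suc 0) X c"
  shows "f c = g c"
proof -
  have cl: "f c \<in> carrier G" "g c \<in> carrier G" if "singular_chain (Suc 0) X c" for c
    using cochain_closed [OF cocycle_cochain] f g that by blast+
  have sub: "singular_chain n X c" if "singular_chain n (subtopology X S) c" for n S and c :: "'x chain"
    using that by (simp add: singular_chain_subtopology)
  have eq: "f c \<otimes> inv (g c) = \<one>" if "singular_chain (Suc 0) (subtopology X S) c" "S = U \<or> S = V" for S c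
  proof -
    have "f c = g c"
    proof (rule cochain_eqI [OF cochain_subtopology [OF cocycle_cochain [OF f]]
          cochain_subtopology [OF cocycle_cochain [OF g]] _ that(1)])
      show "f (frag_of \<sigma>) = g (frag_of \<sigma>)" if "singular_simplex (Suc 0) (subtopology X S) \<sigma>" for \<sigma>
        using that \<open>S = U \<or> S = V\<close> fgU fgV by blast
    qed
    then show ?thesis using cl sub that by simp
  qed
  obtain e where e: "cochain 0 X e"
    "\<And>c. singular_chain (Suc 0) X c \<Longrightarrow> f c \<otimes> inv (g c) = e (chain_boundary (Suc 0) c)"
    "\<And>c. singular_chain 0 (subtopology X U) c \<Longrightarrow> e c = \<one>"
    "\<And>c. singular_chain 0 (subtopology X V) c \<Longrightarrow> e c = \<one>"
    using small_vanishing_cocycle [OF U V UV cocycle_mult [OF f cocycle_inv [OF g]]] eq by blast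
  have "e b = \<one>" if b: "singular_chain 0 X b" for b
  proof (rule cochain_eqI [OF e(1) cochain_one _ b])
    fix \<sigma> assume \<sigma>: "singular_simplex 0 X \<sigma>"
    have "standard_simplex 0 = {bary 1 0 0}"
      by (auto simp: standard_simplex_0 bary_def)
    then have "singular_simplex 0 (subtopology X U) \<sigma> \<or> singular_simplex 0 (subtopology X V) \<sigma>"
      using \<sigma> singular_simplex_0_eq(2) [OF \<sigma>] UV by (auto simp: singular_simplex_subtopology)
    then show "e (frag_of \<sigma>) = \<one>"
      using e(3,4) by (auto simp: singular_chain_of)
  qed
  then have "f c \<otimes> inv (g c) = \<one>"
    using e(2) [OF c] singular_chain_boundary_alt [OF c] by simp
  then show ?thesis
    using cl [OF c] by (metis inv_closed inv_equality inv_inv)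
qed

text \<open>Exactness in the Mayer-Vietoris sequence at the level of cochains: primitives on the
  pieces whose quotient bounds on the overlap are adjusted until they glue, and the result has the
  right coboundary on small simplices. \<open>small_vanishing_cocycle\<close> removes the
  rest.\<close>

lemma coboundary_glue:
  fixes X :: "'x topology"
  assumes U: "openin X U" and V: "openin X V" and UV: "topspace X \<subseteq> U \<union> V"
    and f: "cocycle (Suc (Suc n)) X f"
    and a: "cochain (Suc n) (subtopology X U) a"
      "\<And>c. singular_chain (Suc (Suc n)) (subtopology X U) c \<Longrightarrow> f c = a (chain_boundary (Suc (Suc n)) c)"
    and b: "cochain (Suc n) (subtopology X V) b"
      "\<And>c. singular_chain (Suc (Suc n)) (subtopology X V) c \<Longrightarrow> f c = b (chain_boundary (Suc (Suc n)) c)"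
    and g: "cochain n (subtopology X (U \<inter> V)) g"
      "\<And>c. singular_chain (Suc n) (subtopology X (U \<inter> V)) c \<Longrightarrow> a c = b c \<otimes> g (chain_boundary (Suc n) c)"
  obtains d where "cochain (Suc n) X d"
    "\<And>c. singular_chain (Suc (Suc n)) X c \<Longrightarrow> f c = d (chain_boundary (Suc (Suc n)) c)"
proof -
  have sub: "singular_chain n X c" if "singular_chain n (subtopology X S) c" for n S and c :: "'x chain"
    using that by (simp add: singular_chain_subtopology)
  \<comment> \<open>Extending g to all of X makes its coboundary a cochain on V, by which b can be
    changed without changing the coboundary of b.\<close>
  obtain g' where g': "cochain n X g'" "\<And>c. singular_chain n (subtopology X (U \<inter> V)) c \<Longrightarrow> g' c = g c"
    using cochain_extend [OF g(1)] by blast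
  let ?b = "\<lambda>c. b c \<otimes> g' (chain_boundary (Suc n) c)"
  have b': "cochain (Suc n) (subtopology X V) ?b"
    by (intro cochain_mult b(1) cochain_coboundary cochain_subtopology g'(1))
  have bb: "?b (chain_boundary (Suc (Suc n)) c) = b (chain_boundary (Suc (Suc n)) c)"
    if "singular_chain (Suc (Suc n)) (subtopology X V) c" for c
    using that cochain_closed [OF b(1) singular_chain_boundary_alt [OF that]] cochain_zero [OF g'(1)]
      chain_boundary_boundary_alt [OF that] by simp
  have "a (frag_of \<sigma>) = ?b (frag_of \<sigma>)" if "singular_simplex (Suc n) (subtopology X (U \<inter> V)) \<sigma>" for \<sigma>
    using that g(2) [of "frag_of \<sigma>"] g'(2) [of "chain_boundary (Suc n) (frag_of \<sigma>)"]
      singular_chain_boundary_alt [of n "subtopology X (U \<inter> V)" "frag_of \<sigma>"]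
    by (simp add: singular_chain_of)
  then obtain d where d: "cochain (Suc n) X d"
    "\<And>c. singular_chain (Suc n) (subtopology X U) c \<Longrightarrow> d c = a c"
    "\<And>c. singular_chain (Suc n) (subtopology X V) c \<Longrightarrow> d c = ?b c"
    using cochain_glue [OF a(1) b'] by blast
  let ?f = "\<lambda>c. f c \<otimes> inv (d (chain_boundary (Suc (Suc n)) c))"
  have dc: "d (chain_boundary (Suc (Suc n)) c) \<in> carrier G" if "singular_chain (Suc (Suc n)) X c" for c
    by (rule cochain_closed [OF d(1) singular_chain_boundary_alt [OF that]])
  have fU: "?f c = \<one>" if "singular_chain (Suc (Suc n)) (subtopology X U) c" for c
    using a(2) [OF that] d(2) [OF singular_chain_boundary_alt [OF that]] dc [OF sub [OF that]] by simp
  have fV: "?f c = \<one>" if "singular_chain (Suc (Suc n)) (subtopology X V) c" for c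
    using b(2) [OF that] bb [OF that] d(3) [OF singular_chain_boundary_alt [OF that]] dc [OF sub [OF that]] by simp
  obtain e where e: "cochain (Suc n) X e"
    "\<And>c. singular_chain (Suc (Suc n)) X c \<Longrightarrow> ?f c = e (chain_boundary (Suc (Suc n)) c)"
  proof (rule small_vanishing_cocycle [OF U V UV cocycle_mult [OF f cocycle_inv [OF cocycle_coboundary [OF d(1)]]] fU fV], goal_cases)
    case (3 e)
    show thesis by (rule 3(1) [OF 3(2)]) (rule 3(3))
  qed
  show ?thesis
  proof
    show "cochain (Suc n) X (\<lambda>c. d c \<otimes> e c)"
      using d e by (intro cochain_mult)
    show "f c = d (chain_boundary (Suc (Suc n)) c) \<otimes> e (chain_boundary (Suc (Suc n)) c)"
      if c: "singular_chain (Suc (Suc n)) X c" for c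
      by (rule eq_mult_of_div [OF e(2) [OF c] cochain_closed [OF cocycle_cochain [OF f] c] dc [OF c]])
  qed
qed

text \<open>Both pieces are scattered and provide primitives. Their quotient on the overlap is a
  1-cocycle, and it bounds since the overlap is scattered as well.\<close>

lemma cocycle_2_coboundary:
  fixes X :: "'x topology"
  assumes U: "openin X U" and V: "openin X V" and UV: "topspace X \<subseteq> U \<union> V"
    and sc: "scattered (subtopology X U)" "scattered (subtopology X V)" "scattered (subtopology X (U \<inter> V))"
    and f: "cocycle (Suc (Suc 0)) X f"
  obtains d where "cochain (Suc 0) X d"
    "\<And>c. singular_chain (Suc (Suc 0)) X c \<Longrightarrow> f c = d (chain_boundary (Suc (Suc 0)) c)"
proof -
  obtain a where a: "cochain (Suc 0) (subtopology X U) a"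
      "\<And>c. singular_chain (Suc (Suc 0)) (subtopology X U) c \<Longrightarrow> f c = a (chain_boundary (Suc (Suc 0)) c)"
    using scattered_cocycle_coboundary [OF sc(1) cocycle_subtopology [OF f]] by blast
  obtain b where b: "cochain (Suc 0) (subtopology X V) b"
      "\<And>c. singular_chain (Suc (Suc 0)) (subtopology X V) c \<Longrightarrow> f c = b (chain_boundary (Suc (Suc 0)) c)"
    using scattered_cocycle_coboundary [OF sc(2) cocycle_subtopology [OF f]] by blast
  have UVsub: "singular_chain n (subtopology X U) c \<and> singular_chain n (subtopology X V) c"
    if "singular_chain n (subtopology X (U \<inter> V)) c" for n and c :: "'x chain"
    using that singular_chain_mono [of n X "U \<inter> V" c] by auto
  have ab: "cochain (Suc 0) (subtopology X (U \<inter> V)) a" "cochain (Suc 0) (subtopology X (U \<inter> V)) b"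
    using a(1) b(1) UVsub by (blast intro: cochain_mono)+
  have "cocycle (Suc 0) (subtopology X (U \<inter> V)) (\<lambda>c. a c \<otimes> inv (b c))"
    unfolding cocycle_def
  proof (intro conjI allI impI cochain_mult cochain_inv ab)
    fix c assume c: "singular_chain (Suc (Suc 0)) (subtopology X (U \<inter> V)) c"
    then show "a (chain_boundary (Suc (Suc 0)) c) \<otimes> inv (b (chain_boundary (Suc (Suc 0)) c)) = \<one>"
      using a(2) b(2) UVsub cochain_closed [OF ab(1) singular_chain_boundary_alt] by (metis r_inv)
  qed
  then obtain g where g: "cochain 0 (subtopology X (U \<inter> V)) g"
     "\<And>c. singular_chain (Suc 0) (subtopology X (U \<inter> V)) c \<Longrightarrow> a c \<otimes> inv (b c) = g (chain_boundary (Suc 0) c)"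
    using scattered_cocycle_coboundary [OF sc(3)] by blast
  have "a c = b c \<otimes> g (chain_boundary (Suc 0) c)" if "singular_chain (Suc 0) (subtopology X (U \<inter> V)) c" for c
    by (rule eq_mult_of_div [OF g(2) [OF that] cochain_closed [OF ab(1) that] cochain_closed [OF ab(2) that]])
  from coboundary_glue [OF U V UV f a b g(1) this] show ?thesis
    using that by blast
qed

end

section \<open>Maps into a group realise one-dimensional cohomology classes\<close>

context topological_group_space
begin

text \<open>Where m is constant a single loop is used and only its parameter varies. A point of W
  outside D has the neighbourhood N, on which \<theta> is an end of the interval and each loop is at
  the unit.\<close>

lemma continuous_loop_family:
  assumes W: "openin X W" and N: "openin X N" "W - D \<subseteq> N" and "D \<subseteq> topspace X"
    and m: "\<And>a. openin X {x \<in> D. m x = a}" and l: "\<And>x. x \<in> D \<Longrightarrow> unit_loop (l (m x))"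
    and \<theta>: "continuous_map (prod_topology (subtopology X W) (top_of_set {0..1::real})) euclideanreal \<theta>"
      "\<And>x r. x \<in> W \<Longrightarrow> r \<in> {0..1} \<Longrightarrow> \<theta> (x, r) \<in> {0..1}"
      "\<And>x r. x \<in> W \<Longrightarrow> x \<in> N \<Longrightarrow> r \<in> {0..1} \<Longrightarrow> \<theta> (x, r) \<in> {0, 1}"
  shows "continuous_map (prod_topology (subtopology X W) (top_of_set {0..1})) T
    (\<lambda>z. if fst z \<in> D then l (m (fst z)) (\<theta> z) else \<one>)" (is "continuous_map ?Z T ?F")
proof -
  have WX: "W \<subseteq> topspace X" using W by (rule openin_subset)
  \<comment> \<open>Index \<open>None\<close> is the set N with the constant unit, index
    \<open>Some a\<close> the level set of m at a with the loop of a.\<close>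
  define S where "S i = (case i of None \<Rightarrow> N | Some a \<Rightarrow> {x \<in> D. m x = a}) \<times> (UNIV :: real set)" for i
  define f where "f i z = (case i of None \<Rightarrow> \<one> | Some a \<Rightarrow> if \<exists>x\<in>D. m x = a then l a (\<theta> z) else \<one>)" for i z
  have top: "topspace ?Z = W \<times> {0..1}" using WX by auto
  have l01: "l (m x) (\<theta> (x, r)) = \<one>" if "x \<in> D" "x \<in> W" "x \<in> N" "r \<in> {0..1}" for x r
    using l [OF that(1)] \<theta>(3) [OF that(2-4)] by (auto simp: loop_at_def)
  show ?thesis
  proof (rule pasting_lemma [of UNIV ?Z "\<lambda>i. topspace ?Z \<inter> S i" T f])
    show "openin ?Z (topspace ?Z \<inter> S i)" for i
    proof -
      have "topspace ?Z \<inter> S i = (W \<inter> fst ` S i) \<times> {0..1}"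
        unfolding top by (force simp: S_def)
      moreover have "openin X (fst ` S i)"
        using N(1) m by (auto simp: S_def split: option.split)
      then have "openin (subtopology X W) (W \<inter> fst ` S i)"
        by (auto simp: openin_subtopology)
      ultimately show ?thesis
        by (simp add: openin_prod_Times_iff)
    qed
    show "continuous_map (subtopology ?Z (topspace ?Z \<inter> S i)) T (f i)" for i
    proof (cases "\<exists>a. i = Some a \<and> (\<exists>x\<in>D. m x = a)")
      case True
      then obtain x where x: "i = Some (m x)" "x \<in> D" by auto
      have "continuous_map (subtopology ?Z (topspace ?Z \<inter> S i)) T (\<lambda>z. l (m x) (\<theta> z))"
      proof (rule continuous_path)
        show "pathin T (l (m x))" using l [OF x(2)] by (simp add: loop_at_def)
        show "continuous_map (subtopology ?Z (topspace ?Z \<inter> S i)) euclideanreal \<theta>"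
          by (rule continuous_map_from_subtopology [OF \<theta>(1)])
      qed (use \<theta>(2) in auto)
      moreover have "f i = (\<lambda>z. l (m x) (\<theta> z))"
        by (rule ext) (use x in \<open>auto simp: f_def\<close>)
      ultimately show ?thesis by simp
    next
      case False
      then have "f i = (\<lambda>z. \<one>)"
        by (auto simp: f_def fun_eq_iff split: option.split)
      then show ?thesis by simp
    qed
    show "f i z = f j z" if "z \<in> topspace ?Z \<inter> (topspace ?Z \<inter> S i) \<inter> (topspace ?Z \<inter> S j)" for i j z
      using that l01 unfolding top by (cases i; cases j) (auto simp: S_def f_def)
    show "\<exists>j. j \<in> UNIV \<and> z \<in> topspace ?Z \<inter> S j \<and> ?F z = f j z" if z: "z \<in> topspace ?Z" for z
    proof (cases "fst z \<in> D")
      case True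
      then show ?thesis
        using z by (intro exI [of _ "Some (m (fst z))"]) (auto simp: S_def f_def)
    next
      case False
      then show ?thesis
        using z N(2) unfolding top by (intro exI [of _ None]) (auto simp: S_def f_def)
    qed
  qed
qed

lemma path_to_loop_mult:
  assumes "unit_loop l" "path_to g c"
  shows "path_to g (\<lambda>t. l t \<otimes> c t)"
  using path_to_mult [of \<one> l g c] assms path_to_closed_end [OF assms(2)]
  by (simp add: unit_loop_iff_path_to)

text \<open>The primitives of z on U and V have a locally constant quotient m on the overlap. Let u
  run once through a loop of class m as \<tau> goes from 0 to 1 across the overlap and be the unit
  elsewhere; then it winds as z prescribes.\<close>

lemma represents_onto:
  fixes X :: "'x topology"
  assumes U: "openin X U" and V: "openin X V" and UV: "topspace X = U \<union> V"
    and sc: "scattered (subtopology X U)" "scattered (subtopology X V)" "scattered (subtopology X (U \<inter> V))"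
    and \<tau>: "continuous_map X euclideanreal \<tau>" "\<And>x. x \<in> topspace X \<Longrightarrow> \<tau> x \<in> {0..1}"
    and NU: "openin X NU" "U - V \<subseteq> NU" "\<And>x. x \<in> NU \<Longrightarrow> \<tau> x = 0"
    and NV: "openin X NV" "V - U \<subseteq> NV" "\<And>x. x \<in> NV \<Longrightarrow> \<tau> x = 1"
    and z: "pi.cocycle (Suc 0) X z"
  obtains u where "represents X u z"
proof -
  let ?D = "U \<inter> V"
  let ?I = "top_of_set {0..1::real}"
  have DX: "?D \<subseteq> topspace X" "U \<subseteq> topspace X" "V \<subseteq> topspace X" using UV by auto
  obtain eU where eU: "pi.cochain 0 (subtopology X U) eU"
     "\<And>c. singular_chain (Suc 0) (subtopology X U) c \<Longrightarrow> z c = eU (chain_boundary (Suc 0) c)"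
    using pi.scattered_cocycle_coboundary [OF sc(1) pi.cocycle_subtopology [OF z]] by blast
  obtain eV where eV: "pi.cochain 0 (subtopology X V) eV"
     "\<And>c. singular_chain (Suc 0) (subtopology X V) c \<Longrightarrow> z c = eV (chain_boundary (Suc 0) c)"
    using pi.scattered_cocycle_coboundary [OF sc(2) pi.cocycle_subtopology [OF z]] by blast
  define fU where "fU x = eU (frag_of (point_simplex x))" for x
  define fV where "fV x = eV (frag_of (point_simplex x))" for x
  have fU: "fU x \<in> carrier P" if "x \<in> U" for x
    unfolding fU_def using that DX by (intro pi.cochain_point_closed [OF eU(1)]) auto
  have fV: "fV x \<in> carrier P" if "x \<in> V" for x
    unfolding fV_def using that DX by (intro pi.cochain_point_closed [OF eV(1)]) auto
  have zU: "z (frag_of \<sigma>) = fU (edge \<sigma> 1) \<otimes>\<^bsub>P\<^esub> inv\<^bsub>P\<^esub> fU (edge \<sigma> 0)"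
    if "singular_simplex (Suc 0) (subtopology X U) \<sigma>" for \<sigma>
    using eU(2) [of "frag_of \<sigma>"] pi.cochain_boundary_1 [OF eU(1) that] that
    by (simp add: singular_chain_of fU_def)
  have zV: "z (frag_of \<sigma>) = fV (edge \<sigma> 1) \<otimes>\<^bsub>P\<^esub> inv\<^bsub>P\<^esub> fV (edge \<sigma> 0)"
    if "singular_simplex (Suc 0) (subtopology X V) \<sigma>" for \<sigma>
    using eV(2) [of "frag_of \<sigma>"] pi.cochain_boundary_1 [OF eV(1) that] that
    by (simp add: singular_chain_of fV_def)
  \<comment> \<open>Both primitives have coboundary z, so m does not change along paths of the
    overlap and is locally constant by \<open>scattered_path_constant\<close>.\<close>
  define m where "m x = fU x \<otimes>\<^bsub>P\<^esub> inv\<^bsub>P\<^esub> fV x" for x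
  have shuffle: "x \<otimes>\<^bsub>P\<^esub> (a \<otimes>\<^bsub>P\<^esub> b) \<otimes>\<^bsub>P\<^esub> c = x \<otimes>\<^bsub>P\<^esub> b \<otimes>\<^bsub>P\<^esub> (a \<otimes>\<^bsub>P\<^esub> c)"
    if "x \<in> carrier P" "a \<in> carrier P" "b \<in> carrier P" "c \<in> carrier P" for x a b c
    using that by (simp add: pi.m_ac)
  have mp: "m (p 0) = m (p 1)" if "pathin (subtopology X ?D) p" for p
  proof -
    obtain \<sigma> where \<sigma>: "singular_simplex (Suc 0) (subtopology X ?D) \<sigma>" "\<And>t. t \<in> {0..1} \<Longrightarrow> edge \<sigma> t = p t"
      using pathin_simplex_exists [OF \<open>pathin (subtopology X ?D) p\<close>] by blast
    have \<sigma>': "singular_simplex (Suc 0) (subtopology X U) \<sigma>" "singular_simplex (Suc 0) (subtopology X V) \<sigma>"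
      using \<sigma>(1) by (auto intro: singular_simplex_mono)
    have p: "p 0 \<in> U" "p 1 \<in> U" "p 0 \<in> V" "p 1 \<in> V"
      using edge_in_topspace [OF \<sigma>(1), of 0] edge_in_topspace [OF \<sigma>(1), of 1] \<sigma>(2) by auto
    then have "fU (p 1) \<otimes>\<^bsub>P\<^esub> inv\<^bsub>P\<^esub> fU (p 0) = fV (p 1) \<otimes>\<^bsub>P\<^esub> inv\<^bsub>P\<^esub> fV (p 0)"
      using zU [OF \<sigma>'(1)] zV [OF \<sigma>'(2)] \<sigma>(2) by simp
    then have "fU (p 1) = fU (p 0) \<otimes>\<^bsub>P\<^esub> (fV (p 1) \<otimes>\<^bsub>P\<^esub> inv\<^bsub>P\<^esub> fV (p 0))"
      by (rule pi.eq_mult_of_div [OF _ fU fU]) (use p in auto)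
    then have "m (p 1) = fU (p 0) \<otimes>\<^bsub>P\<^esub> (fV (p 1) \<otimes>\<^bsub>P\<^esub> inv\<^bsub>P\<^esub> fV (p 0)) \<otimes>\<^bsub>P\<^esub> inv\<^bsub>P\<^esub> fV (p 1)"
      by (simp add: m_def)
    also have "\<dots> = fU (p 0) \<otimes>\<^bsub>P\<^esub> inv\<^bsub>P\<^esub> fV (p 0) \<otimes>\<^bsub>P\<^esub> (fV (p 1) \<otimes>\<^bsub>P\<^esub> inv\<^bsub>P\<^esub> fV (p 1))"
      using p fU fV by (intro shuffle) auto
    finally show ?thesis
      using p fU fV by (simp add: m_def)
  qed
  from scattered_path_constant [where f = m, OF sc(3) mp] have "openin (subtopology X ?D) {x \<in> ?D. m x = a}" for a
    using DX by (simp add: Int_absorb1)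
  then have mopen: "openin X {x \<in> ?D. m x = a}" for a
    using openin_trans_full U V by blast
  define l where "l a = (SOME p. unit_loop p \<and> cls p = a)" for a
  have l: "unit_loop (l a)" "cls (l a) = a" if "a \<in> carrier P" for a
    using someI_ex [of "\<lambda>p. unit_loop p \<and> cls p = a"] cls_rep [OF that] unfolding l_def by metis+
  have mP: "m x \<in> carrier P" if "x \<in> ?D" for x
    using that fU fV by (simp add: m_def)
  note lm = l(1) [OF mP]
  \<comment> \<open>On U the loops are shrunk to their start, as \<tau> is 0 near U - V; on V to
    their end, as \<tau> is 1 near V - U. These null homotopies provide paths with trivial holonomy
    on each piece.\<close>
  define FU where "FU z = (if fst z \<in> ?D then l (m (fst z)) (snd z * \<tau> (fst z)) else \<one>)" for z
  define FV where "FV z = (if fst z \<in> ?D then l (m (fst z)) (1 - snd z * (1 - \<tau> (fst z))) else \<one>)" for z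
  define u where "u x = (if x \<in> ?D then l (m x) (\<tau> x) else \<one>)" for x
  have \<tau>': "continuous_map (prod_topology (subtopology X W) ?I) euclideanreal (\<lambda>z. \<tau> (fst z))" for W
    using continuous_map_compose [OF continuous_map_fst continuous_map_from_subtopology [OF \<tau>(1)], of W]
    by (simp add: o_def)
  have snd: "continuous_map (prod_topology (subtopology X W) ?I) euclideanreal snd" for W
    using continuous_map_snd [of "subtopology X W" ?I] by (simp add: continuous_map_in_subtopology)
  have cU: "continuous_map (prod_topology (subtopology X U) ?I) T FU"
    unfolding FU_def
  proof (rule continuous_loop_family [where l = l and m = m, OF U NU(1) _ DX(1) mopen lm])
    show "continuous_map (prod_topology (subtopology X U) ?I) euclideanreal (\<lambda>z. snd z * \<tau> (fst z))"
      by (intro continuous_intros \<tau>' snd)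
    show "snd (x, r) * \<tau> (fst (x, r)) \<in> {0..1}" if "x \<in> U" "r \<in> {0..1}" for x r
      using that \<tau>(2) [of x] UV by (auto intro: mult_le_one)
  qed (use NU in auto)
  have cV: "continuous_map (prod_topology (subtopology X V) ?I) T FV"
    unfolding FV_def
  proof (rule continuous_loop_family [where l = l and m = m, OF V NV(1) _ DX(1) mopen lm])
    show "continuous_map (prod_topology (subtopology X V) ?I) euclideanreal (\<lambda>z. 1 - snd z * (1 - \<tau> (fst z)))"
      by (intro continuous_intros \<tau>' snd)
    show "1 - snd (x, r) * (1 - \<tau> (fst (x, r))) \<in> {0..1}" if "x \<in> V" "r \<in> {0..1}" for x r
      using that \<tau>(2) [of x] UV by (auto intro: mult_le_one)
  qed (use NV in auto)
  have FU0: "FU (x, 0) = \<one>" "FU (x, 1) = u x" for x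
    using lm by (auto simp: FU_def u_def loop_at_def)
  have FV0: "FV (x, 0) = \<one>" "FV (x, 1) = u x" for x
    using lm by (auto simp: FV_def u_def loop_at_def)
  define gU where "gU x t = FU (x, t)" for x t
  define gV where "gV x t = FV (x, t)" for x t
  have hU: "lifting (subtopology X U) u gU"
    "\<And>\<sigma>. singular_simplex (Suc 0) (subtopology X U) \<sigma> \<Longrightarrow> holonomy u gU \<sigma> = \<one>\<^bsub>P\<^esub>"
    unfolding gU_def [abs_def] using holonomy_null_homotopy [OF cU FU0] by blast+
  have hV: "lifting (subtopology X V) u gV"
    "\<And>\<sigma>. singular_simplex (Suc 0) (subtopology X V) \<sigma> \<Longrightarrow> holonomy u gV \<sigma> = \<one>\<^bsub>P\<^esub>"
    unfolding gV_def [abs_def] using holonomy_null_homotopy [OF cV FV0] by blast+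
  have pU: "path_to (u x) (gU x)" if "x \<in> U" for x
    using hU(1) that DX by (auto simp: lifting_def)
  have pV: "path_to (u x) (gV x)" if "x \<in> V" for x
    using hV(1) that DX by (auto simp: lifting_def)
  have gUV: "cls (\<lambda>t. gU x t \<otimes> inv (gV x t)) = m x" if x: "x \<in> ?D" for x
  proof -
    let ?l = "l (m x)"
    have lx: "pathin T ?l" "?l 0 = \<one>" "?l 1 = \<one>"
      using lm [OF x] by (auto simp: loop_at_def)
    have \<tau>x: "0 \<le> \<tau> x" "\<tau> x \<le> 1" using \<tau>(2) [of x] x UV by auto
    \<comment> \<open>This moves the parameter from \<open>\<tau> x\<close> to 1. At s = 1 the first
      factor runs through the full loop and the second stays at its end.\<close>
    define \<theta> where "\<theta> s = (1 - s) * \<tau> x + s" for s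
    have \<theta>: "0 \<le> \<theta> s" "\<theta> s \<le> 1" if "0 \<le> s" "s \<le> 1" for s
      using that \<tau>x convex_bound_le [of "\<tau> x" 1 1 "1 - s" s] by (auto simp: \<theta>_def)
    have \<theta>01: "\<theta> 0 = \<tau> x" "\<theta> 1 = 1" by (simp_all add: \<theta>_def)
    have lG: "?l s \<in> carrier G" if "0 \<le> s" "s \<le> 1" for s
      using pathin_closed [OF lx(1)] that by simp
    have "(\<lambda>t. gU x t \<otimes> inv (gV x t)) \<simeq> ?l"
    proof (rule loop_eqvI [of "\<lambda>s t. ?l (t * \<theta> s) \<otimes> inv (?l (1 - t * (1 - \<theta> s)))"])
      show "continuous_map (top_of_set ({0..1::real} \<times> {0..1::real})) T
         (\<lambda>z. ?l (snd z * \<theta> (fst z)) \<otimes> inv (?l (1 - snd z * (1 - \<theta> (fst z)))))"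
      proof -
        have c\<theta>: "continuous_on ({0..1} \<times> {0..1}) (\<lambda>z :: real \<times> real. \<theta> (fst z))"
          unfolding \<theta>_def by (intro continuous_intros)
        show ?thesis
          using \<theta>
          by (intro continuous_mult continuous_inv continuous_path [OF lx(1)])
            (auto intro!: continuous_intros c\<theta> mult_le_one mult_nonneg_nonneg)
      qed
      show "?l (t * \<theta> 0) \<otimes> inv (?l (1 - t * (1 - \<theta> 0))) = gU x t \<otimes> inv (gV x t)" for t
        using x by (simp add: gU_def gV_def FU_def FV_def \<theta>01)
      show "?l (s * \<theta> 1) \<otimes> inv (?l (1 - s * (1 - \<theta> 1))) = ?l s" if "0 \<le> s" "s \<le> 1" for s
        using lx lG [OF that] by (simp add: \<theta>01)
      show "?l (0 * \<theta> s) \<otimes> inv (?l (1 - 0 * (1 - \<theta> s))) = \<one>" for s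
        using lx by simp
      show "?l (1 * \<theta> s) \<otimes> inv (?l (1 - 1 * (1 - \<theta> s))) = \<one>" if "0 \<le> s" "s \<le> 1" for s
        using lG [OF \<theta> [OF that]] by simp
    qed
    then show ?thesis
      using l(2) [OF mP [OF x]] cls_cong by simp
  qed
  \<comment> \<open>The inverses account for holonomy counting start minus end. On the overlap the
    two cases agree up to homotopy because \<open>gU\<close> and \<open>gV\<close> differ by a loop
    of class m, the quotient of \<open>fU\<close> and \<open>fV\<close>.\<close>
  define g where "g x t = (if x \<in> U then l (inv\<^bsub>P\<^esub> fU x) t \<otimes> gU x t else l (inv\<^bsub>P\<^esub> fV x) t \<otimes> gV x t)" for x t
  have lf: "unit_loop (l (inv\<^bsub>P\<^esub> fU x))" "cls (l (inv\<^bsub>P\<^esub> fU x)) = inv\<^bsub>P\<^esub> fU x" if "x \<in> U" for x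
    using l fU that by auto
  have lf': "unit_loop (l (inv\<^bsub>P\<^esub> fV x))" "cls (l (inv\<^bsub>P\<^esub> fV x)) = inv\<^bsub>P\<^esub> fV x" if "x \<in> V" for x
    using l fV that by auto
  have pg: "path_to (u x) (g x)" if "x \<in> topspace X" for x
  proof (cases "x \<in> U")
    case True
    then show ?thesis
      using path_to_loop_mult [OF lf(1) pU] by (simp add: g_def [abs_def])
  next
    case False
    then have "x \<in> V" using that UV by auto
    with False show ?thesis
      using path_to_loop_mult [OF lf'(1) pV] by (simp add: g_def [abs_def])
  qed
  have "continuous_map X T u"
    by (rule pasting_lemma [of "{U, V}" X "\<lambda>W. W" T "\<lambda>_. u"])
      (use U V UV hU(1) hV(1) in \<open>auto simp: lifting_def\<close>)
  with pg have g: "lifting X u g"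
    by (simp add: lifting_def)
  have gsub: "lifting (subtopology X W) u g" for W
    using g by (auto simp: lifting_def intro: continuous_map_from_subtopology)
  obtain w where w: "pi.cocycle (Suc 0) X w"
    "\<And>\<sigma>. singular_simplex (Suc 0) X \<sigma> \<Longrightarrow> w (frag_of \<sigma>) = holonomy u g \<sigma>"
    using holonomy_cocycle [OF g] by blast
  have dU: "cls (\<lambda>t. g x t \<otimes> inv (gU x t)) = inv\<^bsub>P\<^esub> fU x" if "x \<in> U" for x
  proof -
    have "cls (\<lambda>t. g x t \<otimes> inv (gU x t)) = cls (l (inv\<^bsub>P\<^esub> fU x))"
      using path_to_closed [OF pU [OF that]] unit_loop_closed [OF lf(1) [OF that]] that
      by (intro cls_eqI [OF unit_loop_difference [OF pU [OF that] pg]]) (use DX in \<open>auto simp: g_def m_assoc\<close>)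
    then show ?thesis using lf that by simp
  qed
  have dV: "cls (\<lambda>t. g x t \<otimes> inv (gV x t)) = inv\<^bsub>P\<^esub> fV x" if "x \<in> V" for x
  proof (cases "x \<in> U")
    case True
    then have x: "x \<in> ?D" using that by simp
    have gG: "gU x t \<in> carrier G" "gV x t \<in> carrier G" "l (inv\<^bsub>P\<^esub> fU x) t \<in> carrier G" if "t \<in> {0..1}" for t
      using path_to_closed [OF pU] path_to_closed [OF pV] unit_loop_closed [OF lf(1)] True \<open>x \<in> V\<close> that by auto
    have "cls (\<lambda>t. g x t \<otimes> inv (gV x t)) = cls (\<lambda>t. l (inv\<^bsub>P\<^esub> fU x) t \<otimes> (gU x t \<otimes> inv (gV x t)))"
      using True gG
      by (intro cls_eqI [OF unit_loop_difference [OF pV [OF that] pg]]) (use DX in \<open>auto simp: g_def m_assoc\<close>)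
    also have "\<dots> = inv\<^bsub>P\<^esub> fU x \<otimes>\<^bsub>P\<^esub> m x"
      using lf [OF True] gUV [OF x] unit_loop_difference [OF pV pU, of x] x by (simp flip: cls_mult)
    also have "\<dots> = inv\<^bsub>P\<^esub> fV x"
      using fU [OF True] fV [OF that] by (simp add: m_def flip: pi.m_assoc)
    finally show ?thesis .
  next
    case False
    have "cls (\<lambda>t. g x t \<otimes> inv (gV x t)) = cls (l (inv\<^bsub>P\<^esub> fV x))"
      using path_to_closed [OF pV [OF that]] unit_loop_closed [OF lf'(1) [OF that]] False that
      by (intro cls_eqI [OF unit_loop_difference [OF pV [OF that] pg]]) (use DX in \<open>auto simp: g_def m_assoc\<close>)
    then show ?thesis using lf' that by simp
  qed
  \<comment> \<open>Holonomy is known only along edges inside one piece;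
    \<open>cocycle_1_eqI\<close> extends the equality to all chains.\<close>
  have "w c = z c" if "singular_chain (Suc 0) X c" for c
  proof (rule pi.cocycle_1_eqI [OF U V _ w(1) z _ _ that])
    show "w (frag_of \<sigma>) = z (frag_of \<sigma>)" if \<sigma>: "singular_simplex (Suc 0) (subtopology X U) \<sigma>" for \<sigma>
    proof -
      have E: "edge \<sigma> 0 \<in> U" "edge \<sigma> 1 \<in> U"
        using edge_in_topspace [OF \<sigma>] by auto
      have "singular_simplex (Suc 0) X \<sigma>" using \<sigma> by (simp add: singular_simplex_subtopology)
      then show ?thesis
        using w(2) zU [OF \<sigma>] holonomy_change [OF hU(1) gsub \<sigma>] hU(2) [OF \<sigma>] dU E fU
        by (simp add: pi.m_comm)
    qed
    show "w (frag_of \<sigma>) = z (frag_of \<sigma>)" if \<sigma>: "singular_simplex (Suc 0) (subtopology X V) \<sigma>" for \<sigma>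
    proof -
      have E: "edge \<sigma> 0 \<in> V" "edge \<sigma> 1 \<in> V"
        using edge_in_topspace [OF \<sigma>] by auto
      have "singular_simplex (Suc 0) X \<sigma>" using \<sigma> by (simp add: singular_simplex_subtopology)
      then show ?thesis
        using w(2) zV [OF \<sigma>] holonomy_change [OF hV(1) gsub \<sigma>] hV(2) [OF \<sigma>] dV E fV
        by (simp add: pi.m_comm)
    qed
  qed (use UV in auto)
  then have "z (frag_of \<sigma>) = holonomy u g \<sigma>" if "singular_simplex (Suc 0) X \<sigma>" for \<sigma>
    using w(2) [OF that] that by (metis singular_chain_of)
  with g z have "represents X u z"
    unfolding represents_def by blast
  then show ?thesis ..
qed

end


section \<open>Transition functions and two-dimensional cohomology\<close>

lemma (in topological_group_space) represents_mono:
  assumes "represents (subtopology X S) u z" "W \<subseteq> S"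
  shows "represents (subtopology X W) u z"
  using represents_subtopology [OF assms(1), of W] assms(2) by (simp add: subtopology_subtopology Int_absorb1)

text \<open>\<open>A\<close> is a neighbourhood of the 1-skeleton and \<open>B\<close> the union of the open 2-cells.\<close>

locale two_piece_cover = path_connected_group G T for G (structure) and T +
  fixes M :: "'m topology" and A B :: "'m set"
  assumes openA: "openin M A" and openB: "openin M B" and cover: "topspace M = A \<union> B"
    and H2_A: "pi.cocycle (Suc (Suc 0)) (subtopology M A) f \<Longrightarrow>
      \<exists>a. pi.cochain (Suc 0) (subtopology M A) a \<and>
        (\<forall>c. singular_chain (Suc (Suc 0)) (subtopology M A) c \<longrightarrow> f c = a (chain_boundary (Suc (Suc 0)) c))"
    and scattered_B: "scattered (subtopology M B)"
    and H1_A: "pi.cocycle (Suc 0) (subtopology M A) z \<Longrightarrow> \<exists>u. represents (subtopology M A) u z"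
    and H1_AB: "pi.cocycle (Suc 0) (subtopology M (A \<inter> B)) z \<Longrightarrow> \<exists>u. represents (subtopology M (A \<inter> B)) u z"
    and extension: "represents (subtopology M (A \<inter> B)) w (\<lambda>c. \<one>\<^bsub>P\<^esub>) \<Longrightarrow>
      \<exists>\<beta> K. closedin M K \<and> K \<subseteq> B \<and> continuous_map (subtopology M B) T \<beta> \<and> (\<forall>x\<in>A \<inter> B - K. \<beta> x = w x)"
begin

abbreviation "MA \<equiv> subtopology M A"
abbreviation "MB \<equiv> subtopology M B"
abbreviation "MAB \<equiv> subtopology M (A \<inter> B)"

lemma topspace_pieces [simp]: "topspace MA = A" "topspace MB = B" "topspace MAB = A \<inter> B"
  using cover by auto

lemma singular_chain_MAB: "singular_chain n MAB c \<Longrightarrow> singular_chain n MA c \<and> singular_chain n MB c"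
  using singular_chain_mono [of n M "A \<inter> B" c] by auto

lemma singular_chain_pieces: "singular_chain n MA c \<Longrightarrow> singular_chain n M c" "singular_chain n MB c \<Longrightarrow> singular_chain n M c"
  by (simp_all add: singular_chain_subtopology)

text \<open>The class of \<open>f\<close> is the image of the class represented by \<open>u\<close> under the connecting
  homomorphism of the Mayer-Vietoris sequence.\<close>

definition classifies :: "('m \<Rightarrow> 'a) \<Rightarrow> ('m chain \<Rightarrow> (real \<Rightarrow> 'a) set) \<Rightarrow> bool"
  where "classifies u f \<longleftrightarrow> pi.cocycle (Suc (Suc 0)) M f \<and>
    (\<exists>a b. pi.cochain (Suc 0) MA a \<and> pi.cochain (Suc 0) MB b \<and>
      (\<forall>c. singular_chain (Suc (Suc 0)) MA c \<longrightarrow> f c = a (chain_boundary (Suc (Suc 0)) c)) \<and>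
      (\<forall>c. singular_chain (Suc (Suc 0)) MB c \<longrightarrow> f c = b (chain_boundary (Suc (Suc 0)) c)) \<and>
      represents MAB u (\<lambda>c. a c \<otimes>\<^bsub>P\<^esub> inv\<^bsub>P\<^esub> b c))"

text \<open>This is the effect on a transition function of replacing the section over A by its
  \<alpha>-multiple and the section over B by its \<beta>-multiple.\<close>

definition gauge_equivalent :: "('m \<Rightarrow> 'a) \<Rightarrow> ('m \<Rightarrow> 'a) \<Rightarrow> bool"
  where "gauge_equivalent u v \<longleftrightarrow>
    (\<exists>\<alpha> \<beta>. continuous_map MA T \<alpha> \<and> continuous_map MB T \<beta> \<and> (\<forall>x\<in>A \<inter> B. v x = inv (\<alpha> x) \<otimes> u x \<otimes> \<beta> x))"

lemma classifies_cocycle: "classifies u f \<Longrightarrow> pi.cocycle (Suc (Suc 0)) M f"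
  by (simp add: classifies_def)

lemma classifies_continuous: "classifies u f \<Longrightarrow> continuous_map MAB T u"
  by (auto simp: classifies_def dest: represents_continuous)

lemma classifiesI:
  assumes "pi.cocycle (Suc (Suc 0)) M f" "pi.cochain (Suc 0) MA a" "pi.cochain (Suc 0) MB b"
    "\<And>c. singular_chain (Suc (Suc 0)) MA c \<Longrightarrow> f c = a (chain_boundary (Suc (Suc 0)) c)"
    "\<And>c. singular_chain (Suc (Suc 0)) MB c \<Longrightarrow> f c = b (chain_boundary (Suc (Suc 0)) c)"
    "represents MAB u (\<lambda>c. a c \<otimes>\<^bsub>P\<^esub> inv\<^bsub>P\<^esub> b c)"
  shows "classifies u f"
  using assms unfolding classifies_def by blast

lemma classifiesE:
  assumes "classifies u f"
  obtains a b where "pi.cochain (Suc 0) MA a" "pi.cochain (Suc 0) MB b"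
    "\<forall>c. singular_chain (Suc (Suc 0)) MA c \<longrightarrow> f c = a (chain_boundary (Suc (Suc 0)) c)"
    "\<forall>c. singular_chain (Suc (Suc 0)) MB c \<longrightarrow> f c = b (chain_boundary (Suc (Suc 0)) c)"
    "represents MAB u (\<lambda>c. a c \<otimes>\<^bsub>P\<^esub> inv\<^bsub>P\<^esub> b c)"
  using assms unfolding classifies_def by blast

lemma cochain_pieces:
  assumes "pi.cochain n MA a" "pi.cochain n MB b" "singular_chain n MAB c"
  shows "a c \<in> carrier P" "b c \<in> carrier P"
  using assms singular_chain_MAB pi.cochain_closed by blast+

lemma classifies_one: "classifies (\<lambda>x. \<one>) (\<lambda>c. \<one>\<^bsub>P\<^esub>)"
proof (rule classifiesI [OF pi.cocycle_one pi.cochain_one pi.cochain_one])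
  show "represents MAB (\<lambda>x. \<one>) (\<lambda>c. \<one>\<^bsub>P\<^esub> \<otimes>\<^bsub>P\<^esub> inv\<^bsub>P\<^esub> \<one>\<^bsub>P\<^esub>)"
    using represents_one by simp
qed simp_all

text \<open>The connecting homomorphism: extend a cocycle of u from the overlap to a cochain a on A
  and take b trivial. The coboundary of a is trivial on the overlap, so it glues with the trivial
  cocycle on B.\<close>

lemma classifies_exists:
  assumes u: "continuous_map MAB T u"
  shows "\<exists>f. classifies u f"
proof -
  obtain z where z: "represents MAB u z"
    using represents_exists [OF u] .
  have MAB: "subtopology MA (A \<inter> B) = MAB"
    by (simp add: subtopology_subtopology)
  obtain a where a: "pi.cochain (Suc 0) MA a" "\<And>c. singular_chain (Suc 0) MAB c \<Longrightarrow> a c = z c"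
    using pi.cochain_extend [of "Suc 0" MA "A \<inter> B" z] pi.cocycle_cochain [OF represents_cocycle [OF z]]
    unfolding MAB by metis
  have eq: "a (chain_boundary (Suc (Suc 0)) (frag_of \<sigma>)) = \<one>\<^bsub>P\<^esub>"
    if "singular_simplex (Suc (Suc 0)) MAB \<sigma>" for \<sigma>
    using that a(2) [OF singular_chain_boundary_alt] pi.cocycle_boundary [OF represents_cocycle [OF z]]
    by (simp add: singular_chain_of)
  obtain f where f: "pi.cocycle (Suc (Suc 0)) M f"
      "\<And>c. singular_chain (Suc (Suc 0)) MA c \<Longrightarrow> f c = a (chain_boundary (Suc (Suc 0)) c)"
      "\<And>c. singular_chain (Suc (Suc 0)) MB c \<Longrightarrow> f c = \<one>\<^bsub>P\<^esub>"
    using pi.cocycle_glue [OF openA openB equalityD1 [OF cover] pi.cocycle_coboundary [OF a(1)] pi.cocycle_one eq]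
    by auto
  have "represents MAB u (\<lambda>c. a c \<otimes>\<^bsub>P\<^esub> inv\<^bsub>P\<^esub> \<one>\<^bsub>P\<^esub>)"
    by (rule represents_cong [OF z]) (use a cochain_pieces [OF a(1) pi.cochain_one] in auto)
  from classifiesI [OF f(1) a(1) pi.cochain_one f(2,3) this] show ?thesis
    by blast
qed

text \<open>H^2 vanishes on both pieces, so f has primitives there. Their quotient is a 1-cocycle on
  the overlap and is represented by a map by \<open>H1_AB\<close>.\<close>

lemma classifies_surj:
  assumes f: "pi.cocycle (Suc (Suc 0)) M f"
  shows "\<exists>u. classifies u f"
proof -
  obtain a where a: "pi.cochain (Suc 0) MA a"
      "\<forall>c. singular_chain (Suc (Suc 0)) MA c \<longrightarrow> f c = a (chain_boundary (Suc (Suc 0)) c)"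
    using H2_A [OF pi.cocycle_subtopology [OF f]] by blast
  obtain b where b: "pi.cochain (Suc 0) MB b"
      "\<And>c. singular_chain (Suc (Suc 0)) MB c \<Longrightarrow> f c = b (chain_boundary (Suc (Suc 0)) c)"
    using pi.scattered_cocycle_coboundary [OF scattered_B pi.cocycle_subtopology [OF f]] by blast
  note ab = cochain_pieces [OF a(1) b(1)]
  have "pi.cochain (Suc 0) MAB a" "pi.cochain (Suc 0) MAB b"
    using pi.cochain_mono [OF a(1), of MAB] pi.cochain_mono [OF b(1), of MAB] singular_chain_MAB by auto
  then have "pi.cocycle (Suc 0) MAB (\<lambda>c. a c \<otimes>\<^bsub>P\<^esub> inv\<^bsub>P\<^esub> b c)"
    unfolding pi.cocycle_def
  proof (intro conjI allI impI pi.cochain_mult pi.cochain_inv)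
    fix c assume c: "singular_chain (Suc (Suc 0)) MAB c"
    have "a (chain_boundary (Suc (Suc 0)) c) = b (chain_boundary (Suc (Suc 0)) c)"
      using a(2) b(2) singular_chain_MAB [OF c] by metis
    then show "a (chain_boundary (Suc (Suc 0)) c) \<otimes>\<^bsub>P\<^esub> inv\<^bsub>P\<^esub> b (chain_boundary (Suc (Suc 0)) c) = \<one>\<^bsub>P\<^esub>"
      using ab(2) [OF singular_chain_boundary_alt [OF c]] by simp
  qed
  then obtain u where "represents MAB u (\<lambda>c. a c \<otimes>\<^bsub>P\<^esub> inv\<^bsub>P\<^esub> b c)"
    using H1_AB by blast
  then show ?thesis
    using f a b unfolding classifies_def by blast
qed

text \<open>Multiplying both a and b by d leaves their quotient on the overlap, and with it u,
  unchanged.\<close>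

lemma classifies_coboundary:
  assumes u: "classifies u f" and d: "pi.cochain (Suc 0) M d"
    and g: "\<And>c. singular_chain (Suc (Suc 0)) M c \<Longrightarrow> g c = f c \<otimes>\<^bsub>P\<^esub> d (chain_boundary (Suc (Suc 0)) c)"
  shows "classifies u g"
proof -
  obtain a b where ab: "pi.cochain (Suc 0) MA a" "pi.cochain (Suc 0) MB b"
    "\<forall>c. singular_chain (Suc (Suc 0)) MA c \<longrightarrow> f c = a (chain_boundary (Suc (Suc 0)) c)"
    "\<forall>c. singular_chain (Suc (Suc 0)) MB c \<longrightarrow> f c = b (chain_boundary (Suc (Suc 0)) c)"
    "represents MAB u (\<lambda>c. a c \<otimes>\<^bsub>P\<^esub> inv\<^bsub>P\<^esub> b c)"
    using u by (rule classifiesE)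
  let ?a = "\<lambda>c. a c \<otimes>\<^bsub>P\<^esub> d c" and ?b = "\<lambda>c. b c \<otimes>\<^bsub>P\<^esub> d c"
  show ?thesis
  proof (rule classifiesI [of _ ?a ?b])
    show "pi.cocycle (Suc (Suc 0)) M g"
      by (rule pi.cocycle_cong [OF pi.cocycle_mult [OF classifies_cocycle [OF u] pi.cocycle_coboundary [OF d]] g])
    show "pi.cochain (Suc 0) MA ?a" "pi.cochain (Suc 0) MB ?b"
      using ab d by (auto intro: pi.cochain_mult pi.cochain_subtopology)
    show "g c = ?a (chain_boundary (Suc (Suc 0)) c)" if "singular_chain (Suc (Suc 0)) MA c" for c
      using g ab(3) that singular_chain_pieces by auto
    show "g c = ?b (chain_boundary (Suc (Suc 0)) c)" if "singular_chain (Suc (Suc 0)) MB c" for c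
      using g ab(4) that singular_chain_pieces by auto
    show "represents MAB u (\<lambda>c. ?a c \<otimes>\<^bsub>P\<^esub> inv\<^bsub>P\<^esub> ?b c)"
    proof (rule represents_cong [OF ab(5)])
      fix c assume c: "singular_chain (Suc 0) MAB c"
      have "d c \<in> carrier P"
        using pi.cochain_closed [OF d] singular_chain_pieces singular_chain_MAB [OF c] by blast
      then show "?a c \<otimes>\<^bsub>P\<^esub> inv\<^bsub>P\<^esub> ?b c = a c \<otimes>\<^bsub>P\<^esub> inv\<^bsub>P\<^esub> b c"
      proof -
        have cl: "a c \<in> carrier P" "b c \<in> carrier P"
          using cochain_pieces [OF ab(1,2) c] by auto
        have "(a c \<otimes>\<^bsub>P\<^esub> d c) \<otimes>\<^bsub>P\<^esub> (y \<otimes>\<^bsub>P\<^esub> w) = a c \<otimes>\<^bsub>P\<^esub> y \<otimes>\<^bsub>P\<^esub> (d c \<otimes>\<^bsub>P\<^esub> w)"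
          if "y \<in> carrier P" "w \<in> carrier P" for y w
          using that cl \<open>d c \<in> carrier P\<close> by (simp add: pi.m_ac)
        then show ?thesis
          using cl \<open>d c \<in> carrier P\<close> by (simp add: pi.inv_mult)
      qed
    qed auto
  qed
qed

text \<open>By \<open>represents_unique\<close> the two quotients on the overlap differ by a
  coboundary. After regrouping, this is the compatibility that \<open>coboundary_glue\<close> asks
  for the quotient of f' and f.\<close>

lemma classifies_unique:
  assumes u: "classifies u f" and u': "classifies u f'"
  shows "\<exists>d. pi.cochain (Suc 0) M d \<and>
    (\<forall>c. singular_chain (Suc (Suc 0)) M c \<longrightarrow> f' c = f c \<otimes>\<^bsub>P\<^esub> d (chain_boundary (Suc (Suc 0)) c))"
proof -
  obtain a b where ab: "pi.cochain (Suc 0) MA a" "pi.cochain (Suc 0) MB b"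
    "\<forall>c. singular_chain (Suc (Suc 0)) MA c \<longrightarrow> f c = a (chain_boundary (Suc (Suc 0)) c)"
    "\<forall>c. singular_chain (Suc (Suc 0)) MB c \<longrightarrow> f c = b (chain_boundary (Suc (Suc 0)) c)"
    "represents MAB u (\<lambda>c. a c \<otimes>\<^bsub>P\<^esub> inv\<^bsub>P\<^esub> b c)"
    using u by (rule classifiesE)
  obtain a' b' where ab': "pi.cochain (Suc 0) MA a'" "pi.cochain (Suc 0) MB b'"
    "\<forall>c. singular_chain (Suc (Suc 0)) MA c \<longrightarrow> f' c = a' (chain_boundary (Suc (Suc 0)) c)"
    "\<forall>c. singular_chain (Suc (Suc 0)) MB c \<longrightarrow> f' c = b' (chain_boundary (Suc (Suc 0)) c)"
    "represents MAB u (\<lambda>c. a' c \<otimes>\<^bsub>P\<^esub> inv\<^bsub>P\<^esub> b' c)"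
    using u' by (rule classifiesE)
  obtain e where e: "pi.cochain 0 MAB e"
    "\<And>c. singular_chain (Suc 0) MAB c \<Longrightarrow>
       a' c \<otimes>\<^bsub>P\<^esub> inv\<^bsub>P\<^esub> b' c = a c \<otimes>\<^bsub>P\<^esub> inv\<^bsub>P\<^esub> b c \<otimes>\<^bsub>P\<^esub> e (chain_boundary (Suc 0) c)"
    using represents_unique [OF ab(5) ab'(5)] by metis
  let ?f = "\<lambda>c. f' c \<otimes>\<^bsub>P\<^esub> inv\<^bsub>P\<^esub> f c"
  let ?a = "\<lambda>c. a' c \<otimes>\<^bsub>P\<^esub> inv\<^bsub>P\<^esub> a c" and ?b = "\<lambda>c. b' c \<otimes>\<^bsub>P\<^esub> inv\<^bsub>P\<^esub> b c"
  have f: "pi.cocycle (Suc (Suc 0)) M ?f"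
    by (intro pi.cocycle_mult pi.cocycle_inv classifies_cocycle [OF u] classifies_cocycle [OF u'])
  have fa: "?f c = ?a (chain_boundary (Suc (Suc 0)) c)" if "singular_chain (Suc (Suc 0)) MA c" for c
    using ab(3) ab'(3) that by simp
  have fb: "?f c = ?b (chain_boundary (Suc (Suc 0)) c)" if "singular_chain (Suc (Suc 0)) MB c" for c
    using ab(4) ab'(4) that by simp
  have fe: "?a c = ?b c \<otimes>\<^bsub>P\<^esub> e (chain_boundary (Suc 0) c)" if c: "singular_chain (Suc 0) MAB c" for c
  proof -
    have cl: "e (chain_boundary (Suc 0) c) \<in> carrier P" "a c \<in> carrier P" "b c \<in> carrier P" "a' c \<in> carrier P" "b' c \<in> carrier P"
      using pi.cochain_closed [OF e(1) singular_chain_boundary_alt [OF c]] cochain_pieces [OF ab(1,2) c] cochain_pieces [OF ab'(1,2) c]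
      by auto
    have "a' c = b' c \<otimes>\<^bsub>P\<^esub> (a c \<otimes>\<^bsub>P\<^esub> inv\<^bsub>P\<^esub> b c \<otimes>\<^bsub>P\<^esub> e (chain_boundary (Suc 0) c))"
      by (rule pi.eq_mult_of_div [OF e(2) [OF c]]) (use cl in auto)
    moreover have "b' c \<otimes>\<^bsub>P\<^esub> (a c \<otimes>\<^bsub>P\<^esub> x \<otimes>\<^bsub>P\<^esub> y) \<otimes>\<^bsub>P\<^esub> w = b' c \<otimes>\<^bsub>P\<^esub> x \<otimes>\<^bsub>P\<^esub> y \<otimes>\<^bsub>P\<^esub> (a c \<otimes>\<^bsub>P\<^esub> w)"
      if "x \<in> carrier P" "y \<in> carrier P" "w \<in> carrier P" for x y w
      using that cl by (simp add: pi.m_ac)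
    ultimately show ?thesis
      using cl by simp
  qed
  have ca: "pi.cochain (Suc 0) MA ?a" and cb: "pi.cochain (Suc 0) MB ?b"
    using ab ab' by (auto intro: pi.cochain_mult pi.cochain_inv)
  obtain d where d: "pi.cochain (Suc 0) M d"
    "\<And>c. singular_chain (Suc (Suc 0)) M c \<Longrightarrow> ?f c = d (chain_boundary (Suc (Suc 0)) c)"
  proof (rule pi.coboundary_glue [OF openA openB equalityD1 [OF cover] f ca fa cb fb e(1) fe], goal_cases)
    case (4 d)
    show thesis by (rule 4(1) [OF 4(2)]) (rule 4(3))
  qed
  have "f' c = f c \<otimes>\<^bsub>P\<^esub> d (chain_boundary (Suc (Suc 0)) c)" if c: "singular_chain (Suc (Suc 0)) M c" for c
    by (rule pi.eq_mult_of_div [OF d(2) [OF c]])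
      (use c pi.cochain_closed [OF pi.cocycle_cochain [OF classifies_cocycle]] u u' in blast)+
  with d(1) show ?thesis by blast
qed

text \<open>Cocycles represented by \<alpha> and \<beta> are divided out of a and b. Being cocycles
  on A and on B they do not affect the coboundaries.\<close>

lemma classifies_gauge:
  assumes u: "classifies u f" and v: "gauge_equivalent u v"
  shows "classifies v f"
proof -
  obtain a b where ab: "pi.cochain (Suc 0) MA a" "pi.cochain (Suc 0) MB b"
    "\<forall>c. singular_chain (Suc (Suc 0)) MA c \<longrightarrow> f c = a (chain_boundary (Suc (Suc 0)) c)"
    "\<forall>c. singular_chain (Suc (Suc 0)) MB c \<longrightarrow> f c = b (chain_boundary (Suc (Suc 0)) c)"
    "represents MAB u (\<lambda>c. a c \<otimes>\<^bsub>P\<^esub> inv\<^bsub>P\<^esub> b c)"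
    using u by (rule classifiesE)
  obtain \<alpha> \<beta> where \<alpha>\<beta>: "continuous_map MA T \<alpha>" "continuous_map MB T \<beta>"
      "\<forall>x\<in>A \<inter> B. v x = inv (\<alpha> x) \<otimes> u x \<otimes> \<beta> x"
    using v unfolding gauge_equivalent_def by blast
  obtain x where x: "represents MA \<alpha> x" using represents_exists [OF \<alpha>\<beta>(1)] .
  obtain y where y: "represents MB \<beta> y" using represents_exists [OF \<alpha>\<beta>(2)] .
  note cx = pi.cocycle_cochain [OF represents_cocycle [OF x]] and cy = pi.cocycle_cochain [OF represents_cocycle [OF y]]
  let ?a = "\<lambda>c. a c \<otimes>\<^bsub>P\<^esub> inv\<^bsub>P\<^esub> x c" and ?b = "\<lambda>c. b c \<otimes>\<^bsub>P\<^esub> inv\<^bsub>P\<^esub> y c"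
  have r: "represents MAB (\<lambda>x. inv (\<alpha> x) \<otimes> u x \<otimes> \<beta> x) (\<lambda>c. inv\<^bsub>P\<^esub> x c \<otimes>\<^bsub>P\<^esub> (a c \<otimes>\<^bsub>P\<^esub> inv\<^bsub>P\<^esub> b c) \<otimes>\<^bsub>P\<^esub> y c)"
    by (intro represents_mult represents_inv ab(5) represents_mono [OF x] represents_mono [OF y]) auto
  show ?thesis
  proof (rule classifiesI [of _ ?a ?b])
    show "pi.cocycle (Suc (Suc 0)) M f" by (rule classifies_cocycle [OF u])
    show "pi.cochain (Suc 0) MA ?a" "pi.cochain (Suc 0) MB ?b"
      using ab cx cy by (auto intro: pi.cochain_mult pi.cochain_inv)
    show "f c = ?a (chain_boundary (Suc (Suc 0)) c)" if "singular_chain (Suc (Suc 0)) MA c" for c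
      using that ab(3) pi.cocycle_boundary [OF represents_cocycle [OF x] that]
        pi.cochain_closed [OF ab(1) singular_chain_boundary_alt [OF that]] by simp
    show "f c = ?b (chain_boundary (Suc (Suc 0)) c)" if "singular_chain (Suc (Suc 0)) MB c" for c
      using that ab(4) pi.cocycle_boundary [OF represents_cocycle [OF y] that]
        pi.cochain_closed [OF ab(2) singular_chain_boundary_alt [OF that]] by simp
    show "represents MAB v (\<lambda>c. ?a c \<otimes>\<^bsub>P\<^esub> inv\<^bsub>P\<^esub> ?b c)"
    proof (rule represents_cong [OF r])
      fix c assume c: "singular_chain (Suc 0) MAB c"
      show "?a c \<otimes>\<^bsub>P\<^esub> inv\<^bsub>P\<^esub> ?b c = inv\<^bsub>P\<^esub> x c \<otimes>\<^bsub>P\<^esub> (a c \<otimes>\<^bsub>P\<^esub> inv\<^bsub>P\<^esub> b c) \<otimes>\<^bsub>P\<^esub> y c"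
        using cochain_pieces [OF ab(1,2) c] cochain_pieces [OF cx cy c] by (simp add: pi.inv_mult pi.m_ac)
    qed (use \<alpha>\<beta> in auto)
  qed
qed

text \<open>The quotient of the data is a cocycle on A, represented by some \<alpha>, and a
  coboundary on B. Thus inv u \<alpha> v represents the trivial class on the overlap. The map
  \<beta> on B agrees with it only off K, and \<alpha> is altered inside K to compensate.\<close>

lemma classifies_inj:
  assumes u: "classifies u f" and v: "classifies v f"
  shows "gauge_equivalent u v"
proof -
  obtain a b where ab: "pi.cochain (Suc 0) MA a" "pi.cochain (Suc 0) MB b"
    "\<forall>c. singular_chain (Suc (Suc 0)) MA c \<longrightarrow> f c = a (chain_boundary (Suc (Suc 0)) c)"
    "\<forall>c. singular_chain (Suc (Suc 0)) MB c \<longrightarrow> f c = b (chain_boundary (Suc (Suc 0)) c)"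
    "represents MAB u (\<lambda>c. a c \<otimes>\<^bsub>P\<^esub> inv\<^bsub>P\<^esub> b c)"
    using u by (rule classifiesE)
  obtain a' b' where ab': "pi.cochain (Suc 0) MA a'" "pi.cochain (Suc 0) MB b'"
    "\<forall>c. singular_chain (Suc (Suc 0)) MA c \<longrightarrow> f c = a' (chain_boundary (Suc (Suc 0)) c)"
    "\<forall>c. singular_chain (Suc (Suc 0)) MB c \<longrightarrow> f c = b' (chain_boundary (Suc (Suc 0)) c)"
    "represents MAB v (\<lambda>c. a' c \<otimes>\<^bsub>P\<^esub> inv\<^bsub>P\<^esub> b' c)"
    using v by (rule classifiesE)
  let ?a = "\<lambda>c. a c \<otimes>\<^bsub>P\<^esub> inv\<^bsub>P\<^esub> a' c" and ?b = "\<lambda>c. b c \<otimes>\<^bsub>P\<^esub> inv\<^bsub>P\<^esub> b' c"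
  have "pi.cocycle (Suc 0) MA ?a"
    unfolding pi.cocycle_def
  proof (intro conjI allI impI pi.cochain_mult pi.cochain_inv ab ab')
    fix c assume c: "singular_chain (Suc (Suc 0)) MA c"
    then show "?a (chain_boundary (Suc (Suc 0)) c) = \<one>\<^bsub>P\<^esub>"
      using ab(3) ab'(3) pi.cochain_closed [OF ab(1) singular_chain_boundary_alt [OF c]] by (metis pi.r_inv)
  qed
  then obtain \<alpha> where \<alpha>: "represents MA \<alpha> ?a"
    using H1_A by blast
  have zb: "pi.cocycle (Suc 0) MB ?b"
    unfolding pi.cocycle_def
  proof (intro conjI allI impI pi.cochain_mult pi.cochain_inv ab ab')
    fix c assume c: "singular_chain (Suc (Suc 0)) MB c"
    then show "?b (chain_boundary (Suc (Suc 0)) c) = \<one>\<^bsub>P\<^esub>"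
      using ab(4) ab'(4) pi.cochain_closed [OF ab(2) singular_chain_boundary_alt [OF c]] by (metis pi.r_inv)
  qed
  obtain e where e: "pi.cochain 0 MB e" "\<And>c. singular_chain (Suc 0) MB c \<Longrightarrow> ?b c = e (chain_boundary (Suc 0) c)"
  proof (rule pi.scattered_cocycle_coboundary [OF scattered_B zb], goal_cases)
    case (1 e)
    show thesis by (rule 1(1) [OF 1(2)]) (rule 1(3))
  qed
  have eAB: "pi.cochain 0 MAB e"
    using pi.cochain_mono [OF e(1)] singular_chain_MAB by blast
  note cu = represents_continuous [OF ab(5)] and cv = represents_continuous [OF ab'(5)]
  have \<alpha>AB: "represents MAB \<alpha> ?a" using represents_mono [OF \<alpha>] by simp
  let ?u = "\<lambda>x. inv (\<alpha> x) \<otimes> u x"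
  \<comment> \<open>The value that \<beta> must take for \<alpha> and \<beta> to carry u to
    v.\<close>
  let ?w = "\<lambda>x. inv (?u x) \<otimes> v x"
  have r1: "represents MAB ?u (\<lambda>c. inv\<^bsub>P\<^esub> ?a c \<otimes>\<^bsub>P\<^esub> (a c \<otimes>\<^bsub>P\<^esub> inv\<^bsub>P\<^esub> b c))"
    by (rule represents_mult [OF represents_inv [OF \<alpha>AB] ab(5)])
  have r2: "represents MAB ?w (\<lambda>c. inv\<^bsub>P\<^esub> (inv\<^bsub>P\<^esub> ?a c \<otimes>\<^bsub>P\<^esub> (a c \<otimes>\<^bsub>P\<^esub> inv\<^bsub>P\<^esub> b c)) \<otimes>\<^bsub>P\<^esub> (a' c \<otimes>\<^bsub>P\<^esub> inv\<^bsub>P\<^esub> b' c))"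
    by (rule represents_mult [OF represents_inv [OF r1] ab'(5)])
  have r3: "represents MAB ?w (\<lambda>c. e (chain_boundary (Suc 0) c))"
  proof (rule represents_cong [OF r2])
    fix c assume c: "singular_chain (Suc 0) MAB c"
    have "e (chain_boundary (Suc 0) c) = ?b c"
      using e(2) singular_chain_MAB [OF c] by simp
    moreover have "?b c = inv\<^bsub>P\<^esub> (inv\<^bsub>P\<^esub> ?a c \<otimes>\<^bsub>P\<^esub> (a c \<otimes>\<^bsub>P\<^esub> inv\<^bsub>P\<^esub> b c)) \<otimes>\<^bsub>P\<^esub> (a' c \<otimes>\<^bsub>P\<^esub> inv\<^bsub>P\<^esub> b' c)"
    proof -
      have cl: "a c \<in> carrier P" "b c \<in> carrier P" "a' c \<in> carrier P" "b' c \<in> carrier P"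
        using cochain_pieces [OF ab(1,2) c] cochain_pieces [OF ab'(1,2) c] by auto
      have "inv\<^bsub>P\<^esub> (inv\<^bsub>P\<^esub> ?a c \<otimes>\<^bsub>P\<^esub> (a c \<otimes>\<^bsub>P\<^esub> inv\<^bsub>P\<^esub> b c)) \<otimes>\<^bsub>P\<^esub> (a' c \<otimes>\<^bsub>P\<^esub> inv\<^bsub>P\<^esub> b' c)
        = (a c \<otimes>\<^bsub>P\<^esub> inv\<^bsub>P\<^esub> a' c) \<otimes>\<^bsub>P\<^esub> (inv\<^bsub>P\<^esub> a c \<otimes>\<^bsub>P\<^esub> b c) \<otimes>\<^bsub>P\<^esub> (a' c \<otimes>\<^bsub>P\<^esub> inv\<^bsub>P\<^esub> b' c)"
        using cl by (simp add: pi.inv_mult)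
      also have "\<dots> = (a c \<otimes>\<^bsub>P\<^esub> inv\<^bsub>P\<^esub> a c) \<otimes>\<^bsub>P\<^esub> (a' c \<otimes>\<^bsub>P\<^esub> inv\<^bsub>P\<^esub> a' c) \<otimes>\<^bsub>P\<^esub> ?b c"
      proof -
        have "(x \<otimes>\<^bsub>P\<^esub> y') \<otimes>\<^bsub>P\<^esub> (x' \<otimes>\<^bsub>P\<^esub> b c) \<otimes>\<^bsub>P\<^esub> (y \<otimes>\<^bsub>P\<^esub> w) = (x \<otimes>\<^bsub>P\<^esub> x') \<otimes>\<^bsub>P\<^esub> (y \<otimes>\<^bsub>P\<^esub> y') \<otimes>\<^bsub>P\<^esub> (b c \<otimes>\<^bsub>P\<^esub> w)"
          if "x \<in> carrier P" "x' \<in> carrier P" "y \<in> carrier P" "y' \<in> carrier P" "w \<in> carrier P" for x x' y y' w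
          using that cl by (simp add: pi.m_ac)
        then show ?thesis using cl by auto
      qed
      finally show ?thesis using cl by simp
    qed
    ultimately show "e (chain_boundary (Suc 0) c) = inv\<^bsub>P\<^esub> (inv\<^bsub>P\<^esub> ?a c \<otimes>\<^bsub>P\<^esub> (a c \<otimes>\<^bsub>P\<^esub> inv\<^bsub>P\<^esub> b c)) \<otimes>\<^bsub>P\<^esub> (a' c \<otimes>\<^bsub>P\<^esub> inv\<^bsub>P\<^esub> b' c)"
      by simp
  qed auto
  have "represents MAB ?w (\<lambda>c. \<one>\<^bsub>P\<^esub>)"
  proof (rule represents_cong [OF represents_coboundary [OF r3 pi.cochain_inv [OF eAB]]])
    fix c assume c: "singular_chain (Suc 0) MAB c"
    then show "\<one>\<^bsub>P\<^esub> = e (chain_boundary (Suc 0) c) \<otimes>\<^bsub>P\<^esub> inv\<^bsub>P\<^esub> e (chain_boundary (Suc 0) c)"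
      using pi.cochain_closed [OF eAB singular_chain_boundary_alt [OF c]] by simp
  qed auto
  then obtain \<beta> K where K: "closedin M K" "K \<subseteq> B" and \<beta>: "continuous_map MB T \<beta>" "\<forall>x\<in>A \<inter> B - K. \<beta> x = ?w x"
    using extension by blast
  have cuv: "u x \<in> carrier G" "v x \<in> carrier G" "\<alpha> x \<in> carrier G" "\<beta> x \<in> carrier G" if "x \<in> A \<inter> B" for x
    using that continuous_closed [OF cu, of x] continuous_closed [OF cv, of x]
      continuous_closed [OF represents_continuous [OF \<alpha>], of x] continuous_closed [OF \<beta>(1), of x] cover by auto
  \<comment> \<open>The gauge equation solved for its left factor on B. Off K this gives \<alpha>
    back. Since K is closed in M and contained in B, the sets A - K and A \<inter> B are open and
    cover A, so the two formulas paste.\<close>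
  define \<delta> where "\<delta> x = (if x \<in> B then u x \<otimes> \<beta> x \<otimes> inv (v x) else \<alpha> x)" for x
  have \<delta>K: "\<delta> x = \<alpha> x" if "x \<in> A - K" for x
  proof (cases "x \<in> B")
    case True
    then show ?thesis
      using that \<beta>(2) cuv [of x] by (simp add: \<delta>_def inv_mult_group m_assoc)
  qed (simp add: \<delta>_def)
  have "continuous_map MA T \<delta>"
  proof (rule pasting_lemma [of UNIV MA "\<lambda>i. if i then A - K else A \<inter> B" T "\<lambda>i. if i then \<alpha> else (\<lambda>x. u x \<otimes> \<beta> x \<otimes> inv (v x))"])
    have MAB: "subtopology MA (A \<inter> B) = MAB"
      by (simp add: subtopology_subtopology)
    have "openin M (A - K)" "openin M (A \<inter> B)"
      using openA openB K by auto
    then show "openin MA (if i then A - K else A \<inter> B)" for i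
      by (auto simp: openin_subtopology_alt)
    have "continuous_map MAB T \<beta>"
      using continuous_map_from_subtopology_mono [OF \<beta>(1)] by blast
    then have "continuous_map MAB T (\<lambda>x. u x \<otimes> \<beta> x \<otimes> inv (v x))"
      by (intro continuous_mult continuous_inv cu cv)
    then show "continuous_map (subtopology MA (if i then A - K else A \<inter> B)) T (if i then \<alpha> else (\<lambda>x. u x \<otimes> \<beta> x \<otimes> inv (v x)))" for i
      using represents_continuous [OF \<alpha>] MAB by (auto intro: continuous_map_from_subtopology)
    show "(if i then \<alpha> else (\<lambda>x. u x \<otimes> \<beta> x \<otimes> inv (v x))) x = (if j then \<alpha> else (\<lambda>x. u x \<otimes> \<beta> x \<otimes> inv (v x))) x"
      if "x \<in> topspace MA \<inter> (if i then A - K else A \<inter> B) \<inter> (if j then A - K else A \<inter> B)" for i j x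
      using that \<delta>K [of x] by (auto simp: \<delta>_def split: if_splits)
    show "\<exists>j. j \<in> UNIV \<and> x \<in> (if j then A - K else A \<inter> B) \<and> \<delta> x = (if j then \<alpha> else (\<lambda>x. u x \<otimes> \<beta> x \<otimes> inv (v x))) x"
      if "x \<in> topspace MA" for x
      using that \<delta>K [of x] K by (cases "x \<in> B") (auto simp: \<delta>_def intro: exI [of _ False] exI [of _ True])
  qed
  moreover have "v x = inv (\<delta> x) \<otimes> u x \<otimes> \<beta> x" if "x \<in> A \<inter> B" for x
    using that cuv [of x] by (simp add: \<delta>_def inv_mult_group m_assoc)
  ultimately show ?thesis
    using \<beta>(1) unfolding gauge_equivalent_def by blast
qed

end


section \<open>Discs\<close>

lemma prod_topology_top_of_set: "prod_topology (top_of_set S) (top_of_set S') = top_of_set (S \<times> S')"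
  by (simp add: subtopology_Times)

text \<open>Moves discs into the product topology of the type \<open>nat => real\<close>, where the
  rules for \<open>continuous_on\<close>, \<open>compact\<close> and \<open>closed\<close>
  apply.\<close>

lemma topspace_Euclidean_subtopology:
  assumes "S \<subseteq> topspace (Euclidean_space n)"
  shows "subtopology (Euclidean_space n) S = top_of_set S"
  using assms unfolding Euclidean_space_def euclidean_product_topology
  by (simp add: subtopology_subtopology Int_absorb1 topspace_Euclidean_space)

lemma disc_subset: "disc n \<subseteq> topspace (Euclidean_space n)"
  and open_disc_subset_disc: "open_disc n \<subseteq> disc n"
  and disc_boundary_subset_disc: "disc_boundary n \<subseteq> disc n"
  and disc_eq: "disc n = open_disc n \<union> disc_boundary n"
  by (auto simp: disc_def open_disc_def disc_boundary_def)

lemma disc_topology: "S \<subseteq> disc n \<Longrightarrow> subtopology (Euclidean_space n) S = top_of_set S"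
  using disc_subset [of n] by (intro topspace_Euclidean_subtopology) blast

definition radius :: "nat \<Rightarrow> (nat \<Rightarrow> real) \<Rightarrow> real"
  where "radius n y = sqrt (\<Sum>i<n. (y i)\<^sup>2)"

lemma continuous_on_radius [continuous_intros]:
  fixes f :: "'z::topological_space \<Rightarrow> nat \<Rightarrow> real"
  assumes "continuous_on S f"
  shows "continuous_on S (\<lambda>z. radius n (f z))"
  unfolding radius_def
  by (intro continuous_on_real_sqrt continuous_on_sum continuous_on_power continuous_on_product_then_coordinatewise [OF assms])

lemma radius_nonneg: "0 \<le> radius n y"
  by (simp add: radius_def sum_nonneg)

lemma disc_iff: "y \<in> disc n \<longleftrightarrow> (\<forall>i\<ge>n. y i = 0) \<and> radius n y \<le> 1"
  and open_disc_iff: "y \<in> open_disc n \<longleftrightarrow> (\<forall>i\<ge>n. y i = 0) \<and> radius n y < 1"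
  and disc_boundary_iff: "y \<in> disc_boundary n \<longleftrightarrow> (\<forall>i\<ge>n. y i = 0) \<and> radius n y = 1"
  by (auto simp: disc_def open_disc_def disc_boundary_def topspace_Euclidean_space radius_def)

lemma radius_scale: "0 \<le> c \<Longrightarrow> radius n (\<lambda>i. c * y i) = c * radius n y"
  by (simp add: radius_def power_mult_distrib real_sqrt_mult flip: sum_distrib_left)

lemma radius_eq_0:
  assumes "\<forall>i\<ge>n. y i = 0"
  shows "radius n y = 0 \<longleftrightarrow> y = (\<lambda>i. 0)"
proof
  assume "radius n y = 0"
  then have "\<forall>i<n. y i = 0"
    by (simp add: radius_def sum_nonneg_eq_0_iff)
  with assms show "y = (\<lambda>i. 0)"
    by (metis not_less)
qed (simp add: radius_def)

lemma zero_in_open_disc [simp]: "(\<lambda>i. 0) \<in> open_disc n"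
  by (simp add: open_disc_iff radius_def)

lemma coordinate_le_radius: "i < n \<Longrightarrow> \<bar>y i\<bar> \<le> radius n y"
  unfolding radius_def
  by (rule real_le_rsqrt) (simp add: member_le_sum [of i "{..<n}" "\<lambda>i. (y i)\<^sup>2"])

text \<open>A closed subset of a product of compact intervals over all natural indices; the
  coordinates from n on are 0.\<close>

lemma compact_disc: "compact (disc n)"
proof -
  have "compactin (powertop_real UNIV) (UNIV \<rightarrow>\<^sub>E {-1..1})"
    by (simp add: compactin_PiE)
  then have "compact (UNIV \<rightarrow>\<^sub>E {-1..1::real} :: (nat \<Rightarrow> real) set)"
    by (simp add: euclidean_product_topology)
  moreover have "closed (disc n)"
  proof -
    have "disc n = {y. radius n y \<le> 1} \<inter> (\<Inter>i\<in>{n..}. {y. y i = 0})"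
      by (auto simp: disc_iff)
    moreover have "closed {y. radius n y \<le> 1}" "closed {y :: nat \<Rightarrow> real. y i = 0}" for i
      by (auto intro!: closed_Collect_le closed_Collect_eq continuous_intros)
    ultimately show ?thesis
      by (metis (no_types, lifting) closed_INT closed_Int)
  qed
  moreover have "disc n \<subseteq> UNIV \<rightarrow>\<^sub>E {-1..1}"
  proof
    fix y assume y: "y \<in> disc n"
    have "\<bar>y i\<bar> \<le> 1" for i
      using y coordinate_le_radius [of i n y] by (cases "i < n") (auto simp: disc_iff)
    then show "y \<in> UNIV \<rightarrow>\<^sub>E {-1..1}"
      by (auto simp: abs_le_iff minus_le_iff)
  qed
  ultimately show ?thesis
    by (metis compact_Int_closed inf.absorb2)
qed

section \<open>Skeleta\<close>

locale cw_space =
  fixes M :: "'m topology" and C :: "nat \<Rightarrow> ((nat \<Rightarrow> real) \<Rightarrow> 'm) set"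
  assumes cw: "cw_complex M C"
begin

lemma Hausdorff: "Hausdorff_space M"
  using cw by (simp add: cw_complex_def)

lemma cell_continuous:
  assumes "\<phi> \<in> C n" "S \<subseteq> disc n"
  shows "continuous_map (top_of_set S) M \<phi>"
proof -
  have "continuous_map (top_of_set (disc n)) M \<phi>"
  proof -
    have "continuous_map (subtopology (Euclidean_space n) (disc n)) M \<phi>"
      using cw unfolding cw_complex_def using assms(1) by simp
    then show ?thesis by (simp add: disc_topology)
  qed
  then show ?thesis
    using assms(2) by (rule continuous_map_from_subtopology_mono)
qed

lemma cell_inj:
  assumes "\<phi> \<in> C n"
  shows "inj_on \<phi> (open_disc n)"
proof -
  have "homeomorphic_map (subtopology (Euclidean_space n) (open_disc n)) (subtopology M (\<phi> ` open_disc n)) \<phi>"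
    using cw unfolding cw_complex_def using assms by simp
  from homeomorphic_imp_injective_map [OF this] show ?thesis
    using open_disc_subset_disc disc_subset by (metis Int_absorb1 order_trans topspace_subtopology)
qed

lemma cells_cover: "topspace M = (\<Union>n. \<Union>\<phi>\<in>C n. \<phi> ` open_disc n)"
  using cw unfolding cw_complex_def by auto

lemma cells_disjoint:
  assumes "\<phi> \<in> C n" "\<psi> \<in> C m" "y \<in> open_disc n" "z \<in> open_disc m" "\<phi> y = \<psi> z"
  shows "n = m" "\<phi> = \<psi>" "y = z"
proof -
  have "\<forall>n m. \<forall>\<phi>\<in>C n. \<forall>\<psi>\<in>C m. (n, \<phi>) \<noteq> (m, \<psi>) \<longrightarrow> disjnt (\<phi> ` open_disc n) (\<psi> ` open_disc m)"
    using cw unfolding cw_complex_def by (elim conjE)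
  moreover have "\<not> disjnt (\<phi> ` open_disc n) (\<psi> ` open_disc m)"
    using assms unfolding disjnt_def by blast
  ultimately have "(n, \<phi>) = (m, \<psi>)"
    using assms(1,2) by blast
  then show "n = m" "\<phi> = \<psi>" by auto
  with assms cell_inj [OF assms(1)] show "y = z"
    by (auto simp: inj_on_def)
qed

lemma boundary_finite:
  assumes "\<phi> \<in> C n"
  obtains F where "finite F" "F \<subseteq> (SIGMA m:{..<n}. C m)" "\<phi> ` disc_boundary n \<subseteq> (\<Union>(m, \<psi>)\<in>F. \<psi> ` open_disc m)"
proof -
  have "\<exists>F. finite F \<and> F \<subseteq> (SIGMA m:{..<n}. C m) \<and> \<phi> ` disc_boundary n \<subseteq> (\<Union>(m, \<psi>)\<in>F. \<psi> ` open_disc m)"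
    using cw unfolding cw_complex_def using assms by simp
  then show ?thesis using that by blast
qed

lemma closedin_iff:
  assumes "S \<subseteq> topspace M"
  shows "closedin M S \<longleftrightarrow> (\<forall>n. \<forall>\<phi>\<in>C n. closedin (top_of_set (disc n)) {y \<in> disc n. \<phi> y \<in> S})"
proof -
  have "subtopology (Euclidean_space n) (disc n) = top_of_set (disc n)" for n
    by (rule disc_topology) simp
  then show ?thesis
    using cw unfolding cw_complex_def using assms by simp
qed

definition cells :: "nat \<Rightarrow> 'm set"
  where "cells n = (\<Union>\<phi>\<in>C n. \<phi> ` open_disc n)"

text \<open>Off by one: \<open>skel n\<close> consists of the cells of dimension less than \<open>n\<close>.\<close>

definition skel :: "nat \<Rightarrow> 'm set"
  where "skel n = (\<Union>k<n. cells k)"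

definition centers :: "nat \<Rightarrow> 'm set"
  where "centers n = (\<lambda>\<phi>. \<phi> (\<lambda>i. 0)) ` C n"

lemma cellsI: "\<phi> \<in> C n \<Longrightarrow> y \<in> open_disc n \<Longrightarrow> \<phi> y \<in> cells n"
  by (auto simp: cells_def)

lemma skel_Suc: "skel (Suc n) = skel n \<union> cells n"
  by (auto simp: skel_def lessThan_Suc)

lemma skel_subset: "skel n \<subseteq> topspace M"
  and cells_subset: "cells n \<subseteq> topspace M"
  by (auto simp: skel_def cells_def cells_cover)

lemma cellsE:
  assumes "x \<in> cells n"
  obtains \<phi> y where "\<phi> \<in> C n" "y \<in> open_disc n" "x = \<phi> y"
  using assms by (auto simp: cells_def)

lemma skelE:
  assumes "x \<in> skel n"
  obtains m \<phi> y where "m < n" "\<phi> \<in> C m" "y \<in> open_disc m" "x = \<phi> y"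
  using assms by (auto simp: skel_def cells_def)

lemma skel_disjoint:
  assumes "m \<ge> n"
  shows "skel n \<inter> cells m = {}"
proof (rule ccontr)
  assume "skel n \<inter> cells m \<noteq> {}"
  then obtain x where x: "x \<in> skel n" "x \<in> cells m" by blast
  obtain k \<phi> y where k: "k < n" "\<phi> \<in> C k" "y \<in> open_disc k" "x = \<phi> y" using skelE [OF x(1)] .
  obtain \<psi> z where z: "\<psi> \<in> C m" "z \<in> open_disc m" "x = \<psi> z" using cellsE [OF x(2)] .
  have "k = m" using cells_disjoint(1) [OF k(2) z(1) k(3) z(2)] k z by simp
  then show False using k(1) assms by simp
qed

lemma cell_boundary:
  assumes "\<phi> \<in> C n" "y \<in> disc_boundary n"
  shows "\<phi> y \<in> skel n"
proof -
  obtain F where F: "F \<subseteq> (SIGMA m:{..<n}. C m)" "\<phi> ` disc_boundary n \<subseteq> (\<Union>(m, \<psi>)\<in>F. \<psi> ` open_disc m)"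
    by (rule boundary_finite [OF assms(1)])
  then have "\<phi> y \<in> (\<Union>(m, \<psi>)\<in>F. \<psi> ` open_disc m)" using assms(2) by (rule_tac subsetD) auto
  then obtain m \<psi> where m: "(m, \<psi>) \<in> F" "\<phi> y \<in> \<psi> ` open_disc m" by auto
  then have "m < n" "\<psi> \<in> C m" using F(1) by auto
  then show ?thesis
    using m(2) by (auto simp: skel_def cells_def)
qed

lemma cell_skel: "\<phi> \<in> C m \<Longrightarrow> m < n \<Longrightarrow> y \<in> disc m \<Longrightarrow> \<phi> y \<in> skel n"
proof -
  assume *: "\<phi> \<in> C m" "m < n" "y \<in> disc m"
  show "\<phi> y \<in> skel n"
  proof (cases "y \<in> open_disc m")
    case True
    then show ?thesis using * unfolding skel_def cells_def by blast
  next
    case False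
    then have "\<phi> y \<in> skel m" using * cell_boundary disc_eq by blast
    then show ?thesis using *(2) unfolding skel_def by (auto intro: less_trans)
  qed
qed

lemma cell_in_skel_iff: "\<phi> \<in> C n \<Longrightarrow> y \<in> disc n \<Longrightarrow> \<phi> y \<in> skel n \<longleftrightarrow> y \<in> disc_boundary n"
  using cell_boundary [of \<phi> n y] skel_disjoint [of n n] cellsI [of \<phi> n y] by (auto simp: disc_eq)

lemma cell_in_cells_iff: "\<phi> \<in> C n \<Longrightarrow> y \<in> disc n \<Longrightarrow> \<phi> y \<in> cells n \<longleftrightarrow> y \<in> open_disc n"
  using cell_boundary [of \<phi> n y] skel_disjoint [of n n] cellsI [of \<phi> n y] by (auto simp: disc_eq)

text \<open>A boundary sphere meets only finitely many cells, whose closures are compact.\<close>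

lemma closedin_skel:
  assumes S: "S \<subseteq> skel n"
    and cl: "\<And>m \<phi>. m < n \<Longrightarrow> \<phi> \<in> C m \<Longrightarrow> closedin (top_of_set (disc m)) {y \<in> disc m. \<phi> y \<in> S}"
  shows "closedin M S"
proof -
  have "closedin (top_of_set (disc m)) {y \<in> disc m. \<phi> y \<in> S}" if "\<phi> \<in> C m" for m \<phi>
    using that
  proof (induction m arbitrary: \<phi> rule: less_induct)
    case (less m)
    show ?case
    proof (cases "m < n")
      case True
      then show ?thesis using cl less.prems by blast
    next
      case False
      obtain F where F: "finite F" "F \<subseteq> (SIGMA m:{..<m}. C m)" "\<phi> ` disc_boundary m \<subseteq> (\<Union>(m, \<psi>)\<in>F. \<psi> ` open_disc m)"
        by (rule boundary_finite [OF less.prems])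
      \<comment> \<open>For m at least n the set S meets this cell only along its boundary sphere,
        so there it may be replaced by its part in the finitely many closed cells of F. The
        induction hypothesis makes each such part compact.\<close>
      define Q where "Q = (\<Union>(k, \<psi>)\<in>F. \<psi> ` {z \<in> disc k. \<psi> z \<in> S})"
      have "closedin M (\<psi> ` {z \<in> disc k. \<psi> z \<in> S})" if "(k, \<psi>) \<in> F" for k \<psi>
      proof -
        have k: "k < m" "\<psi> \<in> C k" using that F(2) by auto
        have "compact {z \<in> disc k. \<psi> z \<in> S}"
          using less.IH [OF k] compact_disc closedin_compact by blast
        then have "compactin (top_of_set (disc k)) {z \<in> disc k. \<psi> z \<in> S}"
          by (simp add: compactin_subtopology)
        then have "compactin M (\<psi> ` {z \<in> disc k. \<psi> z \<in> S})"
          using image_compactin cell_continuous [OF k(2) order_refl] by blast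
        then show ?thesis
          using compactin_imp_closedin Hausdorff by blast
      qed
      then have Q: "closedin M Q"
        unfolding Q_def using F(1) by (intro closedin_Union) auto
      have "{y \<in> disc m. \<phi> y \<in> S} = disc_boundary m \<inter> {y \<in> disc m. \<phi> y \<in> Q}"
      proof (rule Set.set_eqI, rule iffI)
        fix y assume y: "y \<in> {y \<in> disc m. \<phi> y \<in> S}"
        moreover have "skel n \<subseteq> skel m"
          using False by (fastforce simp: skel_def)
        ultimately have "\<phi> y \<in> skel m"
          using S by auto
        then have b: "y \<in> disc_boundary m"
          using cell_in_skel_iff less.prems y by auto
        then have "\<phi> y \<in> (\<Union>(m, \<psi>)\<in>F. \<psi> ` open_disc m)" using F(3) by blast
        then obtain k \<psi> z where "(k, \<psi>) \<in> F" "z \<in> open_disc k" "\<phi> y = \<psi> z" by blast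
        then have "\<phi> y \<in> Q"
          unfolding Q_def using y open_disc_subset_disc [of k] by fastforce
        then show "y \<in> disc_boundary m \<inter> {y \<in> disc m. \<phi> y \<in> Q}"
          using b y by blast
      next
        fix y assume "y \<in> disc_boundary m \<inter> {y \<in> disc m. \<phi> y \<in> Q}"
        then show "y \<in> {y \<in> disc m. \<phi> y \<in> S}"
          unfolding Q_def by auto
      qed
      moreover have "closedin (top_of_set (disc m)) {y \<in> topspace (top_of_set (disc m)). \<phi> y \<in> Q}"
        by (rule closedin_continuous_map_preimage [OF cell_continuous [OF less.prems order_refl] Q])
      moreover have "closedin (top_of_set (disc m)) (disc_boundary m)"
      proof -
        have "disc_boundary m = {y \<in> disc m. radius m y = 1}"
          by (auto simp: disc_boundary_iff disc_iff)
        then show ?thesis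
          using continuous_closedin_preimage_constant [of "disc m" "radius m" 1] continuous_on_radius [OF continuous_on_id]
          by (simp add: vimage_def)
      qed
      ultimately show ?thesis
        by (simp add: closedin_Int)
    qed
  qed
  then show ?thesis
    using S skel_subset [of n] closedin_iff [of S] by blast
qed

lemma closedin_skel_self: "closedin M (skel n)"
proof (rule closedin_skel)
  show "closedin (top_of_set (disc m)) {y \<in> disc m. \<phi> y \<in> skel n}" if "m < n" "\<phi> \<in> C m" for m \<phi>
  proof -
    have "{y \<in> disc m. \<phi> y \<in> skel n} = disc m" using cell_skel that by auto
    then show ?thesis by simp
  qed
qed simp

text \<open>The cellwise test is for closed sets and is applied to the complement of W. The preimage
  of X in each disc is open, which turns openness relative to it into openness in the disc.\<close>

lemma openin_skel_iff:
  assumes X: "openin (subtopology M (skel n)) X" and "W \<subseteq> X"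
    and op: "\<And>m \<phi>. m < n \<Longrightarrow> \<phi> \<in> C m \<Longrightarrow>
      openin (top_of_set {y \<in> disc m. \<phi> y \<in> X}) {y \<in> disc m. \<phi> y \<in> W}"
  shows "openin (subtopology M (skel n)) W"
proof -
  have X': "X \<subseteq> skel n" using openin_subset [OF X] by simp
  have "closedin M (skel n - W)"
  proof (rule closedin_skel)
    fix m \<phi> assume m: "m < n" "\<phi> \<in> C m"
    have "continuous_map (top_of_set (disc m)) (subtopology M (skel n)) \<phi>"
      using cell_continuous [OF m(2) order_refl] cell_skel [OF m(2,1)]
      by (auto simp: continuous_map_in_subtopology)
    from openin_continuous_map_preimage [OF this X]
    have "openin (top_of_set (disc m)) {y \<in> disc m. \<phi> y \<in> X}" by simp
    then have "openin (top_of_set (disc m)) {y \<in> disc m. \<phi> y \<in> W}"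
      using op [OF m] openin_trans by blast
    moreover have "{y \<in> disc m. \<phi> y \<in> skel n - W} = disc m - {y \<in> disc m. \<phi> y \<in> W}"
      using cell_skel [OF m(2,1)] by auto
    ultimately show "closedin (top_of_set (disc m)) {y \<in> disc m. \<phi> y \<in> skel n - W}"
      by (simp add: closedin_diff)
  qed auto
  moreover have "W = skel n \<inter> (topspace M - (skel n - W))"
    using assms(2) X' skel_subset by blast
  ultimately show ?thesis
    by (metis inf_commute openin_closedin_eq openin_subtopology_Int closedin_def)
qed

lemma openin_open_in_skel:
  assumes X: "openin (subtopology M (skel n)) X" and "W \<subseteq> X"
    and op: "\<And>m \<phi>. m < n \<Longrightarrow> \<phi> \<in> C m \<Longrightarrow>
      openin (top_of_set {y \<in> disc m. \<phi> y \<in> X}) {y \<in> disc m. \<phi> y \<in> W}"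
  shows "openin (subtopology M X) W"
proof -
  have "subtopology M X = subtopology (subtopology M (skel n)) X"
    using openin_subset [OF X] by (simp add: subtopology_subtopology Int_absorb1)
  then show ?thesis
    using openin_skel_iff [OF X assms(2) op] X assms(2) by (simp add: openin_open_subtopology)
qed

lemma continuous_on_skel:
  assumes X: "openin (subtopology M (skel n)) X"
    and f: "\<And>m \<phi>. m < n \<Longrightarrow> \<phi> \<in> C m \<Longrightarrow> continuous_map (top_of_set {y \<in> disc m. \<phi> y \<in> X}) Y (\<lambda>y. f (\<phi> y))"
  shows "continuous_map (subtopology M X) Y f"
  unfolding continuous_map_def
proof (intro conjI allI impI)
  have X': "X \<subseteq> skel n" "X \<subseteq> topspace M" using openin_subset [OF X] by auto
  show "f \<in> topspace (subtopology M X) \<rightarrow> topspace Y"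
  proof
    fix x assume x: "x \<in> topspace (subtopology M X)"
    then have "x \<in> skel n" using X' by auto
    then obtain m \<phi> y where y: "m < n" "\<phi> \<in> C m" "y \<in> open_disc m" "x = \<phi> y"
      by (rule skelE)
    then show "f x \<in> topspace Y"
      using continuous_map_image_subset_topspace [OF f [OF y(1,2)]] x open_disc_subset_disc [of m] by auto
  qed
  fix W assume W: "openin Y W"
  show "openin (subtopology M X) {x \<in> topspace (subtopology M X). f x \<in> W}"
  proof (rule openin_open_in_skel [OF X])
    fix m \<phi> assume m: "m < n" "\<phi> \<in> C m"
    have "{y \<in> disc m. \<phi> y \<in> {x \<in> topspace (subtopology M X). f x \<in> W}} = {y \<in> {y \<in> disc m. \<phi> y \<in> X}. f (\<phi> y) \<in> W}"
      using X' by auto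
    then show "openin (top_of_set {y \<in> disc m. \<phi> y \<in> X}) {y \<in> disc m. \<phi> y \<in> {x \<in> topspace (subtopology M X). f x \<in> W}}"
      using openin_continuous_map_preimage [OF f [OF m] W] by simp
  qed auto
qed

text \<open>The unit interval is compact, so the set of points \<open>x\<close> with
  \<open>f (J \<times> {x}) \<subseteq> W\<close>, for a closed interval \<open>J\<close>, is tested on cells.\<close>

lemma continuous_homotopy_on_skel:
  assumes X: "openin (subtopology M (skel n)) X"
    and f: "\<And>m \<phi>. m < n \<Longrightarrow> \<phi> \<in> C m \<Longrightarrow>
      continuous_map (top_of_set ({0..1::real} \<times> {y \<in> disc m. \<phi> y \<in> X})) Y (\<lambda>(t, y). f (t, \<phi> y))"
  shows "continuous_map (prod_topology (top_of_set {0..1}) (subtopology M X)) Y f"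
proof -
  have X': "X \<subseteq> skel n" "X \<subseteq> topspace M" using openin_subset [OF X] by auto
  let ?Z = "prod_topology (top_of_set {0..1::real}) (subtopology M X)"
  have top: "topspace ?Z = {0..1} \<times> X" using X' by auto
  have cell: "\<exists>m \<phi> y. m < n \<and> \<phi> \<in> C m \<and> y \<in> disc m \<and> x = \<phi> y" if "x \<in> X" for x
  proof -
    have "x \<in> skel n" using X' that by auto
    then obtain m \<phi> y where "m < n" "\<phi> \<in> C m" "y \<in> open_disc m" "x = \<phi> y"
      by (rule skelE)
    then show ?thesis using open_disc_subset_disc [of m] by auto
  qed
  show ?thesis
    unfolding continuous_map_def
  proof (intro conjI allI impI)
    show "f \<in> topspace ?Z \<rightarrow> topspace Y"
    proof
      fix p assume p: "p \<in> topspace ?Z"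
      then obtain t x where tx: "p = (t, x)" "t \<in> {0..1}" "x \<in> X" using top by auto
      then obtain m \<phi> y where y: "m < n" "\<phi> \<in> C m" "y \<in> disc m" "x = \<phi> y" using cell by blast
      have "(t, y) \<in> topspace (top_of_set ({0..1::real} \<times> {y \<in> disc m. \<phi> y \<in> X}))"
        using tx y by auto
      then have "(\<lambda>(t, y). f (t, \<phi> y)) (t, y) \<in> topspace Y"
        using continuous_map_image_subset_topspace [OF f [OF y(1,2)]] by blast
      then show "f p \<in> topspace Y" using tx y by simp
    qed
    fix W assume W: "openin Y W"
    show "openin ?Z {p \<in> topspace ?Z. f p \<in> W}"
    proof (subst openin_subopen, intro ballI)
      fix p assume p: "p \<in> {p \<in> topspace ?Z. f p \<in> W}"
      then obtain t x where tx: "p = (t, x)" "t \<in> {0..1}" "x \<in> X" "f (t, x) \<in> W" using top by auto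
      then obtain m \<phi> y where y: "m < n" "\<phi> \<in> C m" "y \<in> disc m" "x = \<phi> y" using cell by blast
      have pre: "openin (top_of_set ({0..1::real} \<times> {y \<in> disc m. \<phi> y \<in> X})) {(t, y). t \<in> {0..1} \<and> y \<in> disc m \<and> \<phi> y \<in> X \<and> f (t, \<phi> y) \<in> W}"
        if "m < n" "\<phi> \<in> C m" for m \<phi>
      proof -
        have "{(t, y). t \<in> {0..1} \<and> y \<in> disc m \<and> \<phi> y \<in> X \<and> f (t, \<phi> y) \<in> W}
          = {p \<in> topspace (top_of_set ({0..1::real} \<times> {y \<in> disc m. \<phi> y \<in> X})). (\<lambda>(t, y). f (t, \<phi> y)) p \<in> W}"
          by auto
        then show ?thesis
          using openin_continuous_map_preimage [OF f [OF that] W] by simp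
      qed
      have "continuous_on {0..1} (\<lambda>s::real. (s, y))"
        by (intro continuous_intros)
      then have "openin (top_of_set {0..1}) ({0..1} \<inter> (\<lambda>s::real. (s, y)) -` {(t, y). t \<in> {0..1} \<and> y \<in> disc m \<and> \<phi> y \<in> X \<and> f (t, \<phi> y) \<in> W})"
        by (rule continuous_openin_preimage) (use pre [OF y(1,2)] y tx in auto)
      moreover have "t \<in> {0..1} \<inter> (\<lambda>s::real. (s, y)) -` {(t, y). t \<in> {0..1} \<and> y \<in> disc m \<and> \<phi> y \<in> X \<and> f (t, \<phi> y) \<in> W}"
        using tx y by auto
      ultimately obtain e where e: "0 < e" "cball t e \<inter> {0..1} \<subseteq> {0..1} \<inter> (\<lambda>s::real. (s, y)) -` {(t, y). t \<in> {0..1} \<and> y \<in> disc m \<and> \<phi> y \<in> X \<and> f (t, \<phi> y) \<in> W}"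
        by (meson openin_contains_cball)
      define J where "J = cball t e \<inter> {0..1}"
      have J: "compact J" "J \<subseteq> {0..1}" by (auto simp: J_def compact_Int)
      define O' where "O' = {x \<in> X. \<forall>s\<in>J. f (s, x) \<in> W}"
      have "openin (subtopology M X) O'"
      proof (rule openin_open_in_skel [OF X])
        show "O' \<subseteq> X" by (auto simp: O'_def)
        fix k \<psi> assume k: "k < n" "\<psi> \<in> C k"
        let ?V = "{y \<in> disc k. \<psi> y \<in> X}"
        let ?B = "(J \<times> ?V) - {(t, y). t \<in> {0..1} \<and> y \<in> disc k \<and> \<psi> y \<in> X \<and> f (t, \<psi> y) \<in> W}"
        have "closedin (prod_topology (top_of_set J) (top_of_set ?V)) ?B"
        proof -
          have "openin (top_of_set (J \<times> ?V)) ((J \<times> ?V) \<inter> {(t, y). t \<in> {0..1} \<and> y \<in> disc k \<and> \<psi> y \<in> X \<and> f (t, \<psi> y) \<in> W})"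
            using pre [OF k] J(2) by (force simp: openin_subtopology)
          then have "closedin (top_of_set (J \<times> ?V)) (J \<times> ?V - ((J \<times> ?V) \<inter> {(t, y). t \<in> {0..1} \<and> y \<in> disc k \<and> \<psi> y \<in> X \<and> f (t, \<psi> y) \<in> W}))"
            by (intro closedin_diff) auto
          moreover have "prod_topology (top_of_set J) (top_of_set ?V) = top_of_set (J \<times> ?V)"
            by (rule prod_topology_top_of_set)
          ultimately show ?thesis by (simp add: Diff_Int)
        qed
        \<comment> \<open>The tube lemma: projection along the compact J is closed, so the points
          over which some parameter in J fails form a closed set.\<close>
        moreover have "closed_map (prod_topology (top_of_set J) (top_of_set ?V)) (top_of_set ?V) snd"
          using J(1) by (intro Abstract_Topological_Spaces.closed_map_snd) (simp add: compact_space_subtopology)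
        ultimately have "closedin (top_of_set ?V) (snd ` ?B)"
          by (simp add: closed_map_def)
        moreover have "{y \<in> disc k. \<psi> y \<in> O'} = ?V - snd ` ?B"
        proof (rule Set.set_eqI, rule iffI)
          fix y assume y: "y \<in> {y \<in> disc k. \<psi> y \<in> O'}"
          then have "f (s, \<psi> y) \<in> W" if "s \<in> J" for s using that by (auto simp: O'_def)
          with y J(2) show "y \<in> ?V - snd ` ?B" by (auto simp: O'_def)
        next
          fix y assume y: "y \<in> ?V - snd ` ?B"
          have "f (s, \<psi> y) \<in> W" if "s \<in> J" for s
          proof (rule ccontr)
            assume "f (s, \<psi> y) \<notin> W"
            then have "(s, y) \<in> ?B" using that y by auto
            then have "y \<in> snd ` ?B" by (rule rev_image_eqI) simp
            with y show False by blast
          qed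
          with y show "y \<in> {y \<in> disc k. \<psi> y \<in> O'}" by (auto simp: O'_def)
        qed
        ultimately show "openin (top_of_set ?V) {y \<in> disc k. \<psi> y \<in> O'}"
          by (simp add: openin_diff)
      qed
      moreover have "openin (top_of_set {0..1}) (ball t e \<inter> {0..1})"
        by (auto simp: openin_open)
      ultimately have "openin ?Z ((ball t e \<inter> {0..1}) \<times> O')"
        by (simp add: openin_prod_Times_iff)
      moreover have "p \<in> (ball t e \<inter> {0..1}) \<times> O'"
        using e tx y by (auto simp: O'_def J_def)
      moreover have "(ball t e \<inter> {0..1}) \<times> O' \<subseteq> {p \<in> topspace ?Z. f p \<in> W}"
        unfolding top by (auto simp: O'_def J_def)
      ultimately show "\<exists>V. openin ?Z V \<and> p \<in> V \<and> V \<subseteq> {p \<in> topspace ?Z. f p \<in> W}"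
        by blast
    qed
  qed
qed

end


section \<open>Open cells and the radial flow\<close>

lemma continuous_on_locally_constant:
  fixes f :: "'x::topological_space \<Rightarrow> 'y::topological_space"
  assumes "\<And>q. openin (top_of_set E) {y \<in> E. f y = q}"
  shows "continuous_on E f"
proof -
  have "openin (top_of_set E) (E \<inter> f -` U)" for U
  proof -
    have "E \<inter> f -` U = (\<Union>q\<in>U. {y \<in> E. f y = q})" by auto
    then show ?thesis using assms by auto
  qed
  then show ?thesis
    by (simp add: continuous_on_open_gen [of f E UNIV])
qed

lemma continuous_on_scale:
  fixes y :: "'z::topological_space \<Rightarrow> nat \<Rightarrow> real"
  assumes "continuous_on S a" "continuous_on S y"
  shows "continuous_on S (\<lambda>z i. a z * y z i)"
  by (intro continuous_on_coordinatewise_then_product continuous_on_mult assms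
      continuous_on_product_then_coordinatewise [OF assms(2)])

lemma continuous_on_combination:
  fixes x y :: "'z::topological_space \<Rightarrow> nat \<Rightarrow> real"
  assumes "continuous_on S a" "continuous_on S x" "continuous_on S b" "continuous_on S y"
  shows "continuous_on S (\<lambda>z i. a z * x z i + b z * y z i)"
  by (intro continuous_on_coordinatewise_then_product continuous_on_add continuous_on_mult assms
      continuous_on_product_then_coordinatewise [OF assms(2)] continuous_on_product_then_coordinatewise [OF assms(4)])

context cw_space
begin

text \<open>The choice is forced on \<open>cells n\<close>, since open cells are disjoint and
  injectively parametrised; elsewhere the value is arbitrary.\<close>

definition chart :: "nat \<Rightarrow> 'm \<Rightarrow> ((nat \<Rightarrow> real) \<Rightarrow> 'm) \<times> (nat \<Rightarrow> real)"
  where "chart n x = (SOME p. fst p \<in> C n \<and> snd p \<in> open_disc n \<and> x = fst p (snd p))"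

lemma chart_cell:
  assumes "\<phi> \<in> C n" "y \<in> open_disc n"
  shows "chart n (\<phi> y) = (\<phi>, y)"
proof -
  let ?P = "\<lambda>p. fst p \<in> C n \<and> snd p \<in> open_disc n \<and> \<phi> y = fst p (snd p)"
  have "?P (\<phi>, y)" using assms by simp
  then have p: "?P (chart n (\<phi> y))" unfolding chart_def by (rule someI)
  then show ?thesis
    using cells_disjoint(2,3) [of \<phi> n "fst (chart n (\<phi> y))" n y "snd (chart n (\<phi> y))"] assms
    by (simp add: prod_eq_iff)
qed

definition cell_part :: "nat \<Rightarrow> (nat \<Rightarrow> real) set \<Rightarrow> 'm set"
  where "cell_part n E = (\<Union>\<phi>\<in>C n. \<phi> ` E)"

lemma cells_eq_cell_part: "cells n = cell_part n (open_disc n)"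
  by (simp add: cells_def cell_part_def)

lemma cell_preimage_part:
  assumes "\<phi> \<in> C n" "E \<subseteq> open_disc n"
  shows "{y \<in> disc n. \<phi> y \<in> cell_part n E} = E"
proof (rule Set.set_eqI, rule iffI)
  fix y assume y: "y \<in> {y \<in> disc n. \<phi> y \<in> cell_part n E}"
  then obtain \<psi> z where z: "\<psi> \<in> C n" "z \<in> E" "\<phi> y = \<psi> z" by (auto simp: cell_part_def)
  then have "y \<in> open_disc n"
    using assms y cell_in_cells_iff [of \<phi> n y] cellsI [of \<psi> n z] by auto
  then show "y \<in> E"
    using cells_disjoint(3) [OF assms(1) z(1) _ _ z(3)] z assms(2) by auto
next
  fix y assume "y \<in> E"
  then show "y \<in> {y \<in> disc n. \<phi> y \<in> cell_part n E}"
    using assms open_disc_subset_disc [of n] by (auto simp: cell_part_def)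
qed

lemma lower_cell_preimage_part:
  assumes "\<phi> \<in> C m" "m < n" "E \<subseteq> open_disc n"
  shows "{y \<in> disc m. \<phi> y \<in> cell_part n E} = {}"
proof -
  have "cell_part n E \<subseteq> cells n"
    using assms(3) by (auto simp: cell_part_def cells_def)
  then show ?thesis
    using cell_skel [OF assms(1,2)] skel_disjoint [of n n] by blast
qed

lemma openin_cells: "openin (subtopology M (skel (Suc n))) (cells n)"
proof -
  have "cells n = (topspace M - skel n) \<inter> skel (Suc n)"
    using skel_disjoint [of n n] cells_subset [of n] by (auto simp: skel_Suc)
  then show ?thesis
    using closedin_skel_self by (metis closedin_def openin_subtopology_Int)
qed

lemma openin_cell_part:
  assumes "openin (top_of_set (open_disc n)) E"
  shows "openin (subtopology M (skel (Suc n))) (cell_part n E)"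
proof (rule openin_skel_iff [OF openin_cells])
  have E: "E \<subseteq> open_disc n" using openin_subset [OF assms] by simp
  then show "cell_part n E \<subseteq> cells n"
    by (auto simp: cell_part_def cells_def)
  fix m \<phi> assume m: "m < Suc n" "\<phi> \<in> C m"
  show "openin (top_of_set {y \<in> disc m. \<phi> y \<in> cells n}) {y \<in> disc m. \<phi> y \<in> cell_part n E}"
  proof (cases "m = n")
    case True
    then show ?thesis
      using m assms E by (simp add: cell_preimage_part cells_eq_cell_part)
  next
    case False
    then show ?thesis
      using m E by (simp add: lower_cell_preimage_part)
  qed
qed

lemma cell_part_subset: "E \<subseteq> open_disc n \<Longrightarrow> cell_part n E \<subseteq> topspace M"
  using cells_subset [of n] by (auto simp: cell_part_def cells_def)

lemma continuous_on_cell_part: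
  assumes E: "openin (top_of_set (open_disc n)) E"
    and f: "\<And>\<phi>. \<phi> \<in> C n \<Longrightarrow> continuous_map (top_of_set E) Y (\<lambda>y. f (\<phi> y))"
  shows "continuous_map (subtopology M (cell_part n E)) Y f"
proof (rule continuous_on_skel [OF openin_cell_part [OF E]])
  have E': "E \<subseteq> open_disc n" using openin_subset [OF E] by simp
  fix m \<phi> assume m: "m < Suc n" "\<phi> \<in> C m"
  show "continuous_map (top_of_set {y \<in> disc m. \<phi> y \<in> cell_part n E}) Y (\<lambda>y. f (\<phi> y))"
  proof (cases "m = n")
    case True
    then show ?thesis using m f E' by (simp add: cell_preimage_part)
  next
    case False
    then show ?thesis using m E' by (simp add: lower_cell_preimage_part)
  qed
qed

text \<open>Here p picks a point near which E is star-shaped in the sense of \<open>seg\<close>,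
  locally the same point. The straight contractions are performed in all n-cells
  simultaneously.\<close>

lemma scattered_cell_part:
  assumes E: "openin (top_of_set (open_disc n)) E"
    and p: "\<And>y. y \<in> E \<Longrightarrow> p y \<in> E" "\<And>q. openin (top_of_set E) {y \<in> E. p y = q}"
    and seg: "\<And>y c. y \<in> E \<Longrightarrow> 0 \<le> c \<Longrightarrow> c \<le> 1 \<Longrightarrow> (\<lambda>i. (1 - c) * y i + c * p y i) \<in> E"
  shows "scattered (subtopology M (cell_part n E))"
proof -
  have E': "E \<subseteq> open_disc n" using openin_subset [OF E] by simp
  let ?X = "subtopology M (cell_part n E)"
  have top: "topspace ?X = cell_part n E" using cell_part_subset [OF E'] by auto
  \<comment> \<open>Double speed and a cap at 1 make the contraction rest from time 1/2 on, as
    \<open>scattering\<close> demands.\<close>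
  define s where "s t y = (\<lambda>i. (1 - min (2 * t) 1) * y i + min (2 * t) 1 * p y i)" for t :: real and y
  define H where "H z = (let (\<phi>, y) = chart n (snd z) in \<phi> (s (fst z) y))" for z :: "real \<times> 'm"
  define k where "k x = (let (\<phi>, y) = chart n x in \<phi> (p y))" for x
  have H: "H (t, \<phi> y) = \<phi> (s t y)" if "\<phi> \<in> C n" "y \<in> E" for t \<phi> y
    using that E' by (simp add: H_def chart_cell subset_iff)
  have k: "k (\<phi> y) = \<phi> (p y)" if "\<phi> \<in> C n" "y \<in> E" for \<phi> y
    using that E' by (simp add: k_def chart_cell subset_iff)
  have sE: "s t y \<in> E" if "0 \<le> t" "y \<in> E" for t y
    unfolding s_def using that by (intro seg) auto
  have cp: "continuous_on E p" using p(2) by (rule continuous_on_locally_constant)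
  have cell: "continuous_map (top_of_set E) ?X \<phi>" if "\<phi> \<in> C n" for \<phi>
    using cell_continuous [OF that, of E] E' open_disc_subset_disc [of n] that
    by (auto simp: continuous_map_in_subtopology cell_part_def)
  have "continuous_map (prod_topology (top_of_set {0..1}) ?X) ?X H"
  proof (rule continuous_homotopy_on_skel [OF openin_cell_part [OF E]])
    fix m \<phi> assume m: "m < Suc n" "\<phi> \<in> C m"
    show "continuous_map (top_of_set ({0..1} \<times> {y \<in> disc m. \<phi> y \<in> cell_part n E})) ?X (\<lambda>(t, y). H (t, \<phi> y))"
    proof (cases "m = n")
      case True
      then have \<phi>: "\<phi> \<in> C n" using m by simp
      have "continuous_on ({0..1} \<times> E) (\<lambda>z :: real \<times> (nat \<Rightarrow> real). p (snd z))"
        by (rule continuous_on_compose2 [OF cp]) (auto intro: continuous_intros)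
      then have "continuous_on ({0..1} \<times> E) (\<lambda>z :: real \<times> (nat \<Rightarrow> real). s (fst z) (snd z))"
        unfolding s_def
        by (intro continuous_on_combination [OF _ continuous_on_snd [OF continuous_on_id]])
          (auto intro!: continuous_intros continuous_on_min)
      then have "continuous_map (top_of_set ({0..1} \<times> E)) (top_of_set E) (\<lambda>z. s (fst z) (snd z))"
        using sE by auto
      from continuous_map_compose [OF this cell [OF \<phi>]]
      have "continuous_map (top_of_set ({0..1} \<times> E)) ?X (\<lambda>z. \<phi> (s (fst z) (snd z)))"
        by (simp add: o_def)
      then have "continuous_map (top_of_set ({0..1} \<times> E)) ?X (\<lambda>(t, y). H (t, \<phi> y))"
        using H [OF \<phi>] by (auto elim!: continuous_map_eq)
      then show ?thesis
        using True \<phi> E' by (simp add: cell_preimage_part)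
    next
      case False
      then show ?thesis using m E' by (simp add: lower_cell_preimage_part)
    qed
  qed
  moreover have "H (0, x) = x \<and> (\<forall>t\<in>{1/2..1}. H (t, x) = k x)" if "x \<in> topspace ?X" for x
  proof -
    have "x \<in> cell_part n E" using that top by blast
    then obtain \<phi> y where y: "\<phi> \<in> C n" "y \<in> E" "x = \<phi> y" by (auto simp: cell_part_def)
    have "min (2 * t) 1 = 1" if "t \<ge> 1/2" for t :: real
      using that by auto
    then have "s t y = p y" if "t \<ge> 1/2" for t
      using that by (simp add: s_def)
    moreover have "s 0 y = y"
      by (simp add: s_def)
    ultimately show ?thesis
      using y H k by auto
  qed
  moreover have "openin ?X {x \<in> topspace ?X. k x = v}" for v
  proof (rule openin_open_in_skel [OF openin_cell_part [OF E]])
    fix m \<phi> assume m: "m < Suc n" "\<phi> \<in> C m"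
    show "openin (top_of_set {y \<in> disc m. \<phi> y \<in> cell_part n E}) {y \<in> disc m. \<phi> y \<in> {x \<in> topspace ?X. k x = v}}"
    proof (cases "m = n")
      case True
      have "{y \<in> disc m. \<phi> y \<in> {x \<in> topspace ?X. k x = v}} = {y \<in> {y \<in> disc m. \<phi> y \<in> cell_part n E}. k (\<phi> y) = v}"
        using top by auto
      also have "\<dots> = {y \<in> E. \<phi> (p y) = v}"
        using True m E' k by (auto simp: cell_preimage_part)
      also have "\<dots> = (\<Union>q\<in>{q. \<phi> q = v}. {y \<in> E. p y = q})" by auto
      finally show ?thesis
        using p(2) True m E' by (auto simp: cell_preimage_part)
    next
      case False
      then have "{y \<in> disc m. \<phi> y \<in> {x \<in> topspace ?X. k x = v}} = {}"
        using m E' lower_cell_preimage_part [of \<phi> m n E] top by auto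
      then show ?thesis by (metis openin_empty)
    qed
  qed (use top in auto)
  ultimately show ?thesis
    unfolding scattered_def scattering_def by blast
qed

text \<open>The 0-disc is a point, so every set of vertices is closed. The vertices are discrete and
  the constant homotopy is a scattering.\<close>

lemma scattered_vertices: "scattered (subtopology M (skel (Suc 0)))"
proof -
  have dis: "closedin M S" if "S \<subseteq> skel (Suc 0)" for S
  proof (rule closedin_skel [OF that])
    fix m \<phi> assume "m < Suc 0" "\<phi> \<in> C m"
    then have "disc m = {\<lambda>i. 0}"
      by (auto simp: disc_iff radius_def)
    then have "finite {y \<in> disc m. \<phi> y \<in> S}" by simp
    then have "closed {y \<in> disc m. \<phi> y \<in> S}" by (rule finite_imp_closed)
    then show "closedin (top_of_set (disc m)) {y \<in> disc m. \<phi> y \<in> S}"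
      by (auto intro: closed_subset)
  qed
  let ?X = "subtopology M (skel (Suc 0))"
  have "continuous_map (prod_topology (top_of_set {0..1::real}) ?X) ?X snd"
    by (rule continuous_map_snd)
  moreover have "openin ?X {x \<in> topspace ?X. x = v}" for v
  proof -
    have "closedin M (topspace ?X - {x \<in> topspace ?X. x = v})"
      by (rule dis) auto
    then have "closedin ?X (topspace ?X - {x \<in> topspace ?X. x = v})"
      by (rule closedin_subset_topspace) auto
    then show ?thesis
      by (subst openin_closedin) auto
  qed
  ultimately show ?thesis
    unfolding scattered_def scattering_def by (intro exI [of _ snd] exI [of _ "\<lambda>x. x"]) auto
qed

section \<open>The punctured skeleton and its radial retraction\<close>

definition punct :: "nat \<Rightarrow> 'm set"
  where "punct n = skel (Suc n) - centers n"

text \<open>The scaling factor runs from 1 at time 0 to the inverse radius at time 1, which pushes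
  points radially to the boundary sphere. On that sphere the factor is always 1, in accordance with
  the identity used off the open n-cells.\<close>

definition flow :: "nat \<Rightarrow> real \<times> 'm \<Rightarrow> 'm"
  where "flow n z = (if snd z \<in> cells n
    then (let (\<phi>, y) = chart n (snd z) in \<phi> (\<lambda>i. ((1 - fst z) + fst z / radius n y) * y i)) else snd z)"

definition retract :: "nat \<Rightarrow> 'm \<Rightarrow> 'm"
  where "retract n x = flow n (1, x)"

lemma centers_subset: "centers n \<subseteq> cells n"
  by (auto simp: centers_def cells_def)

lemma skel_subset_punct: "skel n \<subseteq> punct n"
  using centers_subset [of n] skel_disjoint [of n n] by (auto simp: punct_def skel_Suc)

lemma cell_in_punct_iff:
  assumes "\<phi> \<in> C n" "y \<in> disc n"
  shows "\<phi> y \<in> punct n \<longleftrightarrow> y \<noteq> (\<lambda>i. 0)"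
proof
  assume "\<phi> y \<in> punct n"
  then show "y \<noteq> (\<lambda>i. 0)" using assms(1) by (auto simp: punct_def centers_def)
next
  assume y: "y \<noteq> (\<lambda>i. 0)"
  have "\<phi> y \<notin> centers n"
  proof
    assume c: "\<phi> y \<in> centers n"
    then obtain \<psi> where \<psi>: "\<psi> \<in> C n" "\<phi> y = \<psi> (\<lambda>i. 0)" by (auto simp: centers_def)
    have "y \<in> open_disc n"
      using c centers_subset cell_in_cells_iff assms by blast
    then show False
      using cells_disjoint(3) [OF assms(1) \<psi>(1) _ _ \<psi>(2)] y by simp
  qed
  then show "\<phi> y \<in> punct n"
    using cell_skel [OF assms(1) _ assms(2), of "Suc n"] by (simp add: punct_def)
qed

lemma openin_punct: "openin (subtopology M (skel (Suc n))) (punct n)"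
proof -
  have "closedin M (centers n)"
  proof (rule closedin_skel)
    show "centers n \<subseteq> skel (Suc n)"
      using centers_subset by (auto simp: skel_Suc)
    fix m \<phi> assume m: "m < Suc n" "\<phi> \<in> C m"
    have "finite {y \<in> disc m. \<phi> y \<in> centers n}"
    proof (cases "m = n")
      case True
      then have "{y \<in> disc m. \<phi> y \<in> centers n} \<subseteq> {\<lambda>i. 0}"
        using m cell_in_punct_iff [of \<phi> n] cell_skel [of \<phi> n "Suc n"] by (auto simp: punct_def)
      then show ?thesis using finite_subset by blast
    next
      case False
      then have "{y \<in> disc m. \<phi> y \<in> centers n} = {}"
        using m cell_skel [of \<phi> m n] centers_subset [of n] skel_disjoint [of n n] by fastforce
      then show ?thesis by (metis finite.emptyI)
    qed
    then have "closed {y \<in> disc m. \<phi> y \<in> centers n}" by (rule finite_imp_closed)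
    then show "closedin (top_of_set (disc m)) {y \<in> disc m. \<phi> y \<in> centers n}"
      by (auto intro: closed_subset)
  qed
  moreover have "punct n = (topspace M - centers n) \<inter> skel (Suc n)"
    using skel_subset [of "Suc n"] by (auto simp: punct_def)
  ultimately show ?thesis
    by (metis closedin_def openin_subtopology_Int)
qed

lemma flow_cell:
  assumes "\<phi> \<in> C n" "y \<in> disc n" "y \<noteq> (\<lambda>i. 0)"
  shows "flow n (t, \<phi> y) = \<phi> (\<lambda>i. ((1 - t) + t / radius n y) * y i)"
proof (cases "y \<in> open_disc n")
  case True
  then show ?thesis
    using assms cellsI [of \<phi> n y] by (simp add: flow_def chart_cell)
next
  case False
  then have b: "y \<in> disc_boundary n" using assms(2) by (simp add: disc_eq)
  then have "\<phi> y \<notin> cells n" using False assms cell_in_cells_iff by blast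
  moreover have "radius n y = 1" using b by (simp add: disc_boundary_iff)
  ultimately show ?thesis by (simp add: flow_def)
qed

lemma flow_skel: "x \<in> skel n \<Longrightarrow> flow n (t, x) = x"
  using skel_disjoint [of n n] by (auto simp: flow_def)

lemma punctE:
  assumes "x \<in> punct n"
  obtains "x \<in> skel n" | \<phi> y where "\<phi> \<in> C n" "y \<in> disc n" "y \<noteq> (\<lambda>i. 0)" "x = \<phi> y"
proof (cases "x \<in> skel n")
  case False
  then have "x \<in> cells n" using assms by (auto simp: punct_def skel_Suc)
  then obtain \<phi> y where "\<phi> \<in> C n" "y \<in> open_disc n" "x = \<phi> y" by (rule cellsE)
  then show ?thesis
    using that(2) [of \<phi> y] assms cell_in_punct_iff [of \<phi> n y] open_disc_subset_disc [of n] by auto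
qed (use that in auto)

lemma scaled_in_disc:
  assumes "y \<in> disc n" "y \<noteq> (\<lambda>i. 0)" "0 \<le> t" "t \<le> 1"
  defines "z \<equiv> \<lambda>i. ((1 - t) + t / radius n y) * y i"
  shows "z \<in> disc n" "z \<noteq> (\<lambda>i. 0)" "radius n z = (1 - t) * radius n y + t"
proof -
  have r: "0 < radius n y" "radius n y \<le> 1"
    using assms radius_eq_0 [of n y] radius_nonneg [of n y] by (auto simp: disc_iff)
  have c: "0 \<le> (1 - t) + t / radius n y"
    using r assms by simp
  show z: "radius n z = (1 - t) * radius n y + t"
    unfolding z_def radius_scale [OF c] using r by (simp add: field_simps)
  have "(1 - t) * radius n y + t \<le> (1 - t) * 1 + t"
    using r assms by (intro add_right_mono mult_left_mono) auto
  then show "z \<in> disc n"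
    using z assms by (auto simp: disc_iff)
  have "0 < (1 - t) * radius n y + t"
    using r assms by (cases "t = 0") (auto intro: add_nonneg_pos)
  then show "z \<noteq> (\<lambda>i. 0)"
    using z by (auto simp: radius_def)
qed

lemma flow_0: "x \<in> punct n \<Longrightarrow> flow n (0, x) = x"
  by (erule punctE) (auto simp: flow_skel flow_cell)

lemma flow_punct:
  assumes x: "x \<in> punct n" and t: "0 \<le> t" "t \<le> 1"
  shows "flow n (t, x) \<in> punct n"
  using x
proof (rule punctE)
  assume "x \<in> skel n"
  then show ?thesis using x by (simp add: flow_skel)
next
  fix \<phi> y assume y: "\<phi> \<in> C n" "y \<in> disc n" "y \<noteq> (\<lambda>i. 0)" "x = \<phi> y"
  then show ?thesis
    using scaled_in_disc [OF y(2,3) t] by (simp add: flow_cell cell_in_punct_iff)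
qed

text \<open>The flow changes the length of a coordinate vector but not its direction. Hence the
  points retracting into a given set are preserved by it.\<close>

lemma retract_flow:
  assumes x: "x \<in> punct n" and t: "0 \<le> t" "t \<le> 1"
  shows "retract n (flow n (t, x)) = retract n x"
  using x
proof (rule punctE)
  assume "x \<in> skel n"
  then show ?thesis by (simp add: flow_skel retract_def)
next
  fix \<phi> y assume y: "\<phi> \<in> C n" "y \<in> disc n" "y \<noteq> (\<lambda>i. 0)" "x = \<phi> y"
  let ?z = "\<lambda>i. ((1 - t) + t / radius n y) * y i"
  note z = scaled_in_disc [OF y(2,3) t]
  have r: "0 < radius n y"
    using y radius_eq_0 [of n y] radius_nonneg [of n y] by (auto simp: disc_iff)
  have "(1 - t) * radius n y + t > 0"
    using r t by (cases "t = 0") (auto intro: add_nonneg_pos)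
  then have "(1 / radius n ?z) * ?z i = (1 / radius n y) * y i" for i
    unfolding z(3) using r by (simp add: divide_simps)
  then show ?thesis
    unfolding retract_def y(4) flow_cell [OF y(1-3)] flow_cell [OF y(1) z(1,2)] by simp
qed

lemma retract_skel:
  assumes x: "x \<in> punct n"
  shows "retract n x \<in> skel n"
  using x
proof (rule punctE)
  assume "x \<in> skel n"
  then show ?thesis by (simp add: flow_skel retract_def)
next
  fix \<phi> y assume y: "\<phi> \<in> C n" "y \<in> disc n" "y \<noteq> (\<lambda>i. 0)" "x = \<phi> y"
  let ?z = "\<lambda>i. ((1 - 1) + 1 / radius n y) * y i"
  note z = scaled_in_disc [OF y(2,3), of 1]
  have "?z \<in> disc_boundary n"
    using z by (auto simp: disc_boundary_iff disc_iff)
  then show ?thesis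
    unfolding retract_def y(4) flow_cell [OF y(1-3)] using cell_boundary [OF y(1)] by simp
qed

lemma retract_id: "x \<in> skel n \<Longrightarrow> retract n x = x"
  by (simp add: retract_def flow_skel)

lemma punct_subset: "punct n \<subseteq> topspace M"
  using skel_subset by (auto simp: punct_def)

lemma continuous_flow:
  "continuous_map (prod_topology (top_of_set {0..1}) (subtopology M (punct n))) (subtopology M (punct n)) (flow n)"
proof (rule continuous_homotopy_on_skel [OF openin_punct])
  fix m \<phi> assume m: "m < Suc n" "\<phi> \<in> C m"
  let ?S = "{y \<in> disc m. \<phi> y \<in> punct n}"
  have c: "continuous_map (top_of_set ?S) (subtopology M (punct n)) \<phi>"
    using cell_continuous [OF m(2), of ?S] by (auto simp: continuous_map_in_subtopology)
  show "continuous_map (top_of_set ({0..1} \<times> ?S)) (subtopology M (punct n)) (\<lambda>(t, y). flow n (t, \<phi> y))"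
  proof (cases "m = n")
    case True
    then have \<phi>: "\<phi> \<in> C n" using m by simp
    let ?s = "\<lambda>z :: real \<times> (nat \<Rightarrow> real). \<lambda>i. ((1 - fst z) + fst z / radius n (snd z)) * snd z i"
    have S: "y \<in> ?S \<longleftrightarrow> y \<in> disc n \<and> y \<noteq> (\<lambda>i. 0)" for y
      using True cell_in_punct_iff [OF \<phi>] by auto
    have r: "radius n y \<noteq> 0" if "y \<in> ?S" for y
      using that radius_eq_0 [of n y] S [of y] by (auto simp: disc_iff)
    have "continuous_on ({0..1} \<times> ?S) ?s"
      by (intro continuous_on_scale [OF _ continuous_on_snd [OF continuous_on_id]] continuous_on_add continuous_on_divide
          continuous_on_radius continuous_on_diff continuous_on_const continuous_on_fst continuous_on_snd continuous_on_id)
        (use r in auto)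
    moreover have "?s z \<in> ?S" if z: "z \<in> {0..1} \<times> ?S" for z
    proof -
      have "snd z \<in> disc n" "snd z \<noteq> (\<lambda>i. 0)" "0 \<le> fst z" "fst z \<le> 1"
        using z S [of "snd z"] by auto
      then show ?thesis unfolding S using scaled_in_disc(1,2) by blast
    qed
    ultimately have "continuous_map (top_of_set ({0..1} \<times> ?S)) (top_of_set ?S) ?s"
      by auto
    from continuous_map_compose [OF this c]
    have "continuous_map (top_of_set ({0..1} \<times> ?S)) (subtopology M (punct n)) (\<lambda>z. \<phi> (?s z))"
      by (simp add: o_def)
    then show ?thesis
      by (rule continuous_map_eq) (use S flow_cell [OF \<phi>] in auto)
  next
    case False
    then have "flow n (t, \<phi> y) = \<phi> y" if "y \<in> disc m" for t y
      using m that cell_skel [of \<phi> m n y] by (simp add: flow_skel)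
    moreover have "continuous_map (top_of_set ({0..1} \<times> ?S)) (top_of_set ?S) (snd :: real \<times> _ \<Rightarrow> _)"
      by (auto intro: continuous_intros)
    from continuous_map_compose [OF this c]
    have "continuous_map (top_of_set ({0..1::real} \<times> ?S)) (subtopology M (punct n)) (\<lambda>z. \<phi> (snd z))"
      by (simp add: o_def)
    ultimately show ?thesis
      by (auto elim!: continuous_map_eq)
  qed
qed

lemma continuous_retract: "continuous_map (subtopology M (punct n)) (subtopology M (skel n)) (retract n)"
proof -
  have "continuous_map (subtopology M (punct n)) (prod_topology (top_of_set {0..1}) (subtopology M (punct n))) (\<lambda>x. (1::real, x))"
    by (simp add: continuous_map_pairwise o_def)
  from continuous_map_compose [OF this continuous_flow]
  have "continuous_map (subtopology M (punct n)) (subtopology M (punct n)) (retract n)"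
    by (simp add: o_def retract_def [abs_def])
  then show ?thesis
    using retract_skel by (auto simp: continuous_map_in_subtopology)
qed

text \<open>Flow to the lower skeleton, then scatter there; the first stage stays inside the set by
  \<open>retract_flow\<close>.\<close>

lemma scattered_retract:
  assumes Y: "Y \<subseteq> skel n" and sc: "scattered (subtopology M Y)"
  shows "scattered (subtopology M {x \<in> punct n. retract n x \<in> Y})"
proof -
  obtain F k where F: "scattering (subtopology M Y) F k"
    using sc unfolding scattered_def by blast
  let ?I = "top_of_set {0..1::real}"
  let ?X = "{x \<in> punct n. retract n x \<in> Y}"
  have topY: "topspace (subtopology M Y) = Y" using Y skel_subset by auto
  have topX: "topspace (subtopology M ?X) = ?X" using punct_subset by auto
  have cF: "continuous_map (prod_topology ?I (subtopology M Y)) (subtopology M Y) F"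
    using F by (simp add: scattering_def)
  have YX: "Y \<subseteq> ?X"
    using Y skel_subset_punct [of n] retract_id [of _ n] by auto
  let ?Z = "prod_topology ?I (subtopology M ?X)"
  have topZ: "topspace ?Z = {0..1} \<times> ?X" by (simp only: topspace_prod_topology topX) simp
  have fstZ: "continuous_map ?Z euclideanreal fst"
    using continuous_map_fst [of ?I "subtopology M ?X"] by (simp add: continuous_map_in_subtopology)
  have X_punct: "continuous_map (subtopology M ?X) (subtopology M (punct n)) (\<lambda>x. x)"
    by (auto simp: continuous_map_in_subtopology)
  have rX: "continuous_map (subtopology M ?X) (subtopology M Y) (retract n)"
    using continuous_map_compose [OF X_punct continuous_retract]
    by (auto simp: continuous_map_in_subtopology o_def)
  \<comment> \<open>The flow takes the time up to 1/4 and F the next quarter, both at fourfold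
    speed, so everything is at rest at 1/2. The clamps make each branch continuous on the entire
    product.\<close>
  define H where "H z = (if fst z \<le> 1/4 then flow n (min 1 (4 * fst z), snd z)
     else F (max 0 (min 1 (4 * fst z - 1)), retract n (snd z)))" for z
  have I: "continuous_map ?Z ?I f" if "continuous_map ?Z euclideanreal f" "\<And>z. z \<in> topspace ?Z \<Longrightarrow> f z \<in> {0..1}" for f
    using that by (auto simp: continuous_map_in_subtopology)
  have sndZ: "continuous_map ?Z (subtopology M (punct n)) snd"
    using continuous_map_compose [OF continuous_map_snd X_punct, of ?I] by (simp add: o_def)
  have c1: "continuous_map ?Z (subtopology M ?X) (\<lambda>z. flow n (min 1 (4 * fst z), snd z))"
  proof -
    have "continuous_map ?Z ?I (\<lambda>z. min 1 (4 * fst z))"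
      by (rule I) (auto intro!: continuous_intros fstZ simp: topZ)
    then have "continuous_map ?Z (prod_topology ?I (subtopology M (punct n))) (\<lambda>z. (min 1 (4 * fst z), snd z))"
      using sndZ by (simp add: continuous_map_pairwise o_def)
    from continuous_map_compose [OF this continuous_flow]
    have "continuous_map ?Z (subtopology M (punct n)) (\<lambda>z. flow n (min 1 (4 * fst z), snd z))"
      by (simp add: o_def)
    then show ?thesis
      using flow_punct [of _ n] retract_flow [of _ n] by (auto simp: continuous_map_in_subtopology topZ min_def)
  qed
  have c2: "continuous_map ?Z (subtopology M ?X) (\<lambda>z. F (max 0 (min 1 (4 * fst z - 1)), retract n (snd z)))"
  proof -
    have "continuous_map ?Z ?I (\<lambda>z. max 0 (min 1 (4 * fst z - 1)))"
      by (rule I) (auto intro!: continuous_intros fstZ simp: topZ)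
    moreover have "continuous_map ?Z (subtopology M Y) (\<lambda>z. retract n (snd z))"
      using continuous_map_compose [OF continuous_map_snd rX, of ?I] by (simp add: o_def)
    ultimately have "continuous_map ?Z (prod_topology ?I (subtopology M Y)) (\<lambda>z. (max 0 (min 1 (4 * fst z - 1)), retract n (snd z)))"
      by (simp add: continuous_map_pairwise o_def)
    from continuous_map_compose [OF this cF] show ?thesis
      using YX by (auto simp: continuous_map_in_subtopology o_def)
  qed
  have F0: "F (0, y) = y" and F1: "t \<in> {1/2..1} \<Longrightarrow> F (t, y) = k y" if "y \<in> Y" for y t
    using F that topY by (auto simp: scattering_def)
  have "continuous_map ?Z (subtopology M ?X) H"
    unfolding H_def
  proof (rule continuous_map_cases_le)
    show "flow n (min 1 (4 * fst z), snd z) = F (max 0 (min 1 (4 * fst z - 1)), retract n (snd z))"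
      if "z \<in> topspace ?Z" "fst z = 1/4" for z
      using that F0 topZ by (auto simp: retract_def)
  qed (auto intro: fstZ continuous_map_from_subtopology c1 c2)
  moreover have "H (0, x) = x \<and> (\<forall>t\<in>{1/2..1}. H (t, x) = k (retract n x))" if "x \<in> topspace (subtopology M ?X)" for x
    using that topX F1 [of "retract n x"] by (auto simp: H_def flow_0)
  moreover have "openin (subtopology M ?X) {x \<in> topspace (subtopology M ?X). k (retract n x) = v}" for v
  proof -
    have "openin (subtopology M Y) {y \<in> Y. k y = v}"
      using F unfolding scattering_def topY by blast
    from openin_continuous_map_preimage [OF rX this] show ?thesis
      using topX by (auto elim!: back_subst [of "openin (subtopology M ?X)"])
  qed
  ultimately have "scattering (subtopology M ?X) H (\<lambda>x. k (retract n x))"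
    unfolding scattering_def by (intro conjI ballI allI) auto
  then show ?thesis
    unfolding scattered_def by blast
qed

end


section \<open>The two pieces of a two-dimensional complex\<close>

lemma radius_eq_L2_set: "radius n y = L2_set y {..<n}"
  by (simp add: radius_def L2_set_def)

lemma open_disc_convex:
  assumes "y \<in> open_disc n" "z \<in> open_disc n" "0 \<le> c" "c \<le> 1"
  shows "(\<lambda>i. (1 - c) * y i + c * z i) \<in> open_disc n"
proof -
  have "radius n (\<lambda>i. (1 - c) * y i + c * z i) \<le> radius n (\<lambda>i. (1 - c) * y i) + radius n (\<lambda>i. c * z i)"
    unfolding radius_eq_L2_set by (rule L2_set_triangle_ineq)
  also have "\<dots> = (1 - c) * radius n y + c * radius n z"
    using assms by (simp add: radius_scale)
  also have "\<dots> < 1"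
    using assms convex_bound_lt [of "radius n y" 1 "radius n z" "1 - c" c] by (auto simp: open_disc_iff)
  finally show ?thesis
    using assms by (auto simp: open_disc_iff)
qed

lemma radius_bary: "radius 2 (bary a b 0) = sqrt (a\<^sup>2 + b\<^sup>2)"
  by (simp add: radius_def bary_def numeral_2_eq_2)

lemma radius_1: "radius (Suc 0) y = \<bar>y 0\<bar>"
  by (simp add: radius_def)

lemma bary_in_open_disc: "bary a b 0 \<in> open_disc 2 \<longleftrightarrow> a\<^sup>2 + b\<^sup>2 < 1"
  by (simp add: open_disc_iff radius_bary) (simp add: bary_def)

lemma disc_2_bary: "y \<in> disc 2 \<Longrightarrow> y = bary (y 0) (y (Suc 0)) 0"
proof (rule ext)
  fix i assume "y \<in> disc 2"
  then show "y i = bary (y 0) (y (Suc 0)) 0 i"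
    by (cases "i = 0"; cases "i = 1") (auto simp: disc_iff bary_def)
qed

lemma convex_pos:
  fixes a b c :: real
  assumes "0 < a" "0 < b" "0 \<le> c" "c \<le> 1"
  shows "0 < (1 - c) * a + c * b"
proof (cases "c = 0")
  case False
  then show ?thesis using assms by (intro add_nonneg_pos mult_nonneg_nonneg mult_pos_pos) auto
qed (use assms in simp)

lemma openin_Collect_fiber:
  assumes "openin (top_of_set E) {y \<in> E. R y}" "openin (top_of_set E) {y \<in> E. \<not> R y}"
  shows "openin (top_of_set E) {y \<in> E. (if R y then a else b) = q}"
proof -
  have "{y \<in> E. (if R y then a else b) = q} = (if a = q then {y \<in> E. R y} else {}) \<union> (if b = q then {y \<in> E. \<not> R y} else {})"
    by auto
  then show ?thesis
    using assms by auto
qed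

lemma continuous_on_proj [continuous_intros]: "continuous_on S (\<lambda>y :: nat \<Rightarrow> real. y i)"
  by (rule continuous_on_product_then_coordinatewise [OF continuous_on_id])

lemma openin_less:
  fixes f g :: "'z::topological_space \<Rightarrow> real"
  assumes "continuous_on E f" "continuous_on E g"
  shows "openin (top_of_set E) {y \<in> E. f y < g y}"
proof -
  have "openin (top_of_set E) (E \<inter> (\<lambda>y. g y - f y) -` {0<..})"
    by (intro continuous_openin_preimage_gen continuous_intros assms)
  moreover have "E \<inter> (\<lambda>y. g y - f y) -` {0<..} = {y \<in> E. f y < g y}" by auto
  ultimately show ?thesis by simp
qed

context cw_space
begin

lemma cell_part_Int:
  assumes "E \<subseteq> open_disc n" "F \<subseteq> open_disc n"
  shows "cell_part n E \<inter> cell_part n F = cell_part n (E \<inter> F)"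
proof
  show "cell_part n E \<inter> cell_part n F \<subseteq> cell_part n (E \<inter> F)"
  proof
    fix x assume "x \<in> cell_part n E \<inter> cell_part n F"
    then obtain \<phi> y \<psi> z where *: "\<phi> \<in> C n" "y \<in> E" "x = \<phi> y" "\<psi> \<in> C n" "z \<in> F" "x = \<psi> z"
      by (auto simp: cell_part_def)
    then have "y = z"
      using cells_disjoint(3) [of \<phi> n \<psi> n y z] assms by auto
    then show "x \<in> cell_part n (E \<inter> F)"
      using * by (auto simp: cell_part_def)
  qed
qed (auto simp: cell_part_def)

lemma cell_part_Un: "cell_part n E \<union> cell_part n F = cell_part n (E \<union> F)"
  by (auto simp: cell_part_def)

lemma punct_Int_cells: "punct n \<inter> cells n = cell_part n (open_disc n - {\<lambda>i. 0})"
proof (rule Set.set_eqI, rule iffI)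
  fix x assume x: "x \<in> punct n \<inter> cells n"
  then have "x \<in> cells n" by simp
  then obtain \<phi> y where "\<phi> \<in> C n" "y \<in> open_disc n" "x = \<phi> y" by (rule cellsE)
  then show "x \<in> cell_part n (open_disc n - {\<lambda>i. 0})"
    using x cell_in_punct_iff [of \<phi> n y] open_disc_subset_disc [of n] by (auto simp: cell_part_def)
next
  fix x assume "x \<in> cell_part n (open_disc n - {\<lambda>i. 0})"
  then obtain \<phi> y where "\<phi> \<in> C n" "y \<in> open_disc n" "y \<noteq> (\<lambda>i. 0)" "x = \<phi> y" by (auto simp: cell_part_def)
  then show "x \<in> punct n \<inter> cells n"
    using cell_in_punct_iff [of \<phi> n y] open_disc_subset_disc [of n] cellsI [of \<phi> n y] by auto
qed

lemma scattered_cells: "scattered (subtopology M (cells n))"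
  unfolding cells_eq_cell_part
proof (rule scattered_cell_part [where p = "\<lambda>y i. 0"])
  show "(\<lambda>i. (1 - c) * y i + c * 0) \<in> open_disc n" if "y \<in> open_disc n" "0 \<le> c" "c \<le> 1" for y c
    using open_disc_convex [of y n "\<lambda>i. 0" c] that by simp
  show "openin (top_of_set (open_disc n)) {y \<in> open_disc n. (\<lambda>i. 0) = q}" for q :: "nat \<Rightarrow> real"
    by (cases "(\<lambda>i. 0) = q") auto
qed auto

text \<open>The value 1 off the open n-cells is the radius on the boundary sphere, which makes the
  function continuous on \<open>skel (Suc n)\<close>. It supplies the cut-off functions for
  edges.\<close>

definition depth :: "nat \<Rightarrow> 'm \<Rightarrow> real"
  where "depth n x = (if x \<in> cells n then radius n (snd (chart n x)) else 1)"

lemma depth_cell: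
  assumes "\<phi> \<in> C n" "y \<in> disc n"
  shows "depth n (\<phi> y) = radius n y"
proof (cases "y \<in> open_disc n")
  case True
  then show ?thesis
    using assms cellsI [of \<phi> n y] by (simp add: depth_def chart_cell)
next
  case False
  then have "y \<in> disc_boundary n" using assms by (simp add: disc_eq)
  then show ?thesis
    using assms False cell_in_cells_iff [of \<phi> n y] by (simp add: depth_def disc_boundary_iff)
qed

lemma depth_skel: "x \<in> skel n \<Longrightarrow> depth n x = 1"
  using skel_disjoint [of n n] by (auto simp: depth_def)

lemma continuous_depth: "continuous_map (subtopology M (skel (Suc n))) euclideanreal (depth n)"
proof (rule continuous_on_skel)
  show "openin (subtopology M (skel (Suc n))) (skel (Suc n))"
    using skel_subset [of "Suc n"] by (simp add: openin_subtopology_refl)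
  fix m \<phi> assume m: "m < Suc n" "\<phi> \<in> C m"
  show "continuous_map (top_of_set {y \<in> disc m. \<phi> y \<in> skel (Suc n)}) euclideanreal (\<lambda>y. depth n (\<phi> y))"
  proof (cases "m = n")
    case True
    have "continuous_on {y \<in> disc m. \<phi> y \<in> skel (Suc n)} (radius n)"
      by (rule continuous_on_radius [OF continuous_on_id])
    then show ?thesis
      using True m depth_cell [of \<phi> n] by (auto elim: continuous_on_eq)
  next
    case False
    then have "\<forall>y\<in>{y \<in> disc m. \<phi> y \<in> skel (Suc n)}. depth n (\<phi> y) = 1"
      using m cell_skel [of \<phi> m n] depth_skel by simp
    then show ?thesis
      by (auto intro: continuous_on_eq [OF continuous_on_const])
  qed
qed

end

locale cw2_group = path_connected_group G T + cw_space M C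
  for G (structure) and T and M :: "'m topology" and C +
  assumes dim2: "k > 2 \<Longrightarrow> C k = {}"
begin

abbreviation "A \<equiv> punct 2"
abbreviation "B \<equiv> cells 2"

lemma topspace_eq_skel: "topspace M = skel (Suc 2)"
proof
  show "topspace M \<subseteq> skel (Suc 2)"
  proof
    fix x assume "x \<in> topspace M"
    then obtain n \<phi> y where "\<phi> \<in> C n" "y \<in> open_disc n" "x = \<phi> y"
      unfolding cells_cover by blast
    moreover from this have "n < Suc 2"
      using dim2 [of n] by force
    ultimately show "x \<in> skel (Suc 2)"
      by (auto simp: skel_def cells_def)
  qed
qed (rule skel_subset)

lemma subtopology_skel_2: "subtopology M (skel (Suc 2)) = M"
  by (metis subtopology_topspace topspace_eq_skel)

lemma openin_A: "openin M A" and openin_B: "openin M B"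
  using openin_punct [of 2] openin_cells [of 2] by (simp_all only: subtopology_skel_2)

lemma A_Un_B: "topspace M = A \<union> B"
  unfolding topspace_eq_skel punct_def skel_Suc using centers_subset [of 2] by blast

lemma A_subset: "A \<subseteq> topspace M"
  by (rule punct_subset)

text \<open>\<open>retract 2\<close> maps A to the 1-skeleton, which is \<open>skel 2\<close> in
  this indexing. The 1-skeleton is covered by the complement of the edge midpoints and by the open
  edges, and this cover is pulled back to A.\<close>

definition near_vertices where "near_vertices = {x \<in> A. retract 2 x \<in> punct 1}"
definition over_edges where "over_edges = {x \<in> A. retract 2 x \<in> cells 1}"

lemma sub_A: "S \<subseteq> A \<Longrightarrow> subtopology (subtopology M A) S = subtopology M S"
  by (simp add: subtopology_subtopology Int_absorb1)

lemma skel_2: "skel 2 = punct 1 \<union> cells 1"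
proof -
  have "skel 2 = skel (Suc 1)" by (simp add: numeral_2_eq_2)
  then show ?thesis
    unfolding punct_def skel_Suc using centers_subset [of 1] by blast
qed

lemma openin_edge_cover: "openin (subtopology M A) near_vertices" "openin (subtopology M A) over_edges"
proof -
  have *: "openin (subtopology M (skel 2)) (punct 1)" "openin (subtopology M (skel 2)) (cells 1)"
    using openin_punct [of 1] openin_cells [of 1] by (simp_all add: numeral_2_eq_2)
  have "topspace (subtopology M A) = A" using A_subset by auto
  then show "openin (subtopology M A) near_vertices" "openin (subtopology M A) over_edges"
    using openin_continuous_map_preimage [OF continuous_retract *(1)] openin_continuous_map_preimage [OF continuous_retract *(2)]
    by (simp_all add: near_vertices_def over_edges_def)
qed

lemma edge_cover: "topspace (subtopology M A) = near_vertices \<union> over_edges"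
proof -
  have "retract 2 x \<in> punct 1 \<union> cells 1" if "x \<in> A" for x
    using retract_skel [OF that] skel_2 by simp
  then show ?thesis
    using A_subset by (auto simp: near_vertices_def over_edges_def)
qed

lemma scattered_edge_cover:
  "scattered (subtopology (subtopology M A) near_vertices)"
  "scattered (subtopology (subtopology M A) over_edges)"
  "scattered (subtopology (subtopology M A) (near_vertices \<inter> over_edges))"
proof -
  have "{x \<in> punct 1. retract 1 x \<in> skel 1} = punct 1"
    using retract_skel [of _ 1] by auto
  then have 0: "scattered (subtopology M (punct 1))"
    using scattered_retract [of "skel 1" 1] scattered_vertices by simp
  have "scattered (subtopology M {x \<in> punct 2. retract 2 x \<in> punct 1})"
    by (rule scattered_retract [OF _ 0]) (use skel_2 in auto)
  then show "scattered (subtopology (subtopology M A) near_vertices)"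
    by (subst sub_A) (auto simp: near_vertices_def)
  have "scattered (subtopology M {x \<in> punct 2. retract 2 x \<in> cells 1})"
    by (rule scattered_retract [OF _ scattered_cells]) (use skel_2 in auto)
  then show "scattered (subtopology (subtopology M A) over_edges)"
    by (subst sub_A) (auto simp: over_edges_def)
  let ?E = "open_disc 1 - {\<lambda>i. 0}"
  have nz: "y 0 \<noteq> 0" if "y \<in> ?E" for y
    using that radius_eq_0 [of 1 y] by (auto simp: open_disc_iff radius_1)
  \<comment> \<open>An open edge without its midpoint has two halves; each is contracted to its own
    point, at coordinate 1/2 or -1/2.\<close>
  let ?p = "\<lambda>y :: nat \<Rightarrow> real. if 0 < y 0 then bary (1/2) 0 0 else bary (-1/2) 0 0"
  have "scattered (subtopology M (cell_part 1 ?E))"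
  proof (rule scattered_cell_part [where p = ?p])
    show "openin (top_of_set (open_disc 1)) ?E"
      by (simp add: openin_delete)
    have b: "bary (1/2) 0 0 \<in> open_disc 1" "bary (-1/2) 0 0 \<in> open_disc 1"
      by (auto simp: open_disc_iff radius_1) (auto simp: bary_def)
    then show "?p y \<in> ?E" for y
      by (auto simp: bary_def fun_eq_iff)
    show "openin (top_of_set ?E) {y \<in> ?E. ?p y = q}" for q
    proof (rule openin_Collect_fiber)
      show "openin (top_of_set ?E) {y \<in> ?E. 0 < y 0}"
        by (intro openin_less continuous_intros)
      have "{y \<in> ?E. \<not> 0 < y 0} = {y \<in> ?E. y 0 < 0}"
        using nz by (metis (no_types, lifting) linorder_neqE_linordered_idom order_less_asym')
      then show "openin (top_of_set ?E) {y \<in> ?E. \<not> 0 < y 0}"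
        using openin_less [of ?E "\<lambda>y. y 0" "\<lambda>y. 0"] by (simp add: continuous_intros)
    qed
    show "(\<lambda>i. (1 - c) * y i + c * ?p y i) \<in> ?E" if y: "y \<in> ?E" and c: "0 \<le> c" "c \<le> 1" for y c
    proof -
      have "(\<lambda>i. (1 - c) * y i + c * ?p y i) \<in> open_disc 1"
        using b y c by (intro open_disc_convex) auto
      moreover have "(1 - c) * y 0 + c * ?p y 0 \<noteq> 0"
      proof (cases "0 < y 0")
        case True
        then have "(1 - c) * y 0 + c * (1/2) > 0"
          using c by (intro convex_pos) auto
        then show ?thesis using True by simp
      next
        case False
        then have "y 0 < 0" using nz [OF y] by simp
        then have "(1 - c) * (- y 0) + c * (1/2) > 0"
          using c by (intro convex_pos) auto
        then show ?thesis using False by simp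
      qed
      then have "(\<lambda>i. (1 - c) * y i + c * ?p y i) \<noteq> (\<lambda>i. 0)"
        by (metis (no_types, lifting))
      ultimately show ?thesis by blast
    qed
  qed
  then have "scattered (subtopology M (punct 1 \<inter> cells 1))"
    by (simp add: punct_Int_cells)
  then have "scattered (subtopology M {x \<in> punct 2. retract 2 x \<in> punct 1 \<inter> cells 1})"
    by (rule scattered_retract [rotated]) (use skel_2 in auto)
  moreover have "{x \<in> punct 2. retract 2 x \<in> punct 1 \<inter> cells 1} = near_vertices \<inter> over_edges"
    by (auto simp: near_vertices_def over_edges_def)
  ultimately show "scattered (subtopology (subtopology M A) (near_vertices \<inter> over_edges))"
    by (subst sub_A) (auto simp: near_vertices_def)
qed

lemma H2_A:
  assumes "pi.cocycle (Suc (Suc 0)) (subtopology M A) f"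
  shows "\<exists>a. pi.cochain (Suc 0) (subtopology M A) a \<and>
    (\<forall>c. singular_chain (Suc (Suc 0)) (subtopology M A) c \<longrightarrow> f c = a (chain_boundary (Suc (Suc 0)) c))"
  using pi.cocycle_2_coboundary [OF openin_edge_cover equalityD1 [OF edge_cover] scattered_edge_cover assms] by metis

lemma H1_A:
  assumes "pi.cocycle (Suc 0) (subtopology M A) z"
  shows "\<exists>u. represents (subtopology M A) u z"
proof -
  let ?d = "\<lambda>x. depth 1 (retract 2 x)"
  have "continuous_map (subtopology M (skel 2)) euclideanreal (depth 1)"
    using continuous_depth [of 1] by (simp add: numeral_2_eq_2)
  from continuous_map_compose [OF continuous_retract this]
  have d: "continuous_map (subtopology M A) euclideanreal ?d"
    by (simp add: o_def)
  have top: "topspace (subtopology M A) = A" using A_subset by auto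
  obtain u where "represents (subtopology M A) u z"
  proof (rule represents_onto [OF openin_edge_cover edge_cover scattered_edge_cover])
    \<comment> \<open>Points outside \<open>over_edges\<close> have depth 1 and points outside
      \<open>near_vertices\<close> depth 0. The clamped linear function is 0 from depth 2/3 on and 1
      up to depth 1/3, hence constant near both sets.\<close>
    show "continuous_map (subtopology M A) euclideanreal (\<lambda>x. max 0 (min 1 (2 - 3 * ?d x)))"
      by (intro continuous_intros d)
    show "openin (subtopology M A) {x \<in> A. 2/3 < ?d x}"
      using openin_continuous_map_preimage [OF d, of "{2/3<..}"] unfolding top by simp
    show "openin (subtopology M A) {x \<in> A. ?d x < 1/3}"
      using openin_continuous_map_preimage [OF d, of "{..<1/3}"] unfolding top by simp
    show "near_vertices - over_edges \<subseteq> {x \<in> A. 2/3 < ?d x}"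
      by (auto simp: near_vertices_def over_edges_def depth_def)
    show "over_edges - near_vertices \<subseteq> {x \<in> A. ?d x < 1/3}"
    proof
      fix x assume x: "x \<in> over_edges - near_vertices"
      then have "retract 2 x \<in> cells 1" "retract 2 x \<notin> punct 1"
        by (auto simp: near_vertices_def over_edges_def)
      then have "retract 2 x \<in> centers 1"
        by (auto simp: punct_def skel_Suc)
      then have "?d x = 0"
        using depth_cell [of _ 1 "\<lambda>i. 0"] by (auto simp: centers_def radius_1 disc_iff)
      then show "x \<in> {x \<in> A. ?d x < 1/3}"
        using x by (simp add: over_edges_def)
    qed
    show "pi.cocycle (Suc 0) (subtopology M A) z" by fact
  qed auto
  then show ?thesis by blast
qed

text \<open>Discs slit along opposite rays from the origin cover the punctured disc. Each is
  star-shaped about a point of the opposite ray, and they meet in the upper and lower half discs, so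
  all three are scattered, unlike the annulus itself.\<close>

definition slit_left where "slit_left = {y \<in> open_disc 2. \<not> (y (Suc 0) = 0 \<and> y 0 \<le> 0)}"
definition slit_right where "slit_right = {y \<in> open_disc 2. \<not> (y (Suc 0) = 0 \<and> 0 \<le> y 0)}"

lemma A_Int_B: "A \<inter> B = cell_part 2 slit_left \<union> cell_part 2 slit_right"
proof -
  have "open_disc 2 - {\<lambda>i. 0} = slit_left \<union> slit_right"
  proof -
    have "y = (\<lambda>i. 0)" if "y \<in> open_disc 2" "y 0 = 0" "y (Suc 0) = 0" for y
      using that disc_2_bary [of y] open_disc_subset_disc [of 2] by (auto simp: bary_def fun_eq_iff)
    then show ?thesis
      by (fastforce simp: slit_left_def slit_right_def)
  qed
  then show ?thesis
    by (simp add: punct_Int_cells cell_part_Un)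
qed

lemma slit_subset: "slit_left \<subseteq> open_disc 2" "slit_right \<subseteq> open_disc 2"
  by (auto simp: slit_left_def slit_right_def)

lemma openin_slit: "openin (top_of_set (open_disc 2)) slit_left" "openin (top_of_set (open_disc 2)) slit_right"
proof -
  have "closed {y :: nat \<Rightarrow> real. y (Suc 0) = 0 \<and> y 0 \<le> 0}" "closed {y :: nat \<Rightarrow> real. y (Suc 0) = 0 \<and> 0 \<le> y 0}"
    by (auto intro!: closed_Collect_conj closed_Collect_le closed_Collect_eq continuous_intros)
  then have "open (- {y :: nat \<Rightarrow> real. y (Suc 0) = 0 \<and> y 0 \<le> 0})" "open (- {y :: nat \<Rightarrow> real. y (Suc 0) = 0 \<and> 0 \<le> y 0})"
    by (auto simp: open_Compl)
  moreover have "slit_left = open_disc 2 \<inter> - {y. y (Suc 0) = 0 \<and> y 0 \<le> 0}"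
     "slit_right = open_disc 2 \<inter> - {y. y (Suc 0) = 0 \<and> 0 \<le> y 0}"
    by (auto simp: slit_left_def slit_right_def)
  ultimately show "openin (top_of_set (open_disc 2)) slit_left" "openin (top_of_set (open_disc 2)) slit_right"
    by (auto simp: openin_open)
qed

lemma scattered_slit:
  "scattered (subtopology M (cell_part 2 slit_left))"
  "scattered (subtopology M (cell_part 2 slit_right))"
  "scattered (subtopology M (cell_part 2 (slit_left \<inter> slit_right)))"
proof -
  have const: "openin (top_of_set E) {y \<in> E. a = q}" for E :: "(nat \<Rightarrow> real) set" and a q :: "nat \<Rightarrow> real"
    by (cases "a = q") auto
  have b: "bary (1/2) 0 0 \<in> open_disc 2" "bary (-1/2) 0 0 \<in> open_disc 2"
     "bary 0 (1/2) 0 \<in> open_disc 2" "bary 0 (-1/2) 0 \<in> open_disc 2"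
    by (simp_all add: bary_in_open_disc power2_eq_square)
  show "scattered (subtopology M (cell_part 2 slit_left))"
  proof (rule scattered_cell_part [where p = "\<lambda>y. bary (1/2) 0 0", OF openin_slit(1)])
    show "(\<lambda>i. (1 - c) * y i + c * bary (1/2) 0 0 i) \<in> slit_left" if y: "y \<in> slit_left" and c: "0 \<le> c" "c \<le> 1" for y c
    proof -
      have "(\<lambda>i. (1 - c) * y i + c * bary (1/2) 0 0 i) \<in> open_disc 2"
        using b y c by (intro open_disc_convex) (auto simp: slit_left_def)
      \<comment> \<open>Before its end, the segment towards (1/2, 0) meets the first axis only if y
        is on it, and then y is on the positive side.\<close>
      moreover have "0 < (1 - c) * y 0 + c * (1/2)" if "(1 - c) * y (Suc 0) = 0"
      proof (cases "c = 1")
        case False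
        then have "0 < y 0" using that y by (auto simp: slit_left_def)
        then show ?thesis using c False by (intro add_pos_nonneg) auto
      qed simp
      ultimately show ?thesis by (auto simp: slit_left_def not_le)
    qed
    show "openin (top_of_set slit_left) {y \<in> slit_left. bary (1/2) 0 0 = q}" for q
      by (rule const)
  qed (use b in \<open>auto simp: slit_left_def\<close>)
  show "scattered (subtopology M (cell_part 2 slit_right))"
  proof (rule scattered_cell_part [where p = "\<lambda>y. bary (-1/2) 0 0", OF openin_slit(2)])
    show "(\<lambda>i. (1 - c) * y i + c * bary (-1/2) 0 0 i) \<in> slit_right" if y: "y \<in> slit_right" and c: "0 \<le> c" "c \<le> 1" for y c
    proof -
      have "(\<lambda>i. (1 - c) * y i + c * bary (-1/2) 0 0 i) \<in> open_disc 2"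
        using b y c by (intro open_disc_convex) (auto simp: slit_right_def)
      moreover have "0 < (1 - c) * - y 0 + c * (1/2)" if "(1 - c) * y (Suc 0) = 0"
      proof (cases "c = 1")
        case False
        then have "0 < - y 0" using that y by (auto simp: slit_right_def)
        then show ?thesis using c False by (intro add_pos_nonneg) (auto simp: mult_pos_neg)
      qed simp
      ultimately show ?thesis by (auto simp: slit_right_def not_le)
    qed
    show "openin (top_of_set slit_right) {y \<in> slit_right. bary (-1/2) 0 0 = q}" for q
      by (rule const)
  qed (use b in \<open>auto simp: slit_right_def\<close>)
  let ?E = "slit_left \<inter> slit_right"
  have E: "?E = {y \<in> open_disc 2. y (Suc 0) \<noteq> 0}"
    by (auto simp: slit_left_def slit_right_def)
  let ?p = "\<lambda>y :: nat \<Rightarrow> real. if 0 < y (Suc 0) then bary 0 (1/2) 0 else bary 0 (-1/2) 0"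
  show "scattered (subtopology M (cell_part 2 ?E))"
  proof (rule scattered_cell_part [where p = ?p])
    show "openin (top_of_set (open_disc 2)) ?E"
      using openin_slit by blast
    show "?p y \<in> ?E" for y
      unfolding E using b by auto
    show "openin (top_of_set ?E) {y \<in> ?E. ?p y = q}" for q
    proof (rule openin_Collect_fiber)
      show "openin (top_of_set ?E) {y \<in> ?E. 0 < y (Suc 0)}"
        by (intro openin_less continuous_intros)
      have "{y \<in> ?E. \<not> 0 < y (Suc 0)} = {y \<in> ?E. y (Suc 0) < 0}"
        unfolding E by auto
      then show "openin (top_of_set ?E) {y \<in> ?E. \<not> 0 < y (Suc 0)}"
        using openin_less [of ?E "\<lambda>y. y (Suc 0)" "\<lambda>y. 0"] by (simp add: continuous_intros)
    qed
    show "(\<lambda>i. (1 - c) * y i + c * ?p y i) \<in> ?E" if y: "y \<in> ?E" and c: "0 \<le> c" "c \<le> 1" for y c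
    proof -
      have "(\<lambda>i. (1 - c) * y i + c * ?p y i) \<in> open_disc 2"
        using b y c by (intro open_disc_convex) (auto simp: E)
      moreover have "(1 - c) * y (Suc 0) + c * ?p y (Suc 0) \<noteq> 0"
      proof (cases "0 < y (Suc 0)")
        case True
        then have "(1 - c) * y (Suc 0) + c * (1/2) > 0"
          using c by (intro convex_pos) auto
        then show ?thesis using True by simp
      next
        case False
        then have "y (Suc 0) < 0" using y by (simp add: E)
        then have "(1 - c) * (- y (Suc 0)) + c * (1/2) > 0"
          using c by (intro convex_pos) auto
        then show ?thesis using False by simp
      qed
      ultimately show ?thesis by (simp add: E)
    qed
  qed
qed

lemma H1_AB:
  assumes "pi.cocycle (Suc 0) (subtopology M (A \<inter> B)) z"
  shows "\<exists>u. represents (subtopology M (A \<inter> B)) u z"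
proof -
  let ?X = "subtopology M (A \<inter> B)"
  let ?U = "cell_part 2 slit_left" and ?V = "cell_part 2 slit_right"
  let ?E = "open_disc 2 - {\<lambda>i. 0}"
  have X: "A \<inter> B = cell_part 2 ?E" by (simp add: punct_Int_cells)
  have E: "openin (top_of_set (open_disc 2)) ?E"
    by (simp add: openin_delete)
  have sub: "subtopology ?X S = subtopology M S" if "S \<subseteq> A \<inter> B" for S
    using that by (simp add: subtopology_subtopology Int_absorb1)
  have UV: "?U \<subseteq> A \<inter> B" "?V \<subseteq> A \<inter> B" "?U \<inter> ?V \<subseteq> A \<inter> B" "A \<inter> B \<subseteq> topspace M"
    using A_Int_B A_subset by auto
  have op: "openin ?X S" if "openin M S" "S \<subseteq> A \<inter> B" for S
    using that by (auto simp: openin_subtopology)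
  have part: "openin M (cell_part 2 F)" if "openin (top_of_set (open_disc 2)) F" for F
    using openin_cell_part [OF that] by (simp only: subtopology_skel_2)
  \<comment> \<open>The cosine of the polar angle: 1 on the ray missing from
    \<open>slit_right\<close>, -1 on the ray missing from \<open>slit_left\<close>.\<close>
  let ?r = "\<lambda>y. y 0 / radius 2 y"
  let ?t = "\<lambda>x. ?r (snd (chart 2 x))"
  have t: "?t (\<phi> y) = ?r y" if "\<phi> \<in> C 2" "y \<in> open_disc 2" for \<phi> y
    using that by (simp add: chart_cell)
  have rE: "radius 2 y \<noteq> 0" if "y \<in> ?E" for y
    using that radius_eq_0 [of 2 y] by (auto simp: open_disc_iff)
  have cr: "continuous_on ?E ?r"
    using rE by (intro continuous_intros continuous_on_radius continuous_on_id) auto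
  have ct: "continuous_map ?X euclideanreal ?t"
    unfolding X
  proof (rule continuous_on_cell_part [OF E])
    show "continuous_map (top_of_set ?E) euclideanreal (\<lambda>y. ?t (\<phi> y))" if "\<phi> \<in> C 2" for \<phi>
      using cr t [OF that] by (auto elim: continuous_on_eq)
  qed
  let ?NU = "{x \<in> A \<inter> B. 1/2 < ?t x}" and ?NV = "{x \<in> A \<inter> B. ?t x < -1/2}"
  obtain u where "represents ?X u z"
  proof (rule represents_onto [of ?X ?U ?V])
    show "openin ?X ?U" "openin ?X ?V"
      using part openin_slit UV by (auto intro: op)
    show "topspace ?X = ?U \<union> ?V"
      using UV A_Int_B by auto
    show "scattered (subtopology ?X ?U)" "scattered (subtopology ?X ?V)"
      unfolding sub [OF UV(1)] sub [OF UV(2)] by (rule scattered_slit)+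
    show "scattered (subtopology ?X (?U \<inter> ?V))"
      using scattered_slit(3) by (simp only: sub [OF UV(3)] cell_part_Int [OF slit_subset, symmetric])
    \<comment> \<open>The clamp is 0 where the cosine exceeds 1/2 and 1 where it is below -1/2, on
      open neighbourhoods of the two rays.\<close>
    show "continuous_map ?X euclideanreal (\<lambda>x. max 0 (min 1 (1/2 - ?t x)))"
      by (intro continuous_intros ct)
    have top: "topspace ?X = A \<inter> B" using UV by auto
    show "openin ?X ?NU"
      using openin_continuous_map_preimage [OF ct, of "{1/2<..}"] unfolding top by simp
    show "openin ?X ?NV"
      using openin_continuous_map_preimage [OF ct, of "{..<-1/2}"] unfolding top by simp
    have ax: "\<bar>y 0\<bar> = radius 2 y" if "y (Suc 0) = 0" for y
      using that by (simp add: radius_def numeral_2_eq_2)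
    show "?U - ?V \<subseteq> ?NU"
    proof
      fix x assume x: "x \<in> ?U - ?V"
      then obtain \<phi> y where y: "\<phi> \<in> C 2" "y \<in> slit_left" "x = \<phi> y" by (auto simp: cell_part_def)
      then have "y \<notin> slit_right" using x by (auto simp: cell_part_def)
      then have "y \<in> open_disc 2" "y (Suc 0) = 0" "0 < y 0" using y by (auto simp: slit_left_def slit_right_def)
      then have "?r y = 1" using ax [of y] by simp
      then show "x \<in> ?NU"
        using t [OF y(1) \<open>y \<in> open_disc 2\<close>] x UV y(3) by auto
    qed
    show "?V - ?U \<subseteq> ?NV"
    proof
      fix x assume x: "x \<in> ?V - ?U"
      then obtain \<phi> y where y: "\<phi> \<in> C 2" "y \<in> slit_right" "x = \<phi> y" by (auto simp: cell_part_def)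
      then have "y \<notin> slit_left" using x by (auto simp: cell_part_def)
      then have "y \<in> open_disc 2" "y (Suc 0) = 0" "y 0 < 0" using y by (auto simp: slit_left_def slit_right_def)
      moreover from this have "radius 2 y = - y 0" using ax [of y] by simp
      ultimately have "?r y = -1" by simp
      then show "x \<in> ?NV"
        using t [OF y(1)] slit_subset y x UV by auto
    qed
    show "pi.cocycle (Suc 0) ?X z" by fact
  qed auto
  then show ?thesis by blast
qed

end

section \<open>Extending a map over the punctures\<close>

lemma polar_coordinates:
  assumes "y \<in> disc 2" "radius 2 y \<le> 1/2"
  obtains \<rho> s where "\<rho> \<in> {0..1}" "s \<in> {0..1}" "y = bary (\<rho> / 2 * cos (2 * pi * s)) (\<rho> / 2 * sin (2 * pi * s)) 0"
proof -
  define r where "r = radius 2 y"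
  have r: "0 \<le> r" "r \<le> 1/2" "r\<^sup>2 = (y 0)\<^sup>2 + (y (Suc 0))\<^sup>2"
    using assms radius_nonneg [of 2 y] by (auto simp: r_def) (simp add: radius_def numeral_2_eq_2)
  show ?thesis
  proof (cases "r = 0")
    case True
    then have "y 0 = 0" "y (Suc 0) = 0"
      using r(3) by (auto simp: sum_power2_eq_zero_iff)
    then have "y = bary 0 0 0" using disc_2_bary [OF assms(1)] by simp
    then show ?thesis
      by (intro that [of 0 0]) auto
  next
    case False
    have "(y 0 / r)\<^sup>2 + (y (Suc 0) / r)\<^sup>2 = 1"
    proof -
      have "(y 0 / r)\<^sup>2 + (y (Suc 0) / r)\<^sup>2 = r\<^sup>2 / r\<^sup>2"
        by (simp only: power_divide r(3) add_divide_distrib)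
      then show ?thesis using False by simp
    qed
    then obtain \<theta> where \<theta>: "0 \<le> \<theta>" "\<theta> < 2 * pi" "y 0 / r = cos \<theta>" "y (Suc 0) / r = sin \<theta>"
      by (rule sincos_total_2pi)
    have "y = bary (2 * r / 2 * cos (2 * pi * (\<theta> / (2 * pi)))) (2 * r / 2 * sin (2 * pi * (\<theta> / (2 * pi)))) 0"
      using disc_2_bary [OF assms(1)] \<theta> False by (simp add: field_simps)
    then show ?thesis
      using r \<theta> by (intro that [of "2 * r" "\<theta> / (2 * pi)"]) auto
  qed
qed

lemma radius_polar:
  assumes "0 \<le> \<rho>"
  shows "radius 2 (bary (\<rho> / 2 * cos t) (\<rho> / 2 * sin t) 0) = \<rho> / 2"
proof -
  have "(\<rho> / 2 * cos t)\<^sup>2 + (\<rho> / 2 * sin t)\<^sup>2 = (\<rho> / 2)\<^sup>2 * ((sin t)\<^sup>2 + (cos t)\<^sup>2)"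
    by (simp only: power_mult_distrib distrib_left add.commute)
  also have "\<dots> = (\<rho> / 2)\<^sup>2"
    by simp
  finally show ?thesis
    unfolding radius_bary using assms by (metis divide_nonneg_pos real_sqrt_abs abs_of_nonneg zero_less_numeral)
qed

lemma bary_eq_iff: "bary a b 0 = bary c d 0 \<longleftrightarrow> a = c \<and> b = d"
  by (metis bary_simps(1,2))

lemma continuous_on_bary:
  assumes "continuous_on S f" "continuous_on S g"
  shows "continuous_on S (\<lambda>z. bary (f z) (g z) 0)"
proof (rule continuous_on_coordinatewise_then_product)
  show "continuous_on S (\<lambda>z. bary (f z) (g z) 0 i)" for i
    by (cases "i = 0"; cases "i = 1") (auto simp: bary_def assms)
qed

text \<open>A full turn around the circle of radius one half, which is where a map on the annulus is
  cut off and refilled.\<close>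

definition half_circle :: "real \<Rightarrow> nat \<Rightarrow> real"
  where "half_circle t = bary (cos (2 * pi * t) / 2) (sin (2 * pi * t) / 2) 0"

lemma (in topological_group_space) loop_eqvE:
  assumes "p \<simeq> q"
  obtains F where "continuous_map (top_of_set ({0..1::real} \<times> {0..1::real})) T F"
    "\<And>t. t \<in> {0..1} \<Longrightarrow> F (0, t) = p t" "\<And>t. t \<in> {0..1} \<Longrightarrow> F (1, t) = q t"
    "\<And>s. s \<in> {0..1} \<Longrightarrow> F (s, 0) = \<one>" "\<And>s. s \<in> {0..1} \<Longrightarrow> F (s, 1) = \<one>"
  using assms unfolding loop_eqv_iff by blast

text \<open>Polar coordinates map a compact square onto a Hausdorff disc and so form a quotient map.
  A null homotopy of the loop is constant at one end, which becomes the centre, and takes equal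
  values at angles 0 and 1, so it descends to the disc.\<close>

lemma (in topological_group_space) extend_over_disc:
  assumes f: "continuous_map (top_of_set {y \<in> disc 2. radius 2 y = 1/2}) T f"
    and null: "(\<lambda>t. inv (f (half_circle 0)) \<otimes> f (half_circle t)) \<simeq> (\<lambda>t. \<one>)"
  obtains g where "continuous_map (top_of_set {y \<in> disc 2. radius 2 y \<le> 1/2}) T g"
    "\<And>y. y \<in> disc 2 \<Longrightarrow> radius 2 y = 1/2 \<Longrightarrow> g y = f y"
proof -
  let ?K = "{y \<in> disc 2. radius 2 y \<le> 1/2}"
  let ?Q = "{0..1::real} \<times> {0..1::real}"
  define polar where "polar = (\<lambda>z. bary (fst z / 2 * cos (2 * pi * snd z)) (fst z / 2 * sin (2 * pi * snd z)) 0)"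
  obtain F where F: "continuous_map (top_of_set ?Q) T F"
     "\<And>t. t \<in> {0..1} \<Longrightarrow> F (0, t) = inv (f (half_circle 0)) \<otimes> f (half_circle t)"
     "\<And>t. t \<in> {0..1} \<Longrightarrow> F (1, t) = \<one>"
     "\<And>s. s \<in> {0..1} \<Longrightarrow> F (s, 0) = \<one>" "\<And>s. s \<in> {0..1} \<Longrightarrow> F (s, 1) = \<one>"
  proof (rule loop_eqvE [OF null], goal_cases)
    case (1 F)
    show thesis by (rule 1(1) [of F]) (fact 1)+
  qed
  have cp: "continuous_on ?Q polar"
    unfolding polar_def by (intro continuous_on_bary continuous_intros) auto
  have rp: "radius 2 (polar z) = fst z / 2" if "z \<in> ?Q" for z
    using that radius_polar [of "fst z"] by (auto simp: polar_def)
  have pK: "polar z \<in> ?K" if "z \<in> ?Q" for z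
  proof -
    have "\<forall>i\<ge>2. polar z i = 0" by (simp add: polar_def bary_def)
    then show ?thesis using that rp [OF that] by (auto simp: disc_iff)
  qed
  have surj: "polar ` ?Q = ?K"
  proof
    show "?K \<subseteq> polar ` ?Q"
    proof
      fix y assume "y \<in> ?K"
      then obtain \<rho> s where "\<rho> \<in> {0..1}" "s \<in> {0..1}" "y = bary (\<rho> / 2 * cos (2 * pi * s)) (\<rho> / 2 * sin (2 * pi * s)) 0"
        using polar_coordinates [of y] by blast
      then show "y \<in> polar ` ?Q"
        by (intro image_eqI [of _ _ "(\<rho>, s)"]) (auto simp: polar_def)
    qed
  qed (use pK in blast)
  have "quotient_map (top_of_set ?Q) (top_of_set ?K) polar"
  proof (rule T1_Spaces.continuous_imp_quotient_map)
    show "continuous_map (top_of_set ?Q) (top_of_set ?K) polar"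
      using cp pK by auto
    show "compact_space (top_of_set ?Q)"
      by (simp add: compact_space_subtopology compact_Times)
    show "Hausdorff_space (top_of_set ?K)"
      by (simp add: Hausdorff_space_subtopology)
    show "polar ` topspace (top_of_set ?Q) = topspace (top_of_set ?K)"
      using surj by simp
  qed
  have half: "half_circle t \<in> {y \<in> disc 2. radius 2 y = 1/2}" if "t \<in> {0..1}" for t
    using pK [of "(1, t)"] rp [of "(1, t)"] that by (simp add: polar_def half_circle_def)
  have fG: "f (half_circle t) \<in> carrier G" if "t \<in> {0..1}" for t
    using continuous_closed [OF f, of "half_circle t"] half [OF that] by simp
  \<comment> \<open>The homotopy starts at the loop translated to the unit; the left factor undoes
    the translation. Its time 0 is put on the bounding circle and its time 1 at the centre.\<close>
  define h where "h z = f (half_circle 0) \<otimes> F (1 - fst z, snd z)" for z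
  have "continuous_map (top_of_set ?Q) (top_of_set ?Q) (\<lambda>z. (1 - fst z, snd z))"
    by (auto intro!: continuous_intros)
  from continuous_map_compose [OF this F(1)]
  have h: "continuous_map (top_of_set ?Q) T h"
    unfolding h_def [abs_def] using fG [of 0] by (intro continuous_mult) (auto simp: o_def)
  have hcompat: "h z = h w" if z: "z \<in> ?Q" and w: "w \<in> ?Q" and eq: "polar z = polar w" for z w
  proof -
    have \<rho>: "fst z = fst w"
      using rp [OF z] rp [OF w] eq by simp
    show ?thesis
    proof (cases "fst z = 0")
      case True
      then show ?thesis using \<rho> F(3) z w by (auto simp: h_def)
    next
      case False
      then have "cos (2 * pi * snd z) = cos (2 * pi * snd w)" "sin (2 * pi * snd z) = sin (2 * pi * snd w)"
        using eq \<rho> by (auto simp: polar_def bary_eq_iff)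
      then obtain n :: int where "2 * pi * snd z = 2 * pi * snd w + 2 * pi * n"
        using sin_cos_eq_iff by metis
      then have "2 * pi * snd z = 2 * pi * (snd w + n)" by (simp add: algebra_simps)
      then have n: "snd z = snd w + n" by simp
      moreover have "0 \<le> snd z" "snd z \<le> 1" "0 \<le> snd w" "snd w \<le> 1" using z w by auto
      ultimately have "real_of_int n \<le> 1" "- 1 \<le> real_of_int n" by linarith+
      then have "n = 0 \<or> n = 1 \<or> n = -1" by linarith
      then consider "snd z = snd w" | "snd z = 1" "snd w = 0" | "snd z = 0" "snd w = 1"
        using n \<open>snd z \<le> 1\<close> \<open>0 \<le> snd z\<close> \<open>snd w \<le> 1\<close> \<open>0 \<le> snd w\<close> by fastforce
      then show ?thesis
        using \<rho> F(4,5) z by cases (auto simp: h_def)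
    qed
  qed
  obtain g where g: "continuous_map (top_of_set ?K) T g" "\<And>z. z \<in> ?Q \<Longrightarrow> g (polar z) = h z"
  proof (rule quotient_map_lift_exists [OF \<open>quotient_map (top_of_set ?Q) (top_of_set ?K) polar\<close> h], goal_cases)
    case (1 z w)
    then show ?case by (intro hcompat) simp_all
  next
    case (2 g)
    show thesis by (rule 2(1) [OF 2(2)]) (simp add: 2(4))
  qed
  show ?thesis
  proof
    show "continuous_map (top_of_set ?K) T g" by (rule g(1))
    fix y assume y: "y \<in> disc 2" "radius 2 y = 1/2"
    then have "y \<in> polar ` ?Q" unfolding surj by simp
    then obtain z where z: "z \<in> ?Q" "y = polar z" by blast
    then have "fst z = 1" using rp [OF z(1)] y by simp
    then have "y = half_circle (snd z)" "snd z \<in> {0..1}"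
      using z by (auto simp: polar_def half_circle_def)
    moreover have "h z = f (half_circle (snd z))"
      using F(2) \<open>fst z = 1\<close> \<open>snd z \<in> {0..1}\<close> fG [of 0] fG [of "snd z"] by (simp add: h_def)
    ultimately show "g y = f y" using g(2) [OF z(1)] z by simp
  qed
qed

context cw2_group
begin

text \<open>In each cell the trivial class makes w null homotopic on the circle of radius 1/2, so w
  can be replaced inside that circle by a filling. K is the union of the closed discs so bounded.
  Any radius strictly between 0 and 1 would serve.\<close>

lemma extension:
  assumes w: "represents (subtopology M (A \<inter> B)) w (\<lambda>c. \<one>\<^bsub>P\<^esub>)"
  shows "\<exists>\<beta> K. closedin M K \<and> K \<subseteq> B \<and> continuous_map (subtopology M B) T \<beta> \<and> (\<forall>x\<in>A \<inter> B - K. \<beta> x = w x)"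
proof -
  let ?E = "open_disc 2 - {\<lambda>i. 0}"
  have X: "A \<inter> B = cell_part 2 ?E" by (simp add: punct_Int_cells)
  have top: "topspace (subtopology M (A \<inter> B)) = A \<inter> B" using A_subset by auto
  note cw = represents_continuous [OF w]
  have cell: "continuous_map (top_of_set S) (subtopology M (A \<inter> B)) \<phi>" if "\<phi> \<in> C 2" "S \<subseteq> ?E" for S \<phi>
  proof -
    have "\<phi> ` S \<subseteq> cell_part 2 ?E" unfolding cell_part_def using that by blast
    then show ?thesis
      using cell_continuous [OF that(1), of S] that(2) open_disc_subset_disc [of 2]
      unfolding X by (auto simp: continuous_map_in_subtopology)
  qed
  have cwp: "continuous_map (top_of_set S) T (\<lambda>y. w (\<phi> y))" if "\<phi> \<in> C 2" "S \<subseteq> ?E" for S \<phi>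
    using continuous_map_compose [OF cell [OF that] cw] by (simp add: o_def)
  have pos: "y \<in> ?E" if "y \<in> open_disc 2" "1/2 \<le> radius 2 y" for y
    using that by (auto simp: radius_def)
  have circle: "{y \<in> disc 2. radius 2 y = 1/2} \<subseteq> ?E"
  proof
    fix y assume "y \<in> {y \<in> disc 2. radius 2 y = 1/2}"
    then show "y \<in> ?E" by (intro pos) (auto simp: disc_iff open_disc_iff)
  qed
  have ex: "\<exists>g. continuous_map (top_of_set {y \<in> disc 2. radius 2 y \<le> 1/2}) T g \<and>
      (\<forall>y. y \<in> disc 2 \<longrightarrow> radius 2 y = 1/2 \<longrightarrow> g y = w (\<phi> y))" if \<phi>: "\<phi> \<in> C 2" for \<phi>
  proof -
    have hc: "half_circle t \<in> {y \<in> disc 2. radius 2 y = 1/2}" for t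
      using radius_polar [of 1 "2 * pi * t"] unfolding half_circle_def
      by (auto simp: disc_iff) (auto simp: bary_def)
    have "continuous_on {0..1} half_circle"
      unfolding half_circle_def by (intro continuous_on_bary continuous_intros) auto
    then have "continuous_map (top_of_set {0..1}) (top_of_set {y \<in> disc 2. radius 2 y = 1/2}) half_circle"
      using hc by auto
    from continuous_map_compose [OF this cell [OF \<phi> circle]]
    have "pathin (subtopology M (A \<inter> B)) (\<lambda>t. \<phi> (half_circle t))"
      by (simp add: pathin_def o_def)
    then obtain \<sigma> where \<sigma>: "singular_simplex (Suc 0) (subtopology M (A \<inter> B)) \<sigma>"
        "\<And>t. t \<in> {0..1} \<Longrightarrow> edge \<sigma> t = \<phi> (half_circle t)"
      using pathin_simplex_exists by blast
    have "half_circle 0 = half_circle 1"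
      by (simp add: half_circle_def)
    then have closed: "edge \<sigma> 0 = edge \<sigma> 1"
      using \<sigma>(2) by simp
    note l = represents_closed_edge [OF w \<sigma>(1) closed]
    have "(\<lambda>t. inv (w (edge \<sigma> 0)) \<otimes> w (edge \<sigma> t)) \<simeq> (\<lambda>t. \<one>)"
      using l(2) cls_eq_iff [OF l(1), of "\<lambda>t. \<one>"] unfolding one_P by (metis (no_types))
    moreover have "(\<lambda>t. inv (w (edge \<sigma> 0)) \<otimes> w (edge \<sigma> t)) \<simeq> (\<lambda>t. inv (w (\<phi> (half_circle 0))) \<otimes> w (\<phi> (half_circle t)))"
      by (rule loop_eqv_cong [OF l(1)]) (simp add: \<sigma>(2))
    ultimately have null: "(\<lambda>t. inv (w (\<phi> (half_circle 0))) \<otimes> w (\<phi> (half_circle t))) \<simeq> (\<lambda>t. \<one>)"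
      by (rule loop_eqv_trans [OF loop_eqv_sym, rotated])
    obtain h where "continuous_map (top_of_set {y \<in> disc 2. radius 2 y \<le> 1/2}) T h"
        "\<And>y. y \<in> disc 2 \<Longrightarrow> radius 2 y = 1/2 \<Longrightarrow> h y = w (\<phi> y)"
      by (rule extend_over_disc [OF cwp [OF \<phi> circle] null]) blast
    then show ?thesis by blast
  qed
  define g where "g \<phi> = (SOME g. continuous_map (top_of_set {y \<in> disc 2. radius 2 y \<le> 1/2}) T g \<and>
      (\<forall>y. y \<in> disc 2 \<longrightarrow> radius 2 y = 1/2 \<longrightarrow> g y = w (\<phi> y)))" for \<phi>
  have g: "continuous_map (top_of_set {y \<in> disc 2. radius 2 y \<le> 1/2}) T (g \<phi>)"
      "\<And>y. y \<in> disc 2 \<Longrightarrow> radius 2 y = 1/2 \<Longrightarrow> g \<phi> y = w (\<phi> y)" if "\<phi> \<in> C 2" for \<phi>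
    using someI_ex [OF ex [OF that]] unfolding g_def [symmetric] by simp_all
  define \<beta> where "\<beta> x = (let (\<phi>, y) = chart 2 x in if radius 2 y \<le> 1/2 then g \<phi> y else w x)" for x
  have \<beta>: "\<beta> (\<phi> y) = (if radius 2 y \<le> 1/2 then g \<phi> y else w (\<phi> y))" if "\<phi> \<in> C 2" "y \<in> open_disc 2" for \<phi> y
    using that by (simp add: \<beta>_def chart_cell)
  define K where "K = (\<Union>\<phi>\<in>C 2. \<phi> ` {y \<in> disc 2. radius 2 y \<le> 1/2})"
  have Ksub: "{y \<in> disc 2. radius 2 y \<le> 1/2} \<subseteq> open_disc 2"
    by (auto simp: disc_iff open_disc_iff)
  have Kp: "K = cell_part 2 {y \<in> disc 2. radius 2 y \<le> 1/2}"
    by (simp add: K_def cell_part_def)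
  have "closedin M K"
  proof (rule closedin_skel [of K "Suc 2"])
    show "K \<subseteq> skel (Suc 2)"
      using Kp cell_part_subset [OF Ksub] topspace_eq_skel by simp
    fix m \<phi> assume m: "m < Suc 2" "\<phi> \<in> C m"
    show "closedin (top_of_set (disc m)) {y \<in> disc m. \<phi> y \<in> K}"
    proof (cases "m = 2")
      case True
      have "closed {y. radius 2 y \<le> 1/2}"
        by (intro closed_Collect_le continuous_on_radius continuous_intros)
      then have "closedin (top_of_set (disc 2)) (disc 2 \<inter> {y. radius 2 y \<le> 1/2})"
        by (rule closedin_closed_Int)
      moreover have "disc 2 \<inter> {y. radius 2 y \<le> 1/2} = {y \<in> disc 2. radius 2 y \<le> 1/2}"
        by auto
      ultimately show ?thesis
        using m True cell_preimage_part [OF _ Ksub, of \<phi>] by (simp add: Kp)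
    next
      case False
      then have e: "{y \<in> disc m. \<phi> y \<in> K} = {}"
        unfolding Kp using m by (intro lower_cell_preimage_part [OF m(2) _ Ksub]) simp
      show ?thesis unfolding e by simp
    qed
  qed
  moreover have "K \<subseteq> B"
    using Ksub by (auto simp: K_def cells_def)
  moreover have "continuous_map (subtopology M B) T \<beta>"
    unfolding cells_eq_cell_part
  proof (rule continuous_on_cell_part)
    fix \<phi> assume \<phi>: "\<phi> \<in> C 2"
    let ?O = "top_of_set (open_disc 2)"
    have "continuous_map ?O T (\<lambda>y. if radius 2 y \<le> 1/2 then g \<phi> y else w (\<phi> y))"
    proof (rule continuous_map_cases_le)
      show "continuous_map ?O euclideanreal (radius 2)"
        by (simp add: continuous_on_radius [OF continuous_on_id])
      have "subtopology ?O {y \<in> topspace ?O. radius 2 y \<le> 1/2} = top_of_set {y \<in> disc 2. radius 2 y \<le> 1/2}"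
        using Ksub open_disc_subset_disc [of 2]
        by (simp add: subtopology_subtopology) (rule arg_cong [where f = top_of_set], auto)
      then show "continuous_map (subtopology ?O {y \<in> topspace ?O. radius 2 y \<le> 1/2}) T (g \<phi>)"
        using g(1) [OF \<phi>] by simp
      have "subtopology ?O {y \<in> topspace ?O. 1/2 \<le> radius 2 y} = top_of_set {y \<in> open_disc 2. 1/2 \<le> radius 2 y}"
        by (simp add: subtopology_subtopology) (rule arg_cong [where f = top_of_set], auto)
      moreover have "{y \<in> open_disc 2. 1/2 \<le> radius 2 y} \<subseteq> ?E"
        using pos by auto
      ultimately show "continuous_map (subtopology ?O {y \<in> topspace ?O. 1/2 \<le> radius 2 y}) T (\<lambda>y. w (\<phi> y))"
        using cwp [OF \<phi>] by metis
      show "g \<phi> y = w (\<phi> y)" if "y \<in> topspace ?O" "radius 2 y = 1/2" for y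
        using that g(2) [OF \<phi>] open_disc_subset_disc [of 2] by auto
    qed auto
    then show "continuous_map ?O T (\<lambda>y. \<beta> (\<phi> y))"
      by (rule continuous_map_eq) (use \<beta> [OF \<phi>] in auto)
  qed auto
  moreover have "\<beta> x = w x" if "x \<in> A \<inter> B - K" for x
  proof -
    have "x \<in> cell_part 2 ?E" using that X by blast
    then obtain \<phi> y where y: "\<phi> \<in> C 2" "y \<in> open_disc 2" "x = \<phi> y" by (auto simp: cell_part_def)
    then have "\<not> radius 2 y \<le> 1/2"
      using that open_disc_subset_disc [of 2] by (auto simp: K_def)
    then show ?thesis using \<beta> [OF y(1,2)] y by simp
  qed
  ultimately show ?thesis by blast
qed

end

sublocale cw2_group \<subseteq> two_piece_cover G T M "punct 2" "cells 2"
  by unfold_locales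
    (use openin_A openin_B A_Un_B H2_A scattered_cells H1_A H1_AB extension in auto)


section \<open>Lifts and sections of a principal bundle\<close>

locale principal_bundle_space = topological_group_space G T for G (structure) and T +
  fixes M :: "'m topology" and E :: "('e, 'a, 'm) gbundle"
  assumes principal: "principal_bundle G T M E"
begin

lemma action: "right_action G T (total_space E) (act E)"
  using principal by (simp add: principal_bundle_def)

lemma continuous_proj: "continuous_map (total_space E) M (proj E)"
  using principal by (simp add: principal_bundle_def)

lemma proj_in_M: "e \<in> topspace (total_space E) \<Longrightarrow> proj E e \<in> topspace M"
  using continuous_proj by (auto simp: continuous_map_def)

lemma trivializationE:
  assumes "b \<in> topspace M"
  obtains U \<phi> where "openin M U" "b \<in> U" "local_trivialization G T M E U \<phi>"
  by (rule local_trivialization_exists [OF principal assms])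

lemma continuous_act:
  assumes "continuous_map X (total_space E) s" "continuous_map X T g"
  shows "continuous_map X (total_space E) (\<lambda>x. act E (s x) (g x))"
proof -
  have "continuous_map X (prod_topology (total_space E) T) (\<lambda>x. (s x, g x))"
    using assms by (simp add: continuous_map_pairwise o_def)
  from continuous_map_compose [OF this, of "total_space E" "\<lambda>(e, g). act E e g"] show ?thesis
    using action by (simp add: right_action_def o_def)
qed

lemma act_closed:
  assumes "e \<in> topspace (total_space E)" "g \<in> carrier G"
  shows "act E e g \<in> topspace (total_space E)"
proof -
  have "continuous_map (prod_topology (total_space E) T) (total_space E) (\<lambda>(e, g). act E e g)"
    using action by (simp add: right_action_def)
  from continuous_map_image_subset_topspace [OF this] show ?thesis
    using assms by force
qed

lemma act_one: "e \<in> topspace (total_space E) \<Longrightarrow> act E e \<one> = e"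
  using action by (simp add: right_action_def)

lemma act_act:
  "e \<in> topspace (total_space E) \<Longrightarrow> g \<in> carrier G \<Longrightarrow> h \<in> carrier G \<Longrightarrow> act E (act E e g) h = act E e (g \<otimes> h)"
  using action by (simp add: right_action_def)

lemma trivialization_coordinates:
  assumes U: "openin M U" "local_trivialization G T M E U \<phi>"
    and e: "e \<in> topspace (total_space E)" "proj E e \<in> U"
  obtains g where "g \<in> carrier G" "e = \<phi> (proj E e, g)"
proof -
  have "e \<in> \<phi> ` (U \<times> carrier G)"
    using local_trivialization_image(1) [OF topgroup U] e by simp
  then obtain b g where bg: "b \<in> U" "g \<in> carrier G" "e = \<phi> (b, g)" by auto
  then have "proj E e = b"
    using U(2) unfolding local_trivialization_def by blast
  then show ?thesis using that bg by simp
qed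

lemma proj_act:
  assumes "e \<in> topspace (total_space E)" "g \<in> carrier G"
  shows "proj E (act E e g) = proj E e"
proof -
  obtain U \<phi> where U: "openin M U" "proj E e \<in> U" "local_trivialization G T M E U \<phi>"
    using trivializationE [OF proj_in_M [OF assms(1)]] .
  obtain h where h: "h \<in> carrier G" "e = \<phi> (proj E e, h)"
    using trivialization_coordinates [OF U(1,3) assms(1) U(2)] .
  have "act E e g = \<phi> (proj E e, h \<otimes> g)"
    using local_trivialization_act [OF topgroup U(1) principal U(3,2) h(1) assms(2)] h(2) by simp
  moreover have "proj E (\<phi> (proj E e, h \<otimes> g)) = proj E e"
    using U(2,3) m_closed [OF h(1) assms(2)] unfolding local_trivialization_def by blast
  ultimately show ?thesis by metis
qed

text \<open>The translation function of the bundle. The description is meaningful for two points of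
  one fibre, on which G acts simply transitively.\<close>

definition quot :: "'e \<Rightarrow> 'e \<Rightarrow> 'a"
  where "quot e e' = (THE g. g \<in> carrier G \<and> act E e g = e')"

lemma quot_eqI:
  assumes e: "e \<in> topspace (total_space E)" and g: "g \<in> carrier G" "act E e g = e'"
  shows "quot e e' = g"
  unfolding quot_def
proof (rule the_equality)
  fix h assume h: "h \<in> carrier G \<and> act E e h = e'"
  obtain U \<phi> where U: "openin M U" "proj E e \<in> U" "local_trivialization G T M E U \<phi>"
    using trivializationE [OF proj_in_M [OF e]] .
  obtain k where k: "k \<in> carrier G" "e = \<phi> (proj E e, k)"
    using trivialization_coordinates [OF U(1,3) e U(2)] .
  have "act E e x = \<phi> (proj E e, k \<otimes> x)" if "x \<in> carrier G" for x
    using local_trivialization_act [OF topgroup U(1) principal U(3,2) k(1) that] k(2) by simp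
  then have "\<phi> (proj E e, k \<otimes> h) = \<phi> (proj E e, k \<otimes> g)"
    using g h by metis
  then have "k \<otimes> h = k \<otimes> g"
    using local_trivialization_image(2) [OF topgroup U(1,3)] U(2) k g h by (auto simp: inj_on_def)
  then show "h = g"
    using k g h by simp
qed (use g in simp)

lemma quot_trivialization:
  assumes U: "openin M U" "local_trivialization G T M E U \<phi>" and b: "b \<in> U" and g: "g \<in> carrier G" "h \<in> carrier G"
  shows "quot (\<phi> (b, g)) (\<phi> (b, h)) = inv g \<otimes> h"
proof (rule quot_eqI)
  show "\<phi> (b, g) \<in> topspace (total_space E)"
    using local_trivialization_image(1) [OF topgroup U] b g by blast
  show "act E (\<phi> (b, g)) (inv g \<otimes> h) = \<phi> (b, h)"
    using local_trivialization_act [OF topgroup U(1) principal U(2) b g(1), of "inv g \<otimes> h"] g by simp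
qed (use g in simp)

lemma quot:
  assumes e: "e \<in> topspace (total_space E)" "e' \<in> topspace (total_space E)" "proj E e = proj E e'"
  shows "quot e e' \<in> carrier G" "act E e (quot e e') = e'"
proof -
  obtain U \<phi> where U: "openin M U" "proj E e \<in> U" "local_trivialization G T M E U \<phi>"
    using trivializationE [OF proj_in_M [OF e(1)]] .
  obtain g where g: "g \<in> carrier G" "e = \<phi> (proj E e, g)"
    using trivialization_coordinates [OF U(1,3) e(1) U(2)] .
  obtain h where h: "h \<in> carrier G" "e' = \<phi> (proj E e, h)"
    using trivialization_coordinates [OF U(1,3) e(2)] U(2) e(3) by metis
  have "quot e e' = inv g \<otimes> h"
    using quot_trivialization [OF U(1,3,2) g(1) h(1)] g h by simp
  then show "quot e e' \<in> carrier G" "act E e (quot e e') = e'"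
    using local_trivialization_act [OF topgroup U(1) principal U(3,2) g(1), of "inv g \<otimes> h"] g h by auto
qed

text \<open>For points with coordinates g and h in a local trivialization the value is
  \<open>inv g \<otimes> h\<close>; the trivializing sets are then pasted.\<close>

lemma continuous_quot:
  assumes s: "continuous_map X (total_space E) s" and t: "continuous_map X (total_space E) t"
    and st: "\<And>x. x \<in> topspace X \<Longrightarrow> proj E (s x) = proj E (t x)"
  shows "continuous_map X T (\<lambda>x. quot (s x) (t x))"
proof -
  let ?U = "{U. openin M U \<and> (\<exists>\<phi>. local_trivialization G T M E U \<phi>)}"
  have sE: "s x \<in> topspace (total_space E)" "t x \<in> topspace (total_space E)" if "x \<in> topspace X" for x
    using s t that by (auto simp: continuous_map_def)
  have ps: "continuous_map X M (\<lambda>x. proj E (s x))"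
    using continuous_map_compose [OF s continuous_proj] by (simp add: o_def)
  show ?thesis
  proof (rule pasting_lemma [of ?U X "\<lambda>U. {x \<in> topspace X. proj E (s x) \<in> U}" T "\<lambda>_ x. quot (s x) (t x)"])
    show "openin X {x \<in> topspace X. proj E (s x) \<in> U}" if "U \<in> ?U" for U
      using openin_continuous_map_preimage [OF ps] that by blast
    show "continuous_map (subtopology X {x \<in> topspace X. proj E (s x) \<in> U}) T (\<lambda>x. quot (s x) (t x))" if U': "U \<in> ?U" for U
    proof -
      obtain \<phi> where U: "openin M U" "local_trivialization G T M E U \<phi>" using U' by blast
      let ?EU = "subtopology (total_space E) {e \<in> topspace (total_space E). proj E e \<in> U}"
      let ?X = "subtopology X {x \<in> topspace X. proj E (s x) \<in> U}"
      have topU: "topspace (subtopology M U) = U"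
        using openin_subset [OF U(1)] by auto
      have "homeomorphic_map (prod_topology (subtopology M U) T) ?EU \<phi>"
        using U(2) by (simp add: local_trivialization_def)
      then obtain \<psi> where \<psi>: "homeomorphic_maps (prod_topology (subtopology M U) T) ?EU \<phi> \<psi>"
        using homeomorphic_map_maps by blast
      then have c\<psi>: "continuous_map ?EU T (\<lambda>e. snd (\<psi> e))"
        using continuous_map_compose [OF _ continuous_map_snd, of ?EU "subtopology M U" T \<psi>]
        by (simp add: homeomorphic_maps_def o_def)
      have sU: "continuous_map ?X ?EU s" "continuous_map ?X ?EU t"
        using s t st sE by (auto simp: continuous_map_in_subtopology continuous_map_from_subtopology)
      have "continuous_map ?X T (\<lambda>x. snd (\<psi> (s x)))" "continuous_map ?X T (\<lambda>x. snd (\<psi> (t x)))"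
        using continuous_map_compose [OF sU(1) c\<psi>] continuous_map_compose [OF sU(2) c\<psi>] by (simp_all add: o_def)
      then have "continuous_map ?X T (\<lambda>x. inv (snd (\<psi> (s x))) \<otimes> snd (\<psi> (t x)))"
        by (intro continuous_mult continuous_inv)
      then show ?thesis
      proof (rule continuous_map_eq)
        fix x assume x: "x \<in> topspace ?X"
        have \<psi>\<phi>: "\<psi> (\<phi> (b, g)) = (b, g)" if "b \<in> U" "g \<in> carrier G" for b g
          using \<psi> that topU by (simp add: homeomorphic_maps_def)
        obtain g where g: "g \<in> carrier G" "s x = \<phi> (proj E (s x), g)"
          by (rule trivialization_coordinates [OF U, of "s x"]) (use x sE in auto)
        obtain h where h: "h \<in> carrier G" "t x = \<phi> (proj E (t x), h)"
          by (rule trivialization_coordinates [OF U, of "t x"]) (use x sE st in auto)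
        have h2: "t x = \<phi> (proj E (s x), h)"
          using h(2) st x by simp
        have b: "proj E (s x) \<in> U" using x by simp
        have "quot (s x) (t x) = inv g \<otimes> h"
          using quot_trivialization [OF U b g(1) h(1)] g(2) h2 by simp
        moreover have "snd (\<psi> (s x)) = g" "snd (\<psi> (t x)) = h"
          using \<psi>\<phi> [OF b g(1)] \<psi>\<phi> [OF b h(1)] g(2) h2 by simp_all
        ultimately show "inv (snd (\<psi> (s x))) \<otimes> snd (\<psi> (t x)) = quot (s x) (t x)"
          by simp
      qed
    qed
    show "\<exists>U. U \<in> ?U \<and> x \<in> {x \<in> topspace X. proj E (s x) \<in> U} \<and> quot (s x) (t x) = quot (s x) (t x)"
      if x: "x \<in> topspace X" for x
      using trivializationE [OF proj_in_M [OF sE(1) [OF x]]] x by blast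
  qed auto
qed

text \<open>Sections over a subspace are lifts of the identity. General f is allowed for the sake of
  characteristic maps, which may fail to be injective on the boundary sphere.\<close>

definition lift :: "'x topology \<Rightarrow> ('x \<Rightarrow> 'm) \<Rightarrow> ('x \<Rightarrow> 'e) \<Rightarrow> bool"
  where "lift X f s \<longleftrightarrow> continuous_map X (total_space E) s \<and> (\<forall>x\<in>topspace X. proj E (s x) = f x)"

lemma lift_total: "lift X f s \<Longrightarrow> x \<in> topspace X \<Longrightarrow> s x \<in> topspace (total_space E)"
  by (auto simp: lift_def continuous_map_def)

lemma lift_subtopology: "lift X f s \<Longrightarrow> lift (subtopology X S) f s"
  by (auto simp: lift_def continuous_map_from_subtopology)

lemma lift_mono: "lift (top_of_set S) f s \<Longrightarrow> S' \<subseteq> S \<Longrightarrow> lift (top_of_set S') f s"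
  by (auto simp: lift_def intro: continuous_map_from_subtopology_mono)

lemma lift_act:
  assumes "lift X f s" "continuous_map X T g"
  shows "lift X f (\<lambda>x. act E (s x) (g x))"
  using assms continuous_closed [OF assms(2)] lift_total [OF assms(1)]
  by (simp add: lift_def continuous_act proj_act)

lemma lift_compose:
  assumes "lift Y f s" "continuous_map X Y h"
  shows "lift X (\<lambda>x. f (h x)) (\<lambda>x. s (h x))"
  using assms continuous_map_compose [OF assms(2), of "total_space E" s]
  by (auto simp: lift_def o_def continuous_map_def)

lemma lift_quot:
  assumes "lift X f s" "lift X f t"
  shows "continuous_map X T (\<lambda>x. quot (s x) (t x))"
    and "x \<in> topspace X \<Longrightarrow> quot (s x) (t x) \<in> carrier G"
    and "x \<in> topspace X \<Longrightarrow> act E (s x) (quot (s x) (t x)) = t x"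
  using assms lift_total [OF assms(1)] lift_total [OF assms(2)]
  by (auto simp: lift_def intro!: continuous_quot quot)

text \<open>Where p = m the two lifts differ by the translation function. The retraction r carries
  this difference over the upper region, and acting with it on t makes t match s.\<close>

lemma lift_glue:
  fixes R :: "'z::topological_space set" and p :: "'z \<Rightarrow> real"
  assumes p: "continuous_on R p"
    and s: "lift (top_of_set {x \<in> R. p x \<le> m}) f s" and t: "lift (top_of_set {x \<in> R. m \<le> p x}) f t"
    and r: "continuous_on {x \<in> R. m \<le> p x} r" "\<And>x. x \<in> R \<Longrightarrow> m \<le> p x \<Longrightarrow> r x \<in> R \<and> p (r x) = m"
      "\<And>x. x \<in> R \<Longrightarrow> p x = m \<Longrightarrow> r x = x"
  shows "\<exists>s. lift (top_of_set R) f s"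
proof -
  let ?R1 = "{x \<in> R. p x \<le> m}" and ?R2 = "{x \<in> R. m \<le> p x}" and ?L = "{x \<in> R. p x = m}"
  have "lift (top_of_set ?L) f t" "lift (top_of_set ?L) f s"
    using lift_mono [OF t, of ?L] lift_mono [OF s, of ?L] by auto
  note q = lift_quot [OF this]
  have "continuous_map (top_of_set ?R2) (top_of_set ?L) r"
    using r by auto
  from continuous_map_compose [OF this q(1)]
  have g: "continuous_map (top_of_set ?R2) T (\<lambda>x. quot (t (r x)) (s (r x)))"
    by (simp add: o_def)
  let ?t = "\<lambda>x. act E (t x) (quot (t (r x)) (s (r x)))"
  have t': "lift (top_of_set ?R2) f ?t"
    by (rule lift_act [OF t g])
  have "continuous_map (top_of_set R) (total_space E) (\<lambda>x. if p x \<le> m then s x else ?t x)"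
  proof (rule continuous_map_cases_le)
    have 1: "subtopology (top_of_set R) {x \<in> topspace (top_of_set R). p x \<le> m} = top_of_set ?R1"
      by (simp add: subtopology_subtopology) (rule arg_cong [where f = top_of_set], auto)
    have 2: "subtopology (top_of_set R) {x \<in> topspace (top_of_set R). m \<le> p x} = top_of_set ?R2"
      by (simp add: subtopology_subtopology) (rule arg_cong [where f = top_of_set], auto)
    show "continuous_map (subtopology (top_of_set R) {x \<in> topspace (top_of_set R). p x \<le> m}) (total_space E) s"
      unfolding 1 using s by (simp add: lift_def)
    show "continuous_map (subtopology (top_of_set R) {x \<in> topspace (top_of_set R). m \<le> p x}) (total_space E) ?t"
      unfolding 2 using t' by (simp add: lift_def)
    show "s x = ?t x" if "x \<in> topspace (top_of_set R)" "p x = m" for x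
      using that r(3) [of x] q(3) [of x] by simp
  qed (use p in auto)
  moreover have "proj E (if p x \<le> m then s x else ?t x) = f x" if "x \<in> R" for x
    using that s t' by (auto simp: lift_def)
  ultimately show ?thesis
    unfolding lift_def by (intro exI [of _ "\<lambda>x. if p x \<le> m then s x else ?t x"]) auto
qed

lemma lift_local:
  assumes f: "continuous_map X M f" and U: "openin M U" "local_trivialization G T M E U \<phi>"
    and fU: "f \<in> topspace X \<rightarrow> U"
  shows "\<exists>s. lift X f s"
proof -
  let ?EU = "subtopology (total_space E) {e \<in> topspace (total_space E). proj E e \<in> U}"
  have "continuous_map X (prod_topology (subtopology M U) T) (\<lambda>x. (f x, \<one>))"
    using f fU by (auto simp: continuous_map_pairwise o_def continuous_map_in_subtopology)
  moreover have "continuous_map (prod_topology (subtopology M U) T) ?EU \<phi>"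
    using U(2) by (simp add: local_trivialization_def homeomorphic_imp_continuous_map)
  ultimately have "continuous_map X ?EU (\<phi> \<circ> (\<lambda>x. (f x, \<one>)))"
    by (rule continuous_map_compose)
  then have "continuous_map X (total_space E) (\<lambda>x. \<phi> (f x, \<one>))"
    by (simp add: o_def continuous_map_in_subtopology)
  moreover have "proj E (\<phi> (f x, \<one>)) = f x" if "x \<in> topspace X" for x
    using that fU U(2) one_closed unfolding local_trivialization_def by blast
  ultimately show ?thesis
    unfolding lift_def by blast
qed

text \<open>Bisection in the form of \<open>Bolzano\<close>: liftability holds on small rectangles
  and passes from two adjacent rectangles to their union. One coordinate gives a strip around each
  horizontal line, the other joins the strips.\<close>

lemma lift_square:
  fixes f :: "real \<times> real \<Rightarrow> 'm"
  assumes f: "continuous_map (top_of_set ({-1..1} \<times> {-1..1})) M f"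
  shows "\<exists>s. lift (top_of_set ({-1..1} \<times> {-1..1})) f s"
proof -
  define I where "I = {-1..1::real}"
  \<comment> \<open>Rectangles are clipped to the square, so that neighbourhoods of its boundary
    points need no separate treatment.\<close>
  define L where "L R \<longleftrightarrow> (\<exists>s. lift (top_of_set (R \<inter> I \<times> I)) f s)" for R
  have mono: "L R'" if "L R" "R' \<subseteq> R" for R R'
    using that lift_mono unfolding L_def by (metis inf_mono order_refl)
  have fstI: "L ({a..c} \<times> K)" if hyp: "L ({a..b} \<times> K)" "L ({b..c} \<times> K)" "a \<le> b" "b \<le> c" for a b c and K :: "real set"
  proof (cases "b \<in> I")
    case True
    let ?R = "({a..c} \<times> K) \<inter> I \<times> I"
    have e: "({a..b} \<times> K) \<inter> I \<times> I = {x \<in> ?R. fst x \<le> b}" "({b..c} \<times> K) \<inter> I \<times> I = {x \<in> ?R. b \<le> fst x}"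
      using hyp by auto
    obtain s t where "lift (top_of_set {x \<in> ?R. fst x \<le> b}) f s" "lift (top_of_set {x \<in> ?R. b \<le> fst x}) f t"
      using hyp(1,2) unfolding L_def e by blast
    then have "\<exists>s. lift (top_of_set ?R) f s"
      by (rule lift_glue [where r = "\<lambda>x. (b, snd x)", rotated])
        (use hyp True in \<open>auto intro!: continuous_intros\<close>)
    then show ?thesis by (simp add: L_def)
  next
    case False
    \<comment> \<open>The dividing line misses the square and there is nothing to glue: one of the
      two clipped rectangles is already the whole.\<close>
    then have "{a..c} \<inter> I \<subseteq> {b..c} \<or> {a..c} \<inter> I \<subseteq> {a..b}"
      by (auto simp: I_def)
    then have "({a..c} \<times> K) \<inter> I \<times> I \<subseteq> ({b..c} \<times> K) \<inter> I \<times> I \<or> ({a..c} \<times> K) \<inter> I \<times> I \<subseteq> ({a..b} \<times> K) \<inter> I \<times> I"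
      by blast
    then show ?thesis
      using hyp(1,2) lift_mono unfolding L_def by blast
  qed
  have sndI: "L (K \<times> {a..c})" if hyp: "L (K \<times> {a..b})" "L (K \<times> {b..c})" "a \<le> b" "b \<le> c" for a b c and K :: "real set"
  proof (cases "b \<in> I")
    case True
    let ?R = "(K \<times> {a..c}) \<inter> I \<times> I"
    have e: "(K \<times> {a..b}) \<inter> I \<times> I = {x \<in> ?R. snd x \<le> b}" "(K \<times> {b..c}) \<inter> I \<times> I = {x \<in> ?R. b \<le> snd x}"
      using hyp by auto
    obtain s t where "lift (top_of_set {x \<in> ?R. snd x \<le> b}) f s" "lift (top_of_set {x \<in> ?R. b \<le> snd x}) f t"
      using hyp(1,2) unfolding L_def e by blast
    then have "\<exists>s. lift (top_of_set ?R) f s"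
      by (rule lift_glue [where r = "\<lambda>x. (fst x, b)", rotated])
        (use hyp True in \<open>auto intro!: continuous_intros\<close>)
    then show ?thesis by (simp add: L_def)
  next
    case False
    then have "{a..c} \<inter> I \<subseteq> {b..c} \<or> {a..c} \<inter> I \<subseteq> {a..b}"
      by (auto simp: I_def)
    then have "(K \<times> {a..c}) \<inter> I \<times> I \<subseteq> (K \<times> {b..c}) \<inter> I \<times> I \<or> (K \<times> {a..c}) \<inter> I \<times> I \<subseteq> (K \<times> {a..b}) \<inter> I \<times> I"
      by blast
    then show ?thesis
      using hyp(1,2) lift_mono unfolding L_def by blast
  qed
  have box: "\<exists>d>0. L ({x - d..x + d} \<times> {y - d..y + d})" if xy: "x \<in> I" "y \<in> I" for x y
  proof -
    have "f (x, y) \<in> topspace M"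
      using f xy by (auto simp: continuous_map_def I_def)
    then obtain U \<phi> where U: "openin M U" "f (x, y) \<in> U" "local_trivialization G T M E U \<phi>"
      by (rule trivializationE)
    have "openin (top_of_set (I \<times> I)) {z \<in> I \<times> I. f z \<in> U}"
      using openin_continuous_map_preimage [OF f U(1)] by (simp add: I_def)
    then obtain W where W: "open W" "{z \<in> I \<times> I. f z \<in> U} = (I \<times> I) \<inter> W"
      by (auto simp: openin_open)
    then have "(x, y) \<in> W" using xy U(2) by auto
    then obtain e where e: "0 < e" "cball (x, y) e \<subseteq> W"
      using W(1) open_contains_cball by blast
    have sub: "{x - e/2..x + e/2} \<times> {y - e/2..y + e/2} \<subseteq> cball (x, y) e"
    proof
      fix z assume z: "z \<in> {x - e/2..x + e/2} \<times> {y - e/2..y + e/2}"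
      have "dist (x, y) z \<le> dist x (fst z) + dist y (snd z)"
        unfolding dist_prod_def by (simp add: sqrt_sum_squares_le_sum)
      also have "\<dots> \<le> e"
        using z by (auto simp: dist_real_def abs_le_iff)
      finally show "z \<in> cball (x, y) e" by simp
    qed
    let ?R = "({x - e/2..x + e/2} \<times> {y - e/2..y + e/2}) \<inter> I \<times> I"
    have "\<exists>s. lift (top_of_set ?R) f s"
    proof (rule lift_local [OF _ U(1,3)])
      show "continuous_map (top_of_set ?R) M f"
        by (rule continuous_map_from_subtopology_mono [OF f]) (auto simp: I_def)
      show "f \<in> topspace (top_of_set ?R) \<rightarrow> U"
        using sub e(2) W(2) by auto
    qed
    then have "L ({x - e/2..x + e/2} \<times> {y - e/2..y + e/2})"
      by (simp add: L_def)
    then show ?thesis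
      using e(1) by (intro exI [of _ "e/2"]) auto
  qed
  have strip: "\<exists>d>0. L (I \<times> {y - d..y + d})" if y: "y \<in> I" for y
  proof -
    \<comment> \<open>The height may depend on the interval under consideration; joining two
      intervals takes the smaller height.\<close>
    have "\<exists>d>0. L ({-1..1} \<times> {y - d..y + d})"
    proof (rule Bolzano [of "-1" 1 "\<lambda>u v. \<exists>d>0. L ({u..v} \<times> {y - d..y + d})"])
      show "\<exists>d>0. L ({a..c} \<times> {y - d..y + d})"
        if hyp: "\<exists>d>0. L ({a..b} \<times> {y - d..y + d})" "\<exists>d>0. L ({b..c} \<times> {y - d..y + d})" "a \<le> b" "b \<le> c" for a b c
      proof -
        obtain d d' where d: "0 < d" "L ({a..b} \<times> {y - d..y + d})" "0 < d'" "L ({b..c} \<times> {y - d'..y + d'})"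
          using hyp by blast
        have "L ({a..b} \<times> {y - min d d'..y + min d d'})" "L ({b..c} \<times> {y - min d d'..y + min d d'})"
          by (rule mono [OF d(2)], force) (rule mono [OF d(4)], force)
        then have "L ({a..c} \<times> {y - min d d'..y + min d d'})"
          using fstI hyp(3,4) by blast
        then show ?thesis using d by (intro exI [of _ "min d d'"]) auto
      qed
      show "\<exists>e>0. \<forall>a b. a \<le> x \<and> x \<le> b \<and> b - a < e \<longrightarrow> (\<exists>d>0. L ({a..b} \<times> {y - d..y + d}))"
        if x: "-1 \<le> x" "x \<le> 1" for x
      proof -
        obtain d where d: "0 < d" "L ({x - d..x + d} \<times> {y - d..y + d})"
          using box [of x y] x y by (auto simp: I_def)
        have "L ({a..b} \<times> {y - d..y + d})" if "a \<le> x" "x \<le> b" "b - a < d" for a b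
          by (rule mono [OF d(2)]) (use that in force)
        then show ?thesis using d(1) by blast
      qed
    qed simp
    then show ?thesis by (simp add: I_def)
  qed
  have "L (I \<times> {-1..1})"
  proof (rule Bolzano [of "-1" 1 "\<lambda>u v. L (I \<times> {u..v})"])
    show "\<exists>e>0. \<forall>a b. a \<le> y \<and> y \<le> b \<and> b - a < e \<longrightarrow> L (I \<times> {a..b})" if y: "-1 \<le> y" "y \<le> 1" for y
    proof -
      obtain d where d: "0 < d" "L (I \<times> {y - d..y + d})"
        using strip [of y] y by (auto simp: I_def)
      have "L (I \<times> {a..b})" if "a \<le> y" "y \<le> b" "b - a < d" for a b
        by (rule mono [OF d(2)]) (use that in force)
      then show ?thesis using d(1) by blast
    qed
  qed (auto intro: sndI)
  then show ?thesis
    by (simp add: L_def I_def)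
qed

text \<open>The disc is a retract of the square: \<open>b\<close> fills in zeros for the coordinates
  from n on and \<open>c\<close> pulls exterior points back radially. A lift over the square of f
  composed with \<open>c\<close> restricts to the disc.\<close>

lemma lift_disc:
  assumes f: "continuous_map (top_of_set (disc n)) M f" and n: "n \<le> 2"
  shows "\<exists>s. lift (top_of_set (disc n)) f s"
proof -
  define b where "b z = (\<lambda>i. if i < n then bary (fst z) (snd z) 0 i else 0)" for z :: "real \<times> real"
  define c where "c z = (\<lambda>i. (1 / max 1 (radius n (b z))) * b z i)" for z
  have cb: "continuous_on UNIV b"
    unfolding b_def
  proof (rule continuous_on_coordinatewise_then_product)
    have "continuous_on UNIV (\<lambda>z :: real \<times> real. bary (fst z) (snd z) 0)"
      by (intro continuous_on_bary continuous_intros)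
    then show "continuous_on UNIV (\<lambda>z. if i < n then bary (fst z) (snd z) 0 i else 0)" for i
      using continuous_on_product_then_coordinatewise by (cases "i < n") auto
  qed
  have cc: "continuous_on UNIV c"
    unfolding c_def by (intro continuous_on_scale cb continuous_on_divide continuous_on_max continuous_on_radius continuous_on_const) auto
  have cd: "c z \<in> disc n" for z
  proof -
    have "radius n (c z) = (1 / max 1 (radius n (b z))) * radius n (b z)"
      unfolding c_def by (rule radius_scale) auto
    then show ?thesis
      by (auto simp: disc_iff c_def b_def divide_le_eq)
  qed
  have cid: "c (y 0, y 1) = y" if y: "y \<in> disc n" for y
  proof -
    have "b (y 0, y 1) = y"
    proof
      fix i
      show "b (y 0, y 1) i = y i"
        using y n by (cases "i = 0"; cases "i = 1") (auto simp: b_def disc_iff bary_def)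
    qed
    then show ?thesis
      using y by (simp add: c_def disc_iff)
  qed
  have "continuous_map (top_of_set ({-1..1} \<times> {-1..1})) (top_of_set (disc n)) c"
    using continuous_on_subset [OF cc] cd by auto
  from continuous_map_compose [OF this f]
  have "continuous_map (top_of_set ({-1..1} \<times> {-1..1})) M (\<lambda>z. f (c z))"
    by (simp add: o_def)
  then obtain s where s: "lift (top_of_set ({-1..1} \<times> {-1..1})) (\<lambda>z. f (c z)) s"
    using lift_square by blast
  have "continuous_map (top_of_set (disc n)) (top_of_set ({-1..1} \<times> {-1..1})) (\<lambda>y. (y 0, y 1))"
  proof -
    have "\<bar>y i\<bar> \<le> 1" if "y \<in> disc n" for y i
      using that coordinate_le_radius [of i n y] by (cases "i < n") (auto simp: disc_iff)
    then have "y i \<in> {-1..1}" if "y \<in> disc n" for y i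
      using that by (simp add: abs_le_iff minus_le_iff)
    then show ?thesis
      by (auto intro!: continuous_intros)
  qed
  from lift_compose [OF s this] have "lift (top_of_set (disc n)) (\<lambda>y. f (c (y 0, y 1))) (\<lambda>y. s (y 0, y 1))" .
  then have "lift (top_of_set (disc n)) f (\<lambda>y. s (y 0, y 1))"
    using cid by (simp add: lift_def)
  then show ?thesis by blast
qed

end


section \<open>Sections over the two pieces\<close>

locale cw2_bundle = cw2_group G T M C + principal_bundle_space G T M E
  for G (structure) and T and M and C and E
begin

lemma lift_cell:
  assumes "\<phi> \<in> C n"
  shows "\<exists>s. lift (top_of_set (disc n)) \<phi> s"
proof (rule lift_disc)
  show "continuous_map (top_of_set (disc n)) M \<phi>"
    using assms by (rule cell_continuous) simp
  show "n \<le> 2"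
    using assms dim2 [of n] by (cases "n > 2") auto
qed

text \<open>X is the full next skeleton for vertices and edges and the punctured one for 2-cells.
  Cellwise lifts that agree with s on the boundary spheres define a section that is continuous by
  the cellwise test.\<close>

lemma extend_section:
  assumes X: "openin (subtopology M (skel (Suc n))) X" "skel n \<subseteq> X"
    and s: "lift (subtopology M (skel n)) (\<lambda>x. x) s"
    and t: "\<And>\<phi>. \<phi> \<in> C n \<Longrightarrow> \<exists>t. lift (top_of_set {y \<in> disc n. \<phi> y \<in> X}) \<phi> t \<and> (\<forall>y\<in>disc_boundary n. t y = s (\<phi> y))"
  shows "\<exists>s. lift (subtopology M X) (\<lambda>x. x) s"
proof -
  obtain t where t: "\<And>\<phi>. \<phi> \<in> C n \<Longrightarrow> lift (top_of_set {y \<in> disc n. \<phi> y \<in> X}) \<phi> (t \<phi>)"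
    "\<And>\<phi> y. \<phi> \<in> C n \<Longrightarrow> y \<in> disc_boundary n \<Longrightarrow> t \<phi> y = s (\<phi> y)"
    using t by metis
  define s' where "s' x = (if x \<in> cells n then (let (\<phi>, y) = chart n x in t \<phi> y) else s x)" for x
  have s'n: "s' (\<phi> y) = t \<phi> y" if "\<phi> \<in> C n" "y \<in> disc n" for \<phi> y
    using that t(2) [of \<phi> y] cell_in_cells_iff [of \<phi> n y] chart_cell [of \<phi> n y]
    unfolding s'_def disc_eq by auto
  have s'm: "s' x = s x" if "x \<in> skel n" for x
    using that skel_disjoint [of n n] by (auto simp: s'_def)
  have top: "topspace (subtopology M X) = X" "topspace (subtopology M (skel n)) = skel n"
    using openin_subset [OF X(1)] skel_subset [of n] by auto
  have "continuous_map (subtopology M X) (total_space E) s'"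
  proof (rule continuous_on_skel [OF X(1)])
    fix m \<phi> assume m: "m < Suc n" "\<phi> \<in> C m"
    show "continuous_map (top_of_set {y \<in> disc m. \<phi> y \<in> X}) (total_space E) (\<lambda>y. s' (\<phi> y))"
    proof (cases "m = n")
      case True
      have "continuous_map (top_of_set {y \<in> disc m. \<phi> y \<in> X}) (total_space E) (t \<phi>)"
        using t(1) [of \<phi>] m True by (simp add: lift_def)
      then show ?thesis
        by (rule continuous_map_eq) (use s'n m True in auto)
    next
      case False
      then have sk: "\<phi> y \<in> skel n" if "y \<in> disc m" for y
        using that m cell_skel [of \<phi> m n y] by simp
      have "continuous_map (top_of_set {y \<in> disc m. \<phi> y \<in> X}) (subtopology M (skel n)) \<phi>"
        using cell_continuous [OF m(2), of "{y \<in> disc m. \<phi> y \<in> X}"] sk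
        by (auto simp: continuous_map_in_subtopology)
      from continuous_map_compose [OF this, of "total_space E" s]
      have "continuous_map (top_of_set {y \<in> disc m. \<phi> y \<in> X}) (total_space E) (\<lambda>y. s (\<phi> y))"
        using s by (simp add: lift_def o_def)
      then show ?thesis
        by (rule continuous_map_eq) (use s'm sk in auto)
    qed
  qed
  moreover have "proj E (s' x) = x" if x: "x \<in> X" for x
  proof (cases "x \<in> skel n")
    case True
    then show ?thesis using s s'm top by (simp add: lift_def)
  next
    case False
    then have "x \<in> cells n"
      using x openin_subset [OF X(1)] by (auto simp: skel_Suc)
    then obtain \<phi> y where y: "\<phi> \<in> C n" "y \<in> open_disc n" "x = \<phi> y" by (rule cellsE)
    then show ?thesis
      using t(1) [of \<phi>] x s'n [of \<phi> y] open_disc_subset_disc [of n] by (auto simp: lift_def)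
  qed
  ultimately show ?thesis
    using top unfolding lift_def by (intro exI [of _ s']) auto
qed

lemma section_skel_1: "\<exists>s. lift (subtopology M (skel (Suc 0))) (\<lambda>x. x) s"
proof (rule extend_section)
  show "openin (subtopology M (skel (Suc 0))) (skel (Suc 0))"
    by (metis openin_topspace openin_subtopology_Int2 openin_subset inf.absorb_iff2 topspace_subtopology_subset skel_subset)
  have "skel 0 = {}" by (simp add: skel_def)
  \<comment> \<open>\<open>skel 0\<close> is empty, so any function is a section over it; this
    starts the induction over skeleta.\<close>
  then show "skel 0 \<subseteq> skel (Suc 0)" "lift (subtopology M (skel 0)) (\<lambda>x. x) undefined"
    by (simp_all add: lift_def)
  fix \<phi> assume \<phi>: "\<phi> \<in> C 0"
  obtain t where "lift (top_of_set (disc 0)) \<phi> t"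
    using lift_cell [OF \<phi>] by blast
  then have "lift (top_of_set {y \<in> disc 0. \<phi> y \<in> skel (Suc 0)}) \<phi> t"
    by (rule lift_mono) auto
  moreover have "disc_boundary 0 = {}"
    by (auto simp: disc_boundary_iff radius_def)
  ultimately show "\<exists>t. lift (top_of_set {y \<in> disc 0. \<phi> y \<in> skel (Suc 0)}) \<phi> t \<and> (\<forall>y\<in>disc_boundary 0. t y = s (\<phi> y))" for s
    by blast
qed

lemma section_skel_2: "\<exists>s. lift (subtopology M (skel 2)) (\<lambda>x. x) s"
proof -
  obtain s where s: "lift (subtopology M (skel (Suc 0))) (\<lambda>x. x) s"
    using section_skel_1 by blast
  have "\<exists>s. lift (subtopology M (skel (Suc (Suc 0)))) (\<lambda>x. x) s"
  proof (rule extend_section [OF _ _ s])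
    show "openin (subtopology M (skel (Suc (Suc 0)))) (skel (Suc (Suc 0)))"
      by (metis openin_topspace openin_subtopology_Int2 openin_subset inf.absorb_iff2 topspace_subtopology_subset skel_subset)
    show "skel (Suc 0) \<subseteq> skel (Suc (Suc 0))"
      by (auto simp: skel_Suc)
    fix \<phi> assume \<phi>: "\<phi> \<in> C (Suc 0)"
    obtain t where t: "lift (top_of_set (disc (Suc 0))) \<phi> t"
      using lift_cell [OF \<phi>] by blast
    let ?q = "\<lambda>y. quot (t y) (s (\<phi> y))"
    have q: "?q y \<in> carrier G" "act E (t y) (?q y) = s (\<phi> y)" if "y \<in> disc_boundary (Suc 0)" for y
    proof -
      have y: "y \<in> disc (Suc 0)" "\<phi> y \<in> skel (Suc 0)"
        using that disc_boundary_subset_disc cell_boundary [OF \<phi>] by auto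
      then have "s (\<phi> y) \<in> topspace (total_space E)" "proj E (s (\<phi> y)) = \<phi> y"
        using lift_total [OF s, of "\<phi> y"] s skel_subset [of "Suc 0"] by (auto simp: lift_def)
      then show "?q y \<in> carrier G" "act E (t y) (?q y) = s (\<phi> y)"
        using quot [of "t y" "s (\<phi> y)"] lift_total [OF t, of y] t y by (auto simp: lift_def)
    qed
    define e where "e a = (\<lambda>i :: nat. if i = 0 then a else 0)" for a :: real
    have eb: "e 1 \<in> disc_boundary (Suc 0)" "e (-1) \<in> disc_boundary (Suc 0)"
      by (auto simp: disc_boundary_iff radius_1 e_def)
    have ecases: "y = e 1 \<or> y = e (-1)" if "y \<in> disc_boundary (Suc 0)" for y
    proof -
      have "y = e (y 0)"
        using that by (auto simp: e_def disc_boundary_iff fun_eq_iff)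
      moreover have "y 0 = 1 \<or> y 0 = -1"
        using that by (auto simp: disc_boundary_iff radius_1 abs_eq_iff abs_if split: if_splits)
      ultimately show ?thesis by metis
    qed
    \<comment> \<open>At the two ends of the edge, t differs from s by two elements of G. A path
      between them, parametrised from -1 to 1, corrects t along the whole edge.\<close>
    obtain p where p: "pathin T p" "p 0 = ?q (e (-1))" "p 1 = ?q (e 1)"
      using path_connected q(1) [OF eb(1)] q(1) [OF eb(2)] unfolding path_connected_space_def by auto
    have "continuous_map (top_of_set (disc (Suc 0))) T (\<lambda>y. p ((1 + y 0) / 2))"
    proof (rule continuous_path [OF p(1)])
      show "continuous_map (top_of_set (disc (Suc 0))) euclideanreal (\<lambda>y. (1 + y 0) / 2)"
        by (auto intro!: continuous_intros)
      show "(1 + y 0) / 2 \<in> {0..1}" if "y \<in> topspace (top_of_set (disc (Suc 0)))" for y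
        using that by (auto simp: disc_iff radius_1)
    qed
    from lift_act [OF t this]
    have "lift (top_of_set (disc (Suc 0))) \<phi> (\<lambda>y. act E (t y) (p ((1 + y 0) / 2)))" .
    then have "lift (top_of_set {y \<in> disc (Suc 0). \<phi> y \<in> skel (Suc (Suc 0))}) \<phi> (\<lambda>y. act E (t y) (p ((1 + y 0) / 2)))"
      by (rule lift_mono) auto
    moreover have "act E (t y) (p ((1 + y 0) / 2)) = s (\<phi> y)" if y: "y \<in> disc_boundary (Suc 0)" for y
    proof -
      have "p ((1 + y 0) / 2) = ?q y"
        using ecases [OF y] p by (auto simp: e_def)
      then show ?thesis using q(2) [OF y] by simp
    qed
    ultimately show "\<exists>t. lift (top_of_set {y \<in> disc (Suc 0). \<phi> y \<in> skel (Suc (Suc 0))}) \<phi> t \<and>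
        (\<forall>y\<in>disc_boundary (Suc 0). t y = s (\<phi> y))"
      by blast
  qed
  then show ?thesis by (simp only: numeral_2_eq_2)
qed

text \<open>On the boundary circle of a 2-cell, t differs from s by a map to G. With the centre
  removed this map extends along the radial retraction \<open>r\<close>; over the full disc it may
  be obstructed by its class in pi_1.\<close>

lemma section_A: "\<exists>s. lift (subtopology M A) (\<lambda>x. x) s"
proof -
  obtain s where s: "lift (subtopology M (skel 2)) (\<lambda>x. x) s"
    using section_skel_2 by blast
  show ?thesis
  proof (rule extend_section [OF openin_punct skel_subset_punct s])
    fix \<phi> assume \<phi>: "\<phi> \<in> C 2"
    obtain t where t: "lift (top_of_set (disc 2)) \<phi> t"
      using lift_cell [OF \<phi>] by blast
    let ?D = "{y \<in> disc 2. \<phi> y \<in> A}" and ?S = "disc_boundary 2"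
    have D: "y \<in> disc 2" "radius 2 y \<noteq> 0" if "y \<in> ?D" for y
      using that cell_in_punct_iff [OF \<phi>, of y] radius_eq_0 [of 2 y] by (auto simp: disc_iff)
    have tD: "lift (top_of_set ?D) \<phi> t" and tS: "lift (top_of_set ?S) \<phi> t"
      using lift_mono [OF t] disc_boundary_subset_disc [of 2] by auto
    have "continuous_map (top_of_set ?S) (subtopology M (skel 2)) \<phi>"
      using cell_continuous [OF \<phi> disc_boundary_subset_disc] cell_boundary [OF \<phi>]
      by (auto simp: continuous_map_in_subtopology)
    from lift_compose [OF s this] have sS: "lift (top_of_set ?S) \<phi> (\<lambda>y. s (\<phi> y))" .
    note q = lift_quot [OF tS sS]
    define r where "r y = (\<lambda>i. (1 / radius 2 y) * y i)" for y :: "nat \<Rightarrow> real"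
    have rS: "r y \<in> ?S" if "y \<in> ?D" for y
    proof -
      have "radius 2 (r y) = (1 / radius 2 y) * radius 2 y"
        unfolding r_def by (rule radius_scale) (simp add: radius_nonneg)
      then show ?thesis
        using D [OF that] by (simp add: disc_boundary_iff disc_iff r_def)
    qed
    have "continuous_on ?D r"
      unfolding r_def
      by (intro continuous_on_scale continuous_on_divide continuous_on_radius continuous_on_const continuous_on_id)
        (use D in auto)
    then have "continuous_map (top_of_set ?D) (top_of_set ?S) r"
      using rS by auto
    from continuous_map_compose [OF this q(1)]
    have "continuous_map (top_of_set ?D) T (\<lambda>y. quot (t (r y)) (s (\<phi> (r y))))"
      by (simp add: o_def)
    from lift_act [OF tD this]
    have "lift (top_of_set ?D) \<phi> (\<lambda>y. act E (t y) (quot (t (r y)) (s (\<phi> (r y)))))" .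
    moreover have "act E (t y) (quot (t (r y)) (s (\<phi> (r y)))) = s (\<phi> y)" if "y \<in> ?S" for y
    proof -
      have "r y = y" using that by (simp add: r_def disc_boundary_iff)
      then show ?thesis using q(3) [of y] that by simp
    qed
    ultimately show "\<exists>t. lift (top_of_set ?D) \<phi> t \<and> (\<forall>y\<in>?S. t y = s (\<phi> y))"
      by blast
  qed
qed

text \<open>The open 2-cells are disjoint and open in M, so sections chosen in each of them combine
  without a matching condition.\<close>

lemma section_B: "\<exists>s. lift (subtopology M B) (\<lambda>x. x) s"
proof -
  have "\<forall>\<phi>\<in>C 2. \<exists>t. lift (top_of_set (disc 2)) \<phi> t"
    using lift_cell by blast
  then obtain t where t: "\<And>\<phi>. \<phi> \<in> C 2 \<Longrightarrow> lift (top_of_set (disc 2)) \<phi> (t \<phi>)"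
    by metis
  define s where "s x = (let (\<phi>, y) = chart 2 x in t \<phi> y)" for x
  have s: "s (\<phi> y) = t \<phi> y" if "\<phi> \<in> C 2" "y \<in> open_disc 2" for \<phi> y
    using that by (simp add: s_def chart_cell)
  have "continuous_map (subtopology M (cell_part 2 (open_disc 2))) (total_space E) s"
  proof (rule continuous_on_cell_part)
    fix \<phi> assume \<phi>: "\<phi> \<in> C 2"
    have "lift (top_of_set (open_disc 2)) \<phi> (t \<phi>)"
      using lift_mono [OF t [OF \<phi>]] open_disc_subset_disc by blast
    then show "continuous_map (top_of_set (open_disc 2)) (total_space E) (\<lambda>y. s (\<phi> y))"
      unfolding lift_def using s [OF \<phi>] by (auto elim!: continuous_map_eq)
  qed simp
  moreover have "proj E (s x) = x" if "x \<in> B" for x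
  proof -
    obtain \<phi> y where y: "\<phi> \<in> C 2" "y \<in> open_disc 2" "x = \<phi> y" using cellsE [OF \<open>x \<in> B\<close>] .
    then show ?thesis
      using t [of \<phi>] s open_disc_subset_disc [of 2] by (auto simp: lift_def)
  qed
  ultimately show ?thesis
    unfolding lift_def by (intro exI [of _ s]) (simp add: cells_eq_cell_part)
qed

end


section \<open>Bundles and transition functions\<close>

context two_piece_cover
begin

lemma piece_in_M [simp]: "x \<in> A \<Longrightarrow> x \<in> topspace M" "x \<in> B \<Longrightarrow> x \<in> topspace M"
  using cover by auto

end

locale covered_bundle = two_piece_cover G T M A B + principal_bundle_space G T M E
  for G (structure) and T and M and A B and E
begin

definition section_pair where
  "section_pair s t u \<longleftrightarrow> lift MA (\<lambda>x. x) s \<and> lift MB (\<lambda>x. x) t \<and>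
    (\<forall>x\<in>A \<inter> B. u x \<in> carrier G \<and> act E (s x) (u x) = t x)"

definition transition where
  "transition u \<longleftrightarrow> (\<exists>s t. section_pair s t u)"

lemma section_pairD:
  assumes "section_pair s t u"
  shows "lift MA (\<lambda>x. x) s" "lift MB (\<lambda>x. x) t"
    and "x \<in> A \<Longrightarrow> s x \<in> topspace (total_space E) \<and> proj E (s x) = x"
    and "x \<in> B \<Longrightarrow> t x \<in> topspace (total_space E) \<and> proj E (t x) = x"
    and "x \<in> A \<Longrightarrow> x \<in> B \<Longrightarrow> u x \<in> carrier G \<and> act E (s x) (u x) = t x"
proof -
  show l: "lift MA (\<lambda>x. x) s" "lift MB (\<lambda>x. x) t"
    using assms by (auto simp: section_pair_def)
  show "x \<in> A \<Longrightarrow> s x \<in> topspace (total_space E) \<and> proj E (s x) = x"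
    using l(1) lift_total [OF l(1), of x] by (simp add: lift_def)
  show "x \<in> B \<Longrightarrow> t x \<in> topspace (total_space E) \<and> proj E (t x) = x"
    using l(2) lift_total [OF l(2), of x] by (simp add: lift_def)
  show "x \<in> A \<Longrightarrow> x \<in> B \<Longrightarrow> u x \<in> carrier G \<and> act E (s x) (u x) = t x"
    using assms by (auto simp: section_pair_def)
qed

lemma transition_exists:
  assumes s: "lift MA (\<lambda>x. x) s" and t: "lift MB (\<lambda>x. x) t"
  shows "\<exists>u. transition u"
proof -
  have "quot (s x) (t x) \<in> carrier G \<and> act E (s x) (quot (s x) (t x)) = t x" if "x \<in> A \<inter> B" for x
    using that quot [of "s x" "t x"] lift_total [OF s, of x] lift_total [OF t, of x] s t by (simp add: lift_def)
  then have "section_pair s t (\<lambda>x. quot (s x) (t x))"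
    using s t by (simp add: section_pair_def)
  then show ?thesis
    unfolding transition_def by blast
qed

lemma transition_continuous:
  assumes "transition u"
  shows "continuous_map MAB T u"
proof -
  obtain s t where st: "section_pair s t u"
    using assms by (auto simp: transition_def)
  have "lift MAB (\<lambda>x. x) s" "lift MAB (\<lambda>x. x) t"
    using lift_subtopology [OF section_pairD(1) [OF st], of B] lift_subtopology [OF section_pairD(2) [OF st], of A]
    by (simp_all add: subtopology_subtopology Int_commute)
  then have "continuous_map MAB T (\<lambda>x. quot (s x) (t x))"
    by (rule lift_quot)
  then show ?thesis
  proof (rule continuous_map_eq)
    fix x assume "x \<in> topspace MAB"
    then show "quot (s x) (t x) = u x"
      using section_pairD(3,5) [OF st, of x] by (intro quot_eqI) auto
  qed
qed

text \<open>The gauge functions are the translations between the two sections over A and over B. Two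
  products of group elements carry \<open>s x\<close> to \<open>t' x\<close>, and the action is
  free.\<close>

lemma transition_gauge_equivalent:
  assumes u: "transition u" and v: "transition v"
  shows "gauge_equivalent u v"
proof -
  obtain s t where st: "section_pair s t u"
    using u by (auto simp: transition_def)
  obtain s' t' where st': "section_pair s' t' v"
    using v by (auto simp: transition_def)
  note \<alpha> = lift_quot [OF section_pairD(1) [OF st] section_pairD(1) [OF st']]
  note \<beta> = lift_quot [OF section_pairD(2) [OF st] section_pairD(2) [OF st']]
  let ?\<alpha> = "\<lambda>x. quot (s x) (s' x)" and ?\<beta> = "\<lambda>x. quot (t x) (t' x)"
  have "v x = inv (?\<alpha> x) \<otimes> u x \<otimes> ?\<beta> x" if x: "x \<in> A \<inter> B" for x
  proof -
    have c: "?\<alpha> x \<in> carrier G" "?\<beta> x \<in> carrier G" "u x \<in> carrier G" "v x \<in> carrier G"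
      using \<alpha>(2) \<beta>(2) section_pairD(5) [OF st, of x] section_pairD(5) [OF st', of x] x by auto
    have s: "s x \<in> topspace (total_space E)" using section_pairD(3) [OF st, of x] x by simp
    have "act E (s x) (?\<alpha> x \<otimes> v x) = t' x"
      using \<alpha>(3) [of x] section_pairD(5) [OF st', of x] x c s by (simp flip: act_act)
    moreover have "act E (s x) (u x \<otimes> ?\<beta> x) = t' x"
      using \<beta>(3) [of x] section_pairD(5) [OF st, of x] x c s by (simp flip: act_act)
    ultimately have "?\<alpha> x \<otimes> v x = u x \<otimes> ?\<beta> x"
      using quot_eqI [OF s, of "?\<alpha> x \<otimes> v x" "t' x"] quot_eqI [OF s, of "u x \<otimes> ?\<beta> x" "t' x"] c by simp
    then have "inv (?\<alpha> x) \<otimes> (?\<alpha> x \<otimes> v x) = inv (?\<alpha> x) \<otimes> (u x \<otimes> ?\<beta> x)" by simp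
    then show ?thesis using c by (simp add: m_assoc)
  qed
  then show ?thesis
    unfolding gauge_equivalent_def using \<alpha>(1) \<beta>(1) by blast
qed

text \<open>The gauge functions are absorbed into the sections, which are moved by the inverses of
  \<alpha> and \<beta>.\<close>

lemma gauge_equivalent_transition:
  assumes v: "transition v" and g: "gauge_equivalent u v" and u: "continuous_map MAB T u"
  shows "transition u"
proof -
  obtain s t where st: "section_pair s t v"
    using v by (auto simp: transition_def)
  obtain \<alpha> \<beta> where ab: "continuous_map MA T \<alpha>" "continuous_map MB T \<beta>"
    "\<And>x. x \<in> A \<inter> B \<Longrightarrow> v x = inv (\<alpha> x) \<otimes> u x \<otimes> \<beta> x"
    using g unfolding gauge_equivalent_def by blast
  let ?s = "\<lambda>x. act E (s x) (inv (\<alpha> x))" and ?t = "\<lambda>x. act E (t x) (inv (\<beta> x))"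
  have "lift MA (\<lambda>x. x) ?s" "lift MB (\<lambda>x. x) ?t"
    using lift_act section_pairD(1,2) [OF st] continuous_inv ab(1,2) by blast+
  moreover have "u x \<in> carrier G \<and> act E (?s x) (u x) = ?t x" if x: "x \<in> A \<inter> B" for x
  proof -
    have c: "\<alpha> x \<in> carrier G" "\<beta> x \<in> carrier G" "u x \<in> carrier G" "v x \<in> carrier G"
      using continuous_closed [OF ab(1)] continuous_closed [OF ab(2)] continuous_closed [OF u]
        section_pairD(5) [OF st, of x] x by auto
    have s: "s x \<in> topspace (total_space E)" and t: "t x = act E (s x) (v x)"
      using section_pairD(3,5) [OF st, of x] x by simp_all
    have "?t x = act E (s x) (v x \<otimes> inv (\<beta> x))"
      using t s c by (simp add: act_act)
    also have "v x \<otimes> inv (\<beta> x) = inv (\<alpha> x) \<otimes> u x"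
      using ab(3) [OF x] c by (simp add: m_assoc)
    finally show ?thesis
      using s c by (simp add: act_act)
  qed
  ultimately show ?thesis
    unfolding transition_def section_pair_def by blast
qed

lemma quot_act:
  assumes "e \<in> topspace (total_space E)" "e' \<in> topspace (total_space E)" "proj E e = proj E e'" "g \<in> carrier G"
  shows "quot e (act E e' g) = quot e e' \<otimes> g"
  using assms quot [OF assms(1-3)] by (intro quot_eqI) (simp_all flip: act_act)

end

section \<open>Comparison of two bundles over the same cover\<close>

locale bundle_pair = E: covered_bundle G T M A B E + E': covered_bundle G T M A B E'
  for G (structure) and T and M and A B and E and E'
begin

lemma swap: "bundle_pair G T M A B E' E" ..

text \<open>The equivariant map over \<open>U\<close> carrying the section \<open>s\<close> to the section \<open>s'\<close>.\<close>

definition transfer where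
  "transfer s s' e = act E' (s' (proj E e)) (E.quot (s (proj E e)) e)"

lemma transfer:
  assumes s: "E.lift (subtopology M U) (\<lambda>x. x) s" and s': "E'.lift (subtopology M U) (\<lambda>x. x) s'"
    and U: "U \<subseteq> topspace M"
  shows "continuous_map (subtopology (total_space E) {e \<in> topspace (total_space E). proj E e \<in> U})
      (total_space E') (transfer s s')"
    and "e \<in> topspace (total_space E) \<Longrightarrow> proj E e \<in> U \<Longrightarrow> proj E' (transfer s s' e) = proj E e"
    and "e \<in> topspace (total_space E) \<Longrightarrow> proj E e \<in> U \<Longrightarrow> g \<in> carrier G \<Longrightarrow>
      transfer s s' (act E e g) = act E' (transfer s s' e) g"
    and "x \<in> U \<Longrightarrow> transfer s s' (s x) = s' x"
proof -
  let ?X = "subtopology (total_space E) {e \<in> topspace (total_space E). proj E e \<in> U}"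
  have top: "topspace (subtopology M U) = U" using U by auto
  have p: "continuous_map ?X (subtopology M U) (proj E)"
    using continuous_map_from_subtopology [OF E.continuous_proj] by (auto simp: continuous_map_in_subtopology)
  have "E.lift ?X (proj E) (\<lambda>e. e)"
    by (simp add: E.lift_def continuous_map_from_subtopology)
  note q = E.lift_quot [OF E.lift_compose [OF s p] this]
  have l: "E'.lift ?X (proj E) (transfer s s')"
    unfolding transfer_def by (rule E'.lift_act [OF E'.lift_compose [OF s' p] q(1)])
  then show "continuous_map ?X (total_space E') (transfer s s')"
    by (simp add: E'.lift_def)
  show "proj E' (transfer s s' e) = proj E e" if "e \<in> topspace (total_space E)" "proj E e \<in> U"
    using l that by (simp add: E'.lift_def)
  have sE: "s x \<in> topspace (total_space E)" "proj E (s x) = x" and s'E: "s' x \<in> topspace (total_space E')" if "x \<in> U" for x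
    using that E.lift_total [OF s, of x] E'.lift_total [OF s', of x] s top U by (auto simp: E.lift_def)
  show "transfer s s' (act E e g) = act E' (transfer s s' e) g"
    if e: "e \<in> topspace (total_space E)" "proj E e \<in> U" and g: "g \<in> carrier G"
    using e g sE [OF e(2)] s'E [OF e(2)] q(2) [of e]
    by (simp add: transfer_def E.proj_act E.quot_act E'.act_act)
  show "transfer s s' (s x) = s' x" if "x \<in> U"
    using sE [OF that] s'E [OF that] E.quot_eqI [of "s x" \<one> "s x"]
    by (simp add: transfer_def E.act_one E'.act_one)
qed

text \<open>Over the overlap the transfers along the two pairs of sections agree because both pairs
  have the same transition function u. The values on the sections are recorded to recognise
  composites as the identity.\<close>

lemma bundle_map:
  assumes st: "E.section_pair s t u" and st': "E'.section_pair s' t' u"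
  shows "\<exists>h. continuous_map (total_space E) (total_space E') h \<and>
    (\<forall>e\<in>topspace (total_space E). proj E' (h e) = proj E e) \<and>
    (\<forall>e\<in>topspace (total_space E). \<forall>g\<in>carrier G. h (act E e g) = act E' (h e) g) \<and>
    (\<forall>x\<in>A. h (s x) = s' x) \<and> (\<forall>x\<in>B. h (t x) = t' x)"
proof -
  have sub: "A \<subseteq> topspace M" "B \<subseteq> topspace M" using E.cover by auto
  note a = transfer [OF E.section_pairD(1) [OF st] E'.section_pairD(1) [OF st'] sub(1)]
  note b = transfer [OF E.section_pairD(2) [OF st] E'.section_pairD(2) [OF st'] sub(2)]
  have ab: "transfer s s' e = transfer t t' e" if e: "e \<in> topspace (total_space E)" "proj E e \<in> A" "proj E e \<in> B" for e
  proof -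
    let ?x = "proj E e"
    let ?q = "E.quot (t ?x) e"
    note x = E.section_pairD(3-5) [OF st, of ?x] E'.section_pairD(3-5) [OF st', of ?x]
    have q: "?q \<in> carrier G" "act E (t ?x) ?q = e"
      using E.quot [of "t ?x" e] x e by auto
    have "E.quot (s ?x) e = u ?x \<otimes> ?q"
      using x e q by (intro E.quot_eqI) (simp_all flip: E.act_act)
    then have "transfer s s' e = act E' (s' ?x) (u ?x \<otimes> ?q)"
      by (simp add: transfer_def)
    also have "\<dots> = act E' (act E' (s' ?x) (u ?x)) ?q"
      using x e q by (simp flip: E'.act_act)
    also have "\<dots> = transfer t t' e"
      using x e by (simp add: transfer_def)
    finally show ?thesis .
  qed
  define h where "h e = (if proj E e \<in> A then transfer s s' e else transfer t t' e)" for e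
  have hA: "h e = transfer s s' e" if "proj E e \<in> A" for e
    using that by (simp add: h_def)
  have hB: "h e = transfer t t' e" if "e \<in> topspace (total_space E)" "proj E e \<in> B" for e
    using that ab by (simp add: h_def)
  have cases: "proj E e \<in> A \<or> proj E e \<in> B" if "e \<in> topspace (total_space E)" for e
    using E.proj_in_M [OF that] E.cover by blast
  have "continuous_map (total_space E) (total_space E') h"
  proof (rule pasting_lemma [of UNIV "total_space E"
        "\<lambda>i. {e \<in> topspace (total_space E). proj E e \<in> (if i then A else B)}" "total_space E'"
        "\<lambda>i. if i then transfer s s' else transfer t t'"])
    show "openin (total_space E) {e \<in> topspace (total_space E). proj E e \<in> (if i then A else B)}" for i
      using E.openA E.openB by (intro openin_continuous_map_preimage [OF E.continuous_proj]) auto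
    show "\<exists>i. i \<in> UNIV \<and> e \<in> {e \<in> topspace (total_space E). proj E e \<in> (if i then A else B)} \<and>
        h e = (if i then transfer s s' else transfer t t') e" if "e \<in> topspace (total_space E)" for e
      using cases [OF that] hA hB that by (cases "proj E e \<in> A") (auto intro: exI [of _ True] exI [of _ False])
  qed (use a(1) b(1) ab in \<open>auto split: if_splits\<close>)
  moreover have "proj E' (h e) = proj E e" if e: "e \<in> topspace (total_space E)" for e
    using cases [OF e] e a(2) b(2) hA hB by metis
  moreover have "h (act E e g) = act E' (h e) g" if e: "e \<in> topspace (total_space E)" "g \<in> carrier G" for e g
    using cases [OF e(1)] e a(3) b(3) hA hB E.proj_act E.act_closed by metis
  moreover have "h (s x) = s' x" if "x \<in> A" for x
    using hA a(4) [OF that] E.section_pairD(3) [OF st that] that by metis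
  moreover have "h (t x) = t' x" if "x \<in> B" for x
    using hB b(4) [OF that] E.section_pairD(4) [OF st that] that by metis
  ultimately show ?thesis by blast
qed

text \<open>Each point arises by the action from a section value in its fibre, so an equivariant map
  is determined by its values on the sections.\<close>

lemma equivariant_fixing_sections:
  assumes st: "E.section_pair s t u"
    and f: "\<And>e g. e \<in> topspace (total_space E) \<Longrightarrow> g \<in> carrier G \<Longrightarrow> f (act E e g) = act E (f e) g"
    and "\<And>x. x \<in> A \<Longrightarrow> f (s x) = s x" "\<And>x. x \<in> B \<Longrightarrow> f (t x) = t x"
    and e: "e \<in> topspace (total_space E)"
  shows "f e = e"
proof -
  let ?x = "proj E e"
  have fe: "f e = e" if r: "r \<in> topspace (total_space E)" "proj E r = ?x" "f r = r" for r
    using f [OF r(1)] E.quot [OF r(1) e r(2)] r(3) by metis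
  have "?x \<in> A \<or> ?x \<in> B" using E.proj_in_M [OF e] E.cover by blast
  then show ?thesis
    using fe E.section_pairD(3,4) [OF st] assms(3,4) by metis
qed

lemma bundle_equivalent_of_transition:
  assumes u: "E.transition u" and u': "E'.transition u"
  shows "bundle_equivalent G E E'"
proof -
  obtain s t where st: "E.section_pair s t u" using u by (auto simp: E.transition_def)
  obtain s' t' where st': "E'.section_pair s' t' u" using u' by (auto simp: E'.transition_def)
  obtain h where h: "continuous_map (total_space E) (total_space E') h"
    "\<And>e. e \<in> topspace (total_space E) \<Longrightarrow> proj E' (h e) = proj E e"
    "\<And>e g. e \<in> topspace (total_space E) \<Longrightarrow> g \<in> carrier G \<Longrightarrow> h (act E e g) = act E' (h e) g"
    "\<And>x. x \<in> A \<Longrightarrow> h (s x) = s' x" "\<And>x. x \<in> B \<Longrightarrow> h (t x) = t' x"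
    using bundle_map [OF st st'] by blast
  interpret E'E: bundle_pair G T M A B E' E by (rule swap)
  obtain k where k: "continuous_map (total_space E') (total_space E) k"
    "\<And>e g. e \<in> topspace (total_space E') \<Longrightarrow> g \<in> carrier G \<Longrightarrow> k (act E' e g) = act E (k e) g"
    "\<And>x. x \<in> A \<Longrightarrow> k (s' x) = s x" "\<And>x. x \<in> B \<Longrightarrow> k (t' x) = t x"
    using E'E.bundle_map [OF st' st] by blast
  have he: "h e \<in> topspace (total_space E')" if "e \<in> topspace (total_space E)" for e
    using h(1) that by (auto simp: continuous_map_def)
  have ke: "k e \<in> topspace (total_space E)" if "e \<in> topspace (total_space E')" for e
    using k(1) that by (auto simp: continuous_map_def)
  have "k (h e) = e" if "e \<in> topspace (total_space E)" for e
    by (rule equivariant_fixing_sections [OF st _ _ _ that, of "\<lambda>e. k (h e)"]) (use h k he in auto)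
  moreover have "h (k e) = e" if "e \<in> topspace (total_space E')" for e
    by (rule E'E.equivariant_fixing_sections [OF st' _ _ _ that, of "\<lambda>e. h (k e)"]) (use h k ke in auto)
  ultimately have "homeomorphic_map (total_space E) (total_space E') h"
    using h(1) k(1) unfolding homeomorphic_map_maps homeomorphic_maps_def by blast
  then show ?thesis
    unfolding bundle_equivalent_def using h(2,3) by blast
qed

lemma transition_of_bundle_equivalent:
  assumes "bundle_equivalent G E E'" and u: "E.transition u"
  shows "E'.transition u"
proof -
  obtain h where h: "homeomorphic_map (total_space E) (total_space E') h"
    "\<And>e. e \<in> topspace (total_space E) \<Longrightarrow> proj E' (h e) = proj E e"
    "\<And>e g. e \<in> topspace (total_space E) \<Longrightarrow> g \<in> carrier G \<Longrightarrow> h (act E e g) = act E' (h e) g"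
    using assms(1) unfolding bundle_equivalent_def by blast
  obtain s t where st: "E.section_pair s t u" using u by (auto simp: E.transition_def)
  have lift: "E'.lift X f (\<lambda>x. h (r x))" if r: "E.lift X f r" for X f r
    using r h(2) E.lift_total [OF r] continuous_map_compose [OF _ homeomorphic_imp_continuous_map [OF h(1)], of X r]
    by (simp add: E.lift_def E'.lift_def o_def)
  have "E'.section_pair (\<lambda>x. h (s x)) (\<lambda>x. h (t x)) u"
    unfolding E'.section_pair_def
    using lift [OF E.section_pairD(1) [OF st]] lift [OF E.section_pairD(2) [OF st]]
      E.section_pairD(3,5) [OF st] h(3) by (metis IntE)
  then show ?thesis
    unfolding E'.transition_def by blast
qed

end


section \<open>The bundle with a given transition function\<close>

context topological_group_space
begin

lemma continuous_mult_snd: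
  assumes "continuous_map Z (prod_topology X T) f" "continuous_map Z T g"
  shows "continuous_map Z (prod_topology X T) (\<lambda>z. (fst (f z), snd (f z) \<otimes> g z))"
proof -
  have "continuous_map Z X (\<lambda>z. fst (f z))" "continuous_map Z T (\<lambda>z. snd (f z))"
    using assms(1) by (auto simp: continuous_map_pairwise o_def)
  then show ?thesis
    using assms(2) by (simp add: continuous_map_pairwise o_def continuous_mult)
qed

end

locale clutching = two_piece_cover G T M A B for G (structure) and T and M :: "'m topology" and A B +
  fixes u
  assumes u: "continuous_map MAB T u"
begin

abbreviation "N \<equiv> prod_topology M T"
abbreviation "NA \<equiv> A \<times> carrier G"
abbreviation "NB \<equiv> B \<times> carrier G"

text \<open>The pair \<open>(b, g)\<close> with \<open>b \<in> A\<close> stands for its coordinates over \<open>A\<close>; over \<open>B\<close> the coordinates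
  are those whose image under \<open>glue\<close> is \<open>(b, g)\<close>.\<close>

definition glue where "glue z = (fst z, if fst z \<in> A then u (fst z) \<otimes> snd z else snd z)"

definition unglue where "unglue z = (fst z, if fst z \<in> A then inv (u (fst z)) \<otimes> snd z else snd z)"

text \<open>The final topology for the inclusion of \<open>NA\<close> and for \<open>glue\<close> on
  \<open>NB\<close>, that is, two product bundles clutched along u. Keeping M x G as the set of
  points puts the bundle into the type over which \<open>bundle_classes\<close> is formed.\<close>

definition glued :: "('m \<times> 'a) topology" where
  "glued = topology (\<lambda>W. W \<subseteq> topspace M \<times> carrier G \<and> openin N (W \<inter> NA) \<and> openin N {z \<in> NB. glue z \<in> W})"

lemma u_closed [simp]: "x \<in> A \<Longrightarrow> x \<in> B \<Longrightarrow> u x \<in> carrier G"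
  using continuous_closed [OF u] by simp

lemma openin_carrier [simp]: "openin T (carrier G)"
  using openin_topspace [of T] by simp

lemma openin_N: "openin N NA" "openin N NB" "openin N (NA \<inter> NB)"
  using openA openB by (auto simp: openin_prod_Times_iff Times_Int_Times)

lemma openin_glued:
  "openin glued W \<longleftrightarrow> W \<subseteq> topspace M \<times> carrier G \<and> openin N (W \<inter> NA) \<and> openin N {z \<in> NB. glue z \<in> W}"
proof -
  have "istopology (\<lambda>W. W \<subseteq> topspace M \<times> carrier G \<and> openin N (W \<inter> NA) \<and> openin N {z \<in> NB. glue z \<in> W})"
    unfolding istopology_def
  proof (intro conjI allI impI)
    fix S S' assume S: "S \<subseteq> topspace M \<times> carrier G \<and> openin N (S \<inter> NA) \<and> openin N {z \<in> NB. glue z \<in> S}"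
      and S': "S' \<subseteq> topspace M \<times> carrier G \<and> openin N (S' \<inter> NA) \<and> openin N {z \<in> NB. glue z \<in> S'}"
    show "S \<inter> S' \<subseteq> topspace M \<times> carrier G" using S by blast
    have e: "S \<inter> S' \<inter> NA = (S \<inter> NA) \<inter> (S' \<inter> NA)" by blast
    show "openin N (S \<inter> S' \<inter> NA)" unfolding e using S S' by (blast intro: openin_Int)
    have e: "{z \<in> NB. glue z \<in> S \<inter> S'} = {z \<in> NB. glue z \<in> S} \<inter> {z \<in> NB. glue z \<in> S'}" by blast
    show "openin N {z \<in> NB. glue z \<in> S \<inter> S'}" unfolding e using S S' by (blast intro: openin_Int)
  next
    fix \<K> assume K: "\<forall>K\<in>\<K>. K \<subseteq> topspace M \<times> carrier G \<and> openin N (K \<inter> NA) \<and> openin N {z \<in> NB. glue z \<in> K}"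
    show "\<Union>\<K> \<subseteq> topspace M \<times> carrier G" using K by blast
    have "\<Union>\<K> \<inter> NA = (\<Union>K\<in>\<K>. K \<inter> NA)" by blast
    moreover have "openin N (\<Union>K\<in>\<K>. K \<inter> NA)" using K by (intro openin_clauses(3)) blast
    ultimately show "openin N (\<Union>\<K> \<inter> NA)" by metis
    have "{z \<in> NB. glue z \<in> \<Union>\<K>} = (\<Union>K\<in>\<K>. {z \<in> NB. glue z \<in> K})" by blast
    moreover have "openin N (\<Union>K\<in>\<K>. {z \<in> NB. glue z \<in> K})" using K by (intro openin_clauses(3)) blast
    ultimately show "openin N {z \<in> NB. glue z \<in> \<Union>\<K>}" by metis
  qed
  then show ?thesis
    unfolding glued_def by (simp add: topology_inverse')
qed

lemma glue_closed: "z \<in> NB \<Longrightarrow> glue z \<in> NB" "z \<in> NB \<Longrightarrow> unglue z \<in> NB"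
  by (auto simp: glue_def unglue_def)

lemma unglue_glue: "z \<in> NB \<Longrightarrow> unglue (glue z) = z" "z \<in> NB \<Longrightarrow> glue (unglue z) = z"
  by (auto simp: glue_def unglue_def)

lemma glue_image: "glue ` NB = NB"
proof (intro equalityI subsetI)
  show "z \<in> glue ` NB" if "z \<in> NB" for z
    using that glue_closed(2) unglue_glue(2) by (metis imageI)
qed (use glue_closed in blast)

lemma topspace_glued [simp]: "topspace glued = topspace M \<times> carrier G"
proof
  have "openin glued (topspace M \<times> carrier G)"
  proof -
    have e: "(topspace M \<times> carrier G) \<inter> NA = NA" "{z \<in> NB. glue z \<in> topspace M \<times> carrier G} = NB"
      by (auto simp: glue_def)
    show ?thesis
      unfolding openin_glued e using openin_N by blast
  qed
  then show "topspace M \<times> carrier G \<subseteq> topspace glued"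
    by (rule openin_subset)
  show "topspace glued \<subseteq> topspace M \<times> carrier G"
    using openin_topspace [of glued] unfolding openin_glued by blast
qed

text \<open>Left multiplication by w is continuous over the open overlap. Used with u and with its
  inverse, this shows that either chart alone decides openness there.\<close>

lemma openin_overlap:
  assumes w: "continuous_map MAB T w" and W: "openin N W"
  shows "openin N {z \<in> NA \<inter> NB. (fst z, w (fst z) \<otimes> snd z) \<in> W}"
proof -
  let ?X = "subtopology N (NA \<inter> NB)"
  have X: "?X = prod_topology MAB T"
    by (simp add: prod_topology_subtopology(1) Times_Int_Times)
  have "continuous_map (prod_topology MAB T) T (\<lambda>z. w (fst z))" "continuous_map (prod_topology MAB T) T snd"
    using continuous_map_compose [OF continuous_map_fst w] by (simp_all add: o_def continuous_map_snd)
  moreover have "continuous_map (prod_topology MAB T) M fst"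
    using continuous_map_fst [of MAB T] by (simp add: continuous_map_in_subtopology)
  ultimately have "continuous_map ?X N (\<lambda>z. (fst z, w (fst z) \<otimes> snd z))"
    unfolding X by (simp add: continuous_map_pairwise o_def continuous_mult)
  note p = openin_continuous_map_preimage [OF this W]
  have top: "topspace ?X = NA \<inter> NB"
    by auto
  show ?thesis
    using p openin_N(3) openin_trans_full unfolding top by blast
qed

lemma openin_glued_A:
  assumes "W \<subseteq> NA"
  shows "openin glued W \<longleftrightarrow> openin N W"
proof -
  have 1: "W \<inter> NA = W" "W \<subseteq> topspace M \<times> carrier G" using assms by auto
  have 2: "{z \<in> NB. glue z \<in> W} = {z \<in> NA \<inter> NB. (fst z, u (fst z) \<otimes> snd z) \<in> W}"
    using assms by (auto simp: glue_def)
  show ?thesis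
    unfolding openin_glued 2 1(1) using 1(2) openin_overlap [OF u] by blast
qed

text \<open>Coordinates over B are those before \<open>glue\<close>, hence the image on the left.
  The condition over A then follows through the inverse of u.\<close>

lemma openin_glued_B:
  assumes V: "V \<subseteq> NB"
  shows "openin glued (glue ` V) \<longleftrightarrow> openin N V"
proof -
  have "glue ` V \<subseteq> topspace M \<times> carrier G"
    using V by (auto simp: glue_def)
  moreover have 1: "{z \<in> NB. glue z \<in> glue ` V} = V"
    using V unglue_glue(1) by (auto simp: image_iff subset_iff) metis+
  moreover have 2: "glue ` V \<inter> NA = {z \<in> NA \<inter> NB. (fst z, inv (u (fst z)) \<otimes> snd z) \<in> V}"
  proof (intro equalityI subsetI)
    fix z assume z: "z \<in> glue ` V \<inter> NA"
    then obtain y where y: "y \<in> V" "z = glue y" by blast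
    then have "unglue z \<in> V" "z \<in> NB" using V unglue_glue(1) [of y] glue_closed(1) [of y] by auto
    moreover have "fst z \<in> A" using z by (metis IntD2 mem_Times_iff)
    then have "unglue z = (fst z, inv (u (fst z)) \<otimes> snd z)"
      by (simp add: unglue_def)
    ultimately show "z \<in> {z \<in> NA \<inter> NB. (fst z, inv (u (fst z)) \<otimes> snd z) \<in> V}"
      using z by auto
  next
    fix z assume z: "z \<in> {z \<in> NA \<inter> NB. (fst z, inv (u (fst z)) \<otimes> snd z) \<in> V}"
    then have "unglue z \<in> V" "glue (unglue z) = z" using unglue_glue(2) [of z] by (auto simp: unglue_def)
    then show "z \<in> glue ` V \<inter> NA" using z by (metis (no_types, lifting) IntE IntI imageI mem_Collect_eq)
  qed
  ultimately show ?thesis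
    unfolding openin_glued 1 2 using openin_overlap [OF continuous_inv [OF u]] by blast
qed

lemma subtopology_glued_A: "subtopology glued NA = prod_topology MA T"
proof -
  have "openin glued NA" using openin_glued_A openin_N(1) by blast
  then show ?thesis
    using openin_N(1)
    by (auto simp: topology_eq prod_topology_subtopology(1) openin_open_subtopology openin_glued_A)
qed

lemma glue_homeomorphic: "homeomorphic_map (prod_topology MB T) (subtopology glued NB) glue"
proof (rule bijective_open_imp_homeomorphic_map)
  have oB: "openin glued NB" using openin_glued_B [of NB] openin_N(2) unfolding glue_image by blast
  have X: "prod_topology MB T = subtopology N NB" by (simp add: prod_topology_subtopology(1))
  have top: "topspace (subtopology N NB) = NB" "topspace (subtopology glued NB) = NB"
    by auto
  show "open_map (prod_topology MB T) (subtopology glued NB) glue"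
    unfolding X open_map_def
    using openin_glued_B glue_image by (auto simp: openin_open_subtopology oB openin_N)
  show "continuous_map (prod_topology MB T) (subtopology glued NB) glue"
    unfolding X continuous_map_def top
  proof (intro conjI allI impI)
    fix W assume "openin (subtopology glued NB) W"
    then have "openin glued W" by (simp add: openin_open_subtopology oB)
    then have "openin N {z \<in> NB. glue z \<in> W}" by (simp add: openin_glued)
    then show "openin (subtopology N NB) {z \<in> NB. glue z \<in> W}"
      by (auto simp: openin_open_subtopology openin_N)
  qed (use glue_closed in auto)
  show "glue ` topspace (prod_topology MB T) = topspace (subtopology glued NB)"
    unfolding X top by (rule glue_image)
  show "inj_on glue (topspace (prod_topology MB T))"
    unfolding X top by (rule inj_on_inverseI [of _ unglue]) (rule unglue_glue)
qed

lemma unglue_continuous: "continuous_map (subtopology glued NB) (prod_topology MB T) unglue"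
proof -
  obtain h where h: "homeomorphic_maps (prod_topology MB T) (subtopology glued NB) glue h"
    using glue_homeomorphic homeomorphic_map_maps by blast
  have "h z = unglue z" if "z \<in> NB" for z
  proof -
    have "unglue z \<in> topspace (prod_topology MB T)"
      using glue_closed(2) [OF that] by auto
    then have "h (glue (unglue z)) = unglue z"
      using h unfolding homeomorphic_maps_def by blast
    then show ?thesis using unglue_glue(2) [OF that] by simp
  qed
  then show ?thesis
    using h by (auto simp: homeomorphic_maps_def elim!: continuous_map_eq)
qed

definition clutch :: "('m \<times> 'a, 'a, 'm) gbundle" where
  "clutch = \<lparr>total_space = glued, act = (\<lambda>(b, h) g. (b, h \<otimes> g)), proj = fst\<rparr>"

lemma clutch_simps [simp]:
  "total_space clutch = glued" "act clutch z g = (fst z, snd z \<otimes> g)" "proj clutch = fst"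
  by (simp_all add: clutch_def case_prod_unfold)

lemma right_action_clutch: "right_action G T glued (act clutch)"
  unfolding right_action_def
proof (intro conjI ballI)
  let ?X = "prod_topology glued T"
  let ?f = "\<lambda>z :: ('m \<times> 'a) \<times> 'a. (fst (fst z), snd (fst z) \<otimes> snd z)"
  have op: "openin glued NA" "openin glued NB"
    using openin_glued_A [of NA] openin_glued_B [of NB] openin_N unfolding glue_image by blast+
  have fA: "continuous_map (subtopology ?X (NA \<times> carrier G)) glued ?f"
  proof -
    have "continuous_map (prod_topology (prod_topology MA T) T) (prod_topology MA T) ?f"
      by (intro continuous_mult_snd continuous_map_fst continuous_map_snd)
    then have "continuous_map (prod_topology (subtopology glued NA) T) glued ?f"
      unfolding subtopology_glued_A [symmetric] by (simp add: continuous_map_in_subtopology)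
    then show ?thesis by (simp add: prod_topology_subtopology(1))
  qed
  have fB: "continuous_map (subtopology ?X (NB \<times> carrier G)) glued ?f"
  proof -
    let ?Y = "prod_topology (subtopology glued NB) T"
    have "continuous_map ?Y (prod_topology MB T) (\<lambda>z. unglue (fst z))"
      using continuous_map_compose [OF continuous_map_fst unglue_continuous] by (simp add: o_def)
    then have "continuous_map ?Y (prod_topology MB T) (\<lambda>z. (fst (unglue (fst z)), snd (unglue (fst z)) \<otimes> snd z))"
      by (rule continuous_mult_snd [OF _ continuous_map_snd])
    from continuous_map_compose [OF this homeomorphic_imp_continuous_map [OF glue_homeomorphic]]
    have "continuous_map ?Y glued (\<lambda>z. glue (fst (unglue (fst z)), snd (unglue (fst z)) \<otimes> snd z))"
      by (simp add: o_def continuous_map_in_subtopology)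
    \<comment> \<open>Left multiplication by u commutes with the right action, so passing to the
      coordinates over B and back does not alter the formula.\<close>
    then have "continuous_map ?Y glued ?f"
      by (rule continuous_map_eq) (auto simp: glue_def unglue_def m_assoc)
    then show ?thesis by (simp add: prod_topology_subtopology(1))
  qed
  have "continuous_map ?X glued ?f"
  proof (rule pasting_lemma [of UNIV ?X "\<lambda>i. (if i then NA else NB) \<times> carrier G" glued "\<lambda>_. ?f"])
    show "openin ?X ((if i then NA else NB) \<times> carrier G)" for i
      using op openin_topspace [of T] by (simp add: openin_prod_Times_iff)
    show "\<exists>i. i \<in> UNIV \<and> z \<in> (if i then NA else NB) \<times> carrier G \<and> ?f z = ?f z" if "z \<in> topspace ?X" for z
    proof -
      have "z \<in> NA \<times> carrier G \<or> z \<in> NB \<times> carrier G"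
        using that cover by auto
      then show ?thesis by (auto intro: exI [of _ True] exI [of _ False])
    qed
  qed (use fA fB in auto)
  then show "continuous_map ?X glued (\<lambda>(e, g). act clutch e g)"
    by (simp add: case_prod_unfold)
qed (auto simp: m_assoc)

lemma principal_bundle_clutch: "principal_bundle G T M clutch"
  unfolding principal_bundle_def
proof (intro conjI)
  show "right_action G T (total_space clutch) (act clutch)"
    using right_action_clutch by simp
  show "continuous_map (total_space clutch) M (proj clutch)"
    unfolding continuous_map_def
  proof (intro conjI allI impI)
    fix U assume U: "openin M U"
    then have "U \<subseteq> topspace M" by (rule openin_subset)
    then have "{z \<in> topspace glued. fst z \<in> U} \<inter> NA = (U \<inter> A) \<times> carrier G"
      "{z \<in> NB. glue z \<in> {z \<in> topspace glued. fst z \<in> U}} = (U \<inter> B) \<times> carrier G"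
      using glue_closed(1) by (auto simp: glue_def)
    moreover have "openin N ((U \<inter> A) \<times> carrier G)" "openin N ((U \<inter> B) \<times> carrier G)"
      using U openA openB openin_topspace [of T] by (auto simp: openin_prod_Times_iff openin_Int)
    ultimately show "openin (total_space clutch) {z \<in> topspace (total_space clutch). proj clutch z \<in> U}"
      unfolding openin_glued clutch_simps by auto
  qed auto
  have A: "local_trivialization G T M clutch A (\<lambda>z. z)"
  proof -
    have "{e \<in> topspace glued. fst e \<in> A} = NA" by auto
    then show ?thesis
      unfolding local_trivialization_def using subtopology_glued_A homeomorphic_map_id [of "prod_topology MA T" "prod_topology MA T"]
      by (simp add: id_def)
  qed
  have B: "local_trivialization G T M clutch B glue"
  proof -
    have "{e \<in> topspace glued. fst e \<in> B} = NB" by auto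
    then show ?thesis
      unfolding local_trivialization_def using glue_homeomorphic by (auto simp: glue_def)
  qed
  show "\<exists>\<U>. (\<forall>U\<in>\<U>. openin M U) \<and> \<Union> \<U> = topspace M \<and> (\<forall>U\<in>\<U>. \<exists>\<phi>. local_trivialization G T M clutch U \<phi>)"
    using A B openA openB cover by (intro exI [of _ "{A, B}"]) auto
qed

sublocale covered_bundle G T M A B clutch
  by unfold_locales (rule principal_bundle_clutch)

lemma transition_clutch: "transition u"
proof -
  have "continuous_map MA (prod_topology MA T) (\<lambda>x. (x, \<one>))" "continuous_map MB (prod_topology MB T) (\<lambda>x. (x, \<one>))"
    by (simp_all add: continuous_map_pairwise o_def)
  then have "continuous_map MA glued (\<lambda>x. (x, \<one>))" "continuous_map MB glued (\<lambda>x. glue (x, \<one>))"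
    using continuous_map_compose [OF _ homeomorphic_imp_continuous_map [OF glue_homeomorphic], of MB "\<lambda>x. (x, \<one>)"]
    by (simp_all add: continuous_map_in_subtopology o_def flip: subtopology_glued_A)
  then have "section_pair (\<lambda>x. (x, \<one>)) (\<lambda>x. glue (x, \<one>)) u"
    by (simp add: section_pair_def lift_def glue_def)
  then show ?thesis
    unfolding transition_def by blast
qed

end

context two_piece_cover
begin

text \<open>An equality and not just an equivalence: for the constant unit \<open>glue\<close> is
  the identity on \<open>NB\<close>, and openness on both pieces is openness in the product. It ties
  the base point to the trivial class.\<close>

lemma clutch_one: "clutching.clutch G T M A B (\<lambda>x. \<one>) = trivial_bundle G T M"
proof -
  interpret clutching G T M A B "\<lambda>x. \<one>"
    by unfold_locales simp
  have g: "glue z = z" if "z \<in> NB" for z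
    using that by (auto simp: glue_def)
  have "openin glued W \<longleftrightarrow> openin N W" for W
  proof
    assume "openin glued W"
    then have W: "W \<subseteq> topspace M \<times> carrier G" "openin N (W \<inter> NA)" "openin N {z \<in> NB. glue z \<in> W}"
      by (auto simp: openin_glued)
    moreover have "{z \<in> NB. glue z \<in> W} = W \<inter> NB" using g by auto
    moreover have "W = (W \<inter> NA) \<union> (W \<inter> NB)" using W(1) cover by auto
    ultimately show "openin N W" using openin_Un by metis
  next
    assume W: "openin N W"
    moreover have "{z \<in> NB. glue z \<in> W} = W \<inter> NB" using g by auto
    ultimately show "openin glued W"
      using openin_subset [OF W] openin_N by (simp add: openin_glued openin_Int)
  qed
  then have "glued = N" by (simp add: topology_eq)
  then show ?thesis
    by (simp add: clutch_def trivial_bundle_def)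
qed

end


section \<open>Classification\<close>

context comm_group
begin

lemma carrier_cocycle_group:
  "f \<in> carrier (cocycle_group n X G) \<longleftrightarrow> cocycle n X f \<and> f \<in> extensional (Collect (singular_chain n X))"
proof -
  have "coboundary n X f = \<one>\<^bsub>cochain_group (Suc n) X G\<^esub> \<longleftrightarrow>
      (\<forall>c. singular_chain (Suc n) X c \<longrightarrow> f (chain_boundary (Suc n) c) = \<one>)"
    by (auto simp: coboundary_def cochain_group_def restrict_def fun_eq_iff)
  then show ?thesis
    by (auto simp: cocycle_group_def kernel_def cocycle_def cochain_def cochain_group_def)
qed

text \<open>Members of the coset are extensional while d may have any values off the chain group.
  Restricting d makes it an element of \<open>cochain_group\<close> and is harmless, as only
  boundaries are evaluated.\<close>

lemma r_coset_coboundary_set: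
  assumes f: "f \<in> carrier (cocycle_group (Suc n) X G)"
  shows "coboundary_set (Suc n) X G #>\<^bsub>cocycle_group (Suc n) X G\<^esub> f =
    {g \<in> extensional (Collect (singular_chain (Suc n) X)).
      \<exists>d. cochain n X d \<and> (\<forall>c. singular_chain (Suc n) X c \<longrightarrow> g c = f c \<otimes> d (chain_boundary (Suc n) c))}"
    (is "?L = ?R")
proof (intro equalityI subsetI)
  let ?S = "Collect (singular_chain (Suc n) X)"
  have mult: "g \<otimes>\<^bsub>cocycle_group (Suc n) X G\<^esub> h = (\<lambda>c\<in>?S. g c \<otimes> h c)" for g h
    by (simp add: cocycle_group_def cochain_group_def)
  have fc: "f c \<in> carrier G" if "singular_chain (Suc n) X c" for c
    using f that cochain_closed [OF cocycle_cochain] by (auto simp: carrier_cocycle_group)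
  have dc: "d (chain_boundary (Suc n) c) \<in> carrier G" if "singular_chain (Suc n) X c" "cochain n X d" for c d
    using cochain_closed [OF that(2)] singular_chain_boundary_alt [OF that(1)] by simp
  {
    fix g assume "g \<in> ?L"
    then obtain d where d: "d \<in> carrier (cochain_group n X G)"
      "g = (\<lambda>c\<in>?S. coboundary n X d c \<otimes> f c)"
      by (auto simp: r_coset_def coboundary_set_def mult)
    then have "cochain n X d" by (simp add: cochain_group_def cochain_def)
    moreover have "g c = f c \<otimes> d (chain_boundary (Suc n) c)" if "singular_chain (Suc n) X c" for c
      using that d(2) fc dc [OF that \<open>cochain n X d\<close>] by (simp add: coboundary_def m_comm)
    moreover have "g \<in> extensional ?S" using d(2) by simp
    ultimately show "g \<in> ?R" by blast
  next
    fix g assume "g \<in> ?R"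
    then obtain d where d: "cochain n X d" "g \<in> extensional ?S"
      "\<And>c. singular_chain (Suc n) X c \<Longrightarrow> g c = f c \<otimes> d (chain_boundary (Suc n) c)"
      by blast
    let ?d = "restrict d (Collect (singular_chain n X))"
    have "cochain n X ?d" by (rule cochain_cong [OF d(1)]) simp
    then have "?d \<in> carrier (cochain_group n X G)"
      by (simp add: cochain_group_def cochain_def)
    moreover have "g = (\<lambda>c\<in>?S. coboundary n X ?d c \<otimes> f c)"
    proof (rule extensionalityI [OF d(2)])
      fix c assume "c \<in> ?S"
      then have c: "singular_chain (Suc n) X c" by simp
      have "coboundary n X ?d c = d (chain_boundary (Suc n) c)"
        using c singular_chain_boundary_alt [OF c] by (simp add: coboundary_def)
      then show "g c = (\<lambda>c\<in>?S. coboundary n X ?d c \<otimes> f c) c"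
        using c d(3) [OF c] fc [OF c] dc [OF c d(1)] by (simp add: m_comm)
    qed simp
    ultimately show "g \<in> ?L"
      unfolding r_coset_def coboundary_set_def mult by auto
  }
qed

lemma r_coset_coboundary_set_one:
  "coboundary_set (Suc n) X G #>\<^bsub>cocycle_group (Suc n) X G\<^esub> (\<lambda>c\<in>Collect (singular_chain (Suc n) X). \<one>) =
    coboundary_set (Suc n) X G"
proof -
  let ?S = "Collect (singular_chain (Suc n) X)"
  have "(\<lambda>c\<in>?S. b c \<otimes> (\<lambda>c\<in>?S. \<one>) c) = b" if b: "b \<in> coboundary_set (Suc n) X G" for b
  proof -
    obtain d where d: "cochain n X d" "b = coboundary n X d"
      using b by (auto simp: coboundary_set_def cochain_group_def cochain_def)
    show ?thesis
    proof (rule extensionalityI)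
      show "b \<in> extensional ?S" by (simp add: d(2) coboundary_def)
      fix c assume "c \<in> ?S"
      then have "b c \<in> carrier G"
        using cochain_closed [OF d(1)] by (auto simp: d(2) coboundary_def intro: singular_chain_boundary_alt)
      then show "(\<lambda>c\<in>?S. b c \<otimes> (\<lambda>c\<in>?S. \<one>) c) c = b c"
        using \<open>c \<in> ?S\<close> by simp
    qed simp
  qed
  then show ?thesis
    by (auto simp: r_coset_def cocycle_group_def cochain_group_def)
qed

end

text \<open>The image of an equivalence class under \<kappa> is a singleton, from which the value is
  read off. The formula on representatives is kept in order to evaluate the bijection at the base
  point.\<close>

lemma quotient_bij:
  assumes R: "R = {(x, y). x \<in> S \<and> y \<in> S \<and> \<kappa> x = \<kappa> y}" and K: "\<kappa> ` S = K"
  shows "\<exists>f. bij_betw f (S // R) K \<and> (\<forall>x\<in>S. f (R `` {x}) = \<kappa> x)"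
proof (intro exI conjI ballI)
  let ?f = "\<lambda>X. the_elem (\<kappa> ` X)"
  have cl: "\<kappa> ` (R `` {x}) = {\<kappa> x}" if "x \<in> S" for x
    using that by (auto simp: R)
  then show f: "?f (R `` {x}) = \<kappa> x" if "x \<in> S" for x
    using that by simp
  show "bij_betw ?f (S // R) K"
    unfolding bij_betw_def
  proof
    show "inj_on ?f (S // R)"
    proof (rule inj_onI)
      fix X Y assume "X \<in> S // R" "Y \<in> S // R" and e: "?f X = ?f Y"
      then obtain x y where xy: "x \<in> S" "X = R `` {x}" "y \<in> S" "Y = R `` {y}"
        by (auto simp: quotient_def)
      then have "\<kappa> x = \<kappa> y" using e f by metis
      then show "X = Y" using xy by (auto simp: R)
    qed
    have "?f ` (S // R) = \<kappa> ` S"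
      using f by (force simp: quotient_def image_iff)
    then show "?f ` (S // R) = K" using K by simp
  qed
qed

section \<open>The characteristic class of a bundle\<close>

context two_piece_cover
begin

definition has_transition :: "('e, 'a, 'm) gbundle \<Rightarrow> ('m \<Rightarrow> 'a) \<Rightarrow> bool" where
  "has_transition E u \<longleftrightarrow> principal_bundle G T M E \<and> covered_bundle.transition G M A B E u"

lemma covered_bundle: "principal_bundle G T M E \<Longrightarrow> covered_bundle G T M A B E"
  by unfold_locales

lemma has_transition_covered: "has_transition E u \<Longrightarrow> covered_bundle G T M A B E"
  by (simp add: has_transition_def covered_bundle)

lemma has_transition_pair:
  assumes "has_transition E u" "has_transition E' v"
  shows "bundle_pair G T M A B E E'"
  unfolding bundle_pair_def
  by (intro conjI has_transition_covered [OF assms(1)] has_transition_covered [OF assms(2)])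

lemma has_transition_continuous: "has_transition E u \<Longrightarrow> continuous_map MAB T u"
  using covered_bundle.transition_continuous [OF has_transition_covered] has_transition_def by blast

lemma has_transition_unique: "has_transition E u \<Longrightarrow> has_transition E v \<Longrightarrow> gauge_equivalent u v"
  using covered_bundle.transition_gauge_equivalent [OF has_transition_covered] has_transition_def by blast

lemma bundle_equivalent_of_gauge_equivalent:
  assumes u: "has_transition E u" and v: "has_transition E' v" and g: "gauge_equivalent u v"
  shows "bundle_equivalent G E E'"
proof -
  interpret bundle_pair G T M A B E E' by (rule has_transition_pair [OF u v])
  have "E'.transition u"
    using E'.gauge_equivalent_transition [OF _ g has_transition_continuous [OF u]] v
    by (simp add: has_transition_def)
  then show ?thesis
    using bundle_equivalent_of_transition [of u] u by (simp add: has_transition_def)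
qed

lemma has_transition_equivalent:
  assumes u: "has_transition E u" and E': "principal_bundle G T M E'" and e: "bundle_equivalent G E E'"
  shows "has_transition E' u"
proof -
  interpret bundle_pair G T M A B E E'
    unfolding bundle_pair_def by (intro conjI has_transition_covered [OF u] covered_bundle [OF E'])
  show ?thesis
    using transition_of_bundle_equivalent [OF e] u E' by (simp add: has_transition_def)
qed

lemma has_transition_clutch:
  assumes "continuous_map MAB T u"
  shows "has_transition (clutching.clutch G T M A B u) u"
proof -
  interpret clutching G T M A B u by unfold_locales (rule assms)
  show ?thesis
    unfolding has_transition_def using principal_bundle_clutch transition_clutch by blast
qed

lemma has_transition_trivial: "has_transition (trivial_bundle G T M) (\<lambda>x. \<one>)"
  using has_transition_clutch [of "\<lambda>x. \<one>"] by (simp add: clutch_one)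

abbreviation "Z \<equiv> cocycle_group (Suc (Suc 0)) M P"

text \<open>Cocycles for all transition functions of the bundle are collected, so no choice enters.
  The set is a single coset of the coboundaries and thereby itself an element of the cohomology
  group.\<close>

definition characteristic_class :: "('e, 'a, 'm) gbundle \<Rightarrow> ('m chain \<Rightarrow> (real \<Rightarrow> 'a) set) set" where
  "characteristic_class E = {f \<in> carrier Z. \<exists>u. has_transition E u \<and> classifies u f}"

lemma classifies_restrict:
  assumes "classifies u f"
  shows "classifies u (restrict f (Collect (singular_chain (Suc (Suc 0)) M)))"
    and "restrict f (Collect (singular_chain (Suc (Suc 0)) M)) \<in> carrier Z"
proof -
  let ?g = "restrict f (Collect (singular_chain (Suc (Suc 0)) M))"
  have "f c \<in> carrier P" if "singular_chain (Suc (Suc 0)) M c" for c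
    using pi.cochain_closed [OF pi.cocycle_cochain [OF classifies_cocycle [OF assms]] that] .
  then show "classifies u ?g"
    by (intro classifies_coboundary [OF assms pi.cochain_one]) simp
  then show "?g \<in> carrier Z"
    by (simp add: pi.carrier_cocycle_group classifies_cocycle)
qed

lemma characteristic_class_nonempty:
  assumes "has_transition E u"
  shows "characteristic_class E \<noteq> {}"
proof -
  obtain f where "classifies u f"
    using classifies_exists [OF has_transition_continuous [OF assms]] by blast
  from classifies_restrict [OF this] show ?thesis
    unfolding characteristic_class_def using assms by blast
qed

text \<open>By \<open>classifies_gauge\<close> a cocycle for one transition function serves for all
  of them. Then \<open>classifies_unique\<close> and \<open>classifies_coboundary\<close> give the
  two inclusions.\<close>

lemma characteristic_class_coset:
  assumes f: "f \<in> characteristic_class E"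
  shows "characteristic_class E = coboundary_set (Suc (Suc 0)) M P #>\<^bsub>Z\<^esub> f"
proof -
  have Z: "f \<in> carrier Z" using f by (simp add: characteristic_class_def)
  obtain u where u: "has_transition E u" "classifies u f"
    using f by (auto simp: characteristic_class_def)
  show ?thesis
    unfolding pi.r_coset_coboundary_set [OF Z]
  proof (intro equalityI subsetI)
    fix g assume g: "g \<in> characteristic_class E"
    then obtain v where v: "has_transition E v" "classifies v g"
      by (auto simp: characteristic_class_def)
    have "classifies v f"
      by (rule classifies_gauge [OF u(2) has_transition_unique [OF u(1) v(1)]])
    then show "g \<in> {g \<in> extensional (Collect (singular_chain (Suc (Suc 0)) M)).
        \<exists>d. pi.cochain (Suc 0) M d \<and> (\<forall>c. singular_chain (Suc (Suc 0)) M c \<longrightarrow>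
          g c = f c \<otimes>\<^bsub>P\<^esub> d (chain_boundary (Suc (Suc 0)) c))}"
      using classifies_unique [OF _ v(2)] g by (simp add: characteristic_class_def pi.carrier_cocycle_group)
  next
    fix g assume "g \<in> {g \<in> extensional (Collect (singular_chain (Suc (Suc 0)) M)).
        \<exists>d. pi.cochain (Suc 0) M d \<and> (\<forall>c. singular_chain (Suc (Suc 0)) M c \<longrightarrow>
          g c = f c \<otimes>\<^bsub>P\<^esub> d (chain_boundary (Suc (Suc 0)) c))}"
    then obtain d where d: "g \<in> extensional (Collect (singular_chain (Suc (Suc 0)) M))" "pi.cochain (Suc 0) M d"
        "\<And>c. singular_chain (Suc (Suc 0)) M c \<Longrightarrow> g c = f c \<otimes>\<^bsub>P\<^esub> d (chain_boundary (Suc (Suc 0)) c)"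
      by blast
    have "classifies u g"
      by (rule classifies_coboundary [OF u(2) d(2,3)])
    then show "g \<in> characteristic_class E"
      using u(1) d(1) classifies_cocycle by (auto simp: characteristic_class_def pi.carrier_cocycle_group)
  qed
qed

text \<open>A common cocycle makes the transition functions gauge equivalent by
  \<open>classifies_inj\<close>. Conversely, equivalent bundles share a cocycle, and cosets with a
  common element coincide.\<close>

lemma characteristic_class_eq_iff:
  assumes u: "has_transition E u" and v: "has_transition E' v"
  shows "characteristic_class E = characteristic_class E' \<longleftrightarrow> bundle_equivalent G E E'"
proof
  assume "characteristic_class E = characteristic_class E'"
  then obtain f u' v' where "has_transition E u'" "classifies u' f" "has_transition E' v'" "classifies v' f"
    using characteristic_class_nonempty [OF u] unfolding characteristic_class_def by blast
  then show "bundle_equivalent G E E'"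
    using bundle_equivalent_of_gauge_equivalent classifies_inj by blast
next
  assume "bundle_equivalent G E E'"
  then have eq: "has_transition E' w" if "has_transition E w" for w
    using has_transition_equivalent that v has_transition_def by blast
  obtain f where "f \<in> characteristic_class E"
    using characteristic_class_nonempty [OF u] by blast
  moreover from this have "f \<in> characteristic_class E'"
    unfolding characteristic_class_def using eq by blast
  ultimately show "characteristic_class E = characteristic_class E'"
    using characteristic_class_coset by metis
qed

text \<open>Equivalence of bundles is equality of characteristic classes, and clutching makes every
  coset one. The existence of transition functions is a hypothesis because its proof uses the cells,
  which are not visible in this locale.\<close>

theorem classification:
  assumes ex: "\<And>E :: ('m \<times> 'a, 'a, 'm) gbundle. principal_bundle G T M E \<Longrightarrow> \<exists>u. has_transition E u"
  shows "\<exists>f. bij_betw f (bundle_classes G T M) (carrier (cohomology_group 2 M P)) \<and>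
    f (trivial_class G T M) = \<one>\<^bsub>cohomology_group 2 M P\<^esub>"
proof -
  let ?D = "coboundary_set (Suc (Suc 0)) M P"
  have H: "cohomology_group 2 M P = Z Mod ?D"
    by (simp add: cohomology_group_def numeral_2_eq_2)
  let ?S = "Collect (principal_bundle G T M) :: ('m \<times> 'a, 'a, 'm) gbundle set"
  have R: "bundle_equivalence G T M = {(E, E'). E \<in> ?S \<and> E' \<in> ?S \<and> characteristic_class E = characteristic_class E'}"
    unfolding bundle_equivalence_def using characteristic_class_eq_iff ex by blast
  have K: "characteristic_class ` ?S = rcosets\<^bsub>Z\<^esub> ?D"
  proof (intro equalityI subsetI)
    fix X assume "X \<in> characteristic_class ` ?S"
    then obtain E :: "('m \<times> 'a, 'a, 'm) gbundle" where E: "principal_bundle G T M E" "X = characteristic_class E"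
      by blast
    then obtain f where f: "f \<in> characteristic_class E"
      using ex characteristic_class_nonempty by blast
    then have "f \<in> carrier Z" by (simp add: characteristic_class_def)
    then show "X \<in> rcosets\<^bsub>Z\<^esub> ?D"
      using E(2) characteristic_class_coset [OF f] by (auto simp: RCOSETS_def)
  next
    fix X assume "X \<in> rcosets\<^bsub>Z\<^esub> ?D"
    then obtain f where f: "f \<in> carrier Z" "X = ?D #>\<^bsub>Z\<^esub> f"
      by (auto simp: RCOSETS_def)
    then obtain u where u: "classifies u f"
      using classifies_surj by (auto simp: pi.carrier_cocycle_group)
    have t: "has_transition (clutching.clutch G T M A B u) u"
      by (rule has_transition_clutch [OF classifies_continuous [OF u]])
    then have "f \<in> characteristic_class (clutching.clutch G T M A B u)"
      unfolding characteristic_class_def using f(1) u by blast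
    then show "X \<in> characteristic_class ` ?S"
      using t f(2) characteristic_class_coset unfolding has_transition_def by blast
  qed
  obtain f where f: "bij_betw f (bundle_classes G T M) (rcosets\<^bsub>Z\<^esub> ?D)"
    "\<And>E. E \<in> ?S \<Longrightarrow> f (bundle_equivalence G T M `` {E}) = characteristic_class E"
    using quotient_bij [OF R K] unfolding bundle_classes_def by blast
  have "trivial_bundle G T M \<in> ?S"
    using has_transition_trivial by (simp add: has_transition_def)
  then have "f (trivial_class G T M) = characteristic_class (trivial_bundle G T M)"
    unfolding trivial_class_def by (rule f(2))
  also have "\<dots> = ?D"
  proof -
    \<comment> \<open>The constant cocycle, cut off to be extensional, belongs to the constant
      transition function; its coset is the set of coboundaries, the unit of the cohomology
      group.\<close>
    let ?f = "\<lambda>c\<in>Collect (singular_chain (Suc (Suc 0)) M). \<one>\<^bsub>P\<^esub>"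
    have "?f \<in> characteristic_class (trivial_bundle G T M)"
      unfolding characteristic_class_def
      using classifies_restrict [OF classifies_one] has_transition_trivial by blast
    from characteristic_class_coset [OF this] show ?thesis
      by (simp add: pi.r_coset_coboundary_set_one)
  qed
  finally show ?thesis
    using f(1) by (auto simp: H FactGroup_def)
qed

end

lemma (in cw2_group) has_transition_exists:
  assumes "principal_bundle G T M E"
  shows "\<exists>u. has_transition E u"
proof -
  interpret cw2_bundle G T M C E by unfold_locales (rule assms)
  interpret covered_bundle G T M "punct 2" "cells 2" E by (rule covered_bundle [OF assms])
  obtain s t where "lift (subtopology M (punct 2)) (\<lambda>x. x) s" "lift (subtopology M (cells 2)) (\<lambda>x. x) t"
    using section_A section_B by blast
  from transition_exists [OF this] show ?thesis
    using assms by (simp add: has_transition_def)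
qed

theorem mainTheorem3:
  fixes M :: "'m topology" and C :: "nat \<Rightarrow> ((nat \<Rightarrow> real) \<Rightarrow> 'm) set" and x\<^sub>0 :: 'm
    and G :: "('g, 'b) monoid_scheme" and T :: "'g topology"
  assumes "cw_complex M C" and "cw_has_dim C 2"
    and "path_connected_space M" and "x\<^sub>0 \<in> topspace M"
    and "topological_group G T" and "path_connected_space T"
  shows "\<exists>f. bij_betw f (bundle_classes G T M)
               (carrier (cohomology_group 2 M (fundamental_group T \<one>\<^bsub>G\<^esub>))) \<and>
             f (trivial_class G T M) = \<one>\<^bsub>cohomology_group 2 M (fundamental_group T \<one>\<^bsub>G\<^esub>)\<^esub>"
proof -
  interpret group G using assms(5) by (simp add: topological_group_def)
  interpret cw2_group G T M C
    by unfold_locales (use assms in \<open>auto simp: cw_has_dim_def\<close>)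
  show ?thesis
    by (rule classification [OF has_transition_exists])
qed

end
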